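(* Let $d\ge1$, let $B=dA$ be a magnetic field on $\mathbb{R}^d$ with components $B_{jk}\in BC^\infty(\mathbb{R}^d)$, and let $F$ be a real-valued symbol which belongs either to $S_1^t(\Xi)$ for some $t<0$, or to $S^0_{\Gamma_*}$ for some lattice $\Gamma_*$. Let $\mathcal{E}(\epsilon)$ denote any one of the three quantities $\sup\sigma(\mathfrak{Op}^{\epsilon A}(F))$, $\inf\sigma(\mathfrak{Op}^{\epsilon A}(F))$, $\|\mathfrak{Op}^{\epsilon A}(F)\|$, and let $\mathcal{E}_\epsilon$ denote the same quantity defined with $A_\epsilon$ instead of $\epsilon A$. Then: (i) There exists a constant $C<\infty$ such that $$|\mathcal{E}(\epsilon)-\mathcal{E}(0)|\le C|\epsilon|\ln(1/|\epsilon|),\qquad 0<|\epsilon|\le 1/2.$$ (ii) If the magnetic field is constant or slowly variable, the logarithmic factor is absent. That is, there exists a constant $C<\infty$ such that for all $|\epsilon|\le 1/2$: if $B$ is constant, then $|\mathcal{E}(\epsilon)-\mathcal{E}(0)|\le C|\epsilon|$; and for the perturbation given by the slowly varying vector potential $A_\epsilon(x)=A(\epsilon x)$, $|\mathcal{E}_\epsilon-\mathcal{E}_0|\le C|\epsilon|$.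
   Context: Notation: $\mathcal{X}=\mathbb{R}^d$, $\mathcal{X}^*\cong\mathbb{R}^d$ is its dual with duality form $\langle\xi,x\rangle$, and $\Xi=\mathcal{X}\times\mathcal{X}^*$. $BC^\infty(\mathbb{R}^d)$ is the space of smooth functions that are bounded together with all their derivatives. Magnetic phases. $B=dA$ is a closed two-form with real components $B_{jk}=-B_{kj}=\partial_jA_k-\partial_kA_j$. Its flux through the triangle with vertices $x,y,x'$ is $$\Phi^B(x,y,x'):=\sum_{j,k}(y_j-x_j)(x'_k-y_k)\int_0^1dt\int_0^tds\,B_{jk}\big(x+t(y-x)+s(x'-y)\big).$$ $A$ is taken in the transverse gauge $\sum_jx_jA_j(x)=0$ (other gauges give unitarily equivalent operators), and $\phi^A(x,y):=-\int_{[x,y]}A=-\Phi^B(0,x,y)$, so that $\phi^{\epsilon A}=\epsilon\phi^A$. For the slowly varying potential $A_\epsilon(x):=A(\epsilon x)$, with magnetic field $\epsilon B_\epsilon$, $B_\epsilon(x):=B(\epsilon x)$, one sets $\phi^{A_\epsilon}(x,x'):=-\epsilon\,\Phi^{B_\epsilon}(0,x,x')$. Magnetic quantization. For a symbol $h$ on $\Xi$ and $f\in\mathscr{S}(\mathcal{X})$, $$(\mathfrak{Op}^{A}(h)f)(x):=(2\pi)^{-d}\int_{\mathcal{X}}\int_{\mathcal{X}^*}e^{i\langle\xi,x-y\rangle}e^{i\phi^{A}(x,y)}\,h\Big(\frac{x+y}{2},\xi\Big)f(y)\,dy\,d\xi,$$ as an oscillatory integral. $\mathfrak{Op}^{\epsilon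 A}(h)$ and $\mathfrak{Op}^{A_\epsilon}(h)$ are defined by the same formula with $\phi^A$ replaced by $\phi^{\epsilon A}$ and $\phi^{A_\epsilon}$ respectively. For the symbols considered here these operators extend to bounded operators on $L^2(\mathcal{X})$; $\sigma(\cdot)$ and $\|\cdot\|$ denote the spectrum and operator norm on $L^2(\mathcal{X})$. Symbol classes. $S_1^t(\Xi)$ is the space of $F\in C^\infty(\Xi)$ such that for all multi-indices $a,b$ there is $C_{ab}$ with $|\partial_x^a\partial_\xi^bF(x,\xi)|\le C_{ab}(1+|\xi|^2)^{(t-|b|)/2}$. $S_0^0(\Xi)$ is the space of smooth functions on $\Xi$ bounded together with all their derivatives. $S^0_{\Gamma_*}$ is the set of symbols in $S^0_0(\Xi)$ that do not depend on $x\in\mathcal{X}$ and are periodic in $\xi\in\mathcal{X}^*$ with respect to a (full-rank) lattice $\Gamma_*\subset\mathcal{X}^*$. *)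

theory Defs
  imports "HOL-Analysis.Analysis"
begin

section \<open>Smooth functions and symbol classes\<close>

definition pdiff :: "'a::euclidean_space \<Rightarrow> ('a \<Rightarrow> 'b::real_normed_vector) \<Rightarrow> 'a \<Rightarrow> 'b" where
  "pdiff b f x = frechet_derivative f (at x) b"

text \<open>A multi-index is encoded as a list of basis vectors with repetitions; its order is the
  length of the list.\<close>

definition pdiffs :: "'a::euclidean_space list \<Rightarrow> ('a \<Rightarrow> 'b::real_normed_vector) \<Rightarrow> 'a \<Rightarrow> 'b" where
  "pdiffs bs f = foldr pdiff bs f"

definition smooth :: "('a::euclidean_space \<Rightarrow> 'b::real_normed_vector) \<Rightarrow> bool" where
  "smooth f \<longleftrightarrow> (\<forall>bs. set bs \<subseteq> Basis \<longrightarrow> (\<forall>x. pdiffs bs f differentiable (at x)))"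

definition BC_infinity :: "('a::euclidean_space \<Rightarrow> 'b::real_normed_vector) set" where
  "BC_infinity = {f. smooth f \<and> (\<forall>bs. set bs \<subseteq> Basis \<longrightarrow> bounded (range (pdiffs bs f)))}"

definition schwartz :: "('a::euclidean_space \<Rightarrow> 'b::real_normed_vector) set" where
  "schwartz = {f. smooth f \<and> (\<forall>bs N. set bs \<subseteq> Basis \<longrightarrow>
     (\<exists>C. \<forall>x. norm x ^ N * norm (pdiffs bs f x) \<le> C))}"

text \<open>Phase space is the product of two copies of \<open>real ^ 'n\<close>, the dual being identified with
  \<open>real ^ 'n\<close> through the inner product.\<close>

definition symbol_S1 :: "real \<Rightarrow> ((real ^ 'n) \<times> (real ^ 'n) \<Rightarrow> real) set" where
  "symbol_S1 t = {F. smooth F \<and>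
     (\<forall>as bs. \<exists>C. \<forall>x \<xi>.
        \<bar>pdiffs (map (\<lambda>i. (axis i 1, 0)) as @ map (\<lambda>i. (0, axis i 1)) bs) F (x, \<xi>)\<bar>
          \<le> C * (1 + (norm \<xi>)\<^sup>2) powr ((t - real (length bs)) / 2))}"

definition symbol_S00 :: "((real ^ 'n) \<times> (real ^ 'n) \<Rightarrow> real) set" where
  "symbol_S00 = BC_infinity"

definition full_lattice :: "'a::euclidean_space set \<Rightarrow> bool" where
  "full_lattice \<Gamma> \<longleftrightarrow> (\<exists>b. independent b \<and> span b = UNIV \<and>
     \<Gamma> = {\<Sum>v\<in>b. of_int (m v) *\<^sub>R v | m :: 'a \<Rightarrow> int. True})"

definition symbol_periodic :: "(real ^ 'n) set \<Rightarrow> ((real ^ 'n) \<times> (real ^ 'n) \<Rightarrow> real) set" where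
  "symbol_periodic \<Gamma> = {F \<in> symbol_S00. (\<forall>x x' \<xi>. F (x, \<xi>) = F (x', \<xi>)) \<and>
     (\<forall>x \<xi>. \<forall>\<gamma>\<in>\<Gamma>. F (x, \<xi> + \<gamma>) = F (x, \<xi>))}"


section \<open>Magnetic phases\<close>

definition dform :: "(real ^ 'n \<Rightarrow> real ^ 'n) \<Rightarrow> 'n \<Rightarrow> 'n \<Rightarrow> real ^ 'n \<Rightarrow> real" where
  "dform A j k x = pdiff (axis j 1) (\<lambda>z. A z $ k) x - pdiff (axis k 1) (\<lambda>z. A z $ j) x"

definition transverse_gauge :: "(real ^ 'n \<Rightarrow> real ^ 'n) \<Rightarrow> bool" where
  "transverse_gauge A \<longleftrightarrow> (\<forall>x. (\<Sum>j\<in>UNIV. x $ j * A x $ j) = 0)"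

definition flux ::
  "('n \<Rightarrow> 'n \<Rightarrow> real ^ 'n \<Rightarrow> real) \<Rightarrow> real ^ 'n \<Rightarrow> real ^ 'n \<Rightarrow> real ^ 'n \<Rightarrow> real" where
  "flux B x y x' = (\<Sum>j\<in>UNIV. \<Sum>k\<in>UNIV. (y $ j - x $ j) * (x' $ k - y $ k) *
     integral {0..1} (\<lambda>t. integral {0..t} (\<lambda>s. B j k (x + t *\<^sub>R (y - x) + s *\<^sub>R (x' - y)))))"

text \<open>Minus the line integral of \<open>A\<close> along the segment from \<open>x\<close> to \<open>y\<close>.\<close>

definition phase :: "(real ^ 'n \<Rightarrow> real ^ 'n) \<Rightarrow> real ^ 'n \<Rightarrow> real ^ 'n \<Rightarrow> real" where
  "phase A x y = - integral {0..1} (\<lambda>t. A (x + t *\<^sub>R (y - x)) \<bullet> (y - x))"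

text \<open>The phase of \<open>\<lambda>x. A (\<epsilon> *\<^sub>R x)\<close> when \<open>B = dA\<close>; see \<open>slow_phase_eq\<close> below.\<close>

definition slow_phase ::
  "('n \<Rightarrow> 'n \<Rightarrow> real ^ 'n \<Rightarrow> real) \<Rightarrow> real \<Rightarrow> real ^ 'n \<Rightarrow> real ^ 'n \<Rightarrow> real" where
  "slow_phase B \<epsilon> x y = - \<epsilon> * flux (\<lambda>j k z. B j k (\<epsilon> *\<^sub>R z)) 0 x y"

lemma phase_scale: "phase (\<lambda>z. \<epsilon> *\<^sub>R A z) x y = \<epsilon> * phase A x y"
  by (simp add: phase_def)

lemma smooth_differentiable: "smooth f \<Longrightarrow> f differentiable (at x)"
  unfolding smooth_def by (drule spec[of _ "[]"]) (simp add: pdiffs_def)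

lemma smooth_continuous_pdiff:
  fixes f :: "'a::euclidean_space \<Rightarrow> 'b::real_normed_vector"
  assumes "smooth f"
  shows "continuous_on UNIV (\<lambda>z. frechet_derivative f (at z) u)"
proof -
  have *: "continuous_on UNIV (\<lambda>z. frechet_derivative f (at z) b)" if "b \<in> Basis" for b
  proof -
    have "\<And>x. (\<lambda>z. frechet_derivative f (at z) b) differentiable (at x)"
      using assms that unfolding smooth_def
      by (drule_tac spec[of _ "[b]"]) (simp add: pdiffs_def pdiff_def[abs_def])
    then show ?thesis
      using continuous_at_imp_continuous_on differentiable_imp_continuous_within by blast
  qed
  have "frechet_derivative f (at z) u = (\<Sum>b\<in>Basis. (u \<bullet> b) *\<^sub>R frechet_derivative f (at z) b)" for z
  proof -
    have l: "linear (frechet_derivative f (at z))"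
      using smooth_differentiable[OF assms] by (rule linear_frechet_derivative)
    have "frechet_derivative f (at z) u = frechet_derivative f (at z) (\<Sum>b\<in>Basis. (u \<bullet> b) *\<^sub>R b)"
      by (simp add: euclidean_representation)
    then show ?thesis
      by (simp add: linear_sum[OF l] linear_scale[OF l])
  qed
  then show ?thesis
    by (simp add: continuous_on_sum continuous_on_scaleR *)
qed

lemma dform_eq:
  assumes "smooth A"
  shows "dform A j k z = frechet_derivative A (at z) (axis j 1) $ k
                       - frechet_derivative A (at z) (axis k 1) $ j"
proof -
  have "frechet_derivative (\<lambda>z. A z $ k) (at z) v = frechet_derivative A (at z) v $ k" for k v
  proof -
    have "(A has_derivative frechet_derivative A (at z)) (at z)"
      using smooth_differentiable[OF assms] by (simp add: frechet_derivative_works)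
    then have "((\<lambda>z. A z $ k) has_derivative (\<lambda>v. frechet_derivative A (at z) v $ k)) (at z)"
      by (rule bounded_linear.has_derivative[OF bounded_linear_vec_nth])
    from frechet_derivative_at[OF this] show ?thesis by metis
  qed
  then show ?thesis by (simp add: dform_def pdiff_def)
qed

lemma dform_contract:
  fixes A :: "real ^ 'n \<Rightarrow> real ^ 'n"
  assumes "smooth A"
  shows "(\<Sum>j\<in>UNIV. \<Sum>k\<in>UNIV. u $ j * v $ k * dform A j k z)
       = frechet_derivative A (at z) u \<bullet> v - frechet_derivative A (at z) v \<bullet> u"
proof -
  let ?D = "frechet_derivative A (at z)"
  have l: "linear ?D"
    using smooth_differentiable[OF assms] by (rule linear_frechet_derivative)
  have D: "?D w = (\<Sum>j\<in>UNIV. w $ j *\<^sub>R ?D (axis j 1))" for w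
  proof -
    have "w = (\<Sum>j\<in>UNIV. w $ j *\<^sub>R axis j 1)"
      using basis_expansion[of w] by (simp add: scalar_mult_eq_scaleR)
    then have "?D w = ?D (\<Sum>j\<in>UNIV. w $ j *\<^sub>R axis j 1)" by metis
    then show ?thesis by (simp add: linear_sum[OF l] linear_scale[OF l])
  qed
  have 1: "?D u \<bullet> v = (\<Sum>j\<in>UNIV. \<Sum>k\<in>UNIV. u $ j * v $ k * ?D (axis j 1) $ k)"
    by (subst D, subst inner_vec_def)
      (subst sum.swap, simp add: sum_distrib_left sum_distrib_right mult_ac)
  have 2: "?D v \<bullet> u = (\<Sum>k\<in>UNIV. \<Sum>j\<in>UNIV. u $ j * v $ k * ?D (axis k 1) $ j)"
    by (subst D, subst inner_vec_def)
      (subst sum.swap, simp add: sum_distrib_left sum_distrib_right mult_ac)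
  show ?thesis
    unfolding 1 2 sum.swap[of _ _ "UNIV :: 'n set", where g="\<lambda>k j. u $ j * v $ k * ?D (axis k 1) $ j"]
    by (simp add: dform_eq[OF assms] right_diff_distrib sum_subtractf)
qed

lemma continuous_on_dform:
  assumes "smooth A" shows "continuous_on S (dform A j k)"
proof -
  have "continuous_on UNIV (dform A j k)"
    unfolding dform_eq[OF assms, abs_def]
    by (intro continuous_intros smooth_continuous_pdiff[OF assms])
  then show ?thesis using continuous_on_subset by blast
qed

lemma transverse_radial_integral:
  fixes A :: "real ^ 'n \<Rightarrow> real ^ 'n"
  assumes A: "smooth A" and tr: "transverse_gauge A"
  shows "((\<lambda>t. t * (\<Sum>j\<in>UNIV. \<Sum>k\<in>UNIV. z $ j * v $ k * dform A j k (t *\<^sub>R z))) has_integral A z \<bullet> v) {0..1}"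
proof -
  let ?D = "\<lambda>w. frechet_derivative A (at w)"
  have hd: "(A has_derivative ?D w) (at w)" for w
    by (rule frechet_derivative_works[THEN iffD1, OF smooth_differentiable[OF A]])
  have l: "linear (?D w)" for w
    using smooth_differentiable[OF A] by (rule linear_frechet_derivative)
  have zero: "w \<bullet> A w = 0" for w
    using tr by (simp add: transverse_gauge_def inner_vec_def)
  have t2: "w \<bullet> ?D w v + v \<bullet> A w = 0" for w
  proof -
    have "((\<lambda>w. w \<bullet> A w) has_derivative (\<lambda>v. w \<bullet> ?D w v + v \<bullet> A w)) (at w)"
      by (rule has_derivative_inner[OF has_derivative_ident hd])
    moreover have "((\<lambda>w. w \<bullet> A w) has_derivative (\<lambda>v. 0)) (at w)"
      by (simp add: zero)
    ultimately have "(\<lambda>v. w \<bullet> ?D w v + v \<bullet> A w) = (\<lambda>v. 0)"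
      by (rule has_derivative_unique)
    then show ?thesis by (rule fun_cong)
  qed
  have "((\<lambda>t. t * (A (t *\<^sub>R z) \<bullet> v)) has_vector_derivative
        t * (\<Sum>j\<in>UNIV. \<Sum>k\<in>UNIV. z $ j * v $ k * dform A j k (t *\<^sub>R z))) (at t within {0..1})" for t
  proof -
    have "((\<lambda>t. A (t *\<^sub>R z)) has_derivative (\<lambda>h. ?D (t *\<^sub>R z) (h *\<^sub>R z))) (at t within {0..1})"
      by (rule has_derivative_compose[where f="\<lambda>t. t *\<^sub>R z" and g=A, OF _ hd])
        (auto intro!: derivative_eq_intros)
    then have "((\<lambda>t. t * (A (t *\<^sub>R z) \<bullet> v)) has_derivative
       (\<lambda>h. t * (?D (t *\<^sub>R z) (h *\<^sub>R z) \<bullet> v) + h * (A (t *\<^sub>R z) \<bullet> v))) (at t within {0..1})"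
      by (auto intro!: derivative_eq_intros)
    moreover have "t * (?D (t *\<^sub>R z) (h *\<^sub>R z) \<bullet> v) + h * (A (t *\<^sub>R z) \<bullet> v)
       = h * (t * (?D (t *\<^sub>R z) z \<bullet> v - ?D (t *\<^sub>R z) v \<bullet> z))" for h
      using t2[of "t *\<^sub>R z"]
      by (simp add: linear_scale[OF l] inner_commute algebra_simps eq_neg_iff_add_eq_0[symmetric])
    ultimately show ?thesis
      by (simp add: dform_contract[OF A] has_vector_derivative_def)
  qed
  from fundamental_theorem_of_calculus[OF _ this] show ?thesis by simp
qed

lemma phase_eq_flux:
  fixes A :: "real ^ 'n \<Rightarrow> real ^ 'n"
  assumes A: "smooth A" and tr: "transverse_gauge A"
  shows "phase A x y = - flux (dform A) 0 x y"
proof -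
  define v where "v = y - x"
  define \<beta> where "\<beta> u w = (\<Sum>j\<in>UNIV. \<Sum>k\<in>UNIV. u $ j * v $ k * dform A j k w)" for u w
  have cont: "continuous_on S (\<lambda>p. \<beta> (f p) (g p))"
    if "continuous_on S f" "continuous_on S g" for S and f g :: "'c::t2_space \<Rightarrow> real ^ 'n"
    unfolding \<beta>_def
    by (intro continuous_intros that continuous_on_compose2[OF continuous_on_dform[OF A, of UNIV]]) auto
  have sub: "integral {0..t} g = integral {0..1} (\<lambda>r. t * g (t * r))"
    if "continuous_on UNIV g" "0 \<le> t" for g :: "real \<Rightarrow> real" and t
  proof (cases "t = 0")
    case False
    with that have t: "t > 0" by auto
    have "g integrable_on {0..t}"
      using that continuous_on_subset by (blast intro: integrable_continuous_real)
    then have "(g has_integral integral {0..t} g) (cbox 0 t)"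
      by (simp add: integrable_integral)
    from has_integral_affinity[OF this, of t 0] t
    have "((\<lambda>r. g (t * r)) has_integral (1 / t) * integral {0..t} g) {0..1}"
      by (simp add: image_affinity_cbox field_simps)
    from has_integral_mult_right[OF this, of t] t
    have "((\<lambda>r. t * g (t * r)) has_integral integral {0..t} g) {0..1}" by simp
    then show ?thesis by (rule integral_unique[symmetric])
  qed simp
  have inner_sub: "integral {0..t} (\<lambda>s. \<beta> x (t *\<^sub>R x + s *\<^sub>R v))
      = integral {0..1} (\<lambda>r. t * \<beta> (x + r *\<^sub>R v) (t *\<^sub>R (x + r *\<^sub>R v)))" if "t \<in> {0..1}" for t
  proof -
    have eq: "\<beta> (x + r *\<^sub>R v) w = \<beta> x w" for r w
    proof -
      have "frechet_derivative A (at w) (x + r *\<^sub>R v)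
          = frechet_derivative A (at w) x + r *\<^sub>R frechet_derivative A (at w) v"
        using linear_frechet_derivative[OF smooth_differentiable[OF A]]
        by (simp add: linear_add linear_scale)
      then show ?thesis
        unfolding \<beta>_def dform_contract[OF A] by (simp add: inner_add_left inner_add_right)
    qed
    have "continuous_on UNIV (\<lambda>s. \<beta> x (t *\<^sub>R x + s *\<^sub>R v))"
      by (intro cont continuous_intros)
    from sub[OF this, of t] that show ?thesis
      by (simp only: eq scaleR_add_right scaleR_scaleR atLeastAtMost_iff)
  qed
  have "flux (dform A) 0 x y =
     integral {0..1} (\<lambda>t. integral {0..t} (\<lambda>s. \<beta> x (t *\<^sub>R x + s *\<^sub>R v)))"
  proof -
    have c1: "continuous_on {0..1} (\<lambda>t. integral {0..t} (\<lambda>s. dform A j k (t *\<^sub>R x + s *\<^sub>R v)))" for j k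
    proof -
      have "continuous_on {0..1} (\<lambda>t. integral {0..1} (\<lambda>r. t * dform A j k (t *\<^sub>R x + (t * r) *\<^sub>R v)))"
        unfolding box_real[symmetric]
        by (rule integral_continuous_on_param)
          (auto simp: case_prod_unfold intro!: continuous_intros
             continuous_on_compose2[OF continuous_on_dform[OF A, of UNIV]])
      moreover have "integral {0..t} (\<lambda>s. dform A j k (t *\<^sub>R x + s *\<^sub>R v))
          = integral {0..1} (\<lambda>r. t * dform A j k (t *\<^sub>R x + (t * r) *\<^sub>R v))" if "t \<in> {0..1}" for t
        using that by (intro sub continuous_on_compose2[OF continuous_on_dform[OF A, of UNIV]]
            continuous_intros) auto
      ultimately show ?thesis
        by (subst continuous_on_cong[OF refl]) auto
    qed
    have c2: "(\<lambda>s. dform A j k (t *\<^sub>R x + s *\<^sub>R v)) integrable_on {0..t}" for j k t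
      by (intro integrable_continuous_real continuous_on_compose2[OF continuous_on_dform[OF A, of UNIV]]
            continuous_intros) auto
    have "integral {0..t} (\<lambda>s. \<beta> x (t *\<^sub>R x + s *\<^sub>R v))
       = (\<Sum>j\<in>UNIV. \<Sum>k\<in>UNIV. x $ j * v $ k * integral {0..t} (\<lambda>s. dform A j k (t *\<^sub>R x + s *\<^sub>R v)))" for t
      unfolding \<beta>_def
      by (intro integral_unique has_integral_sum has_integral_mult_right integrable_integral c2) auto
    moreover have "integral {0..1} (\<lambda>t. \<Sum>j\<in>UNIV. \<Sum>k\<in>UNIV. x $ j * v $ k *
          integral {0..t} (\<lambda>s. dform A j k (t *\<^sub>R x + s *\<^sub>R v)))
       = (\<Sum>j\<in>UNIV. \<Sum>k\<in>UNIV. x $ j * v $ k *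
          integral {0..1} (\<lambda>t. integral {0..t} (\<lambda>s. dform A j k (t *\<^sub>R x + s *\<^sub>R v))))"
      by (intro integral_unique has_integral_sum has_integral_mult_right integrable_integral
          integrable_continuous_real c1) auto
    ultimately show ?thesis
      by (simp add: flux_def v_def)
  qed
  also have "\<dots> = integral {0..1} (\<lambda>t. integral {0..1} (\<lambda>r. t * \<beta> (x + r *\<^sub>R v) (t *\<^sub>R (x + r *\<^sub>R v))))"
    by (intro integral_cong inner_sub)
  also have "\<dots> = integral {0..1} (\<lambda>r. integral {0..1} (\<lambda>t. t * \<beta> (x + r *\<^sub>R v) (t *\<^sub>R (x + r *\<^sub>R v))))"
    unfolding box_real[symmetric]
    by (rule integral_swap_continuous)
       (auto simp: case_prod_unfold intro!: continuous_intros cont)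
  also have "\<dots> = integral {0..1} (\<lambda>r. A (x + r *\<^sub>R v) \<bullet> v)"
    unfolding \<beta>_def by (simp only: integral_unique[OF transverse_radial_integral[OF A tr]])
  finally show ?thesis by (simp add: phase_def v_def)
qed

lemma slow_phase_eq:
  fixes A :: "real ^ 'n \<Rightarrow> real ^ 'n"
  assumes A: "smooth A" and tr: "transverse_gauge A"
  shows "slow_phase (dform A) \<epsilon> x y = phase (\<lambda>z. A (\<epsilon> *\<^sub>R z)) x y"
proof (cases "\<epsilon> = 0")
  case True
  have "A 0 = 0"
  proof -
    have "((\<lambda>t. 0) has_integral A 0 \<bullet> A 0) {0..1::real}"
      using transverse_radial_integral[OF A tr, of 0 "A 0"] by simp
    then show ?thesis using has_integral_unique[OF _ has_integral_0] by fastforce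
  qed
  then show ?thesis using True by (simp add: slow_phase_def phase_def)
next
  case False
  have "phase (\<lambda>z. A (\<epsilon> *\<^sub>R z)) x y = phase A (\<epsilon> *\<^sub>R x) (\<epsilon> *\<^sub>R y) / \<epsilon>"
    using False by (simp add: phase_def scaleR_add_right flip: scaleR_diff_right)
      (simp add: mult.commute[of \<epsilon>])
  also note phase_eq_flux[OF A tr]
  also have "flux (dform A) 0 (\<epsilon> *\<^sub>R x) (\<epsilon> *\<^sub>R y)
      = \<epsilon>\<^sup>2 * flux (\<lambda>j k z. dform A j k (\<epsilon> *\<^sub>R z)) 0 x y"
  proof -
    have "0 + t *\<^sub>R (\<epsilon> *\<^sub>R x - 0) + s *\<^sub>R (\<epsilon> *\<^sub>R y - \<epsilon> *\<^sub>R x)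
        = \<epsilon> *\<^sub>R (0 + t *\<^sub>R (x - 0) + s *\<^sub>R (y - x))" for t s
      by (simp add: algebra_simps)
    moreover have "((\<epsilon> *\<^sub>R x) $ j - 0 $ j) * ((\<epsilon> *\<^sub>R y) $ k - (\<epsilon> *\<^sub>R x) $ k) * c
        = \<epsilon>\<^sup>2 * ((x $ j - 0 $ j) * (y $ k - x $ k) * c)" for j k c
      by (simp add: algebra_simps power2_eq_square)
    ultimately show ?thesis
      unfolding flux_def by (simp only: sum_distrib_left)
  qed
  also have "- (\<epsilon>\<^sup>2 * flux (\<lambda>j k z. dform A j k (\<epsilon> *\<^sub>R z)) 0 x y) / \<epsilon> = slow_phase (dform A) \<epsilon> x y"
    using False by (simp add: slow_phase_def power2_eq_square)
  finally show ?thesis by simp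
qed


section \<open>The Hilbert space of square-integrable functions\<close>

definition square_integrable :: "('a::euclidean_space \<Rightarrow> complex) \<Rightarrow> bool" where
  "square_integrable f \<longleftrightarrow>
     f \<in> borel_measurable lborel \<and> integrable lborel (\<lambda>x. (norm (f x))\<^sup>2)"

lemma square_integrable_zero: "square_integrable (\<lambda>x. 0)"
  by (simp add: square_integrable_def)

lemma square_integrable_cmult: "square_integrable f \<Longrightarrow> square_integrable (\<lambda>x. c * f x)"
  by (auto simp: square_integrable_def norm_mult power_mult_distrib)

lemma square_integrable_add:
  assumes "square_integrable f" "square_integrable g"
  shows "square_integrable (\<lambda>x. f x + g x)"
proof -
  have m: "f \<in> borel_measurable lborel" "g \<in> borel_measurable lborel"
    using assms by (auto simp: square_integrable_def)
  have "integrable lborel (\<lambda>x. 2 * (norm (f x))\<^sup>2 + 2 * (norm (g x))\<^sup>2)"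
    using assms by (auto simp: square_integrable_def)
  moreover have "(norm (f x + g x))\<^sup>2 \<le> 2 * (norm (f x))\<^sup>2 + 2 * (norm (g x))\<^sup>2" for x
  proof -
    have "(norm (f x + g x))\<^sup>2 \<le> (norm (f x) + norm (g x))\<^sup>2"
      by (intro power_mono norm_triangle_ineq) auto
    also have "\<dots> \<le> 2 * (norm (f x))\<^sup>2 + 2 * (norm (g x))\<^sup>2"
      using sum_squares_bound[of "norm (f x)" "norm (g x)"] by (simp add: power2_sum)
    finally show ?thesis .
  qed
  ultimately have "integrable lborel (\<lambda>x. (norm (f x + g x))\<^sup>2)"
    by (intro Bochner_Integration.integrable_bound[OF \<open>integrable lborel (\<lambda>x. 2 * (norm (f x))\<^sup>2 + 2 * (norm (g x))\<^sup>2)\<close>])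
      (use m in auto)
  with m show ?thesis by (simp add: square_integrable_def)
qed

lemma square_integrable_inner:
  assumes "square_integrable f" "square_integrable g"
  shows "integrable lborel (\<lambda>x. f x \<bullet> g x)"
proof -
  have m: "f \<in> borel_measurable lborel" "g \<in> borel_measurable lborel"
    using assms by (auto simp: square_integrable_def)
  have "integrable lborel (\<lambda>x. (norm (f x))\<^sup>2 + (norm (g x))\<^sup>2)"
    using assms by (auto simp: square_integrable_def)
  moreover have "norm (f x \<bullet> g x) \<le> norm ((norm (f x))\<^sup>2 + (norm (g x))\<^sup>2)" for x
  proof -
    have "\<bar>f x \<bullet> g x\<bar> \<le> norm (f x) * norm (g x)" by (rule Cauchy_Schwarz_ineq2)
    also have "\<dots> \<le> (norm (f x))\<^sup>2 + (norm (g x))\<^sup>2"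
      using sum_squares_bound[of "norm (f x)" "norm (g x)"]
        mult_nonneg_nonneg[OF norm_ge_zero[of "f x"] norm_ge_zero[of "g x"]] by linarith
    finally show ?thesis by simp
  qed
  ultimately show ?thesis
    by (intro Bochner_Integration.integrable_bound[OF \<open>integrable lborel (\<lambda>x. (norm (f x))\<^sup>2 + (norm (g x))\<^sup>2)\<close>])
      (use m in auto)
qed

quotient_type (overloaded) 'a L2 = "'a::euclidean_space \<Rightarrow> complex" /
  partial: "\<lambda>f g. square_integrable f \<and> square_integrable g \<and> (AE x in lborel. f x = g x)"
  morphisms L2_rep L2_class
proof (rule part_equivpI)
  show "\<exists>f::'a \<Rightarrow> complex. square_integrable f \<and> square_integrable f \<and> (AE x in lborel. f x = f x)"
    by (intro exI[of _ "\<lambda>x. 0"]) (simp add: square_integrable_zero)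
qed (auto intro!: sympI transpI)

text \<open>The real inner product below is the real part of the usual sesquilinear one and induces
  the same norm.\<close>

instantiation L2 :: (euclidean_space) real_inner
begin

lift_definition zero_L2 :: "'a L2" is "\<lambda>x. 0"
  by (simp add: square_integrable_zero)

lift_definition plus_L2 :: "'a L2 \<Rightarrow> 'a L2 \<Rightarrow> 'a L2" is "\<lambda>f g x. f x + g x"
  by (auto simp: square_integrable_add)

lift_definition uminus_L2 :: "'a L2 \<Rightarrow> 'a L2" is "\<lambda>f x. - f x"
  using square_integrable_cmult[of _ "-1"] by auto

definition minus_L2 :: "'a L2 \<Rightarrow> 'a L2 \<Rightarrow> 'a L2" where
  "minus_L2 f g = f + - g"

lift_definition scaleR_L2 :: "real \<Rightarrow> 'a L2 \<Rightarrow> 'a L2" is "\<lambda>r f x. r *\<^sub>R f x"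
  using square_integrable_cmult by (auto simp: scaleR_conv_of_real)

lift_definition inner_L2 :: "'a L2 \<Rightarrow> 'a L2 \<Rightarrow> real" is "\<lambda>f g. \<integral>x. f x \<bullet> g x \<partial>lborel"
  by (rule integral_cong_AE) (auto simp: square_integrable_def)

definition norm_L2 :: "'a L2 \<Rightarrow> real" where
  "norm_L2 f = sqrt (f \<bullet> f)"

definition dist_L2 :: "'a L2 \<Rightarrow> 'a L2 \<Rightarrow> real" where
  "dist_L2 f g = norm (f - g)"

definition sgn_L2 :: "'a L2 \<Rightarrow> 'a L2" where
  "sgn_L2 f = inverse (norm f) *\<^sub>R f"

definition uniformity_L2 :: "('a L2 \<times> 'a L2) filter" where
  "uniformity_L2 = (INF e\<in>{0<..}. principal {(x, y). dist x y < e})"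

definition open_L2 :: "'a L2 set \<Rightarrow> bool" where
  "open_L2 U \<longleftrightarrow> (\<forall>x\<in>U. \<forall>\<^sub>F (x', y) in uniformity. x' = x \<longrightarrow> y \<in> U)"

instance
proof
  fix f g h :: "'a L2" and r s :: real
  show "f + g + h = f + (g + h)"
    by transfer (auto simp: add.assoc square_integrable_add)
  show "f + g = g + f"
    by transfer (auto simp: add.commute square_integrable_add)
  show "0 + f = f" by transfer auto
  show "- f + f = 0"
    by transfer (use square_integrable_zero in auto)
  show "f - g = f + - g" by (rule minus_L2_def)
  show "r *\<^sub>R (f + g) = r *\<^sub>R f + r *\<^sub>R g"
    by transfer (auto simp: scaleR_conv_of_real distrib_left intro!: square_integrable_add square_integrable_cmult)
  show "(r + s) *\<^sub>R f = r *\<^sub>R f + s *\<^sub>R f"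
    by transfer (auto simp: scaleR_conv_of_real distrib_right intro!: square_integrable_add square_integrable_cmult)
  show "r *\<^sub>R s *\<^sub>R f = (r * s) *\<^sub>R f"
    by transfer (auto simp: scaleR_conv_of_real mult.assoc intro!: square_integrable_cmult)
  show "1 *\<^sub>R f = f" by transfer auto
  show "dist f g = norm (f - g)" by (rule dist_L2_def)
  show "sgn f = inverse (norm f) *\<^sub>R f" by (rule sgn_L2_def)
  show "uniformity = (INF e\<in>{0<..}. principal {(x, y :: 'a L2). dist x y < e})"
    by (rule uniformity_L2_def)
  show "open U = (\<forall>x\<in>U. \<forall>\<^sub>F (x', y) in uniformity. x' = x \<longrightarrow> y \<in> U)" for U :: "'a L2 set"
    by (rule open_L2_def)
  show "f \<bullet> g = g \<bullet> f" by transfer (simp add: inner_commute)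
  show "(f + g) \<bullet> h = f \<bullet> h + g \<bullet> h"
    by transfer (simp add: inner_add_left square_integrable_inner)
  show "(r *\<^sub>R f) \<bullet> g = r * (f \<bullet> g)" by transfer simp
  show "0 \<le> f \<bullet> f" by transfer simp
  show "f \<bullet> f = 0 \<longleftrightarrow> f = 0"
  proof transfer
    fix f :: "'a \<Rightarrow> complex"
    assume f: "square_integrable f \<and> square_integrable f \<and> (AE x in lborel. f x = f x)"
    then have "(\<integral>x. f x \<bullet> f x \<partial>lborel) = 0 \<longleftrightarrow> (AE x in lborel. f x \<bullet> f x = 0)"
      by (intro integral_nonneg_eq_0_iff_AE square_integrable_inner) auto
    with f show "(\<integral>x. f x \<bullet> f x \<partial>lborel) = 0 \<longleftrightarrow>
        square_integrable f \<and> square_integrable (\<lambda>x::'a. 0) \<and> (AE x in lborel. f x = 0)"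
      by (simp add: square_integrable_zero)
  qed
  show "norm f = sqrt (f \<bullet> f)" by (rule norm_L2_def)
qed

end

lift_definition cscale_L2 :: "complex \<Rightarrow> 'a::euclidean_space L2 \<Rightarrow> 'a L2" is "\<lambda>c f x. c * f x"
  by (auto simp: square_integrable_cmult)

lemma norm_cscale_L2: "norm (cscale_L2 c f) = cmod c * norm f"
proof -
  have "cscale_L2 c f \<bullet> cscale_L2 c f = (cmod c)\<^sup>2 * (f \<bullet> f)"
    by transfer (simp add: dot_square_norm norm_mult power_mult_distrib)
  then show ?thesis by (simp add: norm_eq_sqrt_inner real_sqrt_mult)
qed

lift_definition scalar_op :: "complex \<Rightarrow> 'a::euclidean_space L2 \<Rightarrow>\<^sub>L 'a L2" is cscale_L2
proof (rule bounded_linear_intro)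
  fix c and f g :: "'a L2" and r :: real
  show "cscale_L2 c (f + g) = cscale_L2 c f + cscale_L2 c g"
    by transfer (auto simp: distrib_left intro!: square_integrable_add square_integrable_cmult)
  show "cscale_L2 c (r *\<^sub>R f) = r *\<^sub>R cscale_L2 c f"
    by transfer (auto simp: scaleR_conv_of_real mult.left_commute intro!: square_integrable_cmult)
  show "norm (cscale_L2 c f) \<le> norm f * cmod c"
    by (simp add: norm_cscale_L2)
qed

text \<open>The elements of \<open>'a L2 \<Rightarrow>\<^sub>L 'a L2\<close> are only required to be real-linear. If \<open>T\<close> is
  complex-linear, then so is any two-sided inverse of \<open>T - scalar_op z\<close>, and \<open>spectrum T\<close> is
  the usual one.\<close>

definition spectrum :: "('a::euclidean_space L2 \<Rightarrow>\<^sub>L 'a L2) \<Rightarrow> complex set" where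
  "spectrum T = {z. \<not> (\<exists>R. R o\<^sub>L (T - scalar_op z) = id_blinfun \<and> (T - scalar_op z) o\<^sub>L R = id_blinfun)}"

text \<open>For self-adjoint operators the spectrum is real, and \<open>Re\<close> only adjusts the type.\<close>

definition sup_spectrum :: "('a::euclidean_space L2 \<Rightarrow>\<^sub>L 'a L2) \<Rightarrow> real" where
  "sup_spectrum T = Sup (Re ` spectrum T)"

definition inf_spectrum :: "('a::euclidean_space L2 \<Rightarrow>\<^sub>L 'a L2) \<Rightarrow> real" where
  "inf_spectrum T = Inf (Re ` spectrum T)"


section \<open>Magnetic quantization\<close>

text \<open>Oscillatory integrals by the usual regularization: the limit must exist and be the same
  for every Schwartz cut-off that equals one at the origin.\<close>

definition osc_integral :: "('a::euclidean_space \<Rightarrow> complex) \<Rightarrow> complex" where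
  "osc_integral G = (THE l. \<forall>\<eta>\<in>schwartz. \<eta> 0 = (1::complex) \<longrightarrow>
     ((\<lambda>\<delta>::real. \<integral>z. \<eta> (\<delta> *\<^sub>R z) * G z \<partial>lborel) \<longlongrightarrow> l) (at_right 0))"

definition Op_schwartz ::
  "(real ^ 'n \<Rightarrow> real ^ 'n \<Rightarrow> real) \<Rightarrow> ((real ^ 'n) \<times> (real ^ 'n) \<Rightarrow> complex)
    \<Rightarrow> (real ^ 'n \<Rightarrow> complex) \<Rightarrow> real ^ 'n \<Rightarrow> complex" where
  "Op_schwartz \<phi> h f x = (2 * pi) powi (- int CARD('n)) *
     osc_integral (\<lambda>(y, \<xi>). exp (\<i> * (\<xi> \<bullet> (x - y))) * exp (\<i> * \<phi> x y) *
                        h ((1/2) *\<^sub>R (x + y), \<xi>) * f y)"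

text \<open>The bounded extension to \<open>L2\<close>; it is unique because Schwartz functions are dense, and for
  the same reason it is complex-linear.\<close>

definition Op ::
  "(real ^ 'n \<Rightarrow> real ^ 'n \<Rightarrow> real) \<Rightarrow> ((real ^ 'n) \<times> (real ^ 'n) \<Rightarrow> real)
    \<Rightarrow> (real ^ 'n) L2 \<Rightarrow>\<^sub>L (real ^ 'n) L2" where
  "Op \<phi> F = (THE T. \<forall>f\<in>schwartz.
     square_integrable (Op_schwartz \<phi> (\<lambda>z. of_real (F z)) f) \<and>
     blinfun_apply T (L2_class f) = L2_class (Op_schwartz \<phi> (\<lambda>z. of_real (F z)) f))"

end

theory Submission
 imports Defs "HOL-Probability.Probability"
begin

text \<open>A symbol of either class is a superposition \<open>F (x, \<xi>) = \<integral> \<kappa> x w * exp (- \<i> * (\<xi> \<bullet> z w)) dM w\<close>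
 in which \<open>|\<kappa> x w| \<le> b w\<close> and \<open>b * (1 + |z|^2)\<close> is integrable. Its quantization is an integral of
 translations by \<open>z w\<close>, and a magnetic phase multiplies the kernel by a unimodular function.
 An upper bound of a quadratic form survives multiplication of the kernel by a positive definite
 function that equals one on the diagonal. Localizing in position at a scale \<open>R\<close>, and in momentum
 around the transverse gauge averaged over base points in a ball of radius \<open>R\<close>, yields such
 functions that agree with the magnetic factor up to \<open>O((l + 1 / R^2) * |x - y|^2)\<close>, where \<open>l\<close> is the
 Lipschitz constant of the averaged gauge. As the argument is symmetric in the two operators, all
 three spectral quantities move by \<open>O(l + 1 / R^2)\<close>. With \<open>R^2 = 1 / |\<epsilon>|\<close> one has \<open>l = O(|\<epsilon>|)\<close> for
 constant and slowly varying fields; in general the average over base points bounds \<open>l\<close> at the price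
 of a logarithm.\<close>


text \<open>The obstacle is the transverse gauge itself. At distance R from its base point its
  Lipschitz constant is of order m + R m', where m bounds the field and m' is the Lipschitz constant
  of the field. For fields of strength |\<epsilon>| and R^2 = 1 / |\<epsilon>| this is only O(sqrt
  |\<epsilon>|). Averaging helps because a displacement of the point can be compensated by a
  displacement of the base point that keeps the evaluation point of the field fixed: the variation
  then falls on the averaging weight and not on the field. On the slice t of the radial integral
  this costs a factor 1 / (1 - t), whose integral up to 1 - \<tau> is the logarithm; the slices
  beyond have total length \<tau> and tolerate the direct bound. Errors linear in x - y would yield
  only the square root of the claimed bound. They cancel because the windows are even and because
  the overlap of two normalized windows is one minus half their squared distance. The remaining
  quadratic errors are integrated against the kernel, whence the second moment demanded of each
  representation.\<close>

abbreviation (input) "bmeas \<equiv> borel_measurable"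
abbreviation (input) "cplx \<equiv> complex_of_real"

text \<open>The unqualified names refer to Henstock-Kurzweil integration.\<close>

lemmas integrable_add' = Bochner_Integration.integrable_add
lemmas integrable_bound' = Bochner_Integration.integrable_bound
lemmas integrable_diff' = Bochner_Integration.integrable_diff
lemmas integral_add' = Bochner_Integration.integral_add
lemmas integral_cnj' = Bochner_Integration.integral_cnj
lemmas integral_cong' = Bochner_Integration.integral_cong
lemmas integral_diff' = Bochner_Integration.integral_diff
lemmas integral_nonneg' = Bochner_Integration.integral_nonneg
lemmas integral_sum' = Bochner_Integration.integral_sum

section \<open>Arithmetic and convergence of classes of square-integrable functions\<close>

lemma L2_class_rep: "L2_class (L2_rep f) = f"
 by (rule Quotient3_abs_rep[OF Quotient3_L2])

lemma square_integrable_rep: "square_integrable (L2_rep f)"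
 using Quotient3_rep_reflp[OF Quotient3_L2] by simp

lemma L2_class_eq_iff:
 assumes "square_integrable f" "square_integrable g"
 shows "L2_class f = L2_class g \<longleftrightarrow> (AE x in lborel. f x = g x)"
 using Quotient3_rel[OF Quotient3_L2, of f g] assms by auto

lemma L2_cases:
 obtains f where "square_integrable f" "F = L2_class f"
 using L2_class_rep square_integrable_rep by metis

lemma L2_class_add:
 assumes "square_integrable f" "square_integrable g"
 shows "L2_class f + L2_class g = L2_class (\<lambda>x. f x + g x)"
 using assms by (simp add: plus_L2.abs_eq)

lemma L2_class_uminus: "square_integrable f \<Longrightarrow> - L2_class f = L2_class (\<lambda>x. - f x)"
 by (simp add: uminus_L2.abs_eq)

lemma L2_class_zero: "0 = L2_class (\<lambda>x. 0)"
 by (simp add: zero_L2.abs_eq)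

lemma square_integrable_uminus: "square_integrable f \<Longrightarrow> square_integrable (\<lambda>x. - f x)"
 using square_integrable_cmult[of f "-1"] by simp

lemma square_integrable_diff:
 assumes "square_integrable f" "square_integrable g"
 shows "square_integrable (\<lambda>x. f x - g x)"
 using square_integrable_add[OF assms(1) square_integrable_uminus[OF assms(2)]] by simp

lemma L2_class_diff:
 assumes "square_integrable f" "square_integrable g"
 shows "L2_class f - L2_class g = L2_class (\<lambda>x. f x - g x)"
 using L2_class_add[OF assms(1) square_integrable_uminus[OF assms(2)]]
 by (simp add: minus_L2_def L2_class_uminus assms)

lemma L2_class_scaleR: "square_integrable f \<Longrightarrow> r *\<^sub>R L2_class f = L2_class (\<lambda>x. r *\<^sub>R f x)"
 by (simp add: scaleR_L2.abs_eq)

lemma L2_class_cscale: "square_integrable f \<Longrightarrow> scalar_op c (L2_class f) = L2_class (\<lambda>x. c * f x)"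
 by (simp add: scalar_op.rep_eq cscale_L2.abs_eq)

lemma L2_class_inner:
 assumes "square_integrable f" "square_integrable g"
 shows "L2_class f \<bullet> L2_class g = (LBINT x. f x \<bullet> g x)"
 using assms by (simp add: inner_L2.abs_eq)

lemma L2_class_norm2:
 assumes "square_integrable f"
 shows "(norm (L2_class f))^2 = (LBINT x. (norm (f x))^2)"
 using L2_class_inner[OF assms assms] by (simp add: power2_norm_eq_inner)

lemma square_integrable_measurable[measurable_dest]: "square_integrable f \<Longrightarrow> f \<in> bmeas borel"
 by (simp add: square_integrable_def)

lemma square_integrableI_bound:
 assumes "square_integrable g" "f \<in> bmeas borel" "\<And>x. norm (f x) \<le> norm (g x)"
 shows "square_integrable f"
 unfolding square_integrable_def
proof
 show "f \<in> bmeas lborel" using assms by simp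
 show "integrable lborel (\<lambda>x. (norm (f x))^2)"
  by (rule integrable_bound'[of _ "\<lambda>x. (norm (g x))^2"])
   (use assms in \<open>auto simp: square_integrable_def power_mono\<close>)
qed

lemma square_integrable_abs_mult:
 assumes "square_integrable f" "square_integrable g"
 shows "integrable lborel (\<lambda>x. norm (f x) * norm (g x))"
proof -
 have "square_integrable (\<lambda>x. cplx (norm (f x)))" "square_integrable (\<lambda>x. cplx (norm (g x)))"
  using assms by (auto simp: square_integrable_def)
 from square_integrable_inner[OF this] show ?thesis by (simp add: inner_complex_def)
qed

lemma integral_abs_mult_le_norm:
 assumes "square_integrable f" "square_integrable g"
 shows "(LBINT x. norm (f x) * norm (g x)) \<le> norm (L2_class f) * norm (L2_class g)"
proof -
 have *: "square_integrable (\<lambda>x. cplx (norm (f x)))" "square_integrable (\<lambda>x. cplx (norm (g x)))"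
  using assms by (auto simp: square_integrable_def)
 have n: "norm (L2_class (\<lambda>x. cplx (norm (h x)))) = norm (L2_class h)"
  if "square_integrable h" "square_integrable (\<lambda>x. cplx (norm (h x)))" for h :: "'a \<Rightarrow> complex"
  by (rule power2_eq_imp_eq) (simp_all add: L2_class_norm2 that)
 have "(LBINT x. norm (f x) * norm (g x)) = L2_class (\<lambda>x. cplx (norm (f x))) \<bullet> L2_class (\<lambda>x. cplx (norm (g x)))"
  by (simp add: L2_class_inner[OF *] inner_complex_def)
 also have "... \<le> norm (L2_class (\<lambda>x. cplx (norm (f x)))) * norm (L2_class (\<lambda>x. cplx (norm (g x))))"
  by (rule norm_cauchy_schwarz)
 finally show ?thesis by (simp add: n assms *)
qed

lemma L2_dominated_convergence:
 fixes f :: "nat \<Rightarrow> 'a::euclidean_space \<Rightarrow> complex"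
 assumes g: "square_integrable g" and [measurable]: "\<And>n. f n \<in> bmeas borel" "h \<in> bmeas borel"
  and le: "\<And>n x. norm (f n x) \<le> norm (g x)"
  and lim: "AE x in lborel. (\<lambda>n. f n x) \<longlonglongrightarrow> h x"
 shows "square_integrable h" "(\<lambda>n. L2_class (f n)) \<longlonglongrightarrow> L2_class h"
proof -
 have [measurable]: "g \<in> bmeas borel" using g by measurable
 have f: "square_integrable (f n)" for n
  by (rule square_integrableI_bound[OF g]) (auto simp: le)
 have hle: "AE x in lborel. norm (h x) \<le> norm (g x)"
  using lim
 proof eventually_elim
  case (elim x)
  then have "(\<lambda>n. norm (f n x)) \<longlonglongrightarrow> norm (h x)" by (rule tendsto_norm)
  then show ?case by (rule LIMSEQ_le_const2) (use le in auto)
 qed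
 show h: "square_integrable h"
  unfolding square_integrable_def
 proof
  show "integrable lborel (\<lambda>x. (norm (h x))^2)"
   by (rule integrable_bound'[of _ "\<lambda>x. (norm (g x))^2"])
    (use g hle in \<open>auto simp: square_integrable_def power_mono elim!: eventually_mono\<close>)
 qed simp
 \<comment> \<open>The limit inherits the bound by \<open>g\<close> almost everywhere, so the
   difference is at most \<open>2 * norm (g x)\<close>; squaring gives the majorant.\<close>
 have "(\<lambda>n. \<integral>x. (norm (f n x - h x))^2 \<partial>lborel) \<longlonglongrightarrow> (LINT x|(lborel::'a measure). (0::real))"
 proof (rule integral_dominated_convergence[where w="\<lambda>x. 4 * (norm (g x))^2"])
  show "integrable lborel (\<lambda>x. 4 * (norm (g x))^2)"
   using g by (simp add: square_integrable_def)
  show "AE x in lborel. (\<lambda>n. (norm (f n x - h x))^2) \<longlonglongrightarrow> 0"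
   using lim
  proof eventually_elim
   case (elim x)
   have "(\<lambda>n. (norm (f n x - h x))^2) \<longlonglongrightarrow> (norm (h x - h x))^2"
    by (intro tendsto_intros elim)
   then show ?case by simp
  qed
  fix n
  show "AE x in lborel. norm ((norm (f n x - h x))^2) \<le> 4 * (norm (g x))^2"
   using hle
  proof eventually_elim
   case (elim x)
   have "norm (f n x - h x) \<le> 2 * norm (g x)"
    using norm_triangle_ineq4[of "f n x" "h x"] le[of n x] elim by linarith
   then have "(norm (f n x - h x))^2 \<le> (2 * norm (g x))^2" by (intro power_mono) auto
   then show ?case by (simp add: power_mult_distrib)
  qed
 qed auto
 then have "(\<lambda>n. (norm (L2_class (f n) - L2_class h))^2) \<longlonglongrightarrow> 0"
  by (simp add: L2_class_diff f h L2_class_norm2 square_integrable_diff)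
 then have "(\<lambda>n. sqrt ((norm (L2_class (f n) - L2_class h))^2)) \<longlonglongrightarrow> sqrt 0"
  by (rule tendsto_real_sqrt)
 then show "(\<lambda>n. L2_class (f n)) \<longlonglongrightarrow> L2_class h"
  by (simp add: tendsto_norm_zero_iff LIM_zero_iff)
qed

subsection \<open>Completeness\<close>

text \<open>Lebesgue measure is infinite, so a Cauchy sequence in L2 need not be Cauchy in L1.
  Multiplication by a strictly positive square-integrable weight \<open>w\<close> makes it so by
  Cauchy-Schwarz, and an L1-Cauchy sequence has a subsequence that converges almost everywhere;
  dividing by \<open>w\<close> recovers the limit. Completeness is what the fixed point argument for
  resolvents rests on.\<close>

instance L2 :: (euclidean_space) banach
proof
 fix X :: "nat \<Rightarrow> 'a L2" assume X: "Cauchy X"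
 define f where "f n = L2_rep (X n)" for n
 have f: "square_integrable (f n)" and Xf: "X n = L2_class (f n)" for n
  by (auto simp: f_def square_integrable_rep L2_class_rep)
 have [measurable]: "f n \<in> bmeas borel" for n using f[of n] by measurable
 obtain h :: "'a \<Rightarrow> ennreal" where h[measurable]: "h \<in> bmeas lborel"
  and hfin: "integral\<^sup>N lborel h \<noteq> \<infinity>" and hpos: "\<And>x. 0 < h x \<and> h x < \<infinity>"
  using sigma_finite_measure.Ex_finite_integrable_function[OF sigma_finite_lborel[where 'a='a]] by auto
 define w where "w x = sqrt (enn2real (h x))" for x
 have wpos: "w x > 0" for x using hpos[of x] by (simp add: w_def enn2real_positive_iff)
 have [measurable]: "w \<in> bmeas borel" unfolding w_def using h by simp
 have W: "square_integrable (\<lambda>x. cplx (w x))"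
 proof -
  have "(\<integral>\<^sup>+x. ennreal ((w x)^2) \<partial>lborel) < \<infinity>"
   using hfin hpos by (simp add: w_def top.not_eq_extremum)
  then have "integrable lborel (\<lambda>x. (w x)^2)"
   by (intro integrableI_bounded) auto
  then show ?thesis by (simp add: square_integrable_def)
 qed
 define s where "s n x = cplx (w x) * f n x" for n x
 have int: "integrable lborel (s n)" for n
 proof (rule integrable_norm_cancel)
  show "integrable lborel (\<lambda>x. norm (s n x))"
   using square_integrable_abs_mult[OF W f[of n]] by (simp add: s_def norm_mult)
 qed (simp add: s_def[abs_def])
 have "\<exists>N. \<forall>i\<ge>N. \<forall>j\<ge>N. LINT x|lborel. norm (s i x - s j x) < e" if "e > 0" for e
 proof -
  let ?W = "norm (L2_class (\<lambda>x. cplx (w x)))"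
  have "e / (?W + 1) > 0" using that by (simp add: add_nonneg_pos)
  from metric_CauchyD[OF X this] obtain N where N: "\<And>i j. i \<ge> N \<Longrightarrow> j \<ge> N \<Longrightarrow> norm (X i - X j) < e / (?W + 1)"
   by (auto simp: dist_norm)
  have "(LINT x|lborel. norm (s i x - s j x)) < e" if "i \<ge> N" "j \<ge> N" for i j
  proof -
   have "(LINT x|lborel. norm (s i x - s j x)) = (LBINT x. norm (cplx (w x)) * norm (f i x - f j x))"
    by (simp add: s_def norm_mult flip: right_diff_distrib)
   also have "... \<le> ?W * norm (X i - X j)"
    unfolding Xf L2_class_diff[OF f f]
    by (rule integral_abs_mult_le_norm[OF W square_integrable_diff[OF f f]])
   also have "... \<le> (?W + 1) * norm (X i - X j)" by (simp add: mult_right_mono)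
   also have "... < e" using N[OF that]
    by (simp add: pos_less_divide_eq add_nonneg_pos mult.commute)
   finally show ?thesis .
  qed
  then show ?thesis by blast
 qed
 from cauchy_L1_AE_cauchy_subseq[OF int this] obtain r where r: "strict_mono r"
  and AE: "AE x in lborel. Cauchy (\<lambda>i. s (r i) x)" by blast
 define g where "g x = lim (\<lambda>i. f (r i) x)" for x
 have lim: "AE x in lborel. (\<lambda>i. f (r i) x) \<longlonglongrightarrow> g x"
  using AE
 proof eventually_elim
  case (elim x)
  have "(\<lambda>i. s (r i) x) \<longlonglongrightarrow> lim (\<lambda>i. s (r i) x)"
   using elim by (simp add: Cauchy_convergent_iff convergent_LIMSEQ_iff)
  then have "(\<lambda>i. inverse (cplx (w x)) * s (r i) x) \<longlonglongrightarrow> inverse (cplx (w x)) * lim (\<lambda>i. s (r i) x)"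
   by (intro tendsto_intros)
  moreover have "(\<lambda>i. inverse (cplx (w x)) * s (r i) x) = (\<lambda>i. f (r i) x)"
   using wpos[of x] by (simp add: s_def fun_eq_iff)
  ultimately have "convergent (\<lambda>i. f (r i) x)"
   unfolding convergent_def by auto
  then show ?case by (simp add: g_def Cauchy_convergent_iff convergent_LIMSEQ_iff)
 qed
 have [measurable]: "g \<in> bmeas borel"
  unfolding g_def by (rule borel_measurable_lim_metric) simp
 \<comment> \<open>Fatou's lemma along the subsequence serves twice: with \<open>e = 1\<close> it
   puts \<open>g\<close> into L2, with small \<open>e\<close> it gives convergence of the whole
   sequence.\<close>
 have fatou: "(\<integral>\<^sup>+x. ennreal ((norm (f n x - g x))^2) \<partial>lborel) \<le> ennreal (e^2)"
  if e: "e > 0" "\<And>m. m \<ge> N \<Longrightarrow> norm (X n - X m) \<le> e" for n e N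
 proof -
  have "(\<integral>\<^sup>+x. ennreal ((norm (f n x - g x))^2) \<partial>lborel)
   = (\<integral>\<^sup>+x. liminf (\<lambda>i. ennreal ((norm (f n x - f (r i) x))^2)) \<partial>lborel)"
  proof (rule nn_integral_cong_AE)
   show "AE x in lborel. ennreal ((norm (f n x - g x))^2) = liminf (\<lambda>i. ennreal ((norm (f n x - f (r i) x))^2))"
    using lim
   proof eventually_elim
    case (elim x)
    have "(\<lambda>i. ennreal ((norm (f n x - f (r i) x))^2)) \<longlonglongrightarrow> ennreal ((norm (f n x - g x))^2)"
     by (intro tendsto_intros elim tendsto_ennrealI)
    from lim_imp_Liminf[OF _ this] show ?case by simp
   qed
  qed
  also have "... \<le> liminf (\<lambda>i. \<integral>\<^sup>+x. ennreal ((norm (f n x - f (r i) x))^2) \<partial>lborel)"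
   by (rule nn_integral_liminf) simp
  also have "... = liminf (\<lambda>i. ennreal ((norm (X n - X (r i)))^2))"
   unfolding Xf L2_class_diff[OF f f] L2_class_norm2[OF square_integrable_diff[OF f f]]
   using square_integrable_diff[OF f f]
   by (subst nn_integral_eq_integral) (auto simp: square_integrable_def)
  also have "... \<le> liminf (\<lambda>i::nat. ennreal (e^2))"
  proof (rule Liminf_mono)
   show "\<forall>\<^sub>F i in sequentially. ennreal ((norm (X n - X (r i)))^2) \<le> ennreal (e^2)"
    using eventually_ge_at_top[of N]
   proof eventually_elim
    case (elim i)
    then have "r i \<ge> N" using seq_suble[OF r, of i] by linarith
    then show ?case using e by (intro ennreal_leI power_mono) auto
   qed
  qed
  also have "... = ennreal (e^2)" by (simp add: Liminf_const)
  finally show ?thesis .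
 qed
 have diff: "square_integrable (\<lambda>x. f n x - g x)" if "(\<integral>\<^sup>+x. ennreal ((norm (f n x - g x))^2) \<partial>lborel) \<le> ennreal c" for n c
  unfolding square_integrable_def
  using that by (intro conjI integrableI_bounded) (auto simp: le_less_trans[OF _ ennreal_less_top])
 have g: "square_integrable g"
 proof -
  obtain N where "\<And>i j. i \<ge> N \<Longrightarrow> j \<ge> N \<Longrightarrow> norm (X i - X j) < 1"
   using metric_CauchyD[OF X, of 1] by (auto simp: dist_norm)
  then have "(\<integral>\<^sup>+x. ennreal ((norm (f N x - g x))^2) \<partial>lborel) \<le> ennreal (1^2)"
   by (intro fatou[of 1 N]) (auto intro: less_imp_le)
  from square_integrable_diff[OF f[of N] diff[OF this]] show ?thesis by simp
 qed
 have "X \<longlonglongrightarrow> L2_class g"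
 proof (rule LIMSEQ_I)
  fix e :: real assume e: "e > 0"
  then obtain N where N: "\<And>i j. i \<ge> N \<Longrightarrow> j \<ge> N \<Longrightarrow> norm (X i - X j) < e/2"
   using metric_CauchyD[OF X, of "e/2"] by (auto simp: dist_norm)
  have "norm (X n - L2_class g) < e" if "n \<ge> N" for n
  proof -
   have b: "(\<integral>\<^sup>+x. ennreal ((norm (f n x - g x))^2) \<partial>lborel) \<le> ennreal ((e/2)^2)"
    using N that e by (intro fatou[of "e/2" N]) (auto intro: less_imp_le)
   have "ennreal ((norm (X n - L2_class g))^2) = (\<integral>\<^sup>+x. ennreal ((norm (f n x - g x))^2) \<partial>lborel)"
    unfolding Xf L2_class_diff[OF f g] L2_class_norm2[OF square_integrable_diff[OF f g]]
    using square_integrable_diff[OF f g]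
    by (subst nn_integral_eq_integral) (auto simp: square_integrable_def)
   with b have "(norm (X n - L2_class g))^2 \<le> (e/2)^2"
    by (metis ennreal_le_iff zero_le_power2)
   then have "norm (X n - L2_class g) \<le> e/2" using e by (simp add: power2_le_iff_abs_le)
   with e show ?thesis by simp
  qed
  then show "\<exists>no. \<forall>n\<ge>no. norm (X n - L2_class g) < e" by blast
 qed
 then show "convergent X" by (auto simp: convergent_def)
qed

section \<open>Spectrum, quadratic form and norm of symmetric operators\<close>

lemma exists_norm_one_L2: "\<exists>f::'a::euclidean_space L2. norm f = 1"
proof -
 let ?b = "cbox 0 (One::'a)"
 let ?g = "\<lambda>x::'a. cplx (indicator ?b x)"
 have e: "emeasure lborel ?b = 1"
  by (subst emeasure_lborel_cbox) auto
 have i: "integrable lborel (indicator ?b :: 'a \<Rightarrow> real)"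
  using e by (intro integrable_real_indicator) auto
 have n: "(\<lambda>x. (cmod (?g x))^2) = indicator ?b"
  by (auto simp: fun_eq_iff indicator_def)
 have g: "square_integrable ?g"
  unfolding square_integrable_def n using i by simp
 have "(norm (L2_class ?g))^2 = 1"
  unfolding L2_class_norm2[OF g] n using e by (simp add: measure_def)
 then have "norm (L2_class ?g) = 1" by (simp only: power2_eq_1_iff) (smt (verit) norm_ge_zero)
 then show ?thesis by blast
qed

lemma scalar_op_of_real: "scalar_op (cplx r) f = r *\<^sub>R f"
 by (rule L2_cases[of f]) (simp add: L2_class_cscale L2_class_scaleR scaleR_conv_of_real)

lemma blinfun_eq_iff: "S = T \<longleftrightarrow> (\<forall>x. blinfun_apply S x = blinfun_apply T x)"
 by (auto intro: blinfun_eqI)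

text \<open>For the real inner product \<open>\<i> * f\<close> is orthogonal to \<open>f\<close>.
  Hence whether \<open>scalar_op z - T\<close> is coercive depends on \<open>Re z\<close> alone, and
  non-real spectral parameters need no separate treatment.\<close>

lemma inner_scalar_op: "f \<bullet> scalar_op z f = Re z * (f \<bullet> f)"
proof (rule L2_cases[of f])
 fix g assume g: "square_integrable g" "f = L2_class g"
 have "g x \<bullet> (z * g x) = Re z * (g x \<bullet> g x)" for x
  by (simp add: inner_complex_def algebra_simps)
 then show ?thesis
  by (simp add: g L2_class_cscale L2_class_inner square_integrable_cmult)
qed

text \<open>Lax--Milgram: a coercive bounded operator is a bijection, as the fixed points of the
 contraction \<open>f \<mapsto> f - t (S f - g)\<close> solve \<open>S f = g\<close>.\<close>

lemma coercive_bijective: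
 fixes S :: "'a::{real_inner, banach} \<Rightarrow>\<^sub>L 'a"
 assumes c: "c > 0" and coer: "\<And>f. c * (f \<bullet> f) \<le> f \<bullet> S f"
 shows "\<exists>R. R o\<^sub>L S = id_blinfun \<and> S o\<^sub>L R = id_blinfun"
proof -
 have below: "c * norm f \<le> norm (S f)" for f
 proof (cases "f = 0")
  case False
  have "c * norm f * norm f \<le> norm (S f) * norm f"
   using coer[of f] norm_cauchy_schwarz[of f "S f"]
   by (simp add: power2_norm_eq_inner[symmetric] power2_eq_square mult_ac)
  then show ?thesis using False by simp
 qed simp
 define N where "N = norm S + c + 1"
 have N: "N > 0" "norm S \<le> N" "c < N" using c by (auto simp: N_def add_nonneg_pos)
 \<comment> \<open>This step size minimizes \<open>1 - 2 * t * c + t^2 * N^2\<close>, the bound for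
   the squared contraction factor; the minimum is \<open>q^2\<close>. The summand \<open>c\<close>
   in \<open>N\<close> ensures \<open>c < N\<close>, so that \<open>q\<close> is the root of a
   positive number.\<close>
 define t where "t = c / N^2"
 define q where "q = sqrt (1 - c\<^sup>2 / N^2)"
 have cN: "c^2 / N^2 < 1" "0 < c^2 / N^2"
  using c N by (auto simp: power_strict_mono)
 have q: "0 \<le> q" "q < 1" using cN by (auto simp: q_def)
 have contr: "norm (f - t *\<^sub>R S f) \<le> q * norm f" for f
 proof (rule power2_le_imp_le)
  have "norm (S f) \<le> N * norm f"
   using norm_blinfun[of S f] N(2) by (meson mult_right_mono norm_ge_zero order_trans)
  then have Sf: "(norm (S f))^2 \<le> N^2 * (norm f)^2"
   by (metis norm_ge_zero power_mono power_mult_distrib)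
  have "(norm (f - t *\<^sub>R S f))^2 = (norm f)^2 - 2 * t * (f \<bullet> S f) + t^2 * (norm (S f))^2"
   unfolding power2_norm_eq_inner
   by (simp add: inner_diff_left inner_diff_right inner_commute power2_eq_square algebra_simps)
  also have "... \<le> (norm f)^2 - 2 * t * (c * (norm f)^2) + t^2 * (N^2 * (norm f)^2)"
   using coer[of f] Sf c N by (intro add_mono diff_mono mult_left_mono) (auto simp: t_def power2_norm_eq_inner)
  also have "... = (1 - c\<^sup>2 / N^2) * (norm f)^2"
   using N by (simp add: t_def field_simps power2_eq_square)
  also have "... = (q * norm f)^2" using cN by (simp add: q_def power_mult_distrib)
  finally show "(norm (f - t *\<^sub>R S f))^2 \<le> (q * norm f)^2" .
 qed (use q in auto)
 have t: "t > 0" using c N by (simp add: t_def)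
 have inj: "f = g" if "S f = S g" for f g
  using below[of "f - g"] that c by (simp add: blinfun.diff_right mult_le_0_iff)
 have surj: "\<exists>f. S f = g" for g
 proof -
  have "\<exists>!x. x - t *\<^sub>R (S x - g) = x"
  proof (rule banach_fix_type[OF q])
   show "\<forall>x y. dist (x - t *\<^sub>R (S x - g)) (y - t *\<^sub>R (S y - g)) \<le> q * dist x y"
    using contr[of "x - y" for x y] by (auto simp: dist_norm blinfun.diff_right algebra_simps)
  qed
  then obtain x where "t *\<^sub>R (S x - g) = 0" by (auto simp: algebra_simps)
  with t show ?thesis by auto
 qed
 define r where "r g = (THE f. S f = g)" for g
 have Sr: "S (r g) = g" for g
 proof -
  obtain f where f: "S f = g" using surj by blast
  show ?thesis unfolding r_def
  proof (rule theI[where a=f])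
   show "h = f" if "S h = g" for h by (rule inj) (simp add: f that)
  qed (rule f)
 qed
 have rS: "r (S f) = f" for f by (rule inj) (simp add: Sr)
 have bl: "bounded_linear r"
 proof (rule bounded_linear_intro[where K="1/c"])
  show "r (x + y) = r x + r y" for x y by (rule inj) (simp add: Sr blinfun.add_right)
  show "r (a *\<^sub>R x) = a *\<^sub>R r x" for a x by (rule inj) (simp add: Sr blinfun.scaleR_right)
  show "norm (r x) \<le> norm x * (1/c)" for x
   using below[of "r x"] c by (simp add: Sr field_simps)
 qed
 show ?thesis
  by (rule exI[of _ "Blinfun r"]) (auto intro!: blinfun_eqI simp: bounded_linear_Blinfun_apply[OF bl] Sr rS)
qed

definition symmetric_op :: "('a::real_inner \<Rightarrow>\<^sub>L 'a) \<Rightarrow> bool" where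
 "symmetric_op T \<longleftrightarrow> (\<forall>f g. T f \<bullet> g = f \<bullet> T g)"

lemma inner_apply_le_norm: "f \<bullet> blinfun_apply T f \<le> norm T * (f \<bullet> f)"
proof -
 have "f \<bullet> T f \<le> norm f * (norm T * norm f)"
  using norm_cauchy_schwarz[of f "T f"] norm_blinfun[of T f]
  by (meson mult_left_mono norm_ge_zero order_trans)
 then show ?thesis by (simp add: power2_norm_eq_inner[symmetric] power2_eq_square mult_ac)
qed

text \<open>If \<open>P\<close> is a positive symmetric operator then \<open>\<parallel>P f\<parallel>^2 \<le> \<parallel>P\<parallel> \<langle>f, P f\<rangle>\<close>, hence a left inverse of
 \<open>P\<close> makes \<open>P\<close> coercive.\<close>

lemma positive_left_inverse_coercive:
 fixes P :: "'a::real_inner \<Rightarrow>\<^sub>L 'a"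
 assumes sym: "symmetric_op P" and pos: "\<And>f. 0 \<le> f \<bullet> P f" and R: "R o\<^sub>L P = id_blinfun"
 shows "\<exists>c>0. \<forall>f. c * (f \<bullet> f) \<le> f \<bullet> P f"
proof -
 define N where "N = norm P + 1"
 define K where "K = norm R + 1"
 have N: "N > 0" "norm P \<le> N" and K: "K > 0" "norm R \<le> K"
  by (auto simp: N_def K_def add_nonneg_pos)
 have Pf: "(norm (P f))^2 \<le> N * (f \<bullet> P f)" for f
 proof -
  \<comment> \<open>Positivity is tested at \<open>f - P f / N\<close>; symmetry turns the term
    \<open>f \<bullet> P (P f)\<close> into the squared norm of \<open>P f\<close>, and with this
    step the quadratic term eats only half of the linear one.\<close>
  let ?t = "1 / N"
  have "0 \<le> (f - ?t *\<^sub>R P f) \<bullet> P (f - ?t *\<^sub>R P f)" by (rule pos)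
  also have "... = f \<bullet> P f - 2 * ?t * (norm (P f))^2 + ?t^2 * (P f \<bullet> P (P f))"
  proof -
   have "f \<bullet> P (P f) = P f \<bullet> P f" using sym by (simp add: symmetric_op_def)
   then show ?thesis
    unfolding power2_norm_eq_inner
    by (simp add: blinfun.diff_right blinfun.scaleR_right inner_diff_left inner_diff_right power2_eq_square algebra_simps)
  qed
  also have "... \<le> f \<bullet> P f - 2 * ?t * (norm (P f))^2 + ?t^2 * (N * (norm (P f))^2)"
   unfolding power2_norm_eq_inner
   using order_trans[OF inner_apply_le_norm[of "P f" P] mult_right_mono[OF N(2) inner_ge_zero]]
   by (intro add_mono mult_left_mono) auto
  also have "... = f \<bullet> P f - (norm (P f))\<^sup>2 / N"
   using N by (simp add: field_simps power2_eq_square)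
  finally show ?thesis using N by (simp add: field_simps)
 qed
 have "1 / (K^2 * N) * (f \<bullet> f) \<le> f \<bullet> P f" for f
 proof -
  have "f = R (P f)" using R by (metis blinfun_apply_blinfun_compose id_blinfun.rep_eq id_apply)
  then have "norm f \<le> K * norm (P f)"
   by (metis K(2) mult_right_mono norm_blinfun norm_ge_zero order_trans)
  then have "(norm f)^2 \<le> K^2 * (norm (P f))^2"
   by (metis norm_ge_zero power_mono power_mult_distrib)
  also have "... \<le> K^2 * (N * (f \<bullet> P f))" using Pf by (intro mult_left_mono) auto
  finally show ?thesis using K N by (simp add: power2_norm_eq_inner field_simps)
 qed
 moreover have "1 / (K^2 * N) > 0" using K N by simp
 ultimately show ?thesis by blast
qed

text \<open>The least element of this set is the top of the spectrum. Phrasing the comparison of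
  operators through all upper bounds lets it run on quadratic forms without mentioning
  spectra.\<close>

definition form_bounds :: "('a::real_inner \<Rightarrow>\<^sub>L 'a) \<Rightarrow> real set" where
 "form_bounds T = {\<beta>. \<forall>f. f \<bullet> T f \<le> \<beta> * (f \<bullet> f)}"

lemma spectrum_Re_le:
 fixes T :: "'a::euclidean_space L2 \<Rightarrow>\<^sub>L 'a L2"
 assumes "a \<in> form_bounds T" and z: "z \<in> spectrum T"
 shows "Re z \<le> a"
proof (rule ccontr)
 assume "\<not> Re z \<le> a"
 then have c: "Re z - a > 0" by simp
 have "(Re z - a) * (f \<bullet> f) \<le> f \<bullet> (scalar_op z - T) f" for f
  using assms(1) by (simp add: form_bounds_def blinfun.diff_left inner_diff_right inner_scalar_op algebra_simps)
 from coercive_bijective[OF c this] obtain R where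
  "R o\<^sub>L (scalar_op z - T) = id_blinfun" "(scalar_op z - T) o\<^sub>L R = id_blinfun" by blast
 then have "(- R) o\<^sub>L (T - scalar_op z) = id_blinfun" "(T - scalar_op z) o\<^sub>L (- R) = id_blinfun"
  by (auto simp: blinfun_eq_iff blinfun.diff_left blinfun.diff_right blinfun.minus_left blinfun.minus_right)
 then show False using z by (auto simp: spectrum_def)
qed

text \<open>Let \<open>M\<close> be the least form bound. Above \<open>M\<close> the resolvent
  exists by coercivity. At \<open>M\<close> it cannot: a left inverse of the positive operator
  \<open>M - T\<close> would make that operator coercive with some \<open>c > 0\<close>, and
  \<open>M - c\<close> would be a smaller form bound.\<close>

lemma sup_spectrum_props:
 fixes T :: "'a::euclidean_space L2 \<Rightarrow>\<^sub>L 'a L2"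
 assumes sym: "symmetric_op T"
 shows "sup_spectrum T \<in> form_bounds T" "\<And>a. a \<in> form_bounds T \<Longrightarrow> sup_spectrum T \<le> a"
proof -
 \<comment> \<open>A unit vector bounds the form bounds from below; on the zero space every real
   number would be one.\<close>
 obtain e :: "'a L2" where e: "norm e = 1" using exists_norm_one_L2 by blast
 have lower: "- norm T \<le> a" if "a \<in> form_bounds T" for a
 proof -
  have "- norm T \<le> e \<bullet> T e"
   using inner_apply_le_norm[of e "- T"] e by (simp add: blinfun.minus_left flip: power2_norm_eq_inner)
  also have "... \<le> a" using that e by (auto simp: form_bounds_def simp flip: power2_norm_eq_inner dest!: spec[of _ e])
  finally show ?thesis .
 qed
 have ne: "norm T \<in> form_bounds T" by (simp add: form_bounds_def inner_apply_le_norm)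
 have bdd: "bdd_below (form_bounds T)" using lower by (auto simp: bdd_below_def)
 define M where "M = Inf (form_bounds T)"
 have M1: "M \<in> form_bounds T"
 proof -
  have "f \<bullet> T f \<le> M * (f \<bullet> f)" for f
  proof (cases "f = 0")
   case False
   then have p: "f \<bullet> f > 0" by simp
   have "f \<bullet> T f / (f \<bullet> f) \<le> M"
    unfolding M_def using ne p by (intro cInf_greatest) (auto simp: form_bounds_def field_simps)
   then show ?thesis using p by (simp add: field_simps)
  qed simp
  then show ?thesis by (simp add: form_bounds_def)
 qed
 have M2: "M \<le> a" if "a \<in> form_bounds T" for a
  unfolding M_def using that bdd by (rule cInf_lower)
 have "cplx M \<in> spectrum T"
 proof (rule ccontr)
  assume "cplx M \<notin> spectrum T"
  then obtain R where "R o\<^sub>L (T - scalar_op M) = id_blinfun" by (auto simp: spectrum_def)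
  then have R: "(- R) o\<^sub>L (scalar_op M - T) = id_blinfun"
   by (auto simp: blinfun_eq_iff blinfun.diff_left blinfun.diff_right blinfun.minus_left blinfun.minus_right)
  have s: "symmetric_op (scalar_op M - T)"
   using sym by (simp add: symmetric_op_def blinfun.diff_left inner_diff_left inner_diff_right scalar_op_of_real)
  have p: "0 \<le> f \<bullet> (scalar_op M - T) f" for f
   using M1 by (simp add: form_bounds_def blinfun.diff_left inner_diff_right inner_scalar_op)
  from positive_left_inverse_coercive[OF s p R] obtain c where c: "c > 0"
   "\<And>f. c * (f \<bullet> f) \<le> f \<bullet> (scalar_op M - T) f" by blast
  have "M - c \<in> form_bounds T"
   using c(2) by (simp add: form_bounds_def blinfun.diff_left inner_diff_right inner_scalar_op algebra_simps)
  from M2[OF this] c show False by simp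
 qed
 then have "sup_spectrum T = M"
  unfolding sup_spectrum_def
  by (intro cSup_eq_maximum) (force, use spectrum_Re_le[OF M1] in blast)
 then show "sup_spectrum T \<in> form_bounds T" "\<And>a. a \<in> form_bounds T \<Longrightarrow> sup_spectrum T \<le> a"
  using M1 M2 by auto
qed

lemma spectrum_uminus:
 fixes T :: "'a::euclidean_space L2 \<Rightarrow>\<^sub>L 'a L2"
 shows "spectrum (- T) = uminus ` spectrum T"
proof -
 have scal: "scalar_op (- z) = (- scalar_op z :: 'a L2 \<Rightarrow>\<^sub>L 'a L2)" for z :: complex
 proof (rule blinfun_eqI)
  fix f :: "'a L2"
  show "scalar_op (- z) f = (- scalar_op z) f"
   by (rule L2_cases[of f]) (simp add: blinfun.minus_left L2_class_cscale L2_class_uminus square_integrable_cmult)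
 qed
 have "z \<in> spectrum T" if "- z \<in> spectrum (- T)" for z and T :: "'a L2 \<Rightarrow>\<^sub>L 'a L2"
 proof (rule ccontr)
  assume "z \<notin> spectrum T"
  then obtain R where "R o\<^sub>L (T - scalar_op z) = id_blinfun" "(T - scalar_op z) o\<^sub>L R = id_blinfun"
   by (auto simp: spectrum_def)
  then have "(- R) o\<^sub>L (- T - scalar_op (- z)) = id_blinfun" "(- T - scalar_op (- z)) o\<^sub>L (- R) = id_blinfun"
   by (auto simp: scal blinfun_eq_iff blinfun.diff_left blinfun.diff_right blinfun.minus_left blinfun.minus_right blinfun.add_left blinfun.add_right)
  with that show False by (auto simp: spectrum_def)
 qed
 note * = this
 have "z \<in> uminus ` spectrum T" if "z \<in> spectrum (- T)" for z
  using *[of "- z" T] that by (auto simp: image_iff intro: bexI[of _ "- z"])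
 moreover have "- z \<in> spectrum (- T)" if "z \<in> spectrum T" for z
  using *[of "- z" "- T"] that by simp
 ultimately show ?thesis by auto
qed

lemma inf_spectrum_eq: "inf_spectrum T = - sup_spectrum (- T)"
 unfolding inf_spectrum_def sup_spectrum_def spectrum_uminus Inf_real_def
 by (simp add: image_image)

text \<open>Polarization expresses \<open>f \<bullet> T g\<close> by the form at
  \<open>f + g\<close> and \<open>f - g\<close>, and the parallelogram law adds up the two
  bounds.\<close>

lemma norm_symmetric_le:
 fixes T :: "'a::real_inner \<Rightarrow>\<^sub>L 'a"
 assumes sym: "symmetric_op T" and b: "c \<in> form_bounds T" "c \<in> form_bounds (- T)" and c: "0 \<le> c"
 shows "norm T \<le> c"
proof (rule norm_blinfun_bound[OF c])
 fix f
 have 1: "\<bar>f \<bullet> T f\<bar> \<le> c * (f \<bullet> f)" for f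
  using b by (auto simp: form_bounds_def abs_le_iff blinfun.minus_left)
 have 2: "4 * (f \<bullet> T g) \<le> 2 * c * (f \<bullet> f + g \<bullet> g)" for f g
 proof -
  have "g \<bullet> T f = f \<bullet> T g" using sym by (simp add: symmetric_op_def inner_commute)
  then have "4 * (f \<bullet> T g) = (f + g) \<bullet> T (f + g) - (f - g) \<bullet> T (f - g)"
   by (simp add: blinfun.add_right blinfun.diff_right inner_add_left inner_add_right inner_diff_left inner_diff_right)
  also have "... \<le> c * ((f + g) \<bullet> (f + g)) + c * ((f - g) \<bullet> (f - g))"
   using 1[of "f + g"] 1[of "f - g"] by linarith
  also have "... = 2 * c * (f \<bullet> f + g \<bullet> g)"
   by (simp add: inner_add_left inner_add_right inner_diff_left inner_diff_right inner_commute algebra_simps)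
  finally show ?thesis .
 qed
 show "norm (T f) \<le> c * norm f"
 proof (cases "T f = 0 \<or> f = 0")
  case False
  \<comment> \<open>The polarized bound involves the sum of the squared norms and is sharp for
    vectors of equal length, hence \<open>f\<close> and \<open>T f\<close> are rescaled to the
    common norm \<open>norm f * norm (T f)\<close>.\<close>
  let ?g = "norm (T f) *\<^sub>R f" and ?h = "norm f *\<^sub>R T f"
  have eqs: "?h \<bullet> T ?g = norm f * norm (T f) * (norm (T f))^2"
   "?h \<bullet> ?h = (norm f)^2 * (norm (T f))^2" "?g \<bullet> ?g = (norm f)^2 * (norm (T f))^2"
   by (simp_all add: blinfun.scaleR_right dot_square_norm power2_eq_square)
  have "(4 * (norm f * norm (T f))) * (norm (T f))^2 \<le> (4 * (c * (norm f)^2)) * (norm (T f))^2"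
   using 2[of ?h ?g] unfolding eqs by (simp add: algebra_simps)
  then have "4 * (norm f * norm (T f)) \<le> 4 * (c * (norm f)^2)"
   using False by (subst (asm) mult_le_cancel_right) auto
  then have "norm (T f) * norm f \<le> c * norm f * norm f"
   by (simp add: power2_eq_square mult_ac)
  then show ?thesis using False by simp
 next
  case True then show ?thesis using c by auto
 qed
qed

text \<open>The top of the spectrum is the least form bound, the bottom is minus the least form
  bound of \<open>- T\<close>, and any nonnegative common form bound of \<open>T\<close> and
  \<open>- T\<close> dominates the norm. All three therefore follow from the same four
  implications.\<close>

lemma spectral_quantity_stable:
 fixes T T' :: "'a::euclidean_space L2 \<Rightarrow>\<^sub>L 'a L2"
 assumes sym: "symmetric_op T" "symmetric_op T'" and d: "d \<ge> 0"
  and up: "\<And>c. c \<in> form_bounds T \<Longrightarrow> c + d \<in> form_bounds T'"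
  and up': "\<And>c. c \<in> form_bounds T' \<Longrightarrow> c + d \<in> form_bounds T"
  and lo: "\<And>c. c \<in> form_bounds (- T) \<Longrightarrow> c + d \<in> form_bounds (- T')"
  and lo': "\<And>c. c \<in> form_bounds (- T') \<Longrightarrow> c + d \<in> form_bounds (- T)"
  and E: "E \<in> {sup_spectrum, inf_spectrum, norm}"
 shows "\<bar>E T' - E T\<bar> \<le> d"
proof -
 have symm: "symmetric_op (- T)" "symmetric_op (- T')"
  using sym by (auto simp: symmetric_op_def blinfun.minus_left)
 have S: "\<bar>sup_spectrum V' - sup_spectrum V\<bar> \<le> d"
  if "symmetric_op V" "symmetric_op V'" "\<And>c. c \<in> form_bounds V \<Longrightarrow> c + d \<in> form_bounds V'"
   "\<And>c. c \<in> form_bounds V' \<Longrightarrow> c + d \<in> form_bounds V" for V V' :: "'a L2 \<Rightarrow>\<^sub>L 'a L2"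
  using sup_spectrum_props(2)[OF that(2) that(3)[OF sup_spectrum_props(1)[OF that(1)]]]
   sup_spectrum_props(2)[OF that(1) that(4)[OF sup_spectrum_props(1)[OF that(2)]]] by linarith
 have nb: "norm V \<in> form_bounds V" "norm V \<in> form_bounds (- V)" for V :: "'a L2 \<Rightarrow>\<^sub>L 'a L2"
  using inner_apply_le_norm[of _ V] inner_apply_le_norm[of _ "- V"] by (auto simp: form_bounds_def)
 have "norm T' \<le> norm T + d"
  by (rule norm_symmetric_le[OF sym(2) up[OF nb(1)] lo[OF nb(2)]]) (use d in simp)
 moreover have "norm T \<le> norm T' + d"
  by (rule norm_symmetric_le[OF sym(1) up'[OF nb(1)] lo'[OF nb(2)]]) (use d in simp)
 ultimately have "\<bar>norm T' - norm T\<bar> \<le> d" by linarith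
 moreover have "\<bar>sup_spectrum T' - sup_spectrum T\<bar> \<le> d" by (rule S[OF sym up up'])
 moreover have "\<bar>sup_spectrum (- T') - sup_spectrum (- T)\<bar> \<le> d" by (rule S[OF symm lo lo'])
 then have "\<bar>inf_spectrum T' - inf_spectrum T\<bar> \<le> d" by (simp add: inf_spectrum_eq abs_minus_commute)
 ultimately show ?thesis using E by auto
qed

subsection \<open>Calculus of smooth functions\<close>

lemma pdiffs_Nil [simp]: "pdiffs [] f = f"
 by (simp add: pdiffs_def)

lemma pdiffs_Cons: "pdiffs (b # bs) f = pdiff b (pdiffs bs f)"
 by (simp add: pdiffs_def)

lemma pdiffs_append: "pdiffs (as @ bs) f = pdiffs as (pdiffs bs f)"
 by (simp add: pdiffs_def)

lemma pdiffs_snoc: "pdiffs (bs @ [b]) f = pdiffs bs (pdiff b f)"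
 by (simp add: pdiffs_append pdiffs_Cons)

lemma pdiff_eqI: "(f has_derivative D) (at x) \<Longrightarrow> pdiff b f x = D b"
 unfolding pdiff_def using frechet_derivative_at by metis

lemma smooth_pdiffs: "smooth f \<Longrightarrow> set bs \<subseteq> Basis \<Longrightarrow> smooth (pdiffs bs f)"
 unfolding smooth_def by (metis pdiffs_append set_append Un_least)

lemma smooth_pdiff: "smooth f \<Longrightarrow> b \<in> Basis \<Longrightarrow> smooth (pdiff b f)"
 using smooth_pdiffs[of f "[b]"] by (simp add: pdiffs_Cons)

lemma pdiffs_closed:
 assumes "P f" "\<And>f b. P f \<Longrightarrow> b \<in> Basis \<Longrightarrow> P (pdiff b f)" "set bs \<subseteq> Basis"
 shows "P (pdiffs bs f)"
 using assms(3) by (induction bs) (auto simp: pdiffs_Cons assms)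

text \<open>A coinduction principle for smoothness: it suffices to exhibit a class of differentiable
  functions that contains \<open>f\<close> and is closed under partial derivatives. Iterated
  derivatives then never have to be computed.\<close>

lemma smooth_coinduct:
 assumes "P f" and "\<And>f x. P f \<Longrightarrow> f differentiable (at x)"
  and "\<And>f b. P f \<Longrightarrow> b \<in> Basis \<Longrightarrow> P (pdiff b f)"
 shows "smooth f"
 unfolding smooth_def using pdiffs_closed[of P f, OF assms(1,3)] assms(2) by blast

lemma smooth_has_frechet: "smooth f \<Longrightarrow> (f has_derivative frechet_derivative f (at x)) (at x)"
 by (rule frechet_derivative_works[THEN iffD1, OF smooth_differentiable])

lemma frechet_derivative_basis_sum:
 assumes "smooth f"
 shows "frechet_derivative f (at x) v = (\<Sum>b\<in>Basis. (v \<bullet> b) *\<^sub>R pdiff b f x)"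
proof -
 have l: "linear (frechet_derivative f (at x))"
  using smooth_differentiable[OF assms] by (rule linear_frechet_derivative)
 have "frechet_derivative f (at x) v = frechet_derivative f (at x) (\<Sum>b\<in>Basis. (v \<bullet> b) *\<^sub>R b)"
  by (simp add: euclidean_representation)
 then show ?thesis
  by (simp add: linear_sum[OF l] linear_scale[OF l] pdiff_def)
qed

lemma smooth_has_derivative:
 assumes "smooth f"
 shows "(f has_derivative (\<lambda>v. \<Sum>b\<in>Basis. (v \<bullet> b) *\<^sub>R pdiff b f x)) (at x)"
 using smooth_has_frechet[OF assms] frechet_derivative_basis_sum[OF assms] by (metis (no_types, lifting) ext)

lemma smooth_continuous: "smooth f \<Longrightarrow> continuous_on S f"
 using smooth_differentiable differentiable_imp_continuous_within continuous_at_imp_continuous_on by blast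

lemma smooth_measurable: "smooth f \<Longrightarrow> f \<in> bmeas borel"
 by (rule borel_measurable_continuous_onI[OF smooth_continuous])

lemma pdiff_const [simp]: "pdiff b (\<lambda>x. c) = (\<lambda>x. 0)"
 by (simp add: pdiff_def fun_eq_iff)

lemma smooth_const [simp]: "smooth (\<lambda>x. c)"
 by (rule smooth_coinduct[where P="\<lambda>f. \<exists>c. f = (\<lambda>x. c)"]) auto

lemma pdiff_add: "smooth f \<Longrightarrow> smooth g \<Longrightarrow> pdiff b (\<lambda>x. f x + g x) = (\<lambda>x. pdiff b f x + pdiff b g x)"
 by (rule ext, rule pdiff_eqI[THEN trans]) (auto intro!: derivative_eq_intros smooth_has_frechet simp: pdiff_def)

lemma smooth_add:
 assumes "smooth f" "smooth g" shows "smooth (\<lambda>x. f x + g x)"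
proof (rule smooth_coinduct[where P="\<lambda>h. \<exists>f g. smooth f \<and> smooth g \<and> h = (\<lambda>x. f x + g x)"])
 show "h differentiable (at x)" if "\<exists>f g. smooth f \<and> smooth g \<and> h = (\<lambda>x. f x + g x)" for h x
  using that differentiable_add smooth_differentiable by blast
 show "\<exists>f g. smooth f \<and> smooth g \<and> pdiff b h = (\<lambda>x. f x + g x)"
  if "\<exists>f g. smooth f \<and> smooth g \<and> h = (\<lambda>x. f x + g x)" "b \<in> Basis" for h b
  using that pdiff_add smooth_pdiff by metis
qed (use assms in blast)

lemma pdiffs_add:
 "smooth f \<Longrightarrow> smooth g \<Longrightarrow> set bs \<subseteq> Basis \<Longrightarrow> pdiffs bs (\<lambda>x. f x + g x) = (\<lambda>x. pdiffs bs f x + pdiffs bs g x)"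
 by (induction bs) (auto simp: pdiffs_Cons pdiff_add smooth_pdiffs)

lemma pdiff_bounded_linear:
 "bounded_linear T \<Longrightarrow> smooth f \<Longrightarrow> pdiff b (\<lambda>x. T (f x)) = (\<lambda>x. T (pdiff b f x))"
 by (rule ext, rule pdiff_eqI[THEN trans])
  (auto intro!: bounded_linear.has_derivative[of T] smooth_has_frechet simp: pdiff_def)

lemma smooth_bounded_linear:
 assumes T: "bounded_linear T" and f: "smooth f" shows "smooth (\<lambda>x. T (f x))"
proof (rule smooth_coinduct[where P="\<lambda>h. \<exists>f. smooth f \<and> h = (\<lambda>x. T (f x))"])
 show "h differentiable (at x)" if "\<exists>f. smooth f \<and> h = (\<lambda>x. T (f x))" for h x
  using that bounded_linear.has_derivative[OF T smooth_has_frechet] unfolding differentiable_def by blast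
 show "\<exists>f. smooth f \<and> pdiff b h = (\<lambda>x. T (f x))"
  if "\<exists>f. smooth f \<and> h = (\<lambda>x. T (f x))" "b \<in> Basis" for h b
  using that pdiff_bounded_linear[OF T] smooth_pdiff by metis
qed (use f in blast)

lemma pdiffs_bounded_linear:
 "bounded_linear T \<Longrightarrow> smooth f \<Longrightarrow> set bs \<subseteq> Basis \<Longrightarrow> pdiffs bs (\<lambda>x. T (f x)) = (\<lambda>x. T (pdiffs bs f x))"
 by (induction bs) (auto simp: pdiffs_Cons pdiff_bounded_linear smooth_pdiffs)

lemmas smooth_scaleR = smooth_bounded_linear[OF bounded_linear_scaleR_right]
lemmas pdiff_scaleR = pdiff_bounded_linear[OF bounded_linear_scaleR_right]
lemmas pdiffs_scaleR = pdiffs_bounded_linear[OF bounded_linear_scaleR_right]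
lemmas smooth_of_real = smooth_bounded_linear[OF bounded_linear_of_real]
lemmas pdiffs_of_real = pdiffs_bounded_linear[OF bounded_linear_of_real]
lemmas pdiff_of_real = pdiff_bounded_linear[OF bounded_linear_of_real]

lemma smooth_sum: "(\<And>i. i \<in> I \<Longrightarrow> smooth (f i)) \<Longrightarrow> smooth (\<lambda>x. \<Sum>i\<in>I. f i x)"
 by (induction I rule: infinite_finite_induct) (auto intro: smooth_add)

lemma pdiffs_zero [simp]: "pdiffs bs (\<lambda>x. 0) = (\<lambda>x. 0)"
 by (induction bs) (auto simp: pdiffs_Cons)

lemma affine_has_derivative:
 fixes g :: "'b::euclidean_space \<Rightarrow> 'c::real_normed_vector"
 assumes L: "bounded_linear L" and g: "smooth g"
 shows "((\<lambda>x. g (c + L x)) has_derivative (\<lambda>v. \<Sum>b'\<in>Basis. (L v \<bullet> b') *\<^sub>R pdiff b' g (c + L x))) (at x)"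
proof -
 have "((\<lambda>x. c + L x) has_derivative L) (at x)"
  using bounded_linear_imp_has_derivative[OF L] by (auto intro!: derivative_eq_intros)
 from has_derivative_compose[OF this smooth_has_derivative[OF g]] show ?thesis .
qed

lemma pdiff_affine:
 fixes g :: "'b::euclidean_space \<Rightarrow> 'c::real_normed_vector"
 assumes "bounded_linear L" "smooth g"
 shows "pdiff b (\<lambda>x. g (c + L x)) = (\<lambda>x. \<Sum>b'\<in>Basis. (L b \<bullet> b') *\<^sub>R pdiff b' g (c + L x))"
 by (rule ext, rule pdiff_eqI[OF affine_has_derivative[OF assms]])

text \<open>Every space of smooth functions that is closed under derivatives and linear combinations is
 stable under composition with affine maps.\<close>

lemma affine_closed:
 fixes g :: "'b::euclidean_space \<Rightarrow> 'c::real_normed_vector" and L :: "'a::euclidean_space \<Rightarrow> 'b"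
 assumes L: "bounded_linear L" and g: "Q g" "\<And>g. Q g \<Longrightarrow> smooth g"
  "\<And>g b. Q g \<Longrightarrow> b \<in> Basis \<Longrightarrow> Q (pdiff b g)"
  "\<And>f g. Q f \<Longrightarrow> Q g \<Longrightarrow> Q (\<lambda>x. f x + g x)" "\<And>r f. Q f \<Longrightarrow> Q (\<lambda>x. r *\<^sub>R f x)"
 shows "smooth (\<lambda>x. g (c + L x))"
  and "set bs \<subseteq> Basis \<Longrightarrow> \<exists>g'. Q g' \<and> pdiffs bs (\<lambda>x. g (c + L x)) = (\<lambda>x. g' (c + L x))"
proof -
 let ?P = "\<lambda>h. \<exists>g'. Q g' \<and> h = (\<lambda>x. g' (c + L x))"
 have z: "Q (\<lambda>x. 0)" using g(5)[OF g(1), of 0] by simp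
 have s: "Q (\<lambda>x. \<Sum>i\<in>I. f i x)" if "\<And>i. i \<in> I \<Longrightarrow> Q (f i)" for f and I :: "'b set"
  using that by (induction I rule: infinite_finite_induct) (auto intro: z g(4))
 have P: "?P (pdiff b h)" if "?P h" "b \<in> Basis" for h and b :: 'a
 proof -
  obtain g' where g': "Q g'" "h = (\<lambda>x. g' (c + L x))" using \<open>?P h\<close> by blast
  show ?thesis
   unfolding g'(2) pdiff_affine[OF L g(2)[OF g'(1)]]
   by (rule exI[of _ "\<lambda>y. \<Sum>b'\<in>Basis. (L b \<bullet> b') *\<^sub>R pdiff b' g' y"]) (auto intro!: s g(5) g(3) g')
 qed
 have d: "h differentiable (at x)" if "?P h" for h x
  using that affine_has_derivative[OF L g(2)] unfolding differentiable_def by blast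
 show "smooth (\<lambda>x. g (c + L x))"
  by (rule smooth_coinduct[where P="?P"]) (use g(1) d P in blast)+
 show "\<exists>g'. Q g' \<and> pdiffs bs (\<lambda>x. g (c + L x)) = (\<lambda>x. g' (c + L x))" if "set bs \<subseteq> Basis"
  by (rule pdiffs_closed[where P="?P"]) (use g(1) P that in blast)+
qed

lemma smooth_affine:
 "bounded_linear L \<Longrightarrow> smooth g \<Longrightarrow> smooth (\<lambda>x. g (c + L x))"
 by (rule affine_closed(1)[where Q=smooth]) (auto intro: smooth_pdiff smooth_add smooth_scaleR)

subsection \<open>Bounded smooth functions and Schwartz functions\<close>

lemma BC_infinity_smooth: "f \<in> BC_infinity \<Longrightarrow> smooth f"
 by (simp add: BC_infinity_def)

lemma BC_infinity_bound:
 assumes "f \<in> BC_infinity" shows "\<exists>C\<ge>0. \<forall>x. norm (f x) \<le> C"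
proof -
 have "bounded (range (pdiffs [] f))"
  using assms unfolding BC_infinity_def by (auto dest: spec[of _ "[]"])
 then obtain C where "\<And>x. norm (f x) \<le> C" by (auto simp: bounded_iff)
 moreover from this have "C \<ge> 0" using norm_ge_zero order_trans by blast
 ultimately show ?thesis by blast
qed

lemma BC_infinity_pdiff: "f \<in> BC_infinity \<Longrightarrow> b \<in> Basis \<Longrightarrow> pdiff b f \<in> BC_infinity"
 unfolding BC_infinity_def by (auto simp: smooth_pdiff simp flip: pdiffs_snoc)

lemma BC_infinity_add:
 assumes "f \<in> BC_infinity" "g \<in> BC_infinity" shows "(\<lambda>x. f x + g x) \<in> BC_infinity"
 using assms unfolding BC_infinity_def
 by (auto simp: smooth_add pdiffs_add image_iff intro!: bounded_plus_comp)

lemma BC_infinity_bounded_linear: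
 assumes "bounded_linear T" "f \<in> BC_infinity" shows "(\<lambda>x. T (f x)) \<in> BC_infinity"
proof -
 have "bounded (range (\<lambda>x. T (pdiffs bs f x)))" if "set bs \<subseteq> Basis" for bs
 proof -
  have "bounded (T ` range (pdiffs bs f))"
   using assms(2) that by (intro bounded_linear_image[OF _ assms(1)]) (simp add: BC_infinity_def)
  then show ?thesis by (simp add: image_image)
 qed
 then show ?thesis using assms
  by (simp add: BC_infinity_def smooth_bounded_linear pdiffs_bounded_linear)
qed

lemma BC_infinity_affine:
 fixes g :: "'b::euclidean_space \<Rightarrow> 'c::real_normed_vector" and L :: "'a::euclidean_space \<Rightarrow> 'b"
 assumes L: "bounded_linear L" and g: "g \<in> BC_infinity"
 shows "(\<lambda>x. g (c + L x)) \<in> BC_infinity"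
proof -
 have "bounded (range (pdiffs bs (\<lambda>x. g (c + L x))))" if "set bs \<subseteq> Basis" for bs
 proof -
  have "\<exists>g'. g' \<in> BC_infinity \<and> pdiffs bs (\<lambda>x. g (c + L x)) = (\<lambda>x. g' (c + L x))"
   by (rule affine_closed(2)[where Q="\<lambda>g. g \<in> BC_infinity", OF L g])
    (use that in \<open>auto intro: BC_infinity_smooth BC_infinity_pdiff BC_infinity_add
     BC_infinity_bounded_linear bounded_linear_scaleR_right\<close>)
  then obtain g' where g': "g' \<in> BC_infinity" "pdiffs bs (\<lambda>x. g (c + L x)) = (\<lambda>x. g' (c + L x))"
   by blast
  obtain D where "\<And>x. norm (g' x) \<le> D" using BC_infinity_bound[OF g'(1)] by blast
  then show ?thesis unfolding g'(2) bounded_iff by auto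
 qed
 moreover have "smooth (\<lambda>x. g (c + L x))" by (rule smooth_affine[OF L BC_infinity_smooth[OF g]])
 ultimately show ?thesis by (simp add: BC_infinity_def)
qed

lemma schwartz_smooth: "f \<in> schwartz \<Longrightarrow> smooth f"
 by (simp add: schwartz_def)

lemma schwartz_pdiff: "f \<in> schwartz \<Longrightarrow> b \<in> Basis \<Longrightarrow> pdiff b f \<in> schwartz"
 unfolding schwartz_def by (auto simp: smooth_pdiff simp flip: pdiffs_snoc)

lemma schwartz_add:
 assumes "f \<in> schwartz" "g \<in> schwartz" shows "(\<lambda>x. f x + g x) \<in> schwartz"
proof -
 have "\<exists>C. \<forall>x. norm x ^ N * norm (pdiffs bs f x + pdiffs bs g x) \<le> C" if bs: "set bs \<subseteq> Basis" for bs N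
 proof -
  obtain C where "\<And>x. norm x ^ N * norm (pdiffs bs f x) \<le> C"
   using assms(1) bs unfolding schwartz_def by blast
  moreover obtain D where "\<And>x. norm x ^ N * norm (pdiffs bs g x) \<le> D"
   using assms(2) bs unfolding schwartz_def by blast
  ultimately have "norm x ^ N * norm (pdiffs bs f x + pdiffs bs g x) \<le> C + D" for x
   by (smt (verit) distrib_left mult_left_mono norm_ge_zero norm_triangle_ineq zero_le_power)
  then show ?thesis by blast
 qed
 then show ?thesis using assms unfolding schwartz_def by (auto simp: smooth_add pdiffs_add)
qed

lemma schwartz_bounded_linear:
 assumes T: "bounded_linear T" and f: "f \<in> schwartz" shows "(\<lambda>x. T (f x)) \<in> schwartz"
proof -
 obtain K where K: "K > 0" "\<And>x. norm (T x) \<le> norm x * K"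
  using bounded_linear.pos_bounded[OF T] by blast
 have "\<exists>C. \<forall>x. norm x ^ N * norm (T (pdiffs bs f x)) \<le> C" if bs: "set bs \<subseteq> Basis" for bs N
 proof -
  obtain C where C: "\<And>x. norm x ^ N * norm (pdiffs bs f x) \<le> C"
   using f bs unfolding schwartz_def by blast
  have "norm x ^ N * norm (T (pdiffs bs f x)) \<le> C * K" for x
  proof -
   have "norm x ^ N * norm (T (pdiffs bs f x)) \<le> norm x ^ N * (norm (pdiffs bs f x) * K)"
    using K by (intro mult_left_mono) auto
   also have "... = (norm x ^ N * norm (pdiffs bs f x)) * K" by simp
   also have "... \<le> C * K" using C K by (intro mult_right_mono) auto
   finally show ?thesis .
  qed
  then show ?thesis by blast
 qed
 then show ?thesis using T f unfolding schwartz_def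
  by (auto simp: smooth_bounded_linear pdiffs_bounded_linear)
qed

lemma schwartz_bound:
 assumes f: "f \<in> schwartz" shows "\<exists>C\<ge>0. \<forall>x. (1 + norm x) ^ N * norm (f x) \<le> C"
proof -
 have *: "\<forall>bs N. set bs \<subseteq> Basis \<longrightarrow> (\<exists>C. \<forall>x. norm x ^ N * norm (pdiffs bs f x) \<le> C)"
  using f by (simp add: schwartz_def)
 obtain C where C: "\<And>x. norm x ^ 0 * norm (f x) \<le> C"
  using *[rule_format, of "[]" 0] by auto
 obtain D where D: "\<And>x. norm x ^ N * norm (f x) \<le> D"
  using *[rule_format, of "[]" N] by auto
 have "(1 + norm x) ^ N * norm (f x) \<le> 2 ^ N * (\<bar>C\<bar> + \<bar>D\<bar>)" for x
 proof -
  have "(1 + norm x) ^ N \<le> (2 * max 1 (norm x)) ^ N" by (intro power_mono) auto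
  also have "... = 2 ^ N * max 1 (norm x) ^ N" by (simp add: power_mult_distrib)
  also have "... \<le> 2 ^ N * (1 + norm x ^ N)" by (intro mult_left_mono) (auto simp: max_def)
  finally have "(1 + norm x) ^ N * norm (f x) \<le> 2 ^ N * (1 + norm x ^ N) * norm (f x)"
   by (rule mult_right_mono) simp
  also have "... = 2 ^ N * (norm x ^ 0 * norm (f x) + norm x ^ N * norm (f x))" by (simp add: algebra_simps)
  also have "... \<le> 2 ^ N * (\<bar>C\<bar> + \<bar>D\<bar>)"
   using C[of x] D[of x] by (intro mult_left_mono add_mono) auto
  finally show ?thesis .
 qed
 then show ?thesis by (intro exI[of _ "2 ^ N * (\<bar>C\<bar> + \<bar>D\<bar>)"]) simp
qed

section \<open>Integrable weights and the decay of Schwartz functions\<close>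

lemma inverse_quadratic_integrable: "integrable lborel (\<lambda>x::real. 1 / (1 + x^2))"
proof -
 have "set_integrable lborel (einterval (-\<infinity>) \<infinity>) (\<lambda>x::real. 1 / (1 + x^2))"
 proof (rule interval_integral_FTC_nonneg(1)[where F=arctan and A="-(pi/2)" and B="pi/2"])
  show "\<And>x. - \<infinity> < ereal x \<Longrightarrow> ereal x < \<infinity> \<Longrightarrow> (arctan has_real_derivative 1 / (1 + x^2)) (at x)"
   by (auto intro!: derivative_eq_intros simp: inverse_eq_divide)
  show "\<And>x. - \<infinity> < ereal x \<Longrightarrow> ereal x < \<infinity> \<Longrightarrow> isCont (\<lambda>x. 1 / (1 + x^2)) x"
   by (auto intro!: continuous_intros simp: add_nonneg_eq_0_iff)
  show "((arctan \<circ> real_of_ereal) \<longlongrightarrow> - (pi / 2)) (at_right (- \<infinity>))"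
   by (simp add: ereal_tendsto_simps tendsto_arctan_at_bot)
  show "((arctan \<circ> real_of_ereal) \<longlongrightarrow> pi / 2) (at_left \<infinity>)"
   by (simp add: ereal_tendsto_simps tendsto_arctan_at_top)
 qed auto
 then show ?thesis by (simp add: set_integrable_def einterval_def)
qed

lemma product_Basis:
 fixes g :: "'a::euclidean_space \<Rightarrow> real \<Rightarrow> 'c::{real_normed_field,banach,second_countable_topology}"
 assumes g: "\<And>b. b \<in> Basis \<Longrightarrow> integrable lborel (g b)"
 shows integrable_product_Basis: "integrable lborel (\<lambda>x. \<Prod>b\<in>Basis. g b (x \<bullet> b))"
  and integral_product_Basis: "(LBINT x. (\<Prod>b\<in>Basis. g b (x \<bullet> b))) = (\<Prod>b\<in>Basis. \<integral>s. g b s \<partial>lborel)"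
proof -
 interpret product_sigma_finite "\<lambda>_::'a. lborel :: real measure" by standard
 have [measurable]: "b \<in> Basis \<Longrightarrow> g b \<in> bmeas borel" for b
  using borel_measurable_integrable[OF g] by simp
 have m: "(\<lambda>x. \<Prod>b\<in>Basis. g b (x \<bullet> b)) \<in> bmeas borel" by measurable
 have e: "(\<Prod>b\<in>Basis. g b ((\<Sum>b'\<in>Basis. f b' *\<^sub>R b') \<bullet> b)) = (\<Prod>b\<in>Basis. g b (f b))" for f
  by (intro prod.cong) (auto simp: inner_sum_left inner_Basis if_distrib cong: if_cong)
 have s: "(\<lambda>f. \<Sum>b\<in>Basis. f b *\<^sub>R b) \<in> measurable (\<Pi>\<^sub>M b\<in>(Basis::'a set). lborel) borel" by measurable
 show "integrable lborel (\<lambda>x. \<Prod>b\<in>Basis. g b (x \<bullet> b))"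
  unfolding lborel_eq[where 'a='a] using product_integrable_prod[of Basis g] g
  by (subst integrable_distr_eq[OF s m]) (simp add: e)
 show "(LBINT x. (\<Prod>b\<in>Basis. g b (x \<bullet> b))) = (\<Prod>b\<in>Basis. \<integral>s. g b s \<partial>lborel)"
  unfolding lborel_eq[where 'a='a] using product_integral_prod[of Basis g] g
  by (subst integral_distr[OF s m]) (simp add: e)
qed

text \<open>A product of one-dimensional weights is used instead of a power of
  \<open>1 + norm x\<close>: its integral factors over the coordinates, and its square is exactly
  the reciprocal of the Fourier multiplier of \<open>bessel_ops 1 basis_list\<close>.\<close>

definition cauchy_weight :: "'a::euclidean_space \<Rightarrow> real" where
 "cauchy_weight x = (\<Prod>b\<in>Basis. 1 / (1 + (x \<bullet> b)^2))"

lemma cauchy_weight_pos: "0 < cauchy_weight x"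
 unfolding cauchy_weight_def by (intro prod_pos) (auto intro: add_pos_nonneg)

lemma integrable_cauchy_weight: "integrable lborel cauchy_weight"
 using integrable_product_Basis[where g="\<lambda>_ x. 1 / (1 + x^2)", OF inverse_quadratic_integrable]
 by (simp add: cauchy_weight_def[abs_def])

lemma cauchy_weight_measurable [measurable]: "cauchy_weight \<in> bmeas borel"
 using borel_measurable_integrable[OF integrable_cauchy_weight] by simp

text \<open>Each coordinate factor is at least \<open>1 / (1 + norm x)^2\<close>, whence the
  exponent. A polynomial bound of degree \<open>2 * DIM('a)\<close> thus turns into a bound by the
  integrable weight.\<close>

lemma cauchy_weight_ge:
 fixes x :: "'a::euclidean_space"
 shows "1 / (1 + norm x) ^ (2 * DIM('a)) \<le> cauchy_weight x"
proof -
 have "1 / (1 + norm x) ^ (2 * DIM('a)) = (\<Prod>b\<in>(Basis::'a set). 1 / (1 + norm x)^2)"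
  by (simp add: power_one_over power_mult)
 also have "... \<le> (\<Prod>b\<in>Basis. 1 / (1 + (x \<bullet> b)^2))"
 proof (rule prod_mono, intro conjI)
  fix b :: 'a assume b: "b \<in> Basis"
  have "(x \<bullet> b)^2 \<le> (norm x)^2" using Basis_le_norm[OF b, of x] by (simp add: power2_le_iff_abs_le)
  then have "1 + (x \<bullet> b)^2 \<le> (1 + norm x)^2"
   using norm_ge_zero[of x] unfolding power2_sum one_power2 by linarith
  then show "1 / (1 + norm x)^2 \<le> 1 / (1 + (x \<bullet> b)^2)"
   by (rule frac_le[OF zero_le_one order_refl, rotated 1]) (simp add: add_pos_nonneg)
 qed simp
 finally show ?thesis by (simp add: cauchy_weight_def)
qed

lemma schwartz_weight_bound:
 fixes f :: "'a::euclidean_space \<Rightarrow> 'b::real_normed_vector"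
 assumes f: "f \<in> schwartz"
 shows "\<exists>C\<ge>0. \<forall>x. (1 + norm x) ^ N * norm (f x) \<le> C * cauchy_weight x"
proof -
 obtain C where C: "C \<ge> 0" "\<And>x. (1 + norm x) ^ (N + 2 * DIM('a)) * norm (f x) \<le> C"
  using schwartz_bound[OF f] by blast
 have "(1 + norm x) ^ N * norm (f x) \<le> C * cauchy_weight x" for x
 proof -
  have "(1 + norm x) ^ N * norm (f x) \<le> C * (1 / (1 + norm x) ^ (2 * DIM('a)))"
   using C(2)[of x] by (simp add: power_add pos_le_divide_eq add_pos_nonneg mult_ac)
  also have "... \<le> C * cauchy_weight x" by (rule mult_left_mono[OF cauchy_weight_ge C(1)])
  finally show ?thesis .
 qed
 with C(1) show ?thesis by blast
qed

lemma schwartz_integrable: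
 fixes f :: "'a::euclidean_space \<Rightarrow> 'b::{banach,second_countable_topology}"
 assumes f: "f \<in> schwartz"
 shows "integrable lborel (\<lambda>x. (1 + norm x) ^ N *\<^sub>R f x)"
proof -
 have [measurable]: "f \<in> bmeas borel" by (rule smooth_measurable[OF schwartz_smooth[OF f]])
 obtain C where C: "C \<ge> 0" "\<And>x. (1 + norm x) ^ N * norm (f x) \<le> C * cauchy_weight x"
  using schwartz_weight_bound[OF f] by blast
 show ?thesis
  by (rule integrable_bound'[of _ "\<lambda>x. C * cauchy_weight x"])
   (use C in \<open>auto intro!: integrable_mult_right integrable_cauchy_weight order_trans[OF _ abs_ge_self]\<close>)
qed

lemma schwartz_square_integrable:
 fixes f :: "'a::euclidean_space \<Rightarrow> complex"
 assumes f: "f \<in> schwartz" shows "square_integrable f"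
proof -
 have [measurable]: "f \<in> bmeas borel" by (rule smooth_measurable[OF schwartz_smooth[OF f]])
 obtain C where C: "C \<ge> 0" "\<And>x. (1 + norm x) ^ 0 * norm (f x) \<le> C"
  using schwartz_bound[OF f] by blast
 have "integrable lborel (\<lambda>x. C * norm (f x))"
  using schwartz_integrable[OF f, of 0] by simp
 then have "integrable lborel (\<lambda>x. (norm (f x))^2)"
  by (rule integrable_bound')
   (use C in \<open>auto simp: power2_eq_square intro!: mult_right_mono order_trans[OF _ abs_ge_self]\<close>)
 then show ?thesis by (simp add: square_integrable_def)
qed

subsection \<open>Density of the Schwartz functions\<close>

lemma real_polynomial_pdiff:
 fixes p :: "'a::euclidean_space \<Rightarrow> real"
 assumes "real_polynomial_function p"
 shows "(\<forall>x. p differentiable (at x)) \<and> real_polynomial_function (pdiff b p)"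
 using assms
proof induction
 case (linear f)
 then have "pdiff b f = (\<lambda>x. f b)"
  by (intro ext pdiff_eqI bounded_linear_imp_has_derivative)
 then show ?case
  using linear by (auto intro: real_polynomial_function.intros(2) bounded_linear_imp_differentiable)
next
 case (const c)
 then show ?case by (auto intro: real_polynomial_function.intros(2))
next
 case (add f g)
 have "pdiff b (\<lambda>x. f x + g x) = (\<lambda>x. pdiff b f x + pdiff b g x)"
  using add by (intro ext pdiff_eqI[THEN trans] has_derivative_add)
   (auto simp: pdiff_def frechet_derivative_works)
 then show ?case using add by (auto intro: real_polynomial_function.intros(3) differentiable_add)
next
 case (mult f g)
 have "pdiff b (\<lambda>x. f x * g x) = (\<lambda>x. f x * pdiff b g x + pdiff b f x * g x)"
  using mult by (intro ext pdiff_eqI[THEN trans] has_derivative_mult)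
   (auto simp: pdiff_def frechet_derivative_works)
 then show ?case using mult by (auto intro!: real_polynomial_function.intros(3,4) differentiable_mult)
qed

lemma real_polynomial_growth:
 fixes p :: "'a::euclidean_space \<Rightarrow> real"
 assumes "real_polynomial_function p"
 shows "\<exists>C k. \<forall>x. \<bar>p x\<bar> \<le> C * (1 + norm x) ^ k"
 using assms
proof induction
 case (linear f)
 then obtain K where "\<And>x. norm (f x) \<le> norm x * K" using bounded_linear.bounded by blast
 then have "\<bar>f x\<bar> \<le> \<bar>K\<bar> * (1 + norm x) ^ 1" for x
  by (smt (verit) abs_ge_self mult.commute mult_left_mono norm_ge_zero power_one_right real_norm_def)
 then show ?case by blast
next
 case (const c)
 have "\<bar>c\<bar> \<le> \<bar>c\<bar> * (1 + norm x) ^ 0" for x :: 'a by simp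
 then show ?case by blast
next
 case (add f g)
 then obtain C D k l where C: "\<And>x. \<bar>f x\<bar> \<le> C * (1 + norm x) ^ k" and D: "\<And>x. \<bar>g x\<bar> \<le> D * (1 + norm x) ^ l" by blast
 have "\<bar>f x + g x\<bar> \<le> (\<bar>C\<bar> + \<bar>D\<bar>) * (1 + norm x) ^ (k + l)" for x
 proof -
  have "C * (1 + norm x) ^ k \<le> \<bar>C\<bar> * (1 + norm x) ^ (k + l)" "D * (1 + norm x) ^ l \<le> \<bar>D\<bar> * (1 + norm x) ^ (k + l)"
   by (intro mult_mono power_increasing; simp)+
  with C[of x] D[of x] show ?thesis by (simp add: distrib_right)
 qed
 then show ?case by blast
next
 case (mult f g)
 then obtain C D k l where C: "\<And>x. \<bar>f x\<bar> \<le> C * (1 + norm x) ^ k" and D: "\<And>x. \<bar>g x\<bar> \<le> D * (1 + norm x) ^ l" by blast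
 have "\<bar>f x * g x\<bar> \<le> (C * D) * (1 + norm x) ^ (k + l)" for x
  using mult_mono[OF C[of x] D[of x]] order_trans[OF abs_ge_zero C[of x]]
  by (simp add: abs_mult power_add mult_ac)
 then show ?case by blast
qed

text \<open>One term of the exponential series gives
  \<open>(1 + u) ^ k \<le> fact k * exp (1 + u)\<close>, and completing the square gives
  \<open>u - u^2 / r \<le> r / 4\<close>.\<close>

lemma power_le_exp_quadratic:
 fixes r :: real assumes r: "r > 0"
 shows "\<exists>C. \<forall>u\<ge>0. (1 + u) ^ k * exp (- (u^2 / r)) \<le> C"
proof -
 have "(1 + u) ^ k * exp (- (u^2 / r)) \<le> fact k * exp (1 + r / 4)" if u: "u \<ge> 0" for u
 proof -
  have "(1 + u) ^ k / fact k \<le> exp (1 + u)"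
   using exp_lower_Taylor_quadratic u
  proof -
   have s: "(\<lambda>n. (1 + u) ^ n /\<^sub>R fact n) sums exp (1 + u)" by (rule exp_converges)
   have "(\<Sum>n\<in>{k}. (1 + u) ^ n /\<^sub>R fact n) \<le> (\<Sum>n. (1 + u) ^ n /\<^sub>R fact n)"
    by (rule sum_le_suminf[OF sums_summable[OF s]]) (use u in auto)
   then show ?thesis using sums_unique[OF s] by (simp add: divide_inverse mult.commute)
  qed
  then have "(1 + u) ^ k * exp (- (u^2 / r)) \<le> fact k * exp (1 + u) * exp (- (u^2 / r))"
   by (intro mult_right_mono) (auto simp: field_simps)
  also have "... = fact k * exp (1 + (u - u\<^sup>2 / r))" by (simp add: exp_add[symmetric] mult.assoc)
  also have "u - u\<^sup>2 / r \<le> r / 4"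
  proof -
   have "0 \<le> (u - r / 2)^2 / r" using r by simp
   also have "... = u^2 / r - u + r / 4" using r by (simp add: power2_eq_square field_simps)
   finally show ?thesis by simp
  qed
  finally show ?thesis by simp
 qed
 then show ?thesis by blast
qed

text \<open>The functions \<open>exp (- P)\<close> below are smoothed indicator functions of boxes.\<close>

lemma exp_polynomial_schwartz:
 fixes P q :: "'a::euclidean_space \<Rightarrow> real"
 assumes P: "real_polynomial_function P" and q: "real_polynomial_function q"
  and r: "r > 0" and Pge: "\<And>x. (norm (x - c))^2 / r - D \<le> P x"
 shows "(\<lambda>x. cplx (q x * exp (- P x))) \<in> schwartz"
proof -
 \<comment> \<open>The class of polynomials times the fixed factor \<open>exp (- P)\<close> is
   closed under derivatives; smoothness and decay are proved for the whole class.\<close>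
 let ?C = "\<lambda>h. \<exists>q. real_polynomial_function q \<and> h = (\<lambda>x. q x * exp (- P x))"
 have der: "((\<lambda>x. q x * exp (- P x)) has_derivative
   (\<lambda>v. q x * (exp (- P x) * - frechet_derivative P (at x) v) + frechet_derivative q (at x) v * exp (- P x))) (at x)"
  if q: "real_polynomial_function q" for q x
 proof -
  have d: "(q has_derivative frechet_derivative q (at x)) (at x)" "(P has_derivative frechet_derivative P (at x)) (at x)"
   using real_polynomial_pdiff[OF q] real_polynomial_pdiff[OF P] by (simp_all add: frechet_derivative_works)
  have "((\<lambda>x. exp (- P x)) has_derivative (\<lambda>v. exp (- P x) * - frechet_derivative P (at x) v)) (at x)"
   by (rule has_derivative_eq_rhs[OF has_derivative_exp[OF has_derivative_minus[OF d(2)]]]) (simp add: mult.commute)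
  from has_derivative_mult[OF d(1) this] show ?thesis .
 qed
 have C1: "?C (pdiff b h)" if "?C h" for h b
 proof -
  obtain q where q: "real_polynomial_function q" "h = (\<lambda>x. q x * exp (- P x))" using \<open>?C h\<close> by blast
  have "pdiff b h = (\<lambda>x. (pdiff b q x - q x * pdiff b P x) * exp (- P x))"
   unfolding q(2) by (rule ext, rule pdiff_eqI[OF der[OF q(1)], THEN trans]) (simp add: pdiff_def algebra_simps)
  moreover have "real_polynomial_function (\<lambda>x. pdiff b q x - q x * pdiff b P x)"
   using real_polynomial_pdiff[OF P] real_polynomial_pdiff[OF q(1)] q(1)
   by (intro real_polynomial_function_diff real_polynomial_function.intros(4)) auto
  ultimately show ?thesis by blast
 qed
 have C2: "h differentiable (at x)" if "?C h" for h x
 proof -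
  obtain q where q: "real_polynomial_function q" "h = (\<lambda>x. q x * exp (- P x))" using \<open>?C h\<close> by blast
  show ?thesis unfolding q(2) differentiable_def using der[OF q(1)] by blast
 qed
 have C3: "\<exists>C. \<forall>x. norm x ^ N * norm (h x) \<le> C" if "?C h" for h N
 proof -
  obtain q where q: "real_polynomial_function q" "h = (\<lambda>x. q x * exp (- P x))" using \<open>?C h\<close> by blast
  obtain C k where C: "\<And>x. \<bar>q x\<bar> \<le> C * (1 + norm x) ^ k"
   using real_polynomial_growth[OF q(1)] by blast
  obtain E where E: "\<And>u. u \<ge> 0 \<Longrightarrow> (1 + u) ^ (N + k) * exp (- (u^2 / r)) \<le> E"
   using power_le_exp_quadratic[OF r, of "N + k"] by blast
  let ?K = "\<bar>C\<bar> * (1 + norm c) ^ (N + k) * exp D"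
  have "norm x ^ N * norm (h x) \<le> ?K * E" for x
  proof -
   have n: "1 + norm x \<le> (1 + norm c) * (1 + norm (x - c))"
   proof -
    have "norm x \<le> norm c + norm (x - c)" using norm_triangle_ineq[of c "x - c"] by simp
    moreover have "0 \<le> norm c * norm (x - c)" by simp
    ultimately show ?thesis unfolding distrib_left distrib_right by linarith
   qed
   have Cq: "\<bar>q x\<bar> \<le> \<bar>C\<bar> * (1 + norm x) ^ k"
    by (rule order_trans[OF C mult_right_mono]) auto
   have "norm x ^ N * norm (h x) = norm x ^ N * (\<bar>q x\<bar> * exp (- P x))" by (simp add: q(2) abs_mult)
   also have "... \<le> (1 + norm x) ^ N * ((\<bar>C\<bar> * (1 + norm x) ^ k) * exp (- ((norm (x - c))^2 / r - D)))"
    using Cq Pge[of x] by (intro mult_mono power_mono) auto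
   also have "... = \<bar>C\<bar> * exp D * ((1 + norm x) ^ (N + k) * exp (- ((norm (x - c))^2 / r)))"
    by (simp add: power_add exp_diff exp_minus field_simps)
   also have "... \<le> \<bar>C\<bar> * exp D * (((1 + norm c) * (1 + norm (x - c))) ^ (N + k) * exp (- ((norm (x - c))^2 / r)))"
    by (intro mult_left_mono mult_right_mono power_mono n) auto
   also have "... = ?K * ((1 + norm (x - c)) ^ (N + k) * exp (- ((norm (x - c))^2 / r)))"
    by (simp add: power_mult_distrib)
   also have "... \<le> ?K * E" by (intro mult_left_mono E) auto
   finally show ?thesis .
  qed
  then show ?thesis by blast
 qed
 have "(\<lambda>x. q x * exp (- P x)) \<in> schwartz"
  unfolding schwartz_def
 proof (intro CollectI conjI allI impI)
  have q': "?C (\<lambda>x. q x * exp (- P x))" using q by blast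
  show "smooth (\<lambda>x. q x * exp (- P x))"
   by (rule smooth_coinduct[where P="?C"]) (fact q', erule C2, erule C1)
  fix bs :: "'a list" and N assume "set bs \<subseteq> Basis"
  then show "\<exists>C. \<forall>x. norm x ^ N * norm (pdiffs bs (\<lambda>x. q x * exp (- P x)) x) \<le> C"
   by (intro C3 pdiffs_closed[where P="?C"] q' C1)
 qed
 from schwartz_bounded_linear[OF bounded_linear_of_real this] show ?thesis .
qed

lemma norm_sq_Basis: "(norm x)^2 = (\<Sum>b\<in>Basis. (x \<bullet> b)^2)"
 unfolding power2_norm_eq_inner by (subst euclidean_inner) (simp add: power2_eq_square)

lemma gaussian_schwartz: "(\<lambda>x::'a::euclidean_space. cplx (exp (- (norm x)\<^sup>2))) \<in> schwartz"
proof -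
 have P: "real_polynomial_function (\<lambda>x::'a. (norm x)^2)"
 proof -
  have "real_polynomial_function (\<lambda>x::'a. \<Sum>b\<in>Basis. (x \<bullet> b)^2)"
   by (intro real_polynomial_function_sum real_polynomial_function_power
     real_polynomial_function.intros(1) bounded_linear_inner_left) auto
  then show ?thesis by (simp add: norm_sq_Basis)
 qed
 have "(\<lambda>x::'a. cplx (1 * exp (- (norm x)\<^sup>2))) \<in> schwartz"
  by (rule exp_polynomial_schwartz[OF P real_polynomial_function.intros(2), of 1 0 0]) auto
 then show ?thesis by simp
qed

text \<open>The coordinates \<open>y x b\<close> run over the interval from -1 to 1 on the box. The
  sums \<open>P n\<close> of their even powers tend to zero inside and to infinity outside, so
  \<open>exp (- P n)\<close> is a sequence of Schwartz functions that converges to the indicator,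
  dominated in L2.\<close>

lemma box_indicator_in_kernel:
 fixes T :: "'a::euclidean_space L2 \<Rightarrow>\<^sub>L 'b::real_normed_vector"
 assumes T: "\<And>f. f \<in> schwartz \<Longrightarrow> T (L2_class f) = 0"
 shows "T (L2_class (\<lambda>x. a * cplx (indicator (box l u) x))) = 0"
proof (cases "box l u = {}")
 case True
 then show ?thesis by (simp add: L2_class_zero[symmetric])
next
 case False
 then have lu: "l \<bullet> b < u \<bullet> b" if "b \<in> Basis" for b using that by (auto simp: box_ne_empty)
 define c where "c = (1/2) *\<^sub>R (l + u)"
 define s where "s b = 2 / (u \<bullet> b - l \<bullet> b)" for b
 have s: "s b > 0" if "b \<in> Basis" for b using lu[OF that] by (simp add: s_def)
 define y where "y x b = (x \<bullet> b - c \<bullet> b) * s b" for x b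
 define P where "P n x = (\<Sum>b\<in>Basis. y x b ^ (2 * Suc n))" for n x
 have Ppoly: "real_polynomial_function (P n)" for n
  unfolding P_def y_def
  by (intro real_polynomial_function_sum real_polynomial_function_power real_polynomial_function.intros(4)
    real_polynomial_function_diff real_polynomial_function.intros(2)
    real_polynomial_function.intros(1) bounded_linear_inner_left) auto
 define m where "m = Min (s ` Basis)"
 have m: "m > 0" "\<And>b. b \<in> Basis \<Longrightarrow> m \<le> s b" using s by (auto simp: m_def)
 \<comment> \<open>This elementary inequality makes every \<open>P n\<close> at least
   \<open>P 0\<close> minus the dimension. It yields both the quadratic growth that the Schwartz
   property asks for and a majorant independent of \<open>n\<close>.\<close>
 have sq: "z^2 - 1 \<le> z ^ (2 * Suc n)" for z :: real and n
 proof -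
  have "z^2 - 1 \<le> (z^2) ^ Suc n"
  proof (cases "z^2 \<le> 1")
   case True
   then show ?thesis by (smt (verit) zero_le_power2 zero_le_power)
  next
   case False
   then have "(z^2) ^ 1 \<le> (z^2) ^ Suc n" by (intro power_increasing) auto
   then show ?thesis by simp
  qed
  then show ?thesis by (simp only: power_mult)
 qed
 have Pge: "(\<Sum>b\<in>Basis. (y x b)^2) - DIM('a) \<le> P n x" for n x
 proof -
  have "(\<Sum>b\<in>(Basis::'a set). (y x b)^2 - 1) \<le> P n x" unfolding P_def by (intro sum_mono sq)
  then show ?thesis by (simp add: sum_subtractf)
 qed
 have Pge2: "(norm (x - c))^2 / (1 / m^2) - DIM('a) \<le> P n x" for n x
 proof -
  have "(norm (x - c))^2 / (1 / m^2) = (\<Sum>b\<in>Basis. (x \<bullet> b - c \<bullet> b)^2 * m^2)"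
   by (simp add: norm_sq_Basis inner_diff_left sum_distrib_right)
  also have "... \<le> (\<Sum>b\<in>Basis. (y x b)^2)"
   unfolding y_def power_mult_distrib using m by (intro sum_mono mult_left_mono power_mono) auto
  finally show ?thesis using Pge[of x n] by linarith
 qed
 define f where "f n x = a * cplx (1 * exp (- P n x))" for n x
 have fs: "f n \<in> schwartz" for n
  unfolding f_def
  by (rule schwartz_bounded_linear[OF bounded_linear_mult_right],
    rule exp_polynomial_schwartz[OF Ppoly real_polynomial_function.intros(2) _ Pge2]) (use m in simp)
 define g where "g x = cplx (exp (real DIM('a))) * f 0 x" for x
 have g: "square_integrable g"
  unfolding g_def by (intro square_integrable_cmult schwartz_square_integrable fs)
 have fm: "f n \<in> bmeas borel" for n
  by (rule smooth_measurable[OF schwartz_smooth[OF fs]])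
 have le: "norm (f n x) \<le> norm (g x)" for n x
 proof -
  have "exp (- P n x) \<le> exp (real DIM('a)) * exp (- P 0 x)"
   using Pge[of x n] by (simp add: exp_add[symmetric] P_def)
  then show ?thesis
   by (simp add: f_def g_def norm_mult mult_left_mono mult.left_commute)
 qed
 \<comment> \<open>On the faces of the box some power stays equal to one and the limit is wrong, but
   the faces are null sets.\<close>
 have lim: "AE x in lborel. (\<lambda>n. f n x) \<longlonglongrightarrow> a * cplx (indicator (box l u) x)"
 proof -
  have "AE x in lborel. \<forall>b\<in>Basis. x \<bullet> b \<noteq> l \<bullet> b \<and> x \<bullet> b \<noteq> u \<bullet> b"
   by (intro AE_finite_allI AE_conjI AE_lborel_inner_neq) auto
  then show ?thesis
  proof eventually_elim
   case (elim x)
   have yabs: "\<bar>y x b\<bar> < 1 \<longleftrightarrow> l \<bullet> b < x \<bullet> b \<and> x \<bullet> b < u \<bullet> b" "\<bar>y x b\<bar> > 1 \<longleftrightarrow> x \<bullet> b < l \<bullet> b \<or> u \<bullet> b < x \<bullet> b" if "b \<in> Basis" for b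
   proof -
    have yb: "y x b = (2 * (x \<bullet> b) - l \<bullet> b - u \<bullet> b) / (u \<bullet> b - l \<bullet> b)"
     using lu[OF that] by (simp add: y_def s_def c_def inner_add_left field_simps)
    show "\<bar>y x b\<bar> < 1 \<longleftrightarrow> l \<bullet> b < x \<bullet> b \<and> x \<bullet> b < u \<bullet> b" "\<bar>y x b\<bar> > 1 \<longleftrightarrow> x \<bullet> b < l \<bullet> b \<or> u \<bullet> b < x \<bullet> b"
     unfolding yb abs_divide using lu[OF that] by (simp_all add: divide_less_eq less_divide_eq, arith+)
   qed
   have "(\<lambda>n. exp (- P n x)) \<longlonglongrightarrow> indicator (box l u) x"
   proof (cases "x \<in> box l u")
    case True
    have "(\<lambda>n. P n x) \<longlonglongrightarrow> (\<Sum>b\<in>(Basis::'a set). 0)"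
     unfolding P_def
    proof (intro tendsto_sum)
     fix b :: 'a assume b: "b \<in> Basis"
     have "\<bar>y x b\<bar> < 1" using True yabs(1)[OF b] b by (auto simp: mem_box)
     then have "(y x b)^2 < 1" by (simp add: abs_square_less_1)
     then have "(\<lambda>n. ((y x b)^2) ^ Suc n) \<longlonglongrightarrow> 0"
      by (intro LIMSEQ_Suc LIMSEQ_realpow_zero) auto
     then show "(\<lambda>n. y x b ^ (2 * Suc n)) \<longlonglongrightarrow> 0" by (simp only: power_mult)
    qed
    then have "(\<lambda>n. exp (- P n x)) \<longlonglongrightarrow> exp (- 0)" by (intro tendsto_intros) simp
    then show ?thesis using True by simp
   next
    case False
    then obtain b where b: "b \<in> Basis" "\<not> (l \<bullet> b < x \<bullet> b \<and> x \<bullet> b < u \<bullet> b)" by (auto simp: mem_box)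
    then have "\<bar>y x b\<bar> > 1" using elim yabs(2)[OF b(1)] by force
    then have y1: "(y x b)^2 > 1" by (metis abs_square_le_1 linorder_not_less)
    have "filterlim (\<lambda>n. ((y x b)^2) ^ n) at_top sequentially"
    proof (rule filterlim_at_infinity_imp_filterlim_at_top)
     show "filterlim (\<lambda>n. ((y x b)^2) ^ n) at_infinity sequentially"
      by (rule filterlim_realpow_sequentially_gt1) (use y1 in simp)
     show "\<forall>\<^sub>F n in sequentially. 0 < ((y x b)^2) ^ n"
      by (rule always_eventually, rule allI, rule zero_less_power) (use y1 in linarith)
    qed
    then have t: "filterlim (\<lambda>n. ((y x b)^2) ^ Suc n) at_top sequentially"
     by (rule filterlim_sequentially_Suc[THEN iffD2])
    have "filterlim (\<lambda>n. P n x) at_top sequentially"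
    proof (rule filterlim_at_top_mono[OF t], rule always_eventually, rule allI)
     fix n
     have "((y x b)^2) ^ Suc n = y x b ^ (2 * Suc n)" by (rule power_mult[symmetric])
     also have "... \<le> P n x" unfolding P_def
      by (rule member_le_sum[OF b(1)]) (rule zero_le_even_power', simp)
     finally show "((y x b)^2) ^ Suc n \<le> P n x" .
    qed
    then have "filterlim (\<lambda>n. - P n x) at_bot sequentially" by (simp add: filterlim_uminus_at_top)
    then have "(\<lambda>n. exp (- P n x)) \<longlonglongrightarrow> 0" by (rule filterlim_compose[OF exp_at_bot])
    then show ?thesis using False by simp
   qed
   then show ?case unfolding f_def by (intro tendsto_intros tendsto_of_real) simp
  qed
 qed
 have "(\<lambda>n. T (L2_class (f n))) \<longlonglongrightarrow> T (L2_class (\<lambda>x. a * cplx (indicator (box l u) x)))"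
  by (intro blinfun.tendsto tendsto_const L2_dominated_convergence(2)[OF g fm _ le lim]) measurable
 then show ?thesis using T[OF fs] by (simp add: LIMSEQ_const_iff)
qed

text \<open>The kernel of \<open>T\<close> is closed. It contains the indicators of boxes, hence by
  Dynkin's argument those of bounded Borel sets, hence simple functions, hence everything. In this
  form the result is what makes the definite description in \<open>Op\<close> unique.\<close>

theorem schwartz_dense:
 fixes T :: "'a::euclidean_space L2 \<Rightarrow>\<^sub>L 'b::real_normed_vector"
 assumes T: "\<And>f. f \<in> schwartz \<Longrightarrow> T (L2_class f) = 0"
 shows "T = 0"
proof -
 define B where "B n = box (- real n *\<^sub>R One) (real n *\<^sub>R One :: 'a)" for n
 have Bin: "\<exists>N. \<forall>n\<ge>N. x \<in> B n" for x
 proof -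
  obtain N :: nat where N: "norm x < N" using reals_Archimedean2 by blast
  have "x \<in> B n" if "n \<ge> N" for n
   unfolding B_def mem_box
  proof
   fix b :: 'a assume b: "b \<in> Basis"
   have "\<bar>x \<bullet> b\<bar> < n" using Basis_le_norm[OF b, of x] N that by (meson le_less_trans less_le_trans of_nat_mono)
   then show "(- real n *\<^sub>R One) \<bullet> b < x \<bullet> b \<and> x \<bullet> b < (real n *\<^sub>R One) \<bullet> b" using b by (auto simp: abs_less_iff)
  qed
  then show ?thesis by blast
 qed
 have Bm [measurable]: "B n \<in> sets borel" for n by (simp add: B_def)
 \<comment> \<open>The truncation to \<open>B n\<close> keeps the Dynkin argument inside L2: its
   complement step subtracts from \<open>J n UNIV a\<close>, which is square-integrable only because
   of the truncation.\<close>
 define J where "J n A a x = a * cplx (indicator (A \<inter> B n) x)" for n A a and x :: 'a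
 have Jsq: "square_integrable (J n A a)" if [measurable]: "A \<in> sets borel" for n A a
  unfolding J_def
 proof (rule square_integrable_cmult, rule square_integrableI_bound[where g="\<lambda>x. cplx (indicator (B n) x)"])
  have "(\<lambda>x. (cmod (cplx (indicator (B n) x)))^2) = indicator (B n)"
   by (auto simp: fun_eq_iff indicator_def)
  moreover have "emeasure lborel (B n) < \<infinity>"
   unfolding B_def by (simp add: emeasure_lborel_box_finite)
  ultimately show "square_integrable (\<lambda>x. cplx (indicator (B n) x))"
   by (simp add: square_integrable_def integrable_real_indicator)
 qed (auto simp: indicator_def)
 have ind: "T (L2_class (J n A a)) = 0" if A: "A \<in> sets borel" for n A a
 proof -
  let ?G = "range (\<lambda>(a, b). box a b :: 'a set)"
  have I: "Int_stable ?G"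
  proof (rule Int_stableI)
   fix a b assume "a \<in> ?G" "b \<in> ?G"
   then obtain l u l' u' where "a = box l u" "b = box l' u'" by auto
   then show "a \<inter> b \<in> ?G" by (auto simp: box_Int_box image_iff)
  qed
  have G: "?G \<subseteq> Pow UNIV" by simp
  have "A \<in> sigma_sets UNIV ?G" using A by (simp add: borel_eq_box)
  from I G this show ?thesis
  proof (induction A rule: sigma_sets_induct_disjoint)
   case (basic A)
   then obtain l u where "A = box l u" by auto
   then obtain l' u' where "A \<inter> B n = box l' u'" unfolding B_def by (simp add: box_Int_box)
   then show ?case unfolding J_def using box_indicator_in_kernel[OF T] by simp
  next
   case empty
   then show ?case by (simp add: J_def L2_class_zero[symmetric])
  next
   case (compl A)
   have mA: "A \<in> sets borel" using compl by (simp add: borel_eq_box)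
   have "J n (UNIV - A) a = (\<lambda>x. J n UNIV a x - J n A a x)"
    by (auto simp: J_def fun_eq_iff indicator_def)
   moreover have "T (L2_class (J n UNIV a)) = 0"
    using box_indicator_in_kernel[OF T, of a] by (simp add: J_def[abs_def] B_def)
   ultimately show ?case
    using compl.IH Jsq[OF mA, of n a] Jsq[of UNIV n a]
    by (simp add: L2_class_diff[symmetric] blinfun.diff_right)
  next
   case (union A)
   have mA: "A i \<in> sets borel" for i using union by (auto simp: borel_eq_box)
   have mU: "(\<Union>i<k. A i) \<in> sets borel" for k using mA by (intro sets.finite_UN) auto
   have sums: "T (L2_class (J n (\<Union>i<k. A i) a)) = 0" for k
   proof (induction k)
    case 0
    then show ?case by (simp add: J_def L2_class_zero[symmetric])
   next
    case (Suc k)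
    have disj: "x \<notin> A i" if "x \<in> A k" "i < k" for x i
    proof -
     have "A i \<inter> A k = {}" using union(1) that(2) by (simp add: disjoint_family_on_def)
     then show ?thesis using that(1) by blast
    qed
    have "J n (\<Union>i<Suc k. A i) a = (\<lambda>x. J n (\<Union>i<k. A i) a x + J n (A k) a x)"
     using disj by (auto simp: J_def fun_eq_iff indicator_def less_Suc_eq)
    then show ?case
     using Suc union.IH Jsq[OF mU[of k], of n a] Jsq[OF mA[of k], of n a]
     by (simp add: L2_class_add[symmetric] blinfun.add_right)
   qed
   have mU': "(\<Union>i. A i) \<in> sets borel" using mA by (intro sets.countable_UN) auto
   have "(\<lambda>k. L2_class (J n (\<Union>i<k. A i) a)) \<longlonglongrightarrow> L2_class (J n (\<Union>i. A i) a)"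
   proof (rule L2_dominated_convergence(2)[where g="J n UNIV a"])
    show "square_integrable (J n UNIV a)" by (rule Jsq) simp
    show "J n (\<Union>i<k. A i) a \<in> bmeas borel" for k
     by (rule square_integrable_measurable[OF Jsq[OF mU]])
    show "J n (\<Union>i. A i) a \<in> bmeas borel"
     by (rule square_integrable_measurable[OF Jsq[OF mU']])
    show "norm (J n (\<Union>i<k. A i) a x) \<le> norm (J n UNIV a x)" for k x
     by (auto simp: J_def indicator_def)
    show "AE x in lborel. (\<lambda>k. J n (\<Union>i<k. A i) a x) \<longlonglongrightarrow> J n (\<Union>i. A i) a x"
    proof (rule AE_I2)
     fix x
     have "\<forall>\<^sub>F k in sequentially. J n (\<Union>i<k. A i) a x = J n (\<Union>i. A i) a x"
     proof (cases "x \<in> (\<Union>i. A i)")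
      case True
      then obtain i where i: "x \<in> A i" by blast
      show ?thesis using eventually_gt_at_top[of i]
      proof eventually_elim
       case (elim k)
       then have "x \<in> (\<Union>i<k. A i)" using i by blast
       with True show ?case by (auto simp: J_def indicator_def)
      qed
     next
      case False
      then show ?thesis by (auto simp: J_def indicator_def)
     qed
     then show "(\<lambda>k. J n (\<Union>i<k. A i) a x) \<longlonglongrightarrow> J n (\<Union>i. A i) a x" by (rule tendsto_eventually)
    qed
   qed
   then have "(\<lambda>k. T (L2_class (J n (\<Union>i<k. A i) a))) \<longlonglongrightarrow> T (L2_class (J n (\<Union>i. A i) a))"
    by (intro blinfun.tendsto tendsto_const)
   then show ?case using sums by (simp add: LIMSEQ_const_iff)
  qed
 qed
 have "T F = 0" for F
 proof (rule L2_cases[of F])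
  fix f assume f: "square_integrable f" "F = L2_class f"
  have [measurable]: "f \<in> bmeas borel" using f(1) by measurable
  obtain s where s: "\<And>i. simple_function borel (s i)" "\<And>x. (\<lambda>i. s i x) \<longlonglongrightarrow> f x"
   "\<And>i x. dist (s i x) 0 \<le> 2 * dist (f x) 0"
   using borel_measurable_implies_sequence_metric[of f borel 0] by auto
  \<comment> \<open>Cutting the simple function \<open>s i\<close> off to \<open>B i\<close> makes
    it a finite combination of the \<open>J\<close>; as \<open>B i\<close> exhausts the space, the
    pointwise limit is unchanged.\<close>
  define h where "h i x = s i x * cplx (indicator (B i) x)" for i x
  have fin: "finite (range (s i))" and pre: "s i -` {y} \<in> sets borel" for i y
   using simple_functionD[OF s(1)[of i]] by auto
  have hrep: "h i = (\<lambda>x. \<Sum>y\<in>range (s i). J i (s i -` {y}) y x)" for i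
  proof
   fix x
   have "(\<Sum>y\<in>range (s i). J i (s i -` {y}) y x) = (\<Sum>y\<in>range (s i). if y = s i x then s i x * cplx (indicator (B i) x) else 0)"
    by (intro sum.cong) (auto simp: J_def indicator_def)
   then show "h i x = (\<Sum>y\<in>range (s i). J i (s i -` {y}) y x)" by (simp add: h_def fin)
  qed
  have sumT: "square_integrable (\<lambda>x. \<Sum>y\<in>Y. J i (s i -` {y}) y x) \<and> T (L2_class (\<lambda>x. \<Sum>y\<in>Y. J i (s i -` {y}) y x)) = 0"
   if "finite Y" for Y i
   using that
  proof induction
   case empty
   then show ?case by (simp add: L2_class_zero[symmetric] square_integrable_zero)
  next
   case (insert y Y)
   then show ?case
    by (simp add: square_integrable_add Jsq pre L2_class_add[symmetric] blinfun.add_right ind)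
  qed
  have h0: "T (L2_class (h i)) = 0" and hsq: "square_integrable (h i)" for i
   using sumT[OF fin] unfolding hrep by auto
  have "(\<lambda>i. L2_class (h i)) \<longlonglongrightarrow> L2_class f"
  proof (rule L2_dominated_convergence(2)[where g="\<lambda>x. 2 * f x"])
   show "square_integrable (\<lambda>x. 2 * f x)" by (rule square_integrable_cmult[OF f(1)])
   show "h i \<in> bmeas borel" for i by (rule square_integrable_measurable[OF hsq])
   show "norm (h i x) \<le> norm (2 * f x)" for i x
    using s(3)[of i x] by (auto simp: h_def norm_mult indicator_def)
   show "AE x in lborel. (\<lambda>i. h i x) \<longlonglongrightarrow> f x"
   proof (rule AE_I2)
    fix x
    obtain N where "\<And>n. n \<ge> N \<Longrightarrow> x \<in> B n" using Bin by blast
    then have "\<forall>\<^sub>F i in sequentially. s i x = h i x"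
     by (intro eventually_sequentiallyI[of N]) (simp add: h_def)
    from Lim_transform_eventually[OF s(2) this] show "(\<lambda>i. h i x) \<longlonglongrightarrow> f x" .
   qed
  qed simp
  then have "(\<lambda>i. T (L2_class (h i))) \<longlonglongrightarrow> T (L2_class f)"
   by (intro blinfun.tendsto tendsto_const)
  then show ?thesis using h0 f(2) by (simp add: LIMSEQ_const_iff)
 qed
 then show ?thesis by (intro blinfun_eqI) simp
qed

subsection \<open>Translation kernel operators\<close>

lemma lborel_translate:
 fixes c :: "'a::euclidean_space" and f :: "'a \<Rightarrow> 'b::{banach,second_countable_topology}"
 shows integral_translate: "(LBINT x. f (x + c)) = (LBINT x. f x)"
  and integrable_translate: "integrable lborel (\<lambda>x. f (x + c)) \<longleftrightarrow> integrable lborel f"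
proof -
 have i: "integrable lborel (\<lambda>x. f (x + c))" if f: "integrable lborel f" for f :: "'a \<Rightarrow> 'b" and c
 proof -
  have "integrable (distr lborel borel ((+) c)) f" using f by (simp add: lborel_distr_plus)
  then show ?thesis
   by (subst (asm) integrable_distr_eq) (use f in \<open>auto simp: add.commute\<close>)
 qed
 show "integrable lborel (\<lambda>x. f (x + c)) \<longleftrightarrow> integrable lborel f"
  using i[of f c] i[of "\<lambda>x. f (x + c)" "- c"] by auto
 show "(LBINT x. f (x + c)) = (LBINT x. f x)"
 proof (cases "integrable lborel f")
  case True
  have "(LBINT x. f x) = (LINT x|(distr lborel borel ((+) c)). f x)" by (simp add: lborel_distr_plus)
  also have "... = (LBINT x. f (c + x))" by (rule integral_distr) (use True in auto)
  finally show ?thesis by (simp add: add.commute)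
 next
  case False
  then have "\<not> integrable lborel (\<lambda>x. f (x + c))" using i[of "\<lambda>x. f (x + c)" "- c"] by auto
  with False show ?thesis by (simp add: not_integrable_integral_eq)
 qed
qed

lemma square_integrable_shift:
 fixes f :: "'a::euclidean_space \<Rightarrow> complex"
 assumes "square_integrable f"
 shows "square_integrable (\<lambda>x. f (x - c))" "norm (L2_class (\<lambda>x. f (x - c))) = norm (L2_class f)"
proof -
 have [measurable]: "f \<in> bmeas borel" using assms by measurable
 show s: "square_integrable (\<lambda>x. f (x - c))"
  using assms integrable_translate[of "\<lambda>x. (norm (f x))^2" "- c"]
  by (simp add: square_integrable_def)
 have "(norm (L2_class (\<lambda>x. f (x - c))))^2 = (norm (L2_class f))^2"
  using integral_translate[of "\<lambda>x. (norm (f x))^2" "- c"]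
  by (simp add: L2_class_norm2 s assms)
 then show "norm (L2_class (\<lambda>x. f (x - c))) = norm (L2_class f)"
  by (rule power2_eq_imp_eq) auto
qed

lemma L2_inner_ext:
 fixes X Y :: "'a::euclidean_space L2"
 assumes "\<And>g. square_integrable g \<Longrightarrow> L2_class g \<bullet> X = L2_class g \<bullet> Y"
 shows "X = Y"
proof -
 have "Z \<bullet> (X - Y) = 0" for Z
  by (rule L2_cases[of Z]) (simp add: inner_diff_right assms)
 from this[of "X - Y"] show ?thesis by simp
qed

lemma borel_measurable_cnj [measurable (raw)]:
 "f \<in> bmeas M \<Longrightarrow> (\<lambda>x. cnj (f x)) \<in> bmeas M"
 by (rule measurable_compose[OF _ borel_measurable_continuous_onI]) (auto intro: continuous_intros)

text \<open>The translations \<open>z w\<close> are indexed by an abstract measure so that both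
  symbol classes are covered, by scales and points in one case and by frequencies and points of a
  torus in the other. The majorant \<open>b\<close> does not depend on the position, which turns
  boundedness on L2 into Young's inequality.\<close>

locale kernel_op = sigma_finite_measure M for M :: "'w measure" +
 fixes z :: "'w \<Rightarrow> 'a::euclidean_space" and b :: "'w \<Rightarrow> real"
 assumes z_measurable [measurable]: "z \<in> bmeas M"
  and b_integrable: "integrable M b" and b_nonneg: "\<And>w. 0 \<le> b w"
begin

sublocale pair_sigma_finite "lborel :: 'a measure" M
 by unfold_locales

lemma sigma_finite_M: "sigma_finite_measure M"
 by (rule kernel_op.axioms(1)[OF kernel_op_axioms])

definition admissible :: "('a \<Rightarrow> 'w \<Rightarrow> complex) \<Rightarrow> bool" where
 "admissible k \<longleftrightarrow> (\<lambda>(x, w). k x w) \<in> bmeas (lborel \<Otimes>\<^sub>M M) \<and> (\<forall>x w. norm (k x w) \<le> b w)"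

definition kop :: "('a \<Rightarrow> 'w \<Rightarrow> complex) \<Rightarrow> ('a \<Rightarrow> complex) \<Rightarrow> 'a \<Rightarrow> complex" where
 "kop k f x = (LINT w|M. k x w * f (x - z w))"

definition kform :: "('a \<Rightarrow> 'w \<Rightarrow> complex) \<Rightarrow> ('a \<Rightarrow> complex) \<Rightarrow> ('a \<Rightarrow> complex) \<Rightarrow> real" where
 "kform k g f = (LINT (x, w)|(lborel \<Otimes>\<^sub>M M). g x \<bullet> (k x w * f (x - z w)))"

lemma b_measurable [measurable]: "b \<in> bmeas M"
 using b_integrable by simp

lemma form_measurable:
 assumes [measurable]: "f \<in> bmeas borel" "g \<in> bmeas borel" "c \<in> bmeas M"
 shows "(\<lambda>(x, w). c w * (norm (g x) * norm (f (x - z w)))) \<in> bmeas (lborel \<Otimes>\<^sub>M M)"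
 by measurable

text \<open>For fixed \<open>w\<close> this is Cauchy-Schwarz and invariance of the norm under
  translation. The weight \<open>c\<close> is left general because it is used both for
  \<open>b\<close> and for the error weight \<open>d * (b w * (norm (z w))^2)\<close>.\<close>

lemma form_bound:
 assumes f: "square_integrable f" and g: "square_integrable g"
  and c: "integrable M c" "\<And>w. 0 \<le> c w"
 shows "integrable (lborel \<Otimes>\<^sub>M M) (\<lambda>(x, w). c w * (norm (g x) * norm (f (x - z w))))"
  and "(LINT (x, w)|(lborel \<Otimes>\<^sub>M M). c w * (norm (g x) * norm (f (x - z w))))
   \<le> integral\<^sup>L M c * (norm (L2_class g) * norm (L2_class f))"
proof -
 have fm[measurable]: "f \<in> bmeas borel" and gm[measurable]: "g \<in> bmeas borel"
  using f g by measurable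
 have cm[measurable]: "c \<in> bmeas M" using c(1) by simp
 let ?h = "\<lambda>(x, w). c w * (norm (g x) * norm (f (x - z w)))"
 let ?N = "norm (L2_class g) * norm (L2_class f)"
 have hm: "?h \<in> bmeas (lborel \<Otimes>\<^sub>M M)" by measurable
 have inner: "(\<integral>\<^sup>+x. ennreal (?h (x, w)) \<partial>lborel) \<le> ennreal (c w * ?N)" for w
 proof -
  have sh: "square_integrable (\<lambda>x. f (x - z w))" by (rule square_integrable_shift(1)[OF f])
  have i: "integrable lborel (\<lambda>x. c w * (norm (g x) * norm (f (x - z w))))"
   by (intro integrable_mult_right square_integrable_abs_mult g sh)
  have "(\<integral>\<^sup>+x. ennreal (?h (x, w)) \<partial>lborel) = ennreal (LBINT x. c w * (norm (g x) * norm (f (x - z w))))"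
   using nn_integral_eq_integral[OF i] c(2) by simp
  also have "... \<le> ennreal (c w * ?N)"
   using integral_abs_mult_le_norm[OF g sh] c(2)[of w]
   by (intro ennreal_leI) (simp add: square_integrable_shift(2)[OF f] mult_left_mono)
  finally show ?thesis .
 qed
 have nn: "(\<integral>\<^sup>+p. ennreal (?h p) \<partial>(lborel \<Otimes>\<^sub>M M)) \<le> ennreal (integral\<^sup>L M c * ?N)"
 proof -
  have "(\<integral>\<^sup>+p. ennreal (?h p) \<partial>(lborel \<Otimes>\<^sub>M M)) = (\<integral>\<^sup>+w. \<integral>\<^sup>+x. ennreal (?h (x, w)) \<partial>lborel \<partial>M)"
   by (rule nn_integral_snd[symmetric]) (use hm in measurable)
  also have "... \<le> (\<integral>\<^sup>+w. ennreal (c w * ?N) \<partial>M)" by (intro nn_integral_mono inner)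
  also have "... = ennreal (LINT w|M. c w * ?N)"
   by (rule nn_integral_eq_integral) (auto intro!: integrable_mult_left c mult_nonneg_nonneg)
  also have "... = ennreal (integral\<^sup>L M c * ?N)" by simp
  finally show ?thesis .
 qed
 show i: "integrable (lborel \<Otimes>\<^sub>M M) ?h"
 proof (rule integrableI_bounded[OF hm])
  have "(\<integral>\<^sup>+p. ennreal (norm (?h p)) \<partial>(lborel \<Otimes>\<^sub>M M)) = (\<integral>\<^sup>+p. ennreal (?h p) \<partial>(lborel \<Otimes>\<^sub>M M))"
   by (intro nn_integral_cong) (auto simp: c(2))
  then show "(\<integral>\<^sup>+p. ennreal (norm (?h p)) \<partial>(lborel \<Otimes>\<^sub>M M)) < \<infinity>"
   using nn le_less_trans[OF _ ennreal_less_top] by auto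
 qed
 have "ennreal (LINT p|(lborel \<Otimes>\<^sub>M M). ?h p) \<le> ennreal (integral\<^sup>L M c * ?N)"
  using nn by (subst nn_integral_eq_integral[OF i, symmetric]) (auto simp: c(2))
 moreover have "0 \<le> integral\<^sup>L M c * ?N" using c(2) by (intro mult_nonneg_nonneg integral_nonneg') auto
 ultimately show "(LINT p|(lborel \<Otimes>\<^sub>M M). ?h p) \<le> integral\<^sup>L M c * ?N"
  by (simp add: ennreal_le_iff)
qed

lemma kform_measurable:
 assumes k: "admissible k" and [measurable]: "f \<in> bmeas borel" "g \<in> bmeas borel"
 shows "(\<lambda>(x, w). k x w * f (x - z w)) \<in> bmeas (lborel \<Otimes>\<^sub>M M)"
  and "(\<lambda>(x, w). g x \<bullet> (k x w * f (x - z w))) \<in> bmeas (lborel \<Otimes>\<^sub>M M)"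
proof -
 have [measurable]: "(\<lambda>(x, w). k x w) \<in> bmeas (lborel \<Otimes>\<^sub>M M)" using k by (simp add: admissible_def)
 show "(\<lambda>(x, w). k x w * f (x - z w)) \<in> bmeas (lborel \<Otimes>\<^sub>M M)" by measurable
 show "(\<lambda>(x, w). g x \<bullet> (k x w * f (x - z w))) \<in> bmeas (lborel \<Otimes>\<^sub>M M)" by measurable
qed

lemma kform_integrand_le:
 assumes "admissible k"
 shows "\<bar>g x \<bullet> (k x w * f (x - z w))\<bar> \<le> b w * (norm (g x) * norm (f (x - z w)))"
proof -
 have "\<bar>g x \<bullet> (k x w * f (x - z w))\<bar> \<le> norm (g x) * (norm (k x w) * norm (f (x - z w)))"
  using Cauchy_Schwarz_ineq2[of "g x" "k x w * f (x - z w)"] by (simp add: norm_mult)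
 also have "... \<le> norm (g x) * (b w * norm (f (x - z w)))"
  using assms by (intro mult_left_mono mult_right_mono) (auto simp: admissible_def)
 finally show ?thesis by (simp add: mult_ac)
qed

lemma kform_integrable:
 assumes k: "admissible k" and f: "square_integrable f" and g: "square_integrable g"
 shows "integrable (lborel \<Otimes>\<^sub>M M) (\<lambda>(x, w). g x \<bullet> (k x w * f (x - z w)))"
proof (rule integrable_bound'[OF form_bound(1)[OF f g b_integrable b_nonneg]])
 show "(\<lambda>(x, w). g x \<bullet> (k x w * f (x - z w))) \<in> bmeas (lborel \<Otimes>\<^sub>M M)"
  by (rule kform_measurable(2)[OF k]) (use f g in measurable)
qed (use kform_integrand_le[OF k] b_nonneg in \<open>auto simp: abs_mult\<close>)

text \<open>Cauchy-Schwarz in \<open>w\<close>, with \<open>b\<close> split into two square roots,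
  followed by Tonelli and translation invariance. Working with nonnegative integrals gives absolute
  convergence of \<open>kop\<close> almost everywhere at the same time as the norm bound.\<close>

lemma kop_nn_bound:
 assumes k: "admissible k" and f: "square_integrable f"
 shows "(\<integral>\<^sup>+x. (\<integral>\<^sup>+w. ennreal (norm (k x w * f (x - z w))) \<partial>M)^2 \<partial>lborel)
   \<le> ennreal ((integral\<^sup>L M b * norm (L2_class f))^2)"
proof -
 have [measurable]: "f \<in> bmeas borel" using f by measurable
 have km[measurable]: "(\<lambda>(x, w). k x w) \<in> bmeas (lborel \<Otimes>\<^sub>M M)" using k by (simp add: admissible_def)
 have B0: "0 \<le> integral\<^sup>L M b" by (intro integral_nonneg' b_nonneg)
 have pt: "(\<integral>\<^sup>+w. ennreal (norm (k x w * f (x - z w))) \<partial>M)^2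
  \<le> ennreal (integral\<^sup>L M b) * (\<integral>\<^sup>+w. ennreal (b w * (norm (f (x - z w)))^2) \<partial>M)" for x
 proof -
  have "(\<integral>\<^sup>+w. ennreal (norm (k x w * f (x - z w))) \<partial>M)
   \<le> (\<integral>\<^sup>+w. ennreal (sqrt (b w)) * ennreal (sqrt (b w) * norm (f (x - z w))) \<partial>M)"
   using k b_nonneg
   by (intro nn_integral_mono)
    (auto simp: admissible_def norm_mult ennreal_mult[symmetric] mult.assoc[symmetric] intro!: ennreal_leI mult_right_mono)
  then have "(\<integral>\<^sup>+w. ennreal (norm (k x w * f (x - z w))) \<partial>M)^2
   \<le> (\<integral>\<^sup>+w. ennreal (sqrt (b w)) * ennreal (sqrt (b w) * norm (f (x - z w))) \<partial>M)^2"
   by (rule power_mono) simp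
  also have "... \<le> (\<integral>\<^sup>+w. (ennreal (sqrt (b w)))^2 \<partial>M) * (\<integral>\<^sup>+w. (ennreal (sqrt (b w) * norm (f (x - z w))))^2 \<partial>M)"
   by (rule Cauchy_Schwarz_nn_integral) measurable
  also have "(\<integral>\<^sup>+w. (ennreal (sqrt (b w)))^2 \<partial>M) = ennreal (integral\<^sup>L M b)"
   using b_nonneg by (simp add: ennreal_power nn_integral_eq_integral[OF b_integrable])
  also have "(\<integral>\<^sup>+w. (ennreal (sqrt (b w) * norm (f (x - z w))))^2 \<partial>M) = (\<integral>\<^sup>+w. ennreal (b w * (norm (f (x - z w)))^2) \<partial>M)"
   using b_nonneg by (simp add: ennreal_power power_mult_distrib)
  finally show ?thesis .
 qed
 have "(\<integral>\<^sup>+x. (\<integral>\<^sup>+w. ennreal (norm (k x w * f (x - z w))) \<partial>M)^2 \<partial>lborel)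
  \<le> (\<integral>\<^sup>+x. ennreal (integral\<^sup>L M b) * (\<integral>\<^sup>+w. ennreal (b w * (norm (f (x - z w)))^2) \<partial>M) \<partial>lborel)"
  by (intro nn_integral_mono pt)
 also have "... = ennreal (integral\<^sup>L M b) * (\<integral>\<^sup>+x. \<integral>\<^sup>+w. ennreal (b w * (norm (f (x - z w)))^2) \<partial>M \<partial>lborel)"
  by (rule nn_integral_cmult) measurable
 also have "(\<integral>\<^sup>+x. \<integral>\<^sup>+w. ennreal (b w * (norm (f (x - z w)))^2) \<partial>M \<partial>lborel)
   = (\<integral>\<^sup>+w. \<integral>\<^sup>+x. ennreal (b w * (norm (f (x - z w)))^2) \<partial>lborel \<partial>M)"
  by (rule Fubini'[symmetric]) measurable
 also have "... = (\<integral>\<^sup>+w. ennreal (b w * (norm (L2_class f))^2) \<partial>M)"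
 proof (rule nn_integral_cong)
  fix w
  have sh: "square_integrable (\<lambda>x. f (x - z w))" by (rule square_integrable_shift(1)[OF f])
  have "(\<integral>\<^sup>+x. ennreal (b w * (norm (f (x - z w)))^2) \<partial>lborel) = ennreal (LBINT x. b w * (norm (f (x - z w)))^2)"
   using sh b_nonneg by (intro nn_integral_eq_integral) (auto simp: square_integrable_def)
  also have "... = ennreal (b w * (norm (L2_class f))^2)"
   by (simp add: L2_class_norm2[OF sh, symmetric] square_integrable_shift(2)[OF f])
  finally show "(\<integral>\<^sup>+x. ennreal (b w * (norm (f (x - z w)))^2) \<partial>lborel) = ennreal (b w * (norm (L2_class f))^2)" .
 qed
 also have "... = ennreal (integral\<^sup>L M b * (norm (L2_class f))^2)"
  using b_integrable b_nonneg by (subst nn_integral_eq_integral) auto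
 also have "ennreal (integral\<^sup>L M b) * ennreal (integral\<^sup>L M b * (norm (L2_class f))^2) = ennreal ((integral\<^sup>L M b * norm (L2_class f))^2)"
  using B0 by (simp add: ennreal_mult[symmetric] power2_eq_square mult_ac)
 finally show ?thesis .
qed

lemma kop_integrable_AE:
 assumes k: "admissible k" and f: "square_integrable f"
 shows "AE x in lborel. integrable M (\<lambda>w. k x w * f (x - z w))"
proof -
 have [measurable]: "f \<in> bmeas borel" using f by measurable
 have km[measurable]: "(\<lambda>(x, w). k x w) \<in> bmeas (lborel \<Otimes>\<^sub>M M)" using k by (simp add: admissible_def)
 have "AE x in lborel. (\<integral>\<^sup>+w. ennreal (norm (k x w * f (x - z w))) \<partial>M)^2 \<noteq> \<infinity>"
  by (rule nn_integral_PInf_AE) (use kop_nn_bound[OF k f] in \<open>auto simp: top_unique\<close>)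
 then show ?thesis
 proof eventually_elim
  case (elim x)
  show ?case
   by (rule integrableI_bounded) (use elim in \<open>auto simp: top.not_eq_extremum power_eq_top_ennreal\<close>)
 qed
qed

lemma kop_measurable:
 assumes k: "admissible k" and [measurable]: "f \<in> bmeas borel"
 shows "kop k f \<in> bmeas borel"
proof -
 have [measurable]: "(\<lambda>(x, w). k x w) \<in> bmeas (lborel \<Otimes>\<^sub>M M)" using k by (simp add: admissible_def)
 have "(\<lambda>x. \<integral>w. k x w * f (x - z w) \<partial>M) \<in> bmeas lborel"
  by (rule sigma_finite_measure.borel_measurable_lebesgue_integral[OF sigma_finite_M]) measurable
 then show ?thesis by (simp add: kop_def[abs_def])
qed

lemma kop_square_integrable:
 assumes k: "admissible k" and f: "square_integrable f"
 shows "square_integrable (kop k f)" "norm (L2_class (kop k f)) \<le> integral\<^sup>L M b * norm (L2_class f)"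
proof -
 have [measurable]: "f \<in> bmeas borel" using f by measurable
 have km [measurable]: "kop k f \<in> bmeas borel" by (rule kop_measurable[OF k]) measurable
 have B0: "0 \<le> integral\<^sup>L M b" by (intro integral_nonneg' b_nonneg)
 have "(\<integral>\<^sup>+x. ennreal ((norm (kop k f x))^2) \<partial>lborel)
   \<le> (\<integral>\<^sup>+x. (\<integral>\<^sup>+w. ennreal (norm (k x w * f (x - z w))) \<partial>M)^2 \<partial>lborel)"
 proof (rule nn_integral_mono_AE)
  show "AE x in lborel. ennreal ((norm (kop k f x))^2) \<le> (\<integral>\<^sup>+w. ennreal (norm (k x w * f (x - z w))) \<partial>M)^2"
   using kop_integrable_AE[OF k f]
  proof eventually_elim
   case (elim x)
   have "ennreal (norm (kop k f x)) \<le> (\<integral>\<^sup>+w. ennreal (norm (k x w * f (x - z w))) \<partial>M)"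
    unfolding kop_def by (rule integral_norm_bound_ennreal[OF elim])
   then have "(ennreal (norm (kop k f x)))^2 \<le> (\<integral>\<^sup>+w. ennreal (norm (k x w * f (x - z w))) \<partial>M)^2"
    by (rule power_mono) simp
   then show ?case by (simp add: ennreal_power)
  qed
 qed
 also note kop_nn_bound[OF k f]
 finally have nn: "(\<integral>\<^sup>+x. ennreal ((norm (kop k f x))^2) \<partial>lborel) \<le> ennreal ((integral\<^sup>L M b * norm (L2_class f))^2)" .
 show s: "square_integrable (kop k f)"
  unfolding square_integrable_def
  by (intro conjI integrableI_bounded) (use nn le_less_trans[OF nn ennreal_less_top] in auto)
 have "(norm (L2_class (kop k f)))^2 \<le> (integral\<^sup>L M b * norm (L2_class f))^2"
  unfolding L2_class_norm2[OF s] using nn s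
  by (subst (asm) nn_integral_eq_integral) (auto simp: square_integrable_def ennreal_le_iff)
 then show "norm (L2_class (kop k f)) \<le> integral\<^sup>L M b * norm (L2_class f)"
  by (rule power2_le_imp_le) (use B0 in simp)
qed

lemma inner_kop:
 assumes k: "admissible k" and f: "square_integrable f" and g: "square_integrable g"
 shows "L2_class g \<bullet> L2_class (kop k f) = kform k g f"
proof -
 have "L2_class g \<bullet> L2_class (kop k f) = (LBINT x. g x \<bullet> kop k f x)"
  by (rule L2_class_inner[OF g kop_square_integrable(1)[OF k f]])
 also have "... = (LBINT x. (LINT w|M. g x \<bullet> (k x w * f (x - z w))))"
 proof (rule integral_cong_AE)
  show "AE x in lborel. g x \<bullet> kop k f x = (LINT w|M. g x \<bullet> (k x w * f (x - z w)))"
   using kop_integrable_AE[OF k f] by eventually_elim (simp add: kop_def)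
  show "(\<lambda>x. g x \<bullet> kop k f x) \<in> bmeas lborel"
   using kop_measurable[OF k square_integrable_measurable[OF f]] square_integrable_measurable[OF g] by simp
  show "(\<lambda>x. \<integral>w. g x \<bullet> (k x w * f (x - z w)) \<partial>M) \<in> bmeas lborel"
   by (rule sigma_finite_measure.borel_measurable_lebesgue_integral[OF sigma_finite_M], rule kform_measurable(2)[OF k]) (use f g in measurable)
 qed
 also have "... = kform k g f"
  unfolding kform_def by (rule integral_fst'[OF kform_integrable[OF k f g], simplified])
 finally show ?thesis .
qed

lemma kform_swap:
 assumes k: "admissible k" and f: "square_integrable f" and g: "square_integrable g"
 shows "kform k g f = (LINT w|M. (LBINT x. g x \<bullet> (k x w * f (x - z w))))"
 unfolding kform_def using integral_snd[of "\<lambda>x w. g x \<bullet> (k x w * f (x - z w))"] kform_integrable[OF k f g] by simp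

text \<open>For fixed \<open>w\<close> translation preserves null sets, so the inner integral does
  not change. This makes the action on L2 classes independent of representatives.\<close>

lemma kform_cong_AE:
 assumes k: "admissible k" and f: "square_integrable f" "square_integrable f'" and g: "square_integrable g"
  and ae: "AE x in lborel. f x = f' x"
 shows "kform k g f = kform k g f'"
proof -
 have "(LBINT x. g x \<bullet> (k x w * f (x - z w))) = (LBINT x. g x \<bullet> (k x w * f' (x - z w)))" if w: "w \<in> space M" for w
 proof (rule integral_cong_AE)
  have [measurable]: "f \<in> bmeas borel" "f' \<in> bmeas borel" "g \<in> bmeas borel" using f g by measurable
  have [measurable]: "(\<lambda>x. k x w) \<in> bmeas borel"
   using k measurable_Pair1[of "\<lambda>(x, w). k x w" lborel M borel w] w
   by (simp add: admissible_def)
  show "(\<lambda>x. g x \<bullet> (k x w * f (x - z w))) \<in> bmeas lborel" by measurable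
  show "(\<lambda>x. g x \<bullet> (k x w * f' (x - z w))) \<in> bmeas lborel" by measurable
  have "L2_class (\<lambda>x. f (x - z w)) = L2_class (\<lambda>x. f' (x - z w))"
  proof -
   have "norm (L2_class (\<lambda>x. f (x - z w) - f' (x - z w))) = norm (L2_class (\<lambda>x. f x - f' x))"
    by (rule square_integrable_shift(2)[OF square_integrable_diff[OF f]])
   also have "L2_class (\<lambda>x. f x - f' x) = 0"
    unfolding L2_class_diff[OF f, symmetric] using ae L2_class_eq_iff[OF f] by simp
   finally show ?thesis
    using L2_class_diff[OF square_integrable_shift(1)[OF f(1)] square_integrable_shift(1)[OF f(2)], of "z w" "z w"] by simp
  qed
  then have "AE x in lborel. f (x - z w) = f' (x - z w)"
   using L2_class_eq_iff[OF square_integrable_shift(1)[OF f(1)] square_integrable_shift(1)[OF f(2)]] by blast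
  then show "AE x in lborel. g x \<bullet> (k x w * f (x - z w)) = g x \<bullet> (k x w * f' (x - z w))"
   by eventually_elim simp
 qed
 then show ?thesis
  unfolding kform_swap[OF k f(1) g] kform_swap[OF k f(2) g] by (rule integral_cong'[OF refl])
qed

text \<open>The integrals defining \<open>kop\<close> converge only almost everywhere, so linearity
  is checked weakly, by testing against every \<open>g\<close>, where \<open>kform\<close> is an
  absolutely convergent integral.\<close>

lemma kop_L2_exists:
 assumes k: "admissible k"
 shows "\<exists>T :: 'a L2 \<Rightarrow>\<^sub>L 'a L2. \<forall>f. square_integrable f \<longrightarrow> T (L2_class f) = L2_class (kop k f)"
proof -
 define T where "T F = L2_class (kop k (L2_rep F))" for F
 have cl: "T (L2_class f) = L2_class (kop k f)" if f: "square_integrable f" for f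
 proof (rule L2_inner_ext)
  fix g :: "'a \<Rightarrow> complex" assume g: "square_integrable g"
  have "AE x in lborel. L2_rep (L2_class f) x = f x"
   using L2_class_eq_iff[OF square_integrable_rep f] L2_class_rep by blast
  from kform_cong_AE[OF k square_integrable_rep f g this]
  show "L2_class g \<bullet> T (L2_class f) = L2_class g \<bullet> L2_class (kop k f)"
   unfolding T_def by (simp add: inner_kop[OF k _ g] f square_integrable_rep)
 qed
 have add: "T (F + G) = T F + T G" for F G
 proof (rule L2_cases[of F], rule L2_cases[of G], rule L2_inner_ext)
  fix f f' g assume f: "square_integrable f" "F = L2_class f" and f': "square_integrable f'" "G = L2_class f'"
   and g: "square_integrable (g :: 'a \<Rightarrow> complex)"
  have ff: "square_integrable (\<lambda>x. f x + f' x)" by (rule square_integrable_add[OF f(1) f'(1)])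
  have "kform k g (\<lambda>x. f x + f' x) = (LINT p|(lborel \<Otimes>\<^sub>M M). (case p of (x, w) \<Rightarrow> g x \<bullet> (k x w * f (x - z w)))
    + (case p of (x, w) \<Rightarrow> g x \<bullet> (k x w * f' (x - z w))))"
   unfolding kform_def by (intro integral_cong') (auto simp: distrib_left inner_add_right)
  also have "... = kform k g f + kform k g f'"
   unfolding kform_def by (rule integral_add'[OF kform_integrable[OF k f(1) g] kform_integrable[OF k f'(1) g]])
  finally show "L2_class g \<bullet> T (F + G) = L2_class g \<bullet> (T F + T G)"
   by (simp add: f f' L2_class_add cl ff inner_add_right inner_kop[OF k _ g])
 qed
 have scale: "T (r *\<^sub>R F) = r *\<^sub>R T F" for r F
 proof (rule L2_cases[of F], rule L2_inner_ext)
  fix f g assume f: "square_integrable f" "F = L2_class f" and g: "square_integrable (g :: 'a \<Rightarrow> complex)"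
  have rf: "square_integrable (\<lambda>x. r *\<^sub>R f x)"
   using square_integrable_cmult[OF f(1), of "of_real r"] by (simp add: scaleR_conv_of_real)
  have "kform k g (\<lambda>x. r *\<^sub>R f x) = (LINT p|(lborel \<Otimes>\<^sub>M M). r * (case p of (x, w) \<Rightarrow> g x \<bullet> (k x w * f (x - z w))))"
   unfolding kform_def by (intro integral_cong') auto
  also have "... = r * kform k g f" unfolding kform_def by simp
  finally show "L2_class g \<bullet> T (r *\<^sub>R F) = L2_class g \<bullet> (r *\<^sub>R T F)"
   by (simp add: f L2_class_scaleR cl rf inner_kop[OF k _ g])
 qed
 have "bounded_linear T"
 proof (rule bounded_linear_intro[OF add scale])
  show "norm (T F) \<le> norm F * integral\<^sup>L M b" for F
   by (rule L2_cases[of F]) (use kop_square_integrable(2)[OF k] cl in \<open>simp add: mult.commute\<close>)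
 qed
 then show ?thesis
  by (intro exI[of _ "Blinfun T"]) (simp add: bounded_linear_Blinfun_apply cl)
qed

text \<open>Multiplying the kernel by a positive definite function
 \<open>G x y = \<integral> Q p x * cnj (Q p y) dp\<close> with \<open>G x x = 1\<close> preserves an upper bound of the
 quadratic form, since the new form is the integral over \<open>p\<close> of the old one at \<open>cnj (Q p) * f\<close>.\<close>

lemma kform_compare:
 fixes P :: "'p measure" and Q :: "'p \<Rightarrow> 'a \<Rightarrow> complex" and t :: "'a \<Rightarrow> 'a \<Rightarrow> real"
 assumes P: "sigma_finite_measure P" and k: "admissible k"
  and Q: "(\<lambda>(p, x). Q p x) \<in> bmeas (P \<Otimes>\<^sub>M lborel)"
  and one: "\<And>x. integrable P (\<lambda>p. (norm (Q p x))^2)" "\<And>x. (LINT p|P. (norm (Q p x))^2) = 1"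
  and t: "(\<lambda>(x, y). t x y) \<in> bmeas (borel \<Otimes>\<^sub>M borel)"
  and G: "\<And>x y. norm ((LINT p|P. Q p x * cnj (Q p y)) - exp (\<i> * t x y)) \<le> d * (norm (x - y))^2"
  and d: "d \<ge> 0" and mom: "integrable M (\<lambda>w. b w * (norm (z w))^2)"
  and a: "\<And>f. square_integrable f \<Longrightarrow> kform k f f \<le> a * (norm (L2_class f))^2"
  and f: "square_integrable f"
 shows "kform (\<lambda>x w. k x w * exp (\<i> * t x (x - z w))) f f
   \<le> (a + d * (LINT w|M. b w * (norm (z w))^2)) * (norm (L2_class f))^2"
proof -
 interpret P: sigma_finite_measure P by (rule P)
 let ?N = "lborel \<Otimes>\<^sub>M M"
 interpret NM: sigma_finite_measure ?N by (rule sigma_finite_pair_measure) unfold_locales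
 interpret NP: pair_sigma_finite ?N P by unfold_locales
 interpret LP: pair_sigma_finite "lborel :: 'a measure" P by unfold_locales
 note Q[measurable] t[measurable]
 have fm[measurable]: "f \<in> bmeas borel" using f by measurable
 have km[measurable]: "(\<lambda>(x, w). k x w) \<in> bmeas ?N" using k by (simp add: admissible_def)
 define F where "F p x = cnj (Q p x) * f x" for p x
 define g where "g x w = cnj (f x) * (k x w * f (x - z w))" for x w
 define G where "G x y = (LINT p|P. Q p x * cnj (Q p y))" for x y
 have gm[measurable]: "(\<lambda>(x, w). g x w) \<in> bmeas ?N" unfolding g_def by measurable
 have gle: "norm (g x w) \<le> b w * (norm (f x) * norm (f (x - z w)))" for x w
 proof -
  have "norm (g x w) = norm (k x w) * (norm (f x) * norm (f (x - z w)))" by (simp add: g_def norm_mult mult_ac)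
  also have "... \<le> b w * (norm (f x) * norm (f (x - z w)))"
   using k by (intro mult_right_mono) (auto simp: admissible_def)
  finally show ?thesis .
 qed
 have Qx[measurable]: "(\<lambda>p. Q p x) \<in> bmeas P" for x
  using measurable_compose[OF measurable_Pair2'[of x lborel P] Q] by simp
 \<comment> \<open>The normalization on the diagonal controls the off-diagonal products through the
   inequality of arithmetic and geometric means.\<close>
 have prod_int: "integrable P (\<lambda>p. norm (Q p x) * norm (Q p y))" "(LINT p|P. norm (Q p x) * norm (Q p y)) \<le> 1" for x y
 proof -
  have le: "norm (Q p x) * norm (Q p y) \<le> ((norm (Q p x))^2 + (norm (Q p y))^2) / 2" for p
   using sum_squares_bound[of "norm (Q p x)" "norm (Q p y)"] by simp
  have i: "integrable P (\<lambda>p. ((norm (Q p x))^2 + (norm (Q p y))^2) / 2)"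
   using one(1) by (intro integrable_divide integrable_add')
  show ii: "integrable P (\<lambda>p. norm (Q p x) * norm (Q p y))"
   by (rule integrable_bound'[OF i]) (use le in \<open>auto intro: order_trans[OF _ abs_ge_self]\<close>)
  have "(LINT p|P. norm (Q p x) * norm (Q p y)) \<le> (LINT p|P. ((norm (Q p x))^2 + (norm (Q p y))^2) / 2)"
   by (rule integral_mono[OF ii i le])
  also have "... = 1" using one by (simp add: integral_add')
  finally show "(LINT p|P. norm (Q p x) * norm (Q p y)) \<le> 1" .
 qed
 define H where "H q p = Re (g (fst q) (snd q) * (Q p (fst q) * cnj (Q p (fst q - z (snd q)))))" for q p
 have Hm: "(\<lambda>(q, p). H q p) \<in> bmeas (?N \<Otimes>\<^sub>M P)"
 proof -
  have [measurable]: "(\<lambda>q. Q (snd q) (fst (fst q))) \<in> bmeas (?N \<Otimes>\<^sub>M P)"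
   by (rule measurable_compose[OF _ Q, of "\<lambda>q. (snd q, fst (fst q))", simplified]) measurable
  have [measurable]: "(\<lambda>q. Q (snd q) (fst (fst q) - z (snd (fst q)))) \<in> bmeas (?N \<Otimes>\<^sub>M P)"
   by (rule measurable_compose[OF _ Q, of "\<lambda>q. (snd q, fst (fst q) - z (snd (fst q)))", simplified]) measurable
  have [measurable]: "(\<lambda>q. g (fst (fst q)) (snd (fst q))) \<in> bmeas (?N \<Otimes>\<^sub>M P)"
   by (rule measurable_compose[OF measurable_fst gm, simplified case_prod_unfold])
  show ?thesis unfolding H_def case_prod_unfold by measurable
 qed
 have Hle: "\<bar>H q p\<bar> \<le> norm (g (fst q) (snd q)) * (norm (Q p (fst q)) * norm (Q p (fst q - z (snd q))))" for q p
  unfolding H_def by (rule order_trans[OF abs_Re_le_cmod]) (simp add: norm_mult)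
 have Hq: "H q \<in> bmeas P" for q
  unfolding H_def[abs_def] by measurable
 have Hintp: "integrable P (H q)" for q
  by (rule integrable_bound'[OF integrable_mult_right[OF prod_int(1)[of "fst q" "fst q - z (snd q)"], of "norm (g (fst q) (snd q))"]])
   (use Hq[of q] Hle in \<open>auto simp: abs_mult\<close>)
 have base: "integrable ?N (\<lambda>q. b (snd q) * (norm (f (fst q)) * norm (f (fst q - z (snd q)))))"
  using form_bound(1)[OF f f b_integrable b_nonneg] by (simp add: case_prod_unfold)
 have Hint: "integrable (?N \<Otimes>\<^sub>M P) (\<lambda>(q, p). H q p)"
 proof (rule NP.Fubini_integrable[OF Hm])
  show "AE q in ?N. integrable P (\<lambda>p. case (q, p) of (q, p) \<Rightarrow> H q p)" using Hintp by simp
  show "integrable ?N (\<lambda>q. \<integral>p. norm (case (q, p) of (q, p) \<Rightarrow> H q p) \<partial>P)"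
  proof (rule integrable_bound'[OF base])
   show "(\<lambda>q. \<integral>p. norm (case (q, p) of (q, p) \<Rightarrow> H q p) \<partial>P) \<in> bmeas ?N"
    by (rule P.borel_measurable_lebesgue_integral) (use Hm in measurable)
   show "AE q in ?N. norm (LINT p|P. norm (case (q, p) of (q, p) \<Rightarrow> H q p))
     \<le> norm (b (snd q) * (norm (f (fst q)) * norm (f (fst q - z (snd q)))))"
   proof (rule AE_I2)
    fix q
    have "(LINT p|P. \<bar>H q p\<bar>) \<le> (LINT p|P. norm (g (fst q) (snd q)) * (norm (Q p (fst q)) * norm (Q p (fst q - z (snd q)))))"
     by (intro integral_mono integrable_abs Hintp integrable_mult_right prod_int Hle)
    also have "... \<le> norm (g (fst q) (snd q)) * 1"
     using prod_int(2) by (simp add: mult_left_le)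
    also have "... \<le> b (snd q) * (norm (f (fst q)) * norm (f (fst q - z (snd q))))" using gle by simp
    finally show "norm (LINT p|P. norm (case (q, p) of (q, p) \<Rightarrow> H q p))
     \<le> norm (b (snd q) * (norm (f (fst q)) * norm (f (fst q - z (snd q)))))"
     by (simp add: abs_mult b_nonneg)
   qed
  qed
 qed
 have inner_g: "u \<bullet> (c * v) = Re (cnj u * (c * v))" for u c v :: complex
  by (simp add: inner_complex_def)
 have HG: "(LINT p|P. H q p) = Re (g (fst q) (snd q) * G (fst q) (fst q - z (snd q)))" for q
 proof -
  have i: "integrable P (\<lambda>p. Q p (fst q) * cnj (Q p (fst q - z (snd q))))"
   by (rule integrable_bound'[OF prod_int(1)[of "fst q" "fst q - z (snd q)"]]) (auto simp: norm_mult)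
  have "(LINT p|P. H q p) = Re (LINT p|P. g (fst q) (snd q) * (Q p (fst q) * cnj (Q p (fst q - z (snd q)))))"
   unfolding H_def using i by (intro integral_Re integrable_mult_right)
  then show ?thesis by (simp add: G_def)
 qed
 \<comment> \<open>Because \<open>(norm (Q p x))^2\<close> integrates to one for every
   \<open>x\<close>, the squared L2 norms of the localized functions \<open>F p\<close> integrate to
   that of \<open>f\<close>. Individually they are finite only for almost every
   \<open>p\<close>.\<close>
 have sqF: "AE p in P. square_integrable (F p)" and intF: "integrable P (\<lambda>p. \<integral>x. (norm (F p x))^2 \<partial>lborel)"
  and intF1: "(LINT p|P. (LBINT x. (norm (F p x))^2)) = (norm (L2_class f))^2"
 proof -
  have m1: "(\<lambda>(x, p). Q p x) \<in> bmeas (lborel \<Otimes>\<^sub>M P)"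
   using measurable_compose[OF measurable_pair_swap' Q] by (simp add: case_prod_unfold)
  have Fm: "(\<lambda>(x, p). (norm (F p x))^2) \<in> bmeas (lborel \<Otimes>\<^sub>M P)"
   unfolding F_def using m1 by measurable
  have e: "(\<lambda>p. (norm (F p x))^2) = (\<lambda>p. (norm (f x))^2 * (norm (Q p x))^2)" for x
   by (simp add: F_def norm_mult power_mult_distrib mult.commute)
  have I: "integrable (lborel \<Otimes>\<^sub>M P) (\<lambda>(x, p). (norm (F p x))^2)"
  proof (rule LP.Fubini_integrable[OF Fm])
   show "integrable lborel (\<lambda>x. \<integral>p. norm (case (x, p) of (x, p) \<Rightarrow> (norm (F p x))^2) \<partial>P)"
    using f by (simp add: e one square_integrable_def)
   show "AE x in lborel. integrable P (\<lambda>p. case (x, p) of (x, p) \<Rightarrow> (norm (F p x))^2)"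
    by (simp add: e one)
  qed
  show "integrable P (\<lambda>p. \<integral>x. (norm (F p x))^2 \<partial>lborel)" by (rule LP.integrable_snd[OF I])
  have "(LINT p|P. (LBINT x. (norm (F p x))^2)) = (LBINT x. (LINT p|P. (norm (F p x))^2))"
   by (rule LP.Fubini_integral[OF I])
  then show "(LINT p|P. (LBINT x. (norm (F p x))^2)) = (norm (L2_class f))^2"
   by (simp add: e one L2_class_norm2[OF f])
  have "AE p in P. integrable lborel (\<lambda>x. (norm (F p x))^2)"
   using LP.AE_integrable_snd[OF I] .
  moreover have "F p \<in> bmeas lborel" if "p \<in> space P" for p
  proof -
   have [measurable]: "(\<lambda>x. Q p x) \<in> bmeas lborel"
    using measurable_compose[OF measurable_Pair1'[OF that] Q] by simp
   show ?thesis unfolding F_def by measurable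
  qed
  ultimately show "AE p in P. square_integrable (F p)"
   by (auto simp: square_integrable_def)
 qed
 have kF: "(LINT q|?N. H q p) = kform k (F p) (F p)" for p
  unfolding kform_def H_def F_def g_def case_prod_unfold inner_g
  by (intro integral_cong' refl arg_cong[where f=Re]) (simp add: mult_ac)
 have "(LINT q|?N. (LINT p|P. H q p)) = (LINT p|P. (LINT q|?N. H q p))"
  by (rule NP.Fubini_integral[OF Hint, symmetric])
 \<comment> \<open>For almost every \<open>p\<close> the inner integral is the original form at
   \<open>F p\<close>, to which the assumed bound applies.\<close>
 also have "... \<le> (LINT p|P. a * (LBINT x. (norm (F p x))^2))"
 proof (rule integral_mono_AE)
  show "integrable P (\<lambda>p. \<integral>q. H q p \<partial>?N)" by (rule NP.integrable_snd[OF Hint])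
  show "integrable P (\<lambda>p. a * (LBINT x. (norm (F p x))^2))" by (rule integrable_mult_right[OF intF])
  show "AE p in P. (LINT q|?N. H q p) \<le> a * (LBINT x. (norm (F p x))^2)"
   using sqF by eventually_elim (use a kF L2_class_norm2 in metis)
 qed
 also have "... = a * (norm (L2_class f))^2" by (simp add: intF1)
 finally have main: "(LINT q|?N. Re (g (fst q) (snd q) * G (fst q) (fst q - z (snd q)))) \<le> a * (norm (L2_class f))^2"
  by (simp add: HG)
 have Gint: "integrable ?N (\<lambda>q. Re (g (fst q) (snd q) * G (fst q) (fst q - z (snd q))))"
  using NP.integrable_fst[OF Hint] by (simp add: HG)
 let ?k = "\<lambda>x w. k x w * exp (\<i> * t x (x - z w))"
 have k': "admissible ?k"
  unfolding admissible_def
 proof (intro conjI allI)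
  have [measurable]: "(\<lambda>q. t (fst q) (fst q - z (snd q))) \<in> bmeas ?N"
   by (rule measurable_compose[OF _ t, of "\<lambda>q. (fst q, fst q - z (snd q))", simplified]) measurable
  have [measurable]: "(\<lambda>q. k (fst q) (snd q)) \<in> bmeas ?N" using km by (simp add: case_prod_unfold)
  show "(\<lambda>(x, w). ?k x w) \<in> bmeas ?N" unfolding case_prod_unfold by measurable
  show "norm (?k x w) \<le> b w" for x w using k by (simp add: admissible_def norm_mult)
 qed
 have kint: "integrable ?N (\<lambda>q. Re (g (fst q) (snd q) * exp (\<i> * t (fst q) (fst q - z (snd q)))))"
  and keq: "kform ?k f f = (LINT q|?N. Re (g (fst q) (snd q) * exp (\<i> * t (fst q) (fst q - z (snd q)))))"
 proof -
  have e: "(\<lambda>(x, w). f x \<bullet> (?k x w * f (x - z w))) = (\<lambda>q. Re (g (fst q) (snd q) * exp (\<i> * t (fst q) (fst q - z (snd q)))))"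
   unfolding g_def case_prod_unfold inner_g by (intro ext arg_cong[where f=Re]) (simp add: mult_ac)
  show "integrable ?N (\<lambda>q. Re (g (fst q) (snd q) * exp (\<i> * t (fst q) (fst q - z (snd q)))))"
   using kform_integrable[OF k' f f] unfolding e .
  show "kform ?k f f = (LINT q|?N. Re (g (fst q) (snd q) * exp (\<i> * t (fst q) (fst q - z (snd q)))))"
   unfolding kform_def e ..
 qed
 let ?c = "\<lambda>w. d * (b w * (norm (z w))^2)"
 have c: "integrable M ?c" "\<And>w. 0 \<le> ?c w" using mom d b_nonneg by (auto intro!: mult_nonneg_nonneg)
 \<comment> \<open>Replacing \<open>G\<close> by the magnetic factor costs
   \<open>d * (norm (z w))^2\<close> pointwise, since the two arguments of \<open>G\<close> differ
   by \<open>z w\<close>; this is where the second moment of \<open>b\<close> enters.\<close>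
 have "kform ?k f f - (LINT q|?N. Re (g (fst q) (snd q) * G (fst q) (fst q - z (snd q))))
  = (LINT q|?N. Re (g (fst q) (snd q) * exp (\<i> * t (fst q) (fst q - z (snd q)))) - Re (g (fst q) (snd q) * G (fst q) (fst q - z (snd q))))"
  unfolding keq by (rule integral_diff'[OF kint Gint, symmetric])
 also have "... \<le> (LINT q|?N. ?c (snd q) * (norm (f (fst q)) * norm (f (fst q - z (snd q)))))"
 proof (rule integral_mono[OF integrable_diff'[OF kint Gint]])
  show "integrable ?N (\<lambda>q. ?c (snd q) * (norm (f (fst q)) * norm (f (fst q - z (snd q)))))"
   using form_bound(1)[OF f f c] by (simp add: case_prod_unfold)
  fix q :: "'a \<times> 'w"
  let ?x = "fst q" and ?w = "snd q"
  have "Re (g ?x ?w * exp (\<i> * t ?x (?x - z ?w))) - Re (g ?x ?w * G ?x (?x - z ?w))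
    = Re (g ?x ?w * (exp (\<i> * t ?x (?x - z ?w)) - G ?x (?x - z ?w)))"
   by (simp add: algebra_simps)
  also have "... \<le> norm (g ?x ?w) * norm (G ?x (?x - z ?w) - exp (\<i> * t ?x (?x - z ?w)))"
   by (metis complex_Re_le_cmod norm_minus_commute norm_mult)
  also have "... \<le> (b ?w * (norm (f ?x) * norm (f (?x - z ?w)))) * (d * (norm (?x - (?x - z ?w)))^2)"
   using G[of ?x "?x - z ?w"] gle b_nonneg by (intro mult_mono) (auto simp: G_def)
  also have "... = ?c ?w * (norm (f ?x) * norm (f (?x - z ?w)))" by simp
  finally show "Re (g ?x ?w * exp (\<i> * t ?x (?x - z ?w))) - Re (g ?x ?w * G ?x (?x - z ?w)) \<le> ?c ?w * (norm (f ?x) * norm (f (?x - z ?w)))" .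
 qed
 also have "... \<le> integral\<^sup>L M ?c * (norm (L2_class f) * norm (L2_class f))"
  using form_bound(2)[OF f f c] by (simp add: case_prod_unfold)
 also have "... = d * (LINT w|M. b w * (norm (z w))^2) * (norm (L2_class f))^2" by (simp add: power2_eq_square)
 finally show ?thesis using main by (simp add: distrib_right)
qed

end

subsection \<open>Localization in phase space\<close>

lemma lborel_scale:
 fixes f :: "'a::euclidean_space \<Rightarrow> 'b::{banach,second_countable_topology}"
 assumes c: "c \<noteq> 0"
 shows integrable_scale: "integrable lborel f \<Longrightarrow> integrable lborel (\<lambda>x. f (c *\<^sub>R x))"
  and integral_scale: "f \<in> bmeas borel \<Longrightarrow> (LBINT x. f x) = \<bar>c\<bar> ^ DIM('a) *\<^sub>R (LBINT x. f (c *\<^sub>R x))"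
proof -
 have l: "lborel = density (distr lborel borel (\<lambda>x::'a. c *\<^sub>R x)) (\<lambda>_. ennreal (\<bar>c\<bar> ^ DIM('a)))"
  using lborel_affine[OF c, of "0::'a"] by simp
 show "integrable lborel (\<lambda>x. f (c *\<^sub>R x))" if f: "integrable lborel f"
 proof -
  have [measurable]: "f \<in> bmeas borel" using f by simp
  have "integrable (density (distr lborel borel (\<lambda>x::'a. c *\<^sub>R x)) (\<lambda>_. ennreal (\<bar>c\<bar> ^ DIM('a)))) f"
   using f l by metis
  then have "integrable lborel (\<lambda>x. (\<bar>c\<bar> ^ DIM('a)) *\<^sub>R f (c *\<^sub>R x))"
   by (subst (asm) integrable_density, simp, simp, simp, subst (asm) integrable_distr_eq, simp, simp)
  from integrable_scaleR_right[OF this, of "inverse (\<bar>c\<bar> ^ DIM('a))"] show ?thesis using c by simp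
 qed
 show "(LBINT x. f x) = \<bar>c\<bar> ^ DIM('a) *\<^sub>R (LBINT x. f (c *\<^sub>R x))"
  if [measurable]: "f \<in> bmeas borel"
  by (subst l, subst integral_density, simp, simp, simp, subst integral_distr, simp, simp, simp)
qed

lemma lborel_reflect:
 fixes f :: "'a::euclidean_space \<Rightarrow> 'b::{banach,second_countable_topology}"
 assumes f: "f \<in> bmeas borel"
 shows "(LBINT x. f (- x)) = (LBINT x. f x)"
 using integral_scale[of "-1" f] f by simp

section \<open>Normalized windows and the overlap of their translates\<close>

definition tent :: "real \<Rightarrow> 'a::euclidean_space \<Rightarrow> real" where
 "tent R x = max 0 (1 - norm x / R)"

definition bump :: "real \<Rightarrow> 'a::euclidean_space \<Rightarrow> real" where
 "bump R x = tent R x / sqrt (LINT y|(lborel :: 'a measure). (tent R y)^2)"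

text \<open>The factors are 4 from the square of the displacement \<open>2 * norm p\<close>, 2 from
  the two balls that carry the difference, and \<open>4 * 2 ^ DIM('a)\<close> from bounding the
  squared norm of the tent below by its values on the ball of half the radius.\<close>

definition bump_const :: "'a::euclidean_space itself \<Rightarrow> real" where
 "bump_const _ = 32 * 2 ^ DIM('a)"

lemma tent_measurable [measurable]: "tent R \<in> bmeas borel"
 unfolding tent_def[abs_def] by measurable

lemma bump_measurable [measurable]: "bump R \<in> bmeas borel"
 unfolding bump_def[abs_def] by measurable

context
 fixes R :: real assumes R: "R > 0"
begin

lemma tent_bounds: "0 \<le> tent R x" "tent R x \<le> 1" "tent R x \<noteq> 0 \<Longrightarrow> norm x < R" "tent R (- x) = tent R x"
 using R by (auto simp: tent_def max_def field_simps split: if_splits)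

lemma tent_lipschitz: "\<bar>tent R x - tent R y\<bar> \<le> norm (x - y) / R"
proof -
 have "\<bar>tent R x - tent R y\<bar> \<le> \<bar>norm x / R - norm y / R\<bar>" unfolding tent_def max_def by auto
 also have "... \<le> norm (x - y) / R"
  using norm_triangle_ineq3[of x y] R by (simp add: diff_divide_distrib[symmetric] abs_divide divide_right_mono)
 finally show ?thesis .
qed

lemma tent2_integrable: "integrable lborel (\<lambda>x::'a::euclidean_space. (tent R x)^2)"
proof (rule integrable_bound')
 show "integrable lborel (indicator (ball 0 R) :: 'a \<Rightarrow> real)"
  using emeasure_lborel_ball_finite[of "0::'a" R] by (intro integrable_real_indicator) auto
 have "(tent R x)^2 \<le> 1" for x :: 'a using tent_bounds[of x] by (simp add: power_le_one)
 then show "AE x in lborel. norm ((tent R (x::'a))^2) \<le> norm (indicator (ball 0 R) x :: real)"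
  using tent_bounds(3) by (intro AE_I2) (auto simp: indicator_def)
qed simp

lemma tent2_integral_ge:
 "unit_ball_vol DIM('a) * R ^ DIM('a) / (4 * 2 ^ DIM('a)) \<le> (LINT x|(lborel::'a::euclidean_space measure). (tent R x)^2)"
proof -
 have "(LINT x|(lborel::'a measure). (1/4) * indicator (ball 0 (R/2)) x) \<le> (LINT x|(lborel::'a measure). (tent R x)^2)"
 proof (rule integral_mono[OF _ tent2_integrable])
  show "integrable lborel (\<lambda>x::'a. (1/4::real) * indicator (ball 0 (R/2)) x)"
   using emeasure_lborel_ball_finite[of "0::'a" "R/2"] by (intro integrable_mult_right integrable_real_indicator) auto
  fix x :: 'a
  have "1/2 \<le> tent R x" if "norm x < R/2" using that R by (auto simp: tent_def max_def field_simps)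
  then have "(1/2)^2 \<le> (tent R x)^2" if "norm x < R/2" using that by (intro power_mono) auto
  then show "(1/4) * indicator (ball 0 (R/2)) x \<le> (tent R x)^2"
   by (auto simp: indicator_def power2_eq_square)
 qed
 moreover have "(LINT x|(lborel::'a measure). (1/4) * indicator (ball 0 (R/2)) x) = unit_ball_vol DIM('a) * R ^ DIM('a) / (4 * 2 ^ DIM('a))"
  using R by (simp add: content_ball power_divide)
 ultimately show ?thesis by simp
qed

lemma tent2_integral_pos: "0 < (LINT x|(lborel::'a::euclidean_space measure). (tent R x)^2)"
 by (rule less_le_trans[OF _ tent2_integral_ge]) (use R in simp)

lemma bump_nonneg: "0 \<le> bump R x"
 by (simp add: bump_def tent_bounds)

lemma bump_support: "bump R x \<noteq> 0 \<Longrightarrow> norm x < R"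
 using tent_bounds(3)[of x] by (simp add: bump_def)

lemma bump_minus [simp]: "bump R (- x) = bump R x"
 by (simp add: bump_def tent_bounds)

lemma bump2_integrable: "integrable lborel (\<lambda>x::'a::euclidean_space. (bump R (x - c))^2)"
 using integrable_translate[of "\<lambda>x::'a. (bump R x)^2" "- c"] tent2_integrable[where 'a='a]
 by (simp add: bump_def power_divide)

lemma bump2_integral: "(LINT x|(lborel::'a::euclidean_space measure). (bump R (x - c))^2) = 1"
 using integral_translate[of "\<lambda>x::'a. (bump R x)^2" "- c"] tent2_integral_pos[where 'a='a]
 by (simp add: bump_def power_divide)

text \<open>The difference lives on two balls of radius \<open>R\<close> and is Lipschitz small
  there; dividing by the normalization cancels the volume of the balls.\<close>

lemma bump_diff2:
 fixes p :: "'a::euclidean_space"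
 shows "integrable lborel (\<lambda>x. (bump R (x - p) - bump R (x + p))^2)"
  and "(LBINT x. (bump R (x - p) - bump R (x + p))^2) \<le> bump_const TYPE('a) * (norm p / R)^2"
proof -
 let ?N = "\<integral>x. (tent R x)^2 \<partial>(lborel::'a measure)"
 let ?I = "\<lambda>x. indicator (ball p R) x + indicator (ball (- p) R) x :: real"
 let ?g = "\<lambda>x. (2 * norm p / R)^2 / ?N * ?I x"
 have N: "?N > 0" by (rule tent2_integral_pos)
 have le: "(bump R (x - p) - bump R (x + p))^2 \<le> ?g x" for x
 proof -
  have e: "(bump R (x - p) - bump R (x + p))^2 = (tent R (x - p) - tent R (x + p))^2 / ?N"
   using N by (simp add: bump_def diff_divide_distrib[symmetric] power_divide)
  have "(tent R (x - p) - tent R (x + p))^2 \<le> (2 * norm p / R)^2 * ?I x"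
  proof (cases "x \<in> ball p R \<or> x \<in> ball (- p) R")
   case True
   have "\<bar>tent R (x - p) - tent R (x + p)\<bar> \<le> 2 * norm p / R"
    using tent_lipschitz[of "x - p" "x + p"] by (simp add: norm_minus_commute flip: scaleR_2)
   then have "(tent R (x - p) - tent R (x + p))^2 \<le> (2 * norm p / R)^2 * 1"
    using R by (simp add: abs_le_square_iff[symmetric])
   also have "... \<le> (2 * norm p / R)^2 * ?I x"
    using True by (intro mult_left_mono) (auto simp: indicator_def)
   finally show ?thesis .
  next
   case False
   then have "tent R (x - p) = 0" "tent R (x + p) = 0"
    using tent_bounds(3)[of "x - p"] tent_bounds(3)[of "x + p"] norm_minus_commute[of x p]
    by (auto simp: dist_norm norm_minus_cancel[of "x + p"] algebra_simps) (metis add.commute minus_add_distrib norm_minus_cancel uminus_add_conv_diff)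
   then show ?thesis by simp
  qed
  then show ?thesis unfolding e using N by (simp add: divide_right_mono)
 qed
 have I: "integrable lborel ?I"
  using emeasure_lborel_ball_finite[of p R] emeasure_lborel_ball_finite[of "- p" R]
  by (intro integrable_add' integrable_real_indicator) auto
 show i: "integrable lborel (\<lambda>x. (bump R (x - p) - bump R (x + p))^2)"
  by (rule integrable_bound'[OF integrable_mult_right[OF I, of "(2 * norm p / R)^2 / ?N"]])
   (use le in \<open>auto intro: order_trans[OF _ abs_ge_self]\<close>)
 have "(LBINT x. (bump R (x - p) - bump R (x + p))^2) \<le> (LBINT x. ?g x)"
  by (rule integral_mono[OF i integrable_mult_right[OF I] le])
 also have "... = (2 * norm p / R)^2 / ?N * (LBINT x. ?I x)" by simp
 also have "(LBINT x. ?I x) = 2 * (unit_ball_vol DIM('a) * R ^ DIM('a))"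
  using emeasure_lborel_ball_finite[of p R] emeasure_lborel_ball_finite[of "- p" R] R
  by (subst integral_add') (auto intro!: integrable_real_indicator simp: content_ball)
 also have "(2 * norm p / R)^2 / ?N * (2 * (unit_ball_vol DIM('a) * R ^ DIM('a)))
  \<le> (2 * norm p / R)^2 / (unit_ball_vol DIM('a) * R ^ DIM('a) / (4 * 2 ^ DIM('a))) * (2 * (unit_ball_vol DIM('a) * R ^ DIM('a)))"
  using R N tent2_integral_ge[where 'a='a]
  by (intro mult_right_mono divide_left_mono mult_pos_pos divide_pos_pos) auto
 also have "... = bump_const TYPE('a) * (norm p / R)^2"
  using R less_imp_neq[OF unit_ball_vol_pos[of "real DIM('a)"]] by (simp add: bump_const_def power_divide power_mult_distrib field_simps)
 finally show "(LBINT x. (bump R (x - p) - bump R (x + p))^2) \<le> bump_const TYPE('a) * (norm p / R)^2" .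
qed

text \<open>The overlap of two unit vectors is one minus half their squared distance. Hence the
  deviation from one is quadratic in the displacement.\<close>

lemma bump_prod:
 fixes p :: "'a::euclidean_space"
 shows "integrable lborel (\<lambda>x. bump R (x - p) * bump R (x + p))"
  and "(LBINT x. bump R (x - p) * bump R (x + p)) \<le> 1"
  and "\<bar>(LBINT x. bump R (x - p) * bump R (x + p)) - 1\<bar> \<le> bump_const TYPE('a) * (norm p / R)^2 / 2"
proof -
 note a = bump2_integrable[of p] and b = bump2_integrable[of "- p", simplified]
 have e: "(\<lambda>x. bump R (x - p) * bump R (x + p)) =
  (\<lambda>x. ((bump R (x - p))^2 + (bump R (x + p))^2 - (bump R (x - p) - bump R (x + p))\<^sup>2) / 2)"
  by (simp add: fun_eq_iff power2_eq_square algebra_simps)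
 show "integrable lborel (\<lambda>x. bump R (x - p) * bump R (x + p))"
  unfolding e using a b bump_diff2(1)[of p] by simp
 have i: "(LBINT x. bump R (x - p) * bump R (x + p)) = 1 - (LBINT x. (bump R (x - p) - bump R (x + p))^2) / 2"
  unfolding e using a b bump_diff2(1)[of p] bump2_integral[of p] bump2_integral[of "- p"] by simp
 moreover have "0 \<le> (LBINT x. (bump R (x - p) - bump R (x + p))^2)" by simp
 ultimately show "(LBINT x. bump R (x - p) * bump R (x + p)) \<le> 1"
  "\<bar>(LBINT x. bump R (x - p) * bump R (x + p)) - 1\<bar> \<le> bump_const TYPE('a) * (norm p / R)^2 / 2"
  using bump_diff2(2)[of p] by linarith+
qed

text \<open>The product of the two windows is even, so the first-order term of the exponential
  integrates to zero. The second-order remainder is at most \<open>R^2 * (norm q)^2 / 2\<close>,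
  because the product is supported in the ball of radius \<open>R\<close> and has integral at most
  one.\<close>

lemma bump_prod_fourier:
 fixes p q :: "'a::euclidean_space"
 shows "integrable lborel (\<lambda>x. cplx (bump R (x - p) * bump R (x + p)) * exp (\<i> * (x \<bullet> q)))"
  and "norm ((LBINT x. cplx (bump R (x - p) * bump R (x + p)) * exp (\<i> * (x \<bullet> q))) - 1)
   \<le> bump_const TYPE('a) * (norm p / R)^2 / 2 + R^2 * (norm q)^2 / 2"
proof -
 define w where "w x = bump R (x - p) * bump R (x + p)" for x
 have w: "integrable lborel w" "w x \<ge> 0" "w (- x) = w x" "(LBINT x. w x) \<le> 1" for x
 proof -
  have "- x - p = - (x + p)" "- x + p = - (x - p)" by simp_all
  then have "bump R (- x - p) = bump R (x + p)" "bump R (- x + p) = bump R (x - p)"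
   using bump_minus by metis+
  then show "w (- x) = w x" by (simp add: w_def)
 qed (use bump_prod[of p] in \<open>auto simp: w_def[abs_def] bump_nonneg\<close>)
 have [measurable]: "w \<in> bmeas borel" using w(1) by simp
 have supp: "norm x \<le> R" if "w x \<noteq> 0" for x
 proof -
  have "norm (x - p) < R" "norm (x + p) < R" using that bump_support[of "x - p"] bump_support[of "x + p"] by (auto simp: w_def)
  moreover have "2 *\<^sub>R x = (x - p) + (x + p)" by (simp add: scaleR_2)
  then have "2 * norm x \<le> norm (x - p) + norm (x + p)"
   using norm_triangle_ineq[of "x - p" "x + p"] by (metis abs_numeral norm_scaleR)
  ultimately show ?thesis by simp
 qed
 have xq: "\<bar>x \<bullet> q\<bar> \<le> R * norm q" if "w x \<noteq> 0" for x
  using Cauchy_Schwarz_ineq2[of x q] mult_right_mono[OF supp[OF that], of "norm q"] by simp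
 show i: "integrable lborel (\<lambda>x. cplx (bump R (x - p) * bump R (x + p)) * exp (\<i> * (x \<bullet> q)))"
  unfolding w_def[symmetric]
  by (rule integrable_bound'[OF w(1)]) (auto simp: norm_mult)
 have lin_i: "integrable lborel (\<lambda>x. w x * (x \<bullet> q))"
 proof (rule integrable_bound'[OF integrable_mult_left[OF w(1), of "R * norm q"]])
  show "AE x in lborel. norm (w x * (x \<bullet> q)) \<le> norm (w x * (R * norm q))"
  proof (rule AE_I2)
   fix x show "norm (w x * (x \<bullet> q)) \<le> norm (w x * (R * norm q))"
    using xq[of x] R by (cases "w x = 0") (auto simp: abs_mult intro!: mult_left_mono)
  qed
 qed measurable
 have lin: "(LBINT x. w x * (x \<bullet> q)) = 0"
 proof -
  have "(LBINT x. w x * (x \<bullet> q)) = (LBINT x. w (- x) * (- x \<bullet> q))"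
   using lborel_reflect[of "\<lambda>x. w x * (x \<bullet> q)"] by simp
  then show ?thesis by (simp add: w)
 qed
 let ?r = "\<lambda>x. exp (\<i> * (x \<bullet> q)) - 1 - \<i> * (x \<bullet> q)"
 have r: "norm (cplx (w x) * ?r x) \<le> w x * (R^2 * (norm q)^2 / 2)" for x
 proof (cases "w x = 0")
  case False
  have "norm (?r x) \<le> \<bar>x \<bullet> q\<bar>^2 / 2"
   using iexp_approx1[of "x \<bullet> q" 1] by (simp add: numeral_2_eq_2 algebra_simps)
  also have "... \<le> (R * norm q)^2 / 2" using xq[OF False] by (intro divide_right_mono power_mono) auto
  finally have "w x * norm (?r x) \<le> w x * ((R * norm q)^2 / 2)" using w(2)[of x] by (rule mult_left_mono)
  then show ?thesis using w(2)[of x] by (simp add: norm_mult power_mult_distrib)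
 qed simp
 have ri: "integrable lborel (\<lambda>x. cplx (w x) * ?r x)"
  by (rule integrable_bound'[OF integrable_mult_left[OF w(1), of "R^2 * (norm q)^2 / 2"]])
   (use r w(2) in \<open>auto intro: order_trans[OF _ abs_ge_self]\<close>)
 have "(LBINT x. cplx (w x) * exp (\<i> * (x \<bullet> q)))
   = (LBINT x. cplx (w x) * ?r x + (cplx (w x) + \<i> * cplx (w x * (x \<bullet> q))))"
  by (intro integral_cong') (auto simp: algebra_simps)
 also have "... = (LBINT x. cplx (w x) * ?r x) + (cplx (LBINT x. w x) + \<i> * cplx (LBINT x. w x * (x \<bullet> q)))"
  using ri w(1) lin_i
  by (subst integral_add', simp, intro integrable_add' integrable_mult_right integrable_of_real, simp, simp)
   (subst integral_add', auto intro!: integrable_mult_right integrable_of_real simp del: of_real_mult)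
 finally have e: "(LBINT x. cplx (w x) * exp (\<i> * (x \<bullet> q))) - 1
   = (LBINT x. cplx (w x) * ?r x) + cplx ((LBINT x. w x) - 1)"
  by (simp add: lin)
 have "norm (LBINT x. cplx (w x) * ?r x) \<le> (LBINT x. w x * (R^2 * (norm q)^2 / 2))"
  by (rule order_trans[OF integral_norm_bound integral_mono])
   (use ri r w(1) in \<open>auto intro!: integrable_mult_left\<close>)
 also have "... = (LBINT x. w x) * (R^2 * (norm q)^2 / 2)" by simp
 also have "... \<le> 1 * (R^2 * (norm q)^2 / 2)" by (intro mult_right_mono w) auto
 finally have 1: "norm (LBINT x. cplx (w x) * ?r x) \<le> R^2 * (norm q)^2 / 2" by simp
 have 2: "norm (cplx ((LBINT x. w x) - 1)) \<le> bump_const TYPE('a) * (norm p / R)^2 / 2"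
  using bump_prod(3)[of p] unfolding norm_of_real w_def[abs_def] .
 show "norm ((LBINT x. cplx (bump R (x - p) * bump R (x + p)) * exp (\<i> * (x \<bullet> q))) - 1)
   \<le> bump_const TYPE('a) * (norm p / R)^2 / 2 + R^2 * (norm q)^2 / 2"
  unfolding w_def[symmetric] e by (rule order_trans[OF norm_triangle_ineq]) (use 1 2 in linarith)
qed

end

lemma norm_exp_i_diff: "norm (exp (\<i> * cplx s) - exp (\<i> * cplx t)) \<le> \<bar>s - t\<bar>"
proof -
 have "norm (exp (\<i> * cplx (s - t)) - 1) \<le> \<bar>s - t\<bar>"
  using iexp_approx1[of "s - t" 0] by simp
 moreover have "exp (\<i> * cplx s) - exp (\<i> * cplx t) = exp (\<i> * cplx t) * (exp (\<i> * cplx (s - t)) - 1)"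
  by (simp add: right_diff_distrib algebra_simps flip: exp_add)
 ultimately show ?thesis by (simp add: norm_mult)
qed

text \<open>If on balls of radius \<open>R\<close> the phase is, up to a gauge transformation, the line integral of a
 vector potential with Lipschitz constant \<open>\<kappa>\<close>, then localization at scale \<open>R\<close> in position and
 \<open>\<surd>\<kappa>\<close> in momentum around the graph of that potential provides the positive definite function
 required by \<open>kform_compare\<close>.\<close>

lemma (in kernel_op) kform_compare_gauge:
 fixes A :: "'a \<Rightarrow> 'a \<Rightarrow> 'a" and L :: "'a \<Rightarrow> 'a \<Rightarrow> real" and t :: "'a \<Rightarrow> 'a \<Rightarrow> real"
 assumes R: "R > 0" and \<kappa>: "\<kappa> > 0" and k: "admissible k"
  and A[measurable]: "(\<lambda>(c, x). A c x) \<in> bmeas (borel \<Otimes>\<^sub>M borel)"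
  and L[measurable]: "(\<lambda>(c, x). L c x) \<in> bmeas (borel \<Otimes>\<^sub>M borel)"
  and t: "(\<lambda>(x, y). t x y) \<in> bmeas (borel \<Otimes>\<^sub>M borel)"
  and lip: "\<And>c x y. norm (x - c) \<le> R \<Longrightarrow> norm (y - c) \<le> R \<Longrightarrow> norm (A c x - A c y) \<le> \<kappa> * norm (x - y)"
  and gauge: "\<And>c x y. norm (x - c) \<le> R \<Longrightarrow> norm (y - c) \<le> R \<Longrightarrow>
   \<bar>t x y - (L c x - L c y) - (1/2) * ((A c x + A c y) \<bullet> (x - y))\<bar> \<le> \<kappa> * (norm (x - y))^2"
  and mom: "integrable M (\<lambda>w. b w * (norm (z w))^2)"
  and u: "\<And>f. square_integrable f \<Longrightarrow> kform k f f \<le> u * (norm (L2_class f))^2"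
  and f: "square_integrable f"
 shows "kform (\<lambda>x w. k x w * exp (\<i> * t x (x - z w))) f f
   \<le> (u + (bump_const TYPE('a) + 2) * (\<kappa> + 1 / R^2) * (LINT w|M. b w * (norm (z w))^2)) * (norm (L2_class f))^2"
proof -
 let ?K = "bump_const TYPE('a)"
 have K: "?K > 0" by (simp add: bump_const_def)
 define S where "S = sqrt \<kappa>"
 have S: "S > 0" "S^2 = \<kappa>" using \<kappa> by (auto simp: S_def)
 let ?P = "lborel \<Otimes>\<^sub>M (lborel :: 'a measure) :: ('a \<times> 'a) measure"
 have Ac[measurable]: "A c \<in> bmeas borel" for c
  using measurable_compose[OF measurable_Pair1'[of c borel borel] A] by simp
 have Ax[measurable]: "(\<lambda>c. A c x) \<in> bmeas borel" for x
  using measurable_compose[OF measurable_Pair2'[of x borel borel] A] by simp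
 have Lx[measurable]: "(\<lambda>c. L c x) \<in> bmeas borel" for x
  using measurable_compose[OF measurable_Pair2'[of x borel borel] L] by simp
 \<comment> \<open>A family of coherent states: \<open>fst p\<close> is the centre in position,
   \<open>snd p\<close> a momentum. The momentum window is centred at the potential
   \<open>A (fst p) x\<close>, and the phase carries the gauge function.\<close>
 define Q where "Q p x = cplx (bump R (x - fst p) * bump S (snd p - A (fst p) x))
   * exp (\<i> * cplx (L (fst p) x + snd p \<bullet> x))" for p :: "'a \<times> 'a" and x
 have n\<Psi>: "(norm (Q p x))^2 = (bump R (x - fst p))^2 * (bump S (snd p - A (fst p) x))^2" for p x
  by (simp add: Q_def norm_mult power_mult_distrib)
 have Qm: "(\<lambda>(p, x). Q p x) \<in> bmeas (?P \<Otimes>\<^sub>M lborel)"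
 proof -
  have [measurable]: "(\<lambda>q. A (fst (fst q)) (snd q)) \<in> bmeas (?P \<Otimes>\<^sub>M lborel)"
   by (rule measurable_compose[OF _ A, of "\<lambda>q. (fst (fst q), snd q)", simplified]) measurable
  have [measurable]: "(\<lambda>q. L (fst (fst q)) (snd q)) \<in> bmeas (?P \<Otimes>\<^sub>M lborel)"
   by (rule measurable_compose[OF _ L, of "\<lambda>q. (fst (fst q), snd q)", simplified]) measurable
  show ?thesis unfolding Q_def case_prod_unfold by measurable
 qed
 have bump_c: "(\<lambda>c. (bump R (x - c))^2) = (\<lambda>c. (bump R (c - x))^2)" for x :: 'a
  by (rule ext) (metis R bump_minus minus_diff_eq)
 have pairm: "(\<lambda>(c, a). (bump R (x - c))^2 * (bump S (a - A c x))^2) \<in> bmeas ?P" for x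
  by measurable
 have I1: "integrable ?P (\<lambda>(c, a). (bump R (x - c))^2 * (bump S (a - A c x))^2)" for x
  by (rule lborel_pair.Fubini_integrable[OF pairm])
   (simp_all add: bump_c bump2_integrable[OF S(1)] bump2_integral[OF S(1)] bump2_integrable[OF R])
 have one: "integrable ?P (\<lambda>p. (norm (Q p x))^2)" "(LINT p|?P. (norm (Q p x))^2) = 1" for x
 proof -
  show i: "integrable ?P (\<lambda>p. (norm (Q p x))^2)" using I1[of x] by (simp add: n\<Psi> case_prod_unfold)
  have "(LINT p|?P. (norm (Q p x))^2) = (LBINT c. \<integral>a. (bump R (x - c))^2 * (bump S (a - A c x))^2 \<partial>lborel)"
   using lborel_pair.integral_fst'[OF i] by (simp add: n\<Psi>)
  also have "... = 1" by (simp add: bump2_integral[OF S(1)] bump2_integral[OF R] bump_c)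
  finally show "(LINT p|?P. (norm (Q p x))^2) = 1" .
 qed
 have G: "norm ((LINT p|?P. Q p x * cnj (Q p y)) - exp (\<i> * t x y)) \<le> ((?K + 2) * (\<kappa> + 1 / R^2)) * (norm (x - y))^2" for x y
 proof -
  define v where "v = x - y"
  \<comment> \<open>Shifting the momentum by the midpoint \<open>m c\<close> extracts the midpoint
    rule for the line integral as a phase and leaves two windows displaced symmetrically by the
    half-difference \<open>p c\<close>.\<close>
  define m where "m c = (1/2) *\<^sub>R (A c x + A c y)" for c
  define p where "p c = (1/2) *\<^sub>R (A c x - A c y)" for c
  define J where "J c = (LBINT a. cplx (bump S (a - p c) * bump S (a + p c)) * exp (\<i> * (a \<bullet> v)))" for c
  define E where "E c = exp (\<i> * cplx (L c x - L c y + m c \<bullet> v)) * J c" for c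
  define W where "W c = bump R (x - c) * bump R (y - c)" for c
  have split: "Q (c, a) x * cnj (Q (c, a) y) = cplx (W c) * exp (\<i> * cplx (L c x - L c y))
   * (cplx (bump S (a - A c x) * bump S (a - A c y)) * exp (\<i> * (a \<bullet> v)))" for c a
  proof -
   have "exp (\<i> * cplx (L c x + a \<bullet> x)) * cnj (exp (\<i> * cplx (L c y + a \<bullet> y)))
    = exp (\<i> * cplx (L c x - L c y)) * exp (\<i> * (a \<bullet> v))"
    by (simp add: exp_cnj v_def inner_diff_right algebra_simps flip: exp_add)
   then show ?thesis unfolding Q_def W_def by (simp add: mult_ac)
  qed
  have inner: "(LBINT a. Q (c, a) x * cnj (Q (c, a) y)) = cplx (W c) * E c" for c
  proof -
   have "(LBINT a. cplx (bump S (a - A c x) * bump S (a - A c y)) * exp (\<i> * (a \<bullet> v)))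
    = (LBINT a. cplx (bump S ((a + m c) - A c x) * bump S ((a + m c) - A c y)) * exp (\<i> * ((a + m c) \<bullet> v)))"
    by (rule integral_translate[symmetric])
   also have "... = (LBINT a. exp (\<i> * (m c \<bullet> v)) * (cplx (bump S (a - p c) * bump S (a + p c)) * exp (\<i> * (a \<bullet> v))))"
   proof (rule integral_cong'[OF refl])
    fix a
    have eqs: "(a + m c) - A c x = a - p c" "(a + m c) - A c y = a + p c"
     unfolding m_def p_def by (rule euclidean_eqI, simp add: inner_diff_left inner_add_left field_simps)+
    show "cplx (bump S ((a + m c) - A c x) * bump S ((a + m c) - A c y)) * exp (\<i> * ((a + m c) \<bullet> v))
     = exp (\<i> * (m c \<bullet> v)) * (cplx (bump S (a - p c) * bump S (a + p c)) * exp (\<i> * (a \<bullet> v)))"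
     unfolding eqs by (simp add: inner_add_left distrib_left exp_add mult_ac)
   qed
   also have "... = exp (\<i> * (m c \<bullet> v)) * J c" unfolding J_def by simp
   finally have J: "(LBINT a. cplx (bump S (a - A c x) * bump S (a - A c y)) * exp (\<i> * (a \<bullet> v))) = exp (\<i> * (m c \<bullet> v)) * J c" .
   show ?thesis
    unfolding split integral_mult_right_zero J E_def by (simp add: distrib_left exp_add mult_ac)
  qed
  have pint: "integrable ?P (\<lambda>p. Q p x * cnj (Q p y))"
  proof (rule integrable_bound'[where f="\<lambda>p. (norm (Q p x))^2 + (norm (Q p y))^2"])
   show "integrable ?P (\<lambda>p. (norm (Q p x))^2 + (norm (Q p y))^2)" using one by simp
   have [measurable]: "(\<lambda>p. Q p x) \<in> bmeas ?P" for x
    using measurable_compose[OF measurable_Pair2'[of x lborel ?P] Qm] by simp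
   show "(\<lambda>p. Q p x * cnj (Q p y)) \<in> bmeas ?P" by measurable
   have "norm (Q p x) * norm (Q p y) \<le> (norm (Q p x))^2 + (norm (Q p y))^2" for p
    using sum_squares_bound[of "norm (Q p x)" "norm (Q p y)"] mult_nonneg_nonneg[OF norm_ge_zero[of "Q p x"] norm_ge_zero[of "Q p y"]] by linarith
   then show "AE p in ?P. norm (Q p x * cnj (Q p y)) \<le> norm ((norm (Q p x))^2 + (norm (Q p y))^2)"
    by (intro AE_I2) (simp add: norm_mult)
  qed
  have Geq: "(LINT p|?P. Q p x * cnj (Q p y)) = (LBINT c. cplx (W c) * E c)"
   using lborel_pair.integral_fst'[OF pint] by (simp add: inner)
  have WEi: "integrable lborel (\<lambda>c. cplx (W c) * E c)"
   using lborel_pair.integrable_fst'[OF pint] by (simp add: inner)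
  \<comment> \<open>Centring the base point at the midpoint of \<open>x\<close> and \<open>y\<close>
    brings the position overlap into the symmetric form with displacement
    \<open>v / 2\<close>.\<close>
  have Wsh: "W (c + (1/2) *\<^sub>R (x + y)) = bump R (c - (1/2) *\<^sub>R v) * bump R (c + (1/2) *\<^sub>R v)" for c
  proof -
   have "x - (c + (1/2) *\<^sub>R (x + y)) = - (c - (1/2) *\<^sub>R v)" "y - (c + (1/2) *\<^sub>R (x + y)) = - (c + (1/2) *\<^sub>R v)"
    unfolding v_def by (rule euclidean_eqI, simp add: inner_diff_left inner_add_left field_simps)+
   then show ?thesis unfolding W_def using bump_minus[OF R] by metis
  qed
  have Wi: "integrable lborel W"
   using bump_prod(1)[OF R, of "(1/2) *\<^sub>R v"] integrable_translate[of W "(1/2) *\<^sub>R (x + y)"] by (simp add: Wsh)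
  have W1: "(LBINT c. W c) \<le> 1" "\<bar>(LBINT c. W c) - 1\<bar> \<le> ?K * (norm v)^2 / R^2"
  proof -
   have e: "(LBINT c. W c) = (LBINT c. bump R (c - (1/2) *\<^sub>R v) * bump R (c + (1/2) *\<^sub>R v))"
    using integral_translate[of W "(1/2) *\<^sub>R (x + y)"] by (simp add: Wsh)
   show "(LBINT c. W c) \<le> 1" unfolding e by (rule bump_prod(2)[OF R])
   have "?K * (norm ((1/2) *\<^sub>R v) / R)^2 / 2 \<le> ?K * (norm v)^2 / R^2"
    using K R by (auto simp: power_divide power_mult_distrib intro!: divide_left_mono mult_pos_pos)
   then show "\<bar>(LBINT c. W c) - 1\<bar> \<le> ?K * (norm v)^2 / R^2"
    unfolding e using bump_prod(3)[OF R, of "(1/2) *\<^sub>R v"] by linarith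
  qed
  have W0: "W c \<ge> 0" for c by (simp add: W_def bump_nonneg[OF R])
  \<comment> \<open>A nonzero weight \<open>W c\<close> forces both points into the ball of radius
    \<open>R\<close> about \<open>c\<close>, the only place where \<open>lip\<close> and
    \<open>gauge\<close> are assumed.\<close>
  have Ebound: "W c * norm (E c - exp (\<i> * t x y)) \<le> W c * ((?K + 2) * \<kappa> * (norm v)^2)" for c
  proof (cases "W c = 0")
   case False
   then have xc: "norm (x - c) \<le> R" "norm (y - c) \<le> R"
    using bump_support[OF R, of "x - c"] bump_support[OF R, of "y - c"] by (auto simp: W_def)
   have "norm (p c) \<le> \<kappa> * norm v / 2" using lip[OF xc] by (simp add: p_def v_def)
   then have "(norm (p c))^2 \<le> (\<kappa> * norm v / 2)^2" by (rule power_mono) simp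
   \<comment> \<open>This explains the momentum width: with \<open>S^2 = \<kappa>\<close> the
     displacement of the centres costs \<open>(\<kappa> * norm v)^2 / \<kappa>\<close> and the
     spread costs \<open>\<kappa> * (norm v)^2\<close>, both linear in
     \<open>\<kappa>\<close>.\<close>
   then have "(norm (p c))^2 / \<kappa> \<le> (\<kappa> * norm v / 2)^2 / \<kappa>"
    by (rule divide_right_mono) (use \<kappa> in simp)
   then have "(norm (p c) / S)^2 \<le> (\<kappa> * norm v / 2)^2 / \<kappa>"
    by (simp only: power_divide S(2))
   also have "... = \<kappa> * (norm v)^2 / 4" using \<kappa> by (simp add: power2_eq_square field_simps)
   finally have pS: "(norm (p c) / S)^2 \<le> \<kappa> * (norm v)^2 / 4" .
   have "norm (J c - 1) \<le> ?K * (norm (p c) / S)^2 / 2 + S^2 * (norm v)^2 / 2"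
    unfolding J_def by (rule bump_prod_fourier(2)[OF S(1)])
   also have "... \<le> ?K * (\<kappa> * (norm v)^2 / 4) / 2 + \<kappa> * (norm v)^2 / 2"
    using pS K S by (intro add_mono divide_right_mono mult_left_mono) auto
   finally have 1: "norm (J c - 1) \<le> ?K * (\<kappa> * (norm v)^2 / 4) / 2 + \<kappa> * (norm v)^2 / 2" .
   have 2: "norm (exp (\<i> * cplx (L c x - L c y + m c \<bullet> v)) - exp (\<i> * t x y)) \<le> \<kappa> * (norm v)^2"
   proof -
    have "\<bar>(L c x - L c y + m c \<bullet> v) - t x y\<bar> \<le> \<kappa> * (norm v)^2"
     using gauge[OF xc] by (simp add: m_def v_def abs_minus_commute algebra_simps)
    then show ?thesis using norm_exp_i_diff[of "L c x - L c y + m c \<bullet> v" "t x y"] by linarith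
   qed
   have Eeq: "E c - exp (\<i> * t x y) = exp (\<i> * cplx (L c x - L c y + m c \<bullet> v)) * (J c - 1)
     + (exp (\<i> * cplx (L c x - L c y + m c \<bullet> v)) - exp (\<i> * t x y))"
    by (simp add: E_def algebra_simps)
   have "norm (E c - exp (\<i> * t x y)) \<le> norm (J c - 1) + \<kappa> * (norm v)^2"
    unfolding Eeq using 2 norm_triangle_ineq[of "exp (\<i> * cplx (L c x - L c y + m c \<bullet> v)) * (J c - 1)"
     "exp (\<i> * cplx (L c x - L c y + m c \<bullet> v)) - exp (\<i> * t x y)"]
    unfolding norm_mult norm_exp_i_times by linarith
   also have "... \<le> ?K * (\<kappa> * (norm v)^2 / 4) / 2 + \<kappa> * (norm v)^2 / 2 + \<kappa> * (norm v)^2" using 1 by linarith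
   also have "... = (?K / 8 + 3 / 2) * (\<kappa> * (norm v)^2)" by (simp add: algebra_simps)
   also have "... \<le> (?K + 2) * (\<kappa> * (norm v)^2)" using K \<kappa> by (intro mult_right_mono) auto
   finally show ?thesis using W0 by (intro mult_left_mono) (auto simp: mult.assoc)
  qed simp
  have dec: "(LBINT c. cplx (W c) * E c) - exp (\<i> * t x y)
   = (LBINT c. cplx (W c) * (E c - exp (\<i> * t x y))) + cplx ((LBINT c. W c) - 1) * exp (\<i> * t x y)"
  proof -
   have "(LBINT c. cplx (W c) * (E c - exp (\<i> * t x y)))
    = (LBINT c. cplx (W c) * E c - cplx (W c) * exp (\<i> * t x y))"
    by (simp add: right_diff_distrib)
   also have "... = (LBINT c. cplx (W c) * E c) - cplx (LBINT c. W c) * exp (\<i> * t x y)"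
    using WEi Wi by (subst integral_diff') (auto intro!: integrable_mult_left integrable_of_real)
   finally show ?thesis by (simp add: algebra_simps)
  qed
  have b1: "norm (LBINT c. cplx (W c) * (E c - exp (\<i> * t x y))) \<le> (?K + 2) * \<kappa> * (norm v)^2"
  proof -
   have i: "integrable lborel (\<lambda>c. cplx (W c) * (E c - exp (\<i> * t x y)))"
    unfolding right_diff_distrib using WEi Wi by (intro integrable_diff' integrable_mult_left integrable_of_real)
   have "norm (LBINT c. cplx (W c) * (E c - exp (\<i> * t x y))) \<le> (LBINT c. norm (cplx (W c) * (E c - exp (\<i> * t x y))))"
    by (rule integral_norm_bound)
   also have "... \<le> (LBINT c. W c * ((?K + 2) * \<kappa> * (norm v)^2))"
    by (rule integral_mono[OF integrable_norm[OF i] integrable_mult_left[OF Wi]])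
     (use Ebound W0 in \<open>simp add: norm_mult\<close>)
   also have "... = (LBINT c. W c) * ((?K + 2) * \<kappa> * (norm v)^2)" by simp
   also have "... \<le> 1 * ((?K + 2) * \<kappa> * (norm v)^2)" using K \<kappa> by (intro mult_right_mono W1) auto
   finally show ?thesis by simp
  qed
  have b2: "norm (cplx ((LBINT c. W c) - 1) * exp (\<i> * t x y)) \<le> ?K * (norm v)^2 / R^2"
   using W1(2) by (simp add: norm_mult del: of_real_diff)
  have "norm ((LBINT c. cplx (W c) * E c) - exp (\<i> * t x y))
    \<le> (?K + 2) * \<kappa> * (norm v)^2 + ?K * (norm v)^2 / R^2"
   unfolding dec by (rule order_trans[OF norm_triangle_ineq add_mono[OF b1 b2]])
  also have "... \<le> (?K + 2) * \<kappa> * (norm v)^2 + (?K + 2) * (norm v)^2 / R^2"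
   by (intro add_left_mono divide_right_mono mult_right_mono) auto
  also have "... = ((?K + 2) * (\<kappa> + 1 / R^2)) * (norm (x - y))^2" by (simp add: v_def algebra_simps)
  finally show ?thesis unfolding Geq .
 qed
 have "sigma_finite_measure ?P" by unfold_locales
 from kform_compare[OF this k Qm one t G _ mom u f] show ?thesis
  using K \<kappa> R by (simp add: add_nonneg_nonneg)
qed

subsection \<open>Averaged transverse gauges\<close>

text \<open>The one-form \<open>v \<mapsto> B(w, v)\<close> at the point \<open>q\<close>.\<close>

definition field_form :: "('n \<Rightarrow> 'n \<Rightarrow> real ^ 'n \<Rightarrow> real) \<Rightarrow> real ^ 'n \<Rightarrow> real ^ 'n \<Rightarrow> real ^ ('n::finite)" where
 "field_form B w q = (\<Sum>j\<in>UNIV. \<Sum>k\<in>UNIV. ((w \<bullet> axis j 1) * B j k q) *\<^sub>R axis k 1)"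

lemma field_form_inner: "field_form B w q \<bullet> v = (\<Sum>j\<in>UNIV. \<Sum>k\<in>UNIV. w $ j * v $ k * B j k q)"
 by (simp add: field_form_def inner_sum_left inner_axis inner_axis' mult_ac)

lemma field_form_diff: "field_form B (w - w') q = field_form B w q - field_form B w' q"
 by (simp add: field_form_def inner_diff_left left_diff_distrib scaleR_diff_left sum_subtractf)

lemma field_form_add: "field_form B (w + w') q = field_form B w q + field_form B w' q"
 by (simp add: field_form_def inner_add_left distrib_right scaleR_add_left sum.distrib)

lemma norm_sum_axis_le:
 fixes w :: "real ^ 'n" and c :: "'n \<Rightarrow> 'n \<Rightarrow> real"
 assumes c: "\<And>j k. \<bar>c j k\<bar> \<le> m"
 shows "norm (\<Sum>j\<in>UNIV. \<Sum>k\<in>UNIV. ((w \<bullet> axis j 1) * c j k) *\<^sub>R (axis k 1 :: real ^ 'n)) \<le> (real CARD('n))^2 * m * norm w"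
proof -
 have "norm (\<Sum>j\<in>UNIV. \<Sum>k\<in>UNIV. ((w \<bullet> axis j 1) * c j k) *\<^sub>R (axis k 1 :: real ^ 'n))
  \<le> (\<Sum>j\<in>(UNIV::'n set). \<Sum>k\<in>(UNIV::'n set). m * norm w)"
 proof (intro order_trans[OF norm_sum] sum_mono)
  fix j k :: 'n
  have "\<bar>w \<bullet> axis j 1\<bar> \<le> norm w" using Cauchy_Schwarz_ineq2[of w "axis j 1"] by simp
  then have "\<bar>w \<bullet> axis j 1\<bar> * \<bar>c j k\<bar> \<le> norm w * m" using c by (intro mult_mono) auto
  then show "norm (((w \<bullet> axis j 1) * c j k) *\<^sub>R (axis k 1 :: real ^ 'n)) \<le> m * norm w"
   by (simp add: abs_mult mult.commute)
 qed
 then show ?thesis by (simp add: power2_eq_square mult_ac)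
qed

lemma norm_field_form_le:
 fixes B :: "'n \<Rightarrow> 'n \<Rightarrow> real ^ 'n \<Rightarrow> real"
 assumes "\<And>j k q. \<bar>B j k q\<bar> \<le> m"
 shows "norm (field_form B w q) \<le> (real CARD('n))^2 * m * norm w"
 unfolding field_form_def by (rule norm_sum_axis_le) (rule assms)

lemma field_form_lipschitz:
 fixes B :: "'n \<Rightarrow> 'n \<Rightarrow> real ^ 'n \<Rightarrow> real"
 assumes "\<And>j k. \<bar>B j k q - B j k q'\<bar> \<le> m"
 shows "norm (field_form B w q - field_form B w q') \<le> (real CARD('n))^2 * m * norm w"
proof -
 have e: "field_form B w q - field_form B w q' = (\<Sum>j\<in>UNIV. \<Sum>k\<in>UNIV. ((w \<bullet> axis j 1) * (B j k q - B j k q')) *\<^sub>R axis k 1)"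
  by (simp add: field_form_def right_diff_distrib scaleR_diff_left sum_subtractf)
 show ?thesis unfolding e by (rule norm_sum_axis_le) (rule assms)
qed

lemma continuous_field_form:
 assumes "\<And>j k. continuous_on UNIV (B j k)" "continuous_on S f" "continuous_on S g"
 shows "continuous_on S (\<lambda>p. field_form B (f p) (g p))"
 unfolding field_form_def
 by (intro continuous_intros assms continuous_on_compose2[OF assms(1)]) auto

text \<open>Stokes' theorem on the triangle with vertices \<open>u\<close>, \<open>x\<close>, \<open>y\<close>.\<close>

lemma phase_triangle:
 fixes A :: "real ^ 'n \<Rightarrow> real ^ 'n"
 assumes A: "smooth A"
 shows "phase A u x - phase A u y + phase A x y =
  - integral {0..1} (\<lambda>r. integral {0..1} (\<lambda>t. t * (field_form (dform A) (x + r *\<^sub>R (y - x) - u) (u + t *\<^sub>R (x + r *\<^sub>R (y - x) - u)) \<bullet> (y - x))))"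
proof -
 define v where "v = y - x"
 define p where "p r = x + r *\<^sub>R v" for r
 define g where "g r t = u + t *\<^sub>R (p r - u)" for r t
 let ?D = "\<lambda>w. frechet_derivative A (at w)"
 have hd: "(A has_derivative ?D w) (at w)" for w by (rule smooth_has_frechet[OF A])
 have l: "linear (?D w)" for w
  using smooth_differentiable[OF A] by (rule linear_frechet_derivative)
 have Ac: "continuous_on S (\<lambda>q. A (h q))" if "continuous_on S h" for S and h :: "'c::t2_space \<Rightarrow> real ^ 'n"
  using that by (intro continuous_on_compose2[OF smooth_continuous[OF A, of UNIV]]) auto
 have Dc: "continuous_on S (\<lambda>q. ?D (h q) (k q))" if h: "continuous_on S h" and k: "continuous_on S k"
  for S and h k :: "'c::t2_space \<Rightarrow> real ^ 'n"
 proof -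
  have e: "?D (h q) (k q) = (\<Sum>b\<in>Basis. (k q \<bullet> b) *\<^sub>R ?D (h q) b)" for q
   using frechet_derivative_basis_sum[OF A, of "h q" "k q"] by (simp add: pdiff_def)
  show ?thesis unfolding e
   by (intro continuous_intros k continuous_on_compose2[OF smooth_continuous_pdiff[OF A] h]) auto
 qed
 have pc: "continuous_on S (\<lambda>q. p (a q))"
  if "continuous_on S a" for S and a :: "'c::t2_space \<Rightarrow> real"
  unfolding p_def by (intro continuous_intros that)
 have gc: "continuous_on S (\<lambda>q. g (a q) (b q))"
  if "continuous_on S a" "continuous_on S b" for S and a b :: "'c::t2_space \<Rightarrow> real"
  unfolding g_def by (intro continuous_intros pc that)
 \<comment> \<open>\<open>I1\<close> integrates an \<open>r\<close>-derivative and \<open>I2\<close>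
   a \<open>t\<close>-derivative. Both integrands contain \<open>A (g r t) \<bullet> v\<close>; it
   cancels in their difference, which leaves the antisymmetric part of the derivative of
   \<open>A\<close>, that is, the field.\<close>
 have I1: "integral {0..1} (\<lambda>r. ?D (g r t) (t *\<^sub>R v) \<bullet> (p r - u) + A (g r t) \<bullet> v)
   = A (u + t *\<^sub>R (y - u)) \<bullet> (y - u) - A (u + t *\<^sub>R (x - u)) \<bullet> (x - u)" for t
 proof (rule integral_unique)
  have "((\<lambda>r. A (g r t) \<bullet> (p r - u)) has_vector_derivative
    (?D (g r t) (t *\<^sub>R v) \<bullet> (p r - u) + A (g r t) \<bullet> v)) (at r within {0..1})" for r
  proof -
   have "((\<lambda>r. A (g r t)) has_derivative (\<lambda>h. ?D (g r t) (h *\<^sub>R (t *\<^sub>R v)))) (at r within {0..1})"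
    by (rule has_derivative_compose[where f="\<lambda>r. g r t" and g=A, OF _ hd])
     (auto simp: g_def p_def intro!: derivative_eq_intros)
   moreover have "((\<lambda>r. p r - u) has_derivative (\<lambda>h. h *\<^sub>R v)) (at r within {0..1})"
    by (auto simp: p_def intro!: derivative_eq_intros)
   ultimately have "((\<lambda>r. A (g r t) \<bullet> (p r - u)) has_derivative
     (\<lambda>h. A (g r t) \<bullet> (h *\<^sub>R v) + ?D (g r t) (h *\<^sub>R (t *\<^sub>R v)) \<bullet> (p r - u))) (at r within {0..1})"
    by (rule has_derivative_inner)
   then show ?thesis
    by (simp add: has_vector_derivative_def linear_scale[OF l] algebra_simps)
  qed
  from fundamental_theorem_of_calculus[OF _ this]
  have "((\<lambda>r. ?D (g r t) (t *\<^sub>R v) \<bullet> (p r - u) + A (g r t) \<bullet> v) has_integral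
   A (g 1 t) \<bullet> (p 1 - u) - A (g 0 t) \<bullet> (p 0 - u)) {0..1}" by simp
  then show "((\<lambda>r. ?D (g r t) (t *\<^sub>R v) \<bullet> (p r - u) + A (g r t) \<bullet> v) has_integral
   A (u + t *\<^sub>R (y - u)) \<bullet> (y - u) - A (u + t *\<^sub>R (x - u)) \<bullet> (x - u)) {0..1}"
   by (simp add: g_def p_def v_def)
 qed
 have I2: "integral {0..1} (\<lambda>t. A (g r t) \<bullet> v + t * (?D (g r t) (p r - u) \<bullet> v)) = A (p r) \<bullet> v" for r
 proof (rule integral_unique)
  have "((\<lambda>t. t * (A (g r t) \<bullet> v)) has_vector_derivative
    (A (g r t) \<bullet> v + t * (?D (g r t) (p r - u) \<bullet> v))) (at t within {0..1})" for t
  proof -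
   have "((\<lambda>t. A (g r t)) has_derivative (\<lambda>h. ?D (g r t) (h *\<^sub>R (p r - u)))) (at t within {0..1})"
    by (rule has_derivative_compose[where f="\<lambda>t. g r t" and g=A, OF _ hd])
     (auto simp: g_def p_def intro!: derivative_eq_intros)
   then have "((\<lambda>t. t * (A (g r t) \<bullet> v)) has_derivative
     (\<lambda>h. t * (?D (g r t) (h *\<^sub>R (p r - u)) \<bullet> v) + h * (A (g r t) \<bullet> v))) (at t within {0..1})"
    by (auto intro!: derivative_eq_intros)
   then show ?thesis
    unfolding linear_scale[OF l] has_vector_derivative_def
    by (rule has_derivative_eq_rhs) (auto simp: fun_eq_iff distrib_left)
  qed
  from fundamental_theorem_of_calculus[OF _ this]
  show "((\<lambda>t. A (g r t) \<bullet> v + t * (?D (g r t) (p r - u) \<bullet> v)) has_integral A (p r) \<bullet> v) {0..1}"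
   by (simp add: g_def)
 qed
 let ?F1 = "\<lambda>r t. ?D (g r t) (t *\<^sub>R v) \<bullet> (p r - u) + A (g r t) \<bullet> v"
 let ?F2 = "\<lambda>r t. A (g r t) \<bullet> v + t * (?D (g r t) (p r - u) \<bullet> v)"
 have c1: "continuous_on S (\<lambda>q. ?F1 (a q) (b q))" and c2: "continuous_on S (\<lambda>q. ?F2 (a q) (b q))"
  if "continuous_on S a" "continuous_on S b" for S and a b :: "'c::t2_space \<Rightarrow> real"
  by (intro continuous_intros Ac Dc gc pc that)+
 have line: "phase A u z = - integral {0..1} (\<lambda>t. A (u + t *\<^sub>R (z - u)) \<bullet> (z - u))" for z by (simp add: phase_def)
 have ci: "continuous_on {0..1} (\<lambda>t. A (u + t *\<^sub>R (z - u)) \<bullet> (z - u))" for z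
  by (intro continuous_intros Ac)
 have "phase A u x - phase A u y = integral {0..1} (\<lambda>t. A (u + t *\<^sub>R (y - u)) \<bullet> (y - u) - A (u + t *\<^sub>R (x - u)) \<bullet> (x - u))"
  unfolding line by (subst integral_diff) (auto intro!: integrable_continuous_real ci)
 also have "... = integral {0..1} (\<lambda>t. integral {0..1} (\<lambda>r. ?F1 r t))"
  by (simp add: I1)
 also have "... = integral {0..1} (\<lambda>r. integral {0..1} (\<lambda>t. ?F1 r t))"
  unfolding box_real[symmetric]
  by (rule integral_swap_continuous) (simp only: case_prod_unfold, rule c1, auto intro!: continuous_intros)
 finally have e1: "phase A u x - phase A u y = integral {0..1} (\<lambda>r. integral {0..1} (\<lambda>t. ?F1 r t))" .
 have e2: "phase A x y = - integral {0..1} (\<lambda>r. integral {0..1} (\<lambda>t. ?F2 r t))"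
  unfolding I2 by (simp add: phase_def p_def v_def)
 have ip: "continuous_on {0..1} (\<lambda>r. integral {0..1} (\<lambda>t. ?F1 r t))" "continuous_on {0..1} (\<lambda>r. integral {0..1} (\<lambda>t. ?F2 r t))"
  unfolding box_real[symmetric]
  by (rule integral_continuous_on_param, simp only: case_prod_unfold, intro c1 c2 continuous_intros)+
 have "phase A u x - phase A u y + phase A x y
   = integral {0..1} (\<lambda>r. integral {0..1} (\<lambda>t. ?F1 r t) - integral {0..1} (\<lambda>t. ?F2 r t))"
  unfolding e1 e2 by (subst integral_diff) (auto intro!: integrable_continuous_real ip)
 also have "... = integral {0..1} (\<lambda>r. integral {0..1} (\<lambda>t. ?F1 r t - ?F2 r t))"
  by (subst integral_diff[symmetric]) (intro integrable_continuous_real c1 c2 continuous_intros, intro integrable_continuous_real c1 c2 continuous_intros, simp)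
 also have "(\<lambda>r. integral {0..1} (\<lambda>t. ?F1 r t - ?F2 r t)) = (\<lambda>r. - integral {0..1} (\<lambda>t. t * (field_form (dform A) (p r - u) (g r t) \<bullet> v)))"
 proof
  fix r
  have "?F1 r t - ?F2 r t = - (t * (field_form (dform A) (p r - u) (g r t) \<bullet> v))" for t
   unfolding field_form_inner dform_contract[OF A] by (simp add: linear_scale[OF l] algebra_simps)
  then show "integral {0..1} (\<lambda>t. ?F1 r t - ?F2 r t) = - integral {0..1} (\<lambda>t. t * (field_form (dform A) (p r - u) (g r t) \<bullet> v))"
   by simp
 qed
 finally show ?thesis by (simp add: p_def g_def v_def)
qed

lemma phase_antisym: "phase A y x = - phase A x y"
proof -
 have "integral {0..1} (\<lambda>t. A (y + t *\<^sub>R (x - y)) \<bullet> (x - y)) = integral {0..1} (\<lambda>t. A (y + (1 - t) *\<^sub>R (x - y)) \<bullet> (x - y))"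
  using Henstock_Kurzweil_Integration.integral_reflect_real[of 1 0 "\<lambda>t. A (y + t *\<^sub>R (x - y)) \<bullet> (x - y)"]
   integral_shift_real_ivl[of 0 1 1 "\<lambda>t. A (y + (1 - t) *\<^sub>R (x - y)) \<bullet> (x - y)"] by simp
 also have "... = - integral {0..1} (\<lambda>t. A (x + t *\<^sub>R (y - x)) \<bullet> (y - x))"
  by (simp add: algebra_simps inner_diff_right flip: integral_neg)
 finally show ?thesis by (simp add: phase_def)
qed

lemma phase_continuous:
 fixes A :: "real ^ 'n \<Rightarrow> real ^ 'n"
 assumes A: "smooth A"
 shows "continuous_on UNIV (\<lambda>(x, y). phase A x y)"
proof -
 have Ac: "continuous_on S (\<lambda>q. A (h q))" if "continuous_on S h" for S and h :: "'c::t2_space \<Rightarrow> real ^ 'n"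
  using that by (intro continuous_on_compose2[OF smooth_continuous[OF A, of UNIV]]) auto
 have "continuous_on UNIV (\<lambda>p. integral {0..1} (\<lambda>t. A (fst p + t *\<^sub>R (snd p - fst p)) \<bullet> (snd p - fst p)))"
  unfolding box_real[symmetric]
  by (rule integral_continuous_on_param, simp only: case_prod_unfold, intro continuous_intros Ac)
 then show ?thesis unfolding phase_def case_prod_unfold by (intro continuous_intros)
qed

section \<open>The averaging measures and the modulus of continuity of the weight\<close>

definition unit_interval :: "real measure" where
 "unit_interval = density lborel (\<lambda>t. ennreal (indicator {0..1} t))"

definition bump_measure :: "real \<Rightarrow> 'a::euclidean_space measure" where
 "bump_measure R = density lborel (\<lambda>u. ennreal ((bump R u)^2))"

lemma sets_unit_interval [measurable_cong, simp]: "sets unit_interval = sets borel"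
 by (simp add: unit_interval_def)

lemma space_unit_interval [simp]: "space unit_interval = UNIV"
 by (simp add: unit_interval_def)

lemma sets_bump_measure [measurable_cong, simp]: "sets (bump_measure R) = sets borel"
 by (simp add: bump_measure_def)

lemma space_bump_measure [simp]: "space (bump_measure R) = UNIV"
 by (simp add: bump_measure_def)

lemma prob_space_unit_interval: "prob_space unit_interval"
proof
 show "emeasure unit_interval (space unit_interval) = 1"
  by (simp add: unit_interval_def emeasure_density ennreal_indicator nn_integral_indicator)
qed

lemma AE_unit_interval: "AE t in unit_interval. 0 \<le> t \<and> t \<le> 1"
 unfolding unit_interval_def by (subst AE_density) (auto simp: indicator_def)

lemma prob_space_bump_measure:
 assumes R: "R > 0" shows "prob_space (bump_measure R :: 'a::euclidean_space measure)"
proof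
 have i: "integrable lborel (\<lambda>u::'a. (bump R u)^2)" "(LBINT u. (bump R (u::'a))^2) = 1"
  using bump2_integrable[OF R, of 0] bump2_integral[OF R, of 0] by simp_all
 show "emeasure (bump_measure R :: 'a measure) (space (bump_measure R)) = 1"
  by (simp add: bump_measure_def emeasure_density nn_integral_eq_integral i)
qed

lemma AE_bump_measure: "R > 0 \<Longrightarrow> AE u in bump_measure R. norm u < R"
 unfolding bump_measure_def using bump_support[of R] by (subst AE_density) (auto simp: less_le)

lemma integral_unit_interval:
 fixes f :: "real \<Rightarrow> 'b::euclidean_space"
 assumes f: "continuous_on UNIV f"
 shows "integral {0..1} f = (LINT t|unit_interval. f t)"
proof -
 have [measurable]: "f \<in> bmeas borel" by (rule borel_measurable_continuous_onI[OF f])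
 have c: "continuous_on {0..1} f" using f continuous_on_subset by blast
 have "integral {0..1} f = (LINT t:{0..1}|lborel. f t)"
  by (rule set_borel_integral_eq_integral(2)[symmetric], rule borel_integrable_atLeastAtMost'[OF c])
 also have "... = (LINT t|unit_interval. f t)"
  unfolding unit_interval_def set_lebesgue_integral_def by (subst integral_density) auto
 finally show ?thesis .
qed

lemma integral_bump_measure:
 fixes f :: "'a::euclidean_space \<Rightarrow> 'b::{banach,second_countable_topology}"
 assumes "f \<in> bmeas borel"
 shows "(LINT u|(bump_measure R). f u) = (LBINT u. (bump R u)^2 *\<^sub>R f u)"
 unfolding bump_measure_def by (subst integral_density) (use assms in auto)

text \<open>The difference of squares factors. The weighted inequality with parameter
  \<open>v\<close> splits it into the squared difference, which is \<open>O(v^2)\<close>, divided by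
  \<open>2 * v\<close>, and \<open>v\<close> times a quantity of integral two. Choosing
  \<open>v\<close> of the order \<open>norm s / R\<close> makes the L1 modulus linear in the
  shift.\<close>

lemma bump_shift:
 fixes s :: "'a::euclidean_space"
 assumes R: "R > 0"
 shows "integrable lborel (\<lambda>u. \<bar>(bump R (u - s))^2 - (bump R u)\<^sup>2\<bar>)"
  and "(LBINT u. \<bar>(bump R (u - s))^2 - (bump R u)\<^sup>2\<bar>) \<le> 2 * sqrt (bump_const TYPE('a)) * norm s / R"
proof -
 let ?K = "bump_const TYPE('a)"
 have K: "?K > 0" by (simp add: bump_const_def)
 note i1 = bump2_integrable[OF R, of s] and i2 = bump2_integrable[OF R, of 0, simplified]
 show i: "integrable lborel (\<lambda>u. \<bar>(bump R (u - s))^2 - (bump R u)\<^sup>2\<bar>)"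
  by (intro integrable_abs integrable_diff' i1 i2)
 show "(LBINT u. \<bar>(bump R (u - s))^2 - (bump R u)\<^sup>2\<bar>) \<le> 2 * sqrt ?K * norm s / R"
 proof (cases "s = 0")
  case False
  define v where "v = sqrt ?K * norm s / (2 * R)"
  have v: "v > 0" "v^2 = ?K * (norm ((1/2) *\<^sub>R s) / R)^2"
   using False K R by (auto simp: v_def power_divide power_mult_distrib)
  let ?d = "\<lambda>u. bump R (u - s) - bump R u"
  have sh: "(\<lambda>u. (bump R (u - (1/2) *\<^sub>R s) - bump R (u + (1/2) *\<^sub>R s))^2) = (\<lambda>u. (?d (u + (1/2) *\<^sub>R s))^2)"
  proof -
   have "u - (1/2) *\<^sub>R s = u + (1/2) *\<^sub>R s - s" for u
    by (rule euclidean_eqI) (simp add: inner_diff_left inner_add_left field_simps)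
   then show ?thesis by (intro ext) (simp only:)
  qed
  have d: "integrable lborel (\<lambda>u. (?d u)^2)" "(LBINT u. (?d u)^2) \<le> v^2"
   using bump_diff2[OF R, of "(1/2) *\<^sub>R s"] integrable_translate[of "\<lambda>u. (?d u)^2" "(1/2) *\<^sub>R s"]
    integral_translate[of "\<lambda>u. (?d u)^2" "(1/2) *\<^sub>R s"] unfolding sh v(2) by auto
  have le: "\<bar>(bump R (u - s))^2 - (bump R u)\<^sup>2\<bar> \<le> (?d u)^2 / (2 * v) + v * ((bump R (u - s))^2 + (bump R u)^2)" for u
  proof -
   let ?a = "\<bar>?d u\<bar>" and ?b = "bump R (u - s) + bump R u"
   have b0: "?b \<ge> 0" using bump_nonneg[OF R, of "u - s"] bump_nonneg[OF R, of u] by linarith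
   have "\<bar>(bump R (u - s))^2 - (bump R u)\<^sup>2\<bar> = ?a * ?b"
    using b0 by (simp add: power2_eq_square square_diff_square_factored abs_mult mult.commute)
   also have "?a * ?b \<le> ?a^2 / (2 * v) + v * ?b^2 / 2"
   proof -
    have "0 \<le> (?a - v * ?b)^2 / (2 * v)" using v(1) by simp
    also have "... = ?a^2 / (2 * v) - ?a * ?b + v * ?b^2 / 2"
     using v(1) by (simp add: power2_diff power_mult_distrib field_simps power2_eq_square)
    finally show ?thesis by linarith
   qed
   also have "v * ?b^2 / 2 \<le> v * ((bump R (u - s))^2 + (bump R u)^2)"
   proof -
    have "?b^2 \<le> 2 * ((bump R (u - s))^2 + (bump R u)^2)"
     using sum_squares_bound[of "bump R (u - s)" "bump R u"] by (simp add: power2_sum)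
    then have "v * ?b^2 \<le> v * (2 * ((bump R (u - s))^2 + (bump R u)^2))" using v(1) by (intro mult_left_mono) auto
    then show ?thesis by (simp add: algebra_simps)
   qed
   finally show ?thesis by simp
  qed
  have "(LBINT u. \<bar>(bump R (u - s))^2 - (bump R u)\<^sup>2\<bar>)
   \<le> (LBINT u. (?d u)^2 / (2 * v) + v * ((bump R (u - s))^2 + (bump R u)^2))"
   by (rule integral_mono[OF i _ le]) (intro integrable_add' integrable_divide integrable_mult_right d i1 i2)
  also have "... = (LBINT u. (?d u)^2) / (2 * v) + v * 2"
  proof -
   have "(LBINT u. (?d u)^2 / (2 * v) + v * ((bump R (u - s))^2 + (bump R u)^2))
    = (LBINT u. (?d u)^2 / (2 * v)) + (LBINT u. v * ((bump R (u - s))^2 + (bump R u)^2))"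
    by (intro integral_add' integrable_add' integrable_divide integrable_mult_right d i1 i2)
   then show ?thesis
    using bump2_integral[OF R, of s] bump2_integral[OF R, of "0::'a"]
    by (simp add: integral_add'[OF i1 i2])
  qed
  also have "... \<le> v^2 / (2 * v) + v * 2" using d(2) v(1) by (intro add_right_mono divide_right_mono) auto
  also have "... = 5/2 * v" using v(1) by (simp add: power2_eq_square)
  also have "... \<le> 4 * v" using v(1) by simp
  finally show ?thesis by (simp add: v_def mult_ac)
 qed simp
qed

text \<open>For a fixed base point \<open>c + u\<close> the integral over the second variable is the
  transverse gauge potential of the field relative to that point; the first variable averages over
  \<open>u\<close>.\<close>

definition avg_gauge :: "real \<Rightarrow> ('n \<Rightarrow> 'n \<Rightarrow> real ^ 'n \<Rightarrow> real) \<Rightarrow> real ^ 'n \<Rightarrow> real ^ 'n \<Rightarrow> real ^ ('n::finite)" where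
 "avg_gauge R B c p = (LINT q|(bump_measure R \<Otimes>\<^sub>M unit_interval). snd q *\<^sub>R field_form B (p - c - fst q) (c + fst q + snd q *\<^sub>R (p - c - fst q)))"

text \<open>This is the gauge function that matches \<open>avg_gauge\<close>: the average of the
  phases from \<open>x\<close> to the base points.\<close>

definition avg_phase :: "real \<Rightarrow> (real ^ 'n \<Rightarrow> real ^ 'n \<Rightarrow> real) \<Rightarrow> real ^ 'n \<Rightarrow> real ^ 'n \<Rightarrow> real" where
 "avg_phase R \<theta> c x = (LINT u|(bump_measure R). \<theta> x (c + u))"

text \<open>The 6 is the 2 of \<open>bump_shift\<close> times the bound \<open>3 * R\<close> for the
  lever arm. The 5 dominates both the constant 4 of the crude bound for large shifts and the 1 from
  the change of the lever arm.\<close>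

definition gauge_const :: "'n::finite itself \<Rightarrow> real" where
 "gauge_const _ = (real CARD('n))^2 * (5 + 6 * sqrt (bump_const TYPE(real ^ 'n)))"

text \<open>The first summand integrates the bound with \<open>1 / (1 - t)\<close> over the slices
  up to \<open>1 - \<tau>\<close>. The second is the direct Lipschitz bound on the remaining slices,
  of length \<open>\<tau>\<close>. For \<open>\<tau> = 1\<close> only the direct bound
  remains.\<close>

definition lip_const :: "'n::finite itself \<Rightarrow> real \<Rightarrow> real \<Rightarrow> real \<Rightarrow> real \<Rightarrow> real" where
 "lip_const _ R m m' \<tau> = gauge_const TYPE('n) * m * ln (1 / \<tau>) + \<tau> * ((real CARD('n))^2 * (m + 2 * R * m'))"

locale local_gauge =
 fixes R :: real and A :: "real ^ 'n \<Rightarrow> real ^ 'n" and m m' :: real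
 assumes R: "R > 0" and A: "smooth A"
  and m: "\<And>j k q. \<bar>dform A j k q\<bar> \<le> m"
  and m': "\<And>j k q q'. \<bar>dform A j k q - dform A j k q'\<bar> \<le> m' * norm (q - q')"
begin

abbreviation "B \<equiv> dform A"
abbreviation "D \<equiv> bump_measure R :: (real ^ 'n) measure"

lemma m_nonneg: "m \<ge> 0" using order_trans[OF abs_ge_zero m] by blast

lemma m'_nonneg: "m' \<ge> 0"
proof -
 obtain q :: "real ^ 'n" where "norm q = 1" using vector_choose_size[of 1] by auto
 then show ?thesis using order_trans[OF abs_ge_zero m'[of _ _ q 0]] by auto
qed

sublocale D: prob_space D by (rule prob_space_bump_measure[OF R])
sublocale U: prob_space unit_interval by (rule prob_space_unit_interval)
sublocale DU: pair_prob_space D unit_interval ..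
sublocale UD: pair_prob_space unit_interval D ..

lemma measure_UNIV_1 [simp]: "measure unit_interval UNIV = 1" "measure D UNIV = 1"
 using U.prob_space D.prob_space by simp_all

lemma ffc: "continuous_on S f \<Longrightarrow> continuous_on S g \<Longrightarrow> continuous_on S (\<lambda>p. field_form B (f p) (g p))"
 by (rule continuous_field_form[OF continuous_on_dform[OF A]])

lemma B_measurable [measurable]: "B j k \<in> bmeas borel"
 by (rule borel_measurable_continuous_onI[OF continuous_on_dform[OF A]])

lemma ff_measurable [measurable (raw)]:
 "f \<in> bmeas M \<Longrightarrow> g \<in> bmeas M \<Longrightarrow> (\<lambda>p. field_form B (f p) (g p)) \<in> bmeas M"
 unfolding field_form_def
 by (intro borel_measurable_sum borel_measurable_scaleR borel_measurable_times borel_measurable_inner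
   borel_measurable_const measurable_compose[OF _ B_measurable])

lemma ff_le: "norm (field_form B w q) \<le> (real CARD('n))^2 * m * norm w"
 by (rule norm_field_form_le[OF m])

definition gi :: "real ^ 'n \<Rightarrow> real ^ 'n \<Rightarrow> real ^ 'n \<Rightarrow> real \<Rightarrow> real ^ 'n" where
 "gi c p u t = t *\<^sub>R field_form B (p - c - u) (c + u + t *\<^sub>R (p - c - u))"

lemma gi_measurable:
 "f \<in> bmeas M \<Longrightarrow> g \<in> bmeas M \<Longrightarrow> h \<in> bmeas M \<Longrightarrow> k \<in> bmeas M \<Longrightarrow>
  (\<lambda>x. gi (f x) (g x) (h x) (k x)) \<in> bmeas M"
 unfolding gi_def
 by (intro borel_measurable_scaleR ff_measurable borel_measurable_diff borel_measurable_add borel_measurable_const)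

lemma gi_le:
 assumes "norm u < R" "0 \<le> t" "t \<le> 1"
 shows "norm (gi c p u t) \<le> (real CARD('n))^2 * m * (norm (p - c) + R)"
proof -
 have "norm (gi c p u t) \<le> 1 * ((real CARD('n))^2 * m * norm (p - c - u))"
  unfolding gi_def norm_scaleR using assms by (intro mult_mono ff_le) auto
 also have "... \<le> (real CARD('n))^2 * m * (norm (p - c) + R)"
  using norm_triangle_ineq4[of "p - c" u] assms(1) m_nonneg by (simp add: mult_left_mono)
 finally show ?thesis .
qed

lemma AE_DU: "AE q in D \<Otimes>\<^sub>M unit_interval. norm (fst q) < R \<and> 0 \<le> snd q \<and> snd q \<le> 1"
proof (rule DU.AE_pair_measure)
 show "{x \<in> space (D \<Otimes>\<^sub>M unit_interval). norm (fst x) < R \<and> 0 \<le> snd x \<and> snd x \<le> 1} \<in> sets (D \<Otimes>\<^sub>M unit_interval)"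
  by measurable
 show "AE x in D. AE y in unit_interval. norm (fst (x, y)) < R \<and> 0 \<le> snd (x, y) \<and> snd (x, y) \<le> 1"
  using AE_bump_measure[OF R] by eventually_elim (use AE_unit_interval in \<open>auto elim: eventually_mono\<close>)
qed

lemma gi_integrable: "integrable (D \<Otimes>\<^sub>M unit_interval) (\<lambda>q. gi c p (fst q) (snd q))"
proof (rule DU.integrable_const_bound[where B="(real CARD('n))^2 * m * (norm (p - c) + R)"])
 show "AE q in D \<Otimes>\<^sub>M unit_interval. norm (gi c p (fst q) (snd q)) \<le> (real CARD('n))^2 * m * (norm (p - c) + R)"
  using AE_DU by eventually_elim (rule gi_le, auto)
qed (intro gi_measurable; measurable)

lemma gi_integrable_t: "norm u < R \<Longrightarrow> integrable unit_interval (\<lambda>t. gi c p u t)"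
proof (rule U.integrable_const_bound[where B="(real CARD('n))^2 * m * (norm (p - c) + R)"])
 assume u: "norm u < R"
 show "AE t in unit_interval. norm (gi c p u t) \<le> (real CARD('n))^2 * m * (norm (p - c) + R)"
  using AE_unit_interval by eventually_elim (rule gi_le[OF u], auto)
qed (intro gi_measurable; measurable)

lemma avg_gauge_gi: "avg_gauge R B c p = (LINT q|(D \<Otimes>\<^sub>M unit_interval). gi c p (fst q) (snd q))"
 by (simp add: avg_gauge_def gi_def)

lemma phase_cont: "continuous_on S f \<Longrightarrow> continuous_on S g \<Longrightarrow> continuous_on S (\<lambda>p. phase A (f p) (g p))"
 using continuous_on_compose2[OF phase_continuous[OF A], of S "\<lambda>p. (f p, g p)"]
 by (auto intro: continuous_on_Pair)

lemma phase_measurable [measurable (raw)]: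
 assumes "f \<in> bmeas M" "g \<in> bmeas M"
 shows "(\<lambda>p. phase A (f p) (g p)) \<in> bmeas M"
 using measurable_compose[OF borel_measurable_Pair[OF assms] borel_measurable_continuous_onI[OF phase_continuous[OF A]]]
 by simp

lemma phase_integrable: "integrable D (\<lambda>u. phase A x (c + u))"
proof -
 have "compact ((\<lambda>u. phase A x (c + u)) ` cball 0 R)"
  by (intro compact_continuous_image phase_cont continuous_intros) auto
 then obtain C where C: "\<And>u. u \<in> cball 0 R \<Longrightarrow> norm (phase A x (c + u)) \<le> C"
  using compact_imp_bounded bounded_iff by (metis (no_types, lifting) imageI)
 show ?thesis
 proof (rule D.integrable_const_bound[where B=C])
  show "AE u in D. norm (phase A x (c + u)) \<le> C"
   using AE_bump_measure[OF R] by eventually_elim (rule C, simp)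
 qed measurable
qed

text \<open>Stokes' theorem on the triangle with vertices \<open>c + u\<close>, \<open>x\<close>,
  \<open>y\<close>, averaged over \<open>u\<close>. The two sides through the base point become a
  difference of gauge functions, and the flux becomes the line integral of the averaged
  potential.\<close>

lemma gauge_line:
 "phase A x y - (avg_phase R (phase A) c x - avg_phase R (phase A) c y)
  = (LINT r|unit_interval. avg_gauge R B c (x + r *\<^sub>R (y - x)) \<bullet> (x - y))"
proof -
 let ?p = "\<lambda>r. x + r *\<^sub>R (y - x)" and ?w = "x - y"
 define a where "a u r = (LINT t|unit_interval. gi c (?p r) u t \<bullet> ?w)" for u r
 have stokes: "phase A x y - phase A x (c + u) + phase A y (c + u) = (LINT r|unit_interval. a u r)" for u
 proof -
  have c: "continuous_on UNIV (\<lambda>(r, t). gi c (?p r) u t \<bullet> ?w)"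
   unfolding gi_def case_prod_unfold by (intro continuous_intros ffc)
  have ct: "continuous_on UNIV (\<lambda>t. gi c (?p r) u t \<bullet> ?w)" for r
   unfolding gi_def by (intro continuous_intros ffc)
  have cr: "continuous_on UNIV (\<lambda>r. integral {0..1} (\<lambda>t. gi c (?p r) u t \<bullet> ?w))"
   unfolding box_real[symmetric]
   by (rule integral_continuous_on_param) (rule continuous_on_subset[OF c], simp)
  have "phase A (c + u) x - phase A (c + u) y + phase A x y =
   - integral {0..1} (\<lambda>r. integral {0..1} (\<lambda>t. t * (field_form B (?p r - (c + u)) ((c + u) + t *\<^sub>R (?p r - (c + u))) \<bullet> (y - x))))"
   by (rule phase_triangle[OF A])
  also have "... = integral {0..1} (\<lambda>r. integral {0..1} (\<lambda>t. gi c (?p r) u t \<bullet> ?w))"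
  proof -
   have yx: "y - x = - ?w" by simp
   have e: "t * (field_form B (?p r - (c + u)) ((c + u) + t *\<^sub>R (?p r - (c + u))) \<bullet> (y - x)) = - (gi c (?p r) u t \<bullet> ?w)" for r t
    unfolding gi_def diff_diff_eq yx by (simp only: inner_minus_right inner_scaleR_left mult_minus_right)
   show ?thesis unfolding e by simp
  qed
  also have "... = (LINT r|unit_interval. integral {0..1} (\<lambda>t. gi c (?p r) u t \<bullet> ?w))"
   by (rule integral_unit_interval[OF cr])
  also have "... = (LINT r|unit_interval. a u r)"
   unfolding a_def by (simp add: integral_unit_interval[OF ct])
  finally show ?thesis by (simp add: phase_antisym[of A "c + u"])
 qed
 have bnd: "norm (a u r) \<le> (real CARD('n))^2 * m * (norm (x - c) + norm (y - c) + R) * norm ?w" if u: "norm u < R" and r: "0 \<le> r" "r \<le> 1" for u r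
 proof -
  have "norm (?p r - c) \<le> norm (x - c) + norm (y - c)"
  proof -
   have "?p r - c = (1 - r) *\<^sub>R (x - c) + r *\<^sub>R (y - c)" by (simp add: algebra_simps)
   then have "norm (?p r - c) \<le> (1 - r) * norm (x - c) + r * norm (y - c)"
    using norm_triangle_ineq[of "(1 - r) *\<^sub>R (x - c)" "r *\<^sub>R (y - c)"] r by simp
   also have "... \<le> 1 * norm (x - c) + 1 * norm (y - c)" using r by (intro add_mono mult_right_mono) auto
   finally show ?thesis by simp
  qed
  then have g: "norm (gi c (?p r) u t) \<le> (real CARD('n))^2 * m * (norm (x - c) + norm (y - c) + R)" if "0 \<le> t" "t \<le> 1" for t
   using gi_le[OF u that, of c "?p r"] m_nonneg by (meson add_right_mono mult_left_mono mult_nonneg_nonneg order_trans zero_le_power2)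
  have "norm (a u r) \<le> (LINT t|unit_interval. norm (gi c (?p r) u t \<bullet> ?w))"
   unfolding a_def by (rule integral_norm_bound)
  also have "... \<le> (LINT t|unit_interval. (real CARD('n))^2 * m * (norm (x - c) + norm (y - c) + R) * norm ?w)"
  proof (rule integral_mono_AE)
   show "integrable unit_interval (\<lambda>t. norm (gi c (?p r) u t \<bullet> ?w))"
    by (intro integrable_norm integrable_inner_left gi_integrable_t[OF u])
   show "AE t in unit_interval. norm (gi c (?p r) u t \<bullet> ?w) \<le> (real CARD('n))^2 * m * (norm (x - c) + norm (y - c) + R) * norm ?w"
    using AE_unit_interval
   proof eventually_elim
    case (elim t)
    have "norm (gi c (?p r) u t \<bullet> ?w) \<le> norm (gi c (?p r) u t) * norm ?w" using Cauchy_Schwarz_ineq2 by simp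
    also have "... \<le> (real CARD('n))^2 * m * (norm (x - c) + norm (y - c) + R) * norm ?w"
     using elim by (intro mult_right_mono g) auto
    finally show ?case .
   qed
  qed simp
  also have "... = (real CARD('n))^2 * m * (norm (x - c) + norm (y - c) + R) * norm ?w" by (simp add: U.prob_space)
  finally show ?thesis .
 qed
 have am: "(\<lambda>(u, r). a u r) \<in> bmeas (D \<Otimes>\<^sub>M unit_interval)"
  unfolding a_def case_prod_unfold
  by (rule U.borel_measurable_lebesgue_integral) (simp only: case_prod_unfold, intro borel_measurable_inner gi_measurable; measurable)
 have ai: "integrable (D \<Otimes>\<^sub>M unit_interval) (\<lambda>(u, r). a u r)"
 proof (rule DU.integrable_const_bound[OF _ am])
  show "AE q in D \<Otimes>\<^sub>M unit_interval. norm (case q of (u, r) \<Rightarrow> a u r) \<le> (real CARD('n))^2 * m * (norm (x - c) + norm (y - c) + R) * norm ?w"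
   using AE_DU by eventually_elim (unfold case_prod_unfold, rule bnd, auto)
 qed
 have Lx: "(LINT u|D. phase A x y - phase A x (c + u) + phase A y (c + u))
  = phase A x y - avg_phase R (phase A) c x + avg_phase R (phase A) c y"
  using phase_integrable[of x c] phase_integrable[of y c] by (simp add: avg_phase_def D.prob_space)
 have "phase A x y - (avg_phase R (phase A) c x - avg_phase R (phase A) c y) = (LINT u|D. (LINT r|unit_interval. a u r))"
  using Lx unfolding stokes by simp
 also have "... = (LINT r|unit_interval. (LINT u|D. a u r))"
  by (rule DU.Fubini_integral[OF ai, symmetric])
 also have "(\<lambda>r. \<integral>u. a u r \<partial>D) = (\<lambda>r. avg_gauge R B c (?p r) \<bullet> ?w)"
 proof
  fix r
  have i: "integrable (D \<Otimes>\<^sub>M unit_interval) (\<lambda>q. gi c (?p r) (fst q) (snd q) \<bullet> ?w)"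
   by (intro integrable_inner_left gi_integrable)
  have "avg_gauge R B c (?p r) \<bullet> ?w = (LINT q|(D \<Otimes>\<^sub>M unit_interval). gi c (?p r) (fst q) (snd q) \<bullet> ?w)"
   unfolding avg_gauge_gi by (rule integral_inner_left[symmetric]) (rule gi_integrable)
  also have "... = (LINT u|D. a u r)"
   unfolding a_def using DU.integral_fst'[OF i] by simp
  finally show "(LINT u|D. a u r) = avg_gauge R B c (?p r) \<bullet> ?w" by simp
 qed
 finally show ?thesis .
qed

text \<open>The first bound differentiates the field and pays \<open>R * m'\<close>. The second
  avoids this: after a change of variables in \<open>u\<close> the field is evaluated at the same
  point for \<open>X\<close> and \<open>X'\<close>, so only the weight and the lever arm
  differ.\<close>

lemma avg_slice_lipschitz:
 fixes c X X' :: "real ^ 'n" and t :: real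
 assumes X: "norm X \<le> R" "norm X' \<le> R" and t: "0 \<le> t" "t \<le> 1"
 defines "y \<equiv> \<lambda>X. \<integral>u. field_form B (X - u) (c + u + t *\<^sub>R (X - u)) \<partial>D"
 shows "norm (y X - y X') \<le> (real CARD('n))^2 * (m + 2 * R * m') * norm (X - X')"
  and "t < 1 \<Longrightarrow> norm (y X - y X') \<le> gauge_const TYPE('n) * m / (1 - t) * norm (X - X')"
proof -
 let ?f = "\<lambda>X u. field_form B (X - u) (c + u + t *\<^sub>R (X - u))"
 have fle: "norm (?f X u) \<le> (real CARD('n))^2 * m * (2 * R)" if "norm X \<le> R" "norm u < R" for X u
  by (rule order_trans[OF ff_le mult_left_mono]) (use that norm_triangle_ineq4[of X u] m_nonneg in auto)
 have fi: "integrable D (?f X)" if "norm X \<le> R" for X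
  by (rule D.integrable_const_bound[where B="(real CARD('n))^2 * m * (2 * R)"])
   (use AE_bump_measure[OF R] fle[OF that] in \<open>auto elim!: eventually_mono\<close>)
 show "norm (y X - y X') \<le> (real CARD('n))^2 * (m + 2 * R * m') * norm (X - X')"
 proof -
  have "norm (y X - y X') = norm (LINT u|D. ?f X u - ?f X' u)"
   unfolding y_def by (subst integral_diff') (auto intro: fi X)
  also have "... \<le> (LINT u|D. norm (?f X u - ?f X' u))" by (rule integral_norm_bound)
  also have "... \<le> (LINT u|D. (real CARD('n))^2 * (m + 2 * R * m') * norm (X - X'))"
  proof (rule integral_mono_AE)
   show "AE u in D. norm (?f X u - ?f X' u) \<le> (real CARD('n))^2 * (m + 2 * R * m') * norm (X - X')"
    using AE_bump_measure[OF R]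
   proof eventually_elim
    case (elim u)
    let ?q = "c + u + t *\<^sub>R (X - u)" and ?q' = "c + u + t *\<^sub>R (X' - u)"
    have e: "?f X u - ?f X' u = field_form B (X - X') ?q + (field_form B (X' - u) ?q - field_form B (X' - u) ?q')"
     using field_form_diff[of B "X - u" "X' - u" ?q] by simp
    have q: "norm (?q - ?q') \<le> norm (X - X')"
    proof -
     have "?q - ?q' = t *\<^sub>R (X - X')" by (simp add: algebra_simps)
     then show ?thesis using t by (simp add: mult_left_le_one_le)
    qed
    have "norm (?f X u - ?f X' u) \<le> norm (field_form B (X - X') ?q) + norm (field_form B (X' - u) ?q - field_form B (X' - u) ?q')"
     unfolding e by (rule norm_triangle_ineq)
    also have "... \<le> (real CARD('n))^2 * m * norm (X - X') + (real CARD('n))^2 * (m' * norm (?q - ?q')) * norm (X' - u)"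
     by (intro add_mono ff_le field_form_lipschitz m')
    also have "... \<le> (real CARD('n))^2 * m * norm (X - X') + (real CARD('n))^2 * (m' * norm (X - X')) * (2 * R)"
     using q norm_triangle_ineq4[of X' u] X elim m'_nonneg
     by (intro add_left_mono mult_mono mult_left_mono mult_nonneg_nonneg) auto
    also have "... = (real CARD('n))^2 * (m + 2 * R * m') * norm (X - X')" by (simp add: algebra_simps)
    finally show ?case .
   qed
  qed (auto intro!: integrable_norm integrable_diff' fi X)
  also have "... = (real CARD('n))^2 * (m + 2 * R * m') * norm (X - X')" by (simp add: D.prob_space)
  finally show ?thesis .
 qed
 assume t1: "t < 1"
 define v where "v = X' - X"
 \<comment> \<open>The evaluation point is \<open>c + (1 - t) *\<^sub>R u + t *\<^sub>R X\<close>.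
   Moving \<open>u\<close> back by \<open>s\<close> changes it by \<open>- t *\<^sub>R v\<close>,
   which compensates the move of \<open>X\<close> by \<open>v\<close>; the lever arm grows by
   \<open>v / (1 - t)\<close>.\<close>
 define s where "s = (t / (1 - t)) *\<^sub>R v"
 have sle: "norm s \<le> norm v / (1 - t)" using t t1 by (simp add: s_def divide_right_mono mult_left_le_one_le)
 let ?K = "sqrt (bump_const TYPE(real ^ 'n))"
 have goal: "norm (y X' - y X) \<le> (real CARD('n))^2 * (5 + 6 * ?K) * m * (norm v / (1 - t))"
 proof (cases "norm s \<le> R")
  \<comment> \<open>For a shift beyond \<open>R\<close> the displacement satisfies
    \<open>R < norm v / (1 - t)\<close>, and the trivial bound by the size of the field is already
    good enough.\<close>
  case False
  have a: "norm (y Y) \<le> (real CARD('n))^2 * m * (2 * R)" if "norm Y \<le> R" for Y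
  proof -
   have "norm (y Y) \<le> (LINT u|D. norm (?f Y u))" unfolding y_def by (rule integral_norm_bound)
   also have "... \<le> (LINT u|D. (real CARD('n))^2 * m * (2 * R))"
    by (rule integral_mono_AE) (use AE_bump_measure[OF R] fle[OF that] fi[OF that] in \<open>auto elim!: eventually_mono\<close>)
   finally show ?thesis by (simp add: D.prob_space)
  qed
  have "norm (y X' - y X) \<le> (real CARD('n))^2 * m * (2 * R) + (real CARD('n))^2 * m * (2 * R)"
   using norm_triangle_ineq4[of "y X'" "y X"] a X by (meson add_mono order_trans)
  also have "... = (real CARD('n))^2 * 4 * m * R" by simp
  also have "... \<le> (real CARD('n))^2 * 4 * m * (norm v / (1 - t))" using False sle m_nonneg by (intro mult_left_mono) auto
  also have "... \<le> (real CARD('n))^2 * (5 + 6 * ?K) * m * (norm v / (1 - t))"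
   using m_nonneg t1 by (intro mult_right_mono mult_left_mono) (auto simp: bump_const_def)
  finally show ?thesis .
 next
  case True
  let ?H = "\<lambda>w u. field_form B w (c + (1 - t) *\<^sub>R u + t *\<^sub>R X)"
  have [measurable]: "(\<lambda>u. ?H (g u) u) \<in> bmeas borel" if "g \<in> bmeas borel" for g
   using that by measurable
  have aX: "y X = (LBINT u. (bump R u)^2 *\<^sub>R ?H (X - u) u)"
  proof -
   have e: "c + u + t *\<^sub>R (X - u) = c + (1 - t) *\<^sub>R u + t *\<^sub>R X" for u by (simp add: algebra_simps)
   have mm: "(\<lambda>u. field_form B (X - u) (c + u + t *\<^sub>R (X - u))) \<in> bmeas borel" by measurable
   show ?thesis unfolding y_def integral_bump_measure[OF mm] by (simp only: e)
  qed
  have aX': "y X' = (LBINT u. (bump R (u - s))^2 *\<^sub>R ?H (X - u + (1 / (1 - t)) *\<^sub>R v) u)"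
  proof -
   have "y X' = (LBINT u. (bump R u)^2 *\<^sub>R field_form B (X' - u) (c + u + t *\<^sub>R (X' - u)))"
    unfolding y_def by (subst integral_bump_measure) auto
   also have "... = (LBINT u. (bump R (u + (- s)))^2 *\<^sub>R field_form B (X' - (u + (- s))) (c + (u + (- s)) + t *\<^sub>R (X' - (u + (- s)))))"
    by (rule integral_translate[symmetric])
   also have "... = (LBINT u. (bump R (u - s))^2 *\<^sub>R ?H (X - u + (1 / (1 - t)) *\<^sub>R v) u)"
   proof (rule integral_cong'[OF refl])
    fix u
    have f: "1 + t / (1 - t) = 1 / (1 - t)" "(1 - t) * (t / (1 - t)) = t" using t1 by (simp_all add: field_simps)
    have e1: "X' - (u + (- s)) = X - u + (1 + t / (1 - t)) *\<^sub>R v" by (simp add: s_def v_def algebra_simps)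
    have e2: "c + (u + (- s)) + t *\<^sub>R (X' - (u + (- s))) = c + (1 - t) *\<^sub>R u + t *\<^sub>R X"
    proof -
     have "c + (u + (- s)) + t *\<^sub>R (X' - (u + (- s))) = c + (1 - t) *\<^sub>R u + t *\<^sub>R X + (t *\<^sub>R v - (1 - t) *\<^sub>R s)"
      by (simp add: v_def algebra_simps)
     also have "(1 - t) *\<^sub>R s = t *\<^sub>R v" unfolding s_def scaleR_scaleR f(2) ..
     finally show ?thesis by simp
    qed
    show "(bump R (u + (- s)))^2 *\<^sub>R field_form B (X' - (u + (- s))) (c + (u + (- s)) + t *\<^sub>R (X' - (u + (- s))))
     = (bump R (u - s))^2 *\<^sub>R ?H (X - u + (1 / (1 - t)) *\<^sub>R v) u"
     unfolding e2 unfolding e1 f(1) by simp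
   qed
   finally show ?thesis .
  qed
  define g where "g u = \<bar>(bump R (u - s))^2 - (bump R u)\<^sup>2\<bar> * ((real CARD('n))^2 * m * (3 * R)) + (bump R (u - s))^2 * ((real CARD('n))^2 * m * (norm v / (1 - t)))" for u
  have gint: "integrable lborel g"
   unfolding g_def by (intro integrable_add' integrable_mult_left bump_shift(1)[OF R] bump2_integrable[OF R])
  have iX: "integrable lborel (\<lambda>u. (bump R u)^2 *\<^sub>R ?H (X - u) u)"
  proof (rule integrable_bound'[OF integrable_mult_left[OF bump2_integrable[OF R, of 0], of "(real CARD('n))^2 * m * (2 * R)"]])
   show "AE u in lborel. norm ((bump R u)^2 *\<^sub>R ?H (X - u) u) \<le> norm ((bump R (u - 0))^2 * ((real CARD('n))^2 * m * (2 * R)))"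
   proof (rule AE_I2)
    fix u
    have "norm (?H (X - u) u) \<le> (real CARD('n))^2 * m * (2 * R)" if "bump R u \<noteq> 0"
     by (rule order_trans[OF ff_le mult_left_mono])
      (use X norm_triangle_ineq4[of X u] bump_support[OF R that] m_nonneg in auto)
    then show "norm ((bump R u)^2 *\<^sub>R ?H (X - u) u) \<le> norm ((bump R (u - 0))^2 * ((real CARD('n))^2 * m * (2 * R)))"
     using m_nonneg R by (cases "bump R u = 0") (auto intro!: mult_left_mono)
   qed
  qed measurable
  have diff: "norm ((bump R (u - s))^2 *\<^sub>R ?H (X - u + (1 / (1 - t)) *\<^sub>R v) u - (bump R u)\<^sup>2 *\<^sub>R ?H (X - u) u) \<le> g u" for u
  proof -
   let ?d = "(bump R (u - s))^2 - (bump R u)\<^sup>2"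
   have e: "(bump R (u - s))^2 *\<^sub>R ?H (X - u + (1 / (1 - t)) *\<^sub>R v) u - (bump R u)\<^sup>2 *\<^sub>R ?H (X - u) u
    = ?d *\<^sub>R ?H (X - u) u + (bump R (u - s))^2 *\<^sub>R ?H ((1 / (1 - t)) *\<^sub>R v) u"
   proof -
    have "a *\<^sub>R (P + Q) - b *\<^sub>R P = (a - b) *\<^sub>R P + a *\<^sub>R Q" for a b and P Q :: "real ^ 'n"
     by (simp add: algebra_simps)
    then show ?thesis unfolding field_form_add .
   qed
   \<comment> \<open>Where the two weights differ, \<open>u\<close> lies in one of two balls, so
     \<open>norm u \<le> 2 * R\<close> and the lever arm is at most \<open>3 * R\<close>.\<close>
   have 1: "norm (?d *\<^sub>R ?H (X - u) u) \<le> \<bar>?d\<bar> * ((real CARD('n))^2 * m * (3 * R))"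
   proof (cases "?d = 0")
    case False
    then have "bump R (u - s) \<noteq> 0 \<or> bump R u \<noteq> 0" by auto
    then have "norm u \<le> 2 * R"
    proof
     assume "bump R (u - s) \<noteq> 0"
     then have "norm (u - s) < R" by (rule bump_support[OF R])
     then show ?thesis using True norm_triangle_ineq[of "u - s" s] by simp
    next
     assume "bump R u \<noteq> 0"
     then have "norm u < R" by (rule bump_support[OF R])
     then show ?thesis using R by simp
    qed
    then have "norm (X - u) \<le> 3 * R" using X norm_triangle_ineq4[of X u] by simp
    then have "norm (?H (X - u) u) \<le> (real CARD('n))^2 * m * (3 * R)"
     using m_nonneg by (intro order_trans[OF ff_le mult_left_mono]) auto
    then show ?thesis by (simp add: mult_left_mono)
   qed simp
   have 2: "norm ((bump R (u - s))^2 *\<^sub>R ?H ((1 / (1 - t)) *\<^sub>R v) u) \<le> (bump R (u - s))^2 * ((real CARD('n))^2 * m * (norm v / (1 - t)))"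
    using mult_left_mono[OF ff_le[of "(1 / (1 - t)) *\<^sub>R v" "c + (1 - t) *\<^sub>R u + t *\<^sub>R X"] zero_le_power2[of "bump R (u - s)"]] t1
    by simp
   show ?thesis unfolding e g_def by (rule order_trans[OF norm_triangle_ineq add_mono[OF 1 2]])
  qed
  have idiff: "integrable lborel (\<lambda>u. (bump R (u - s))^2 *\<^sub>R ?H (X - u + (1 / (1 - t)) *\<^sub>R v) u - (bump R u)\<^sup>2 *\<^sub>R ?H (X - u) u)"
   by (rule integrable_bound'[OF gint]) (use diff in \<open>auto intro: order_trans[OF _ abs_ge_self]\<close>)
  have iX': "integrable lborel (\<lambda>u. (bump R (u - s))^2 *\<^sub>R ?H (X - u + (1 / (1 - t)) *\<^sub>R v) u)"
   using integrable_add'[OF idiff iX] by simp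
  have "norm (y X' - y X) = norm (LBINT u. (bump R (u - s))^2 *\<^sub>R ?H (X - u + (1 / (1 - t)) *\<^sub>R v) u - (bump R u)\<^sup>2 *\<^sub>R ?H (X - u) u)"
   unfolding aX aX' using integral_diff'[OF iX' iX] by simp
  also have "... \<le> (LBINT u. norm ((bump R (u - s))^2 *\<^sub>R ?H (X - u + (1 / (1 - t)) *\<^sub>R v) u - (bump R u)\<^sup>2 *\<^sub>R ?H (X - u) u))"
   by (rule integral_norm_bound)
  also have "... \<le> (LBINT u. g u)"
   by (rule integral_mono[OF integrable_norm[OF idiff] gint diff])
  also have "... = (LBINT u. \<bar>(bump R (u - s))^2 - (bump R u)\<^sup>2\<bar>) * ((real CARD('n))^2 * m * (3 * R)) + (real CARD('n))^2 * m * (norm v / (1 - t))"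
   unfolding g_def using bump_shift(1)[OF R, of s] bump2_integrable[OF R, of s] bump2_integral[OF R, of s] by simp
  also have "... \<le> (2 * ?K * norm s / R) * ((real CARD('n))^2 * m * (3 * R)) + (real CARD('n))^2 * m * (norm v / (1 - t))"
   using bump_shift(2)[OF R, of s] m_nonneg R by (intro add_right_mono mult_right_mono) auto
  also have "... = (real CARD('n))^2 * m * 6 * ?K * norm s + (real CARD('n))^2 * m * (norm v / (1 - t))" using R by (simp add: field_simps)
  also have "... \<le> (real CARD('n))^2 * m * 6 * ?K * (norm v / (1 - t)) + (real CARD('n))^2 * m * 5 * (norm v / (1 - t))"
   using sle m_nonneg t1 by (intro add_mono mult_left_mono mult_right_mono) (auto simp: bump_const_def)
  also have "... = (real CARD('n))^2 * (5 + 6 * ?K) * m * (norm v / (1 - t))" by (simp add: algebra_simps)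
  finally show ?thesis .
 qed
 show "norm (y X - y X') \<le> gauge_const TYPE('n) * m / (1 - t) * norm (X - X')"
  using goal by (simp add: gauge_const_def v_def norm_minus_commute)
qed

text \<open>Fubini writes the averaged gauge as an integral of slices over \<open>t\<close>. The
  sharper of the two slice bounds is chosen on either side of \<open>1 - v\<close>; integrating
  \<open>1 / (1 - t)\<close> produces \<open>ln (1 / v)\<close>.\<close>

lemma avg_gauge_lipschitz:
 assumes p: "norm (p - c) \<le> R" "norm (p' - c) \<le> R" and v: "0 < v" "v \<le> 1"
 shows "norm (avg_gauge R B c p - avg_gauge R B c p') \<le> lip_const TYPE('n) R m m' v * norm (p - p')"
proof -
 define a where "a t X = (LINT u|D. field_form B (X - u) (c + u + t *\<^sub>R (X - u)))" for t X
 let ?C = "gauge_const TYPE('n) * m" and ?E = "(real CARD('n))^2 * (m + 2 * R * m')"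
 define h where "h t = ?C * ((1 / (1 - t)) * indicator {0..1 - v} t) + ?E * indicator {1 - v<..1} t" for t :: real
 have ag: "avg_gauge R B c q = (LINT t|unit_interval. t *\<^sub>R a t (q - c))"
  and agi: "integrable unit_interval (\<lambda>t. t *\<^sub>R a t (q - c))" for q
 proof -
  have i: "integrable (D \<Otimes>\<^sub>M unit_interval) (\<lambda>(u, t). gi c q u t)" using gi_integrable by (simp add: case_prod_unfold)
  have e: "(LINT u|D. gi c q u t) = t *\<^sub>R a t (q - c)" for t by (simp add: gi_def a_def)
  show "avg_gauge R B c q = (LINT t|unit_interval. t *\<^sub>R a t (q - c))"
   using DU.integral_snd[OF i] by (simp add: avg_gauge_gi e case_prod_unfold)
  show "integrable unit_interval (\<lambda>t. t *\<^sub>R a t (q - c))" using DU.integrable_snd[OF i] by (simp add: e)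
 qed
 have hb: "has_bochner_integral lborel (\<lambda>t. (1 / (1 - t)) * indicator {0..1 - v} t) (ln (1 / v))"
 proof -
  have "has_bochner_integral lborel (\<lambda>t. (1 / (1 - t)) * indicator {0..1 - v} t) ((- ln (1 - (1 - v))) - (- ln (1 - 0)))"
  proof (rule has_bochner_integral_FTC_Icc_real)
   fix x assume "0 \<le> x" "x \<le> 1 - v"
   then have "1 - x > 0" using v by linarith
   then show "((\<lambda>x. - ln (1 - x)) has_real_derivative 1 / (1 - x)) (at x)" "isCont (\<lambda>x. 1 / (1 - x)) x"
    by (auto intro!: derivative_eq_intros continuous_intros)
  qed (use v in simp)
  then show ?thesis using v by (simp add: ln_div)
 qed
 have hi: "integrable lborel h" and hint: "(LBINT t. h t) = lip_const TYPE('n) R m m' v"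
 proof -
  have i2: "integrable lborel (indicator {1 - v<..1} :: real \<Rightarrow> real)" by (rule integrable_real_indicator) (use v in auto)
  have i1: "integrable lborel (\<lambda>t. (1 / (1 - t)) * indicator {0..1 - v} t)"
   "(LBINT t. (1 / (1 - t)) * indicator {0..1 - v} t) = ln (1 / v)"
   using hb by (simp_all add: has_bochner_integral_iff)
  show "integrable lborel h"
   unfolding h_def using hb i2 by (intro integrable_add' integrable_mult_right) (auto simp: has_bochner_integral_iff)
  show "(LBINT t. h t) = lip_const TYPE('n) R m m' v"
   unfolding h_def integral_add'[OF integrable_mult_right[OF i1(1)] integrable_mult_right[OF i2]]
    integral_mult_right_zero i1(2)
   using v by (simp add: lip_const_def)
 qed
 have C0: "?C \<ge> 0" using m_nonneg by (simp add: gauge_const_def bump_const_def)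
 have E0: "?E \<ge> 0" using m_nonneg m'_nonneg R by simp
 have hind: "indicator {0..1} t * h t = h t" for t using v by (auto simp: h_def indicator_def)
 have hU: "(LINT t|unit_interval. h t) = lip_const TYPE('n) R m m' v" "integrable unit_interval h"
 proof -
  have [measurable]: "h \<in> bmeas borel" using hi by simp
  show "(LINT t|unit_interval. h t) = lip_const TYPE('n) R m m' v"
   unfolding unit_interval_def by (subst integral_density) (auto simp: hind hint)
  show "integrable unit_interval h"
   unfolding unit_interval_def by (subst integrable_density) (auto simp: hind hi)
 qed
 have "norm (avg_gauge R B c p - avg_gauge R B c p') = norm (LINT t|unit_interval. t *\<^sub>R a t (p - c) - t *\<^sub>R a t (p' - c))"
  unfolding ag using integral_diff'[OF agi agi] by simp
 also have "... \<le> (LINT t|unit_interval. norm (t *\<^sub>R a t (p - c) - t *\<^sub>R a t (p' - c)))"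
  by (rule integral_norm_bound)
 also have "... \<le> (LINT t|unit_interval. h t * norm (p - p'))"
 proof (rule integral_mono_AE)
  show "integrable unit_interval (\<lambda>t. norm (t *\<^sub>R a t (p - c) - t *\<^sub>R a t (p' - c)))"
   by (intro integrable_norm integrable_diff' agi)
  show "integrable unit_interval (\<lambda>t. h t * norm (p - p'))" using hU by (intro integrable_mult_left)
  show "AE t in unit_interval. norm (t *\<^sub>R a t (p - c) - t *\<^sub>R a t (p' - c)) \<le> h t * norm (p - p')"
   using AE_unit_interval
  proof eventually_elim
   case (elim t)
   have "norm (t *\<^sub>R a t (p - c) - t *\<^sub>R a t (p' - c)) = t * norm (a t (p - c) - a t (p' - c))"
    using elim by (simp flip: scaleR_diff_right)
   also have "... \<le> 1 * norm (a t (p - c) - a t (p' - c))" using elim by (intro mult_right_mono) auto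
   also have "... \<le> h t * norm (p - p')"
   proof (cases "t \<le> 1 - v")
    case True
    then have "h t = ?C / (1 - t)" using elim by (simp add: h_def)
    moreover have "t < 1" using True v by simp
    ultimately show ?thesis using avg_slice_lipschitz(2)[OF p, of t c] elim by (simp add: a_def)
   next
    case False
    then have "h t = ?E" using elim by (simp add: h_def)
    then show ?thesis using avg_slice_lipschitz(1)[OF p, of t c] elim by (simp add: a_def)
   qed
   finally show ?case .
  qed
 qed
 also have "... = lip_const TYPE('n) R m m' v * norm (p - p')" by (simp add: hU)
 finally show ?thesis .
qed

text \<open>Along the segment the potential differs from each end value by at most the Lipschitz
  constant times the length, hence also from their mean. Inserting this into
  \<open>gauge_line\<close> gives the error of the midpoint rule, quadratic in
  \<open>x - y\<close>.\<close>

lemma avg_gauge_phase: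
 assumes x: "norm (x - c) \<le> R" "norm (y - c) \<le> R" and t: "0 < t" "t \<le> 1"
 shows "\<bar>phase A x y - (avg_phase R (phase A) c x - avg_phase R (phase A) c y)
   - (1/2) * ((avg_gauge R B c x + avg_gauge R B c y) \<bullet> (x - y))\<bar> \<le> lip_const TYPE('n) R m m' t * (norm (x - y))^2"
proof -
 let ?p = "\<lambda>r. x + r *\<^sub>R (y - x)" and ?w = "x - y"
 let ?a = "\<lambda>p. avg_gauge R B c p"
 let ?mid = "(1/2) *\<^sub>R (?a x + ?a y)"
 have L0: "0 \<le> lip_const TYPE('n) R m m' t * norm ?w"
  using order_trans[OF norm_ge_zero avg_gauge_lipschitz[OF x t]] .
 have le: "\<bar>(?a (?p r) - ?mid) \<bullet> ?w\<bar> \<le> lip_const TYPE('n) R m m' t * (norm ?w)^2" if r: "0 \<le> r" "r \<le> 1" for r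
 proof -
  have pr: "norm (?p r - c) \<le> R"
  proof -
   have "?p r - c = (1 - r) *\<^sub>R (x - c) + r *\<^sub>R (y - c)" by (simp add: algebra_simps)
   then have "norm (?p r - c) \<le> (1 - r) * norm (x - c) + r * norm (y - c)"
    using norm_triangle_ineq[of "(1 - r) *\<^sub>R (x - c)" "r *\<^sub>R (y - c)"] r by simp
   also have "... \<le> (1 - r) * R + r * R" using r x by (intro add_mono mult_left_mono) auto
   finally show ?thesis by (simp add: algebra_simps)
  qed
  have e1: "?p r - x = r *\<^sub>R (y - x)" "?p r - y = (1 - r) *\<^sub>R (x - y)" by (simp_all add: algebra_simps)
  have "norm (?a (?p r) - ?a x) \<le> r * (lip_const TYPE('n) R m m' t * norm ?w)"
   using avg_gauge_lipschitz[OF pr x(1) t] r unfolding e1 by (simp add: norm_minus_commute mult_ac)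
  also have "... \<le> 1 * (lip_const TYPE('n) R m m' t * norm ?w)" using r L0 by (intro mult_right_mono) auto
  finally have 1: "norm (?a (?p r) - ?a x) \<le> lip_const TYPE('n) R m m' t * norm ?w" by simp
  have "norm (?a (?p r) - ?a y) \<le> (1 - r) * (lip_const TYPE('n) R m m' t * norm ?w)"
   using avg_gauge_lipschitz[OF pr x(2) t] r unfolding e1 by (simp add: mult_ac)
  also have "... \<le> 1 * (lip_const TYPE('n) R m m' t * norm ?w)" using r L0 by (intro mult_right_mono) auto
  finally have 2: "norm (?a (?p r) - ?a y) \<le> lip_const TYPE('n) R m m' t * norm ?w" by simp
  have "?a (?p r) - ?mid = (1/2) *\<^sub>R ((?a (?p r) - ?a x) + (?a (?p r) - ?a y))"
   by (rule euclidean_eqI) (simp add: inner_diff_left inner_add_left field_simps)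
  then have "norm (?a (?p r) - ?mid) \<le> (1/2) * (norm (?a (?p r) - ?a x) + norm (?a (?p r) - ?a y))"
   using norm_triangle_ineq[of "?a (?p r) - ?a x" "?a (?p r) - ?a y"] by simp
  also have "... \<le> (1/2) * (lip_const TYPE('n) R m m' t * norm ?w + lip_const TYPE('n) R m m' t * norm ?w)"
   by (intro mult_left_mono add_mono 1 2) simp
  finally have "norm (?a (?p r) - ?mid) \<le> lip_const TYPE('n) R m m' t * norm ?w" by (simp add: mult.commute)
  then have "norm (?a (?p r) - ?mid) * norm ?w \<le> (lip_const TYPE('n) R m m' t * norm ?w) * norm ?w" by (rule mult_right_mono) simp
  then show ?thesis using Cauchy_Schwarz_ineq2[of "?a (?p r) - ?mid" ?w] by (simp add: power2_eq_square mult.assoc)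
 qed
 have am: "(\<lambda>r. ?a (?p r)) \<in> bmeas unit_interval"
  unfolding avg_gauge_gi
  by (rule DU.borel_measurable_lebesgue_integral) (simp only: case_prod_unfold, intro gi_measurable; measurable)
 have di: "integrable unit_interval (\<lambda>r. (?a (?p r) - ?mid) \<bullet> ?w)"
 proof (rule U.integrable_const_bound[where B="lip_const TYPE('n) R m m' t * (norm ?w)^2"])
  show "AE r in unit_interval. norm ((?a (?p r) - ?mid) \<bullet> ?w) \<le> lip_const TYPE('n) R m m' t * (norm ?w)^2"
   using AE_unit_interval by eventually_elim (unfold real_norm_def, rule le, auto)
 qed (use am in measurable)
 have "(LINT r|unit_interval. ?a (?p r) \<bullet> ?w) = (LINT r|unit_interval. (?a (?p r) - ?mid) \<bullet> ?w + ?mid \<bullet> ?w)"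
  by (simp add: inner_diff_left)
 also have "... = (LINT r|unit_interval. (?a (?p r) - ?mid) \<bullet> ?w) + ?mid \<bullet> ?w"
  using di by (simp add: U.prob_space)
 finally have e: "phase A x y - (avg_phase R (phase A) c x - avg_phase R (phase A) c y) - (1/2) * ((?a x + ?a y) \<bullet> ?w)
  = (LINT r|unit_interval. (?a (?p r) - ?mid) \<bullet> ?w)"
  unfolding gauge_line by simp
 have "\<bar>\<integral>r. (?a (?p r) - ?mid) \<bullet> ?w \<partial>unit_interval\<bar> \<le> (LINT r|unit_interval. \<bar>(?a (?p r) - ?mid) \<bullet> ?w\<bar>)"
  by (rule integral_abs_bound)
 also have "... \<le> (LINT r|unit_interval. lip_const TYPE('n) R m m' t * (norm ?w)^2)"
 proof (rule integral_mono_AE)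
  show "AE r in unit_interval. \<bar>(?a (?p r) - ?mid) \<bullet> ?w\<bar> \<le> lip_const TYPE('n) R m m' t * (norm ?w)^2"
   using AE_unit_interval by eventually_elim (rule le, auto)
 qed (use di in \<open>auto intro: integrable_abs\<close>)
 also have "... = lip_const TYPE('n) R m m' t * (norm ?w)^2" by (simp add: U.prob_space)
 finally show ?thesis unfolding e .
qed

lemma avg_gauge_measurable: "(\<lambda>(c, x). avg_gauge R B c x) \<in> bmeas (borel \<Otimes>\<^sub>M borel)"
 unfolding avg_gauge_gi case_prod_unfold
 by (rule DU.borel_measurable_lebesgue_integral) (simp only: case_prod_unfold, intro gi_measurable; measurable)

lemma avg_phase_measurable: "(\<lambda>(c, x). avg_phase R (phase A) c x) \<in> bmeas (borel \<Otimes>\<^sub>M borel)"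
 unfolding avg_phase_def case_prod_unfold
 by (rule D.borel_measurable_lebesgue_integral) measurable

end

subsection \<open>Fourier transform of Schwartz functions\<close>

definition fourier :: "('a::euclidean_space \<Rightarrow> complex) \<Rightarrow> 'a \<Rightarrow> complex" where
 "fourier g z = (LBINT \<xi>. g \<xi> * exp (\<i> * (\<xi> \<bullet> z)))"

lemma fourier_integrand_integrable:
 fixes g :: "'a::euclidean_space \<Rightarrow> complex"
 assumes g: "integrable lborel g"
 shows "integrable lborel (\<lambda>k. g k * exp (\<i> * (k \<bullet> z)))"
 by (rule integrable_bound'[OF integrable_norm[OF g]])
  (use borel_measurable_integrable[OF g] in \<open>auto simp: norm_mult\<close>)

lemma norm_fourier_le: "norm (fourier g z) \<le> (LBINT k. norm (g k))"
proof -
 have "norm (fourier g z) \<le> (LBINT k. norm (g k * exp (\<i> * (k \<bullet> z))))"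
  unfolding fourier_def by (rule integral_norm_bound)
 then show ?thesis by (simp add: norm_mult)
qed

text \<open>The difference \<open>h (x + b) - h x\<close> has integral zero by translation
  invariance and is the integral of \<open>h'\<close> along a unit segment. Fubini and translation
  invariance again give the claim, without boundary terms at infinity.\<close>

lemma integral_directional_derivative_zero:
 fixes h h' :: "'a::euclidean_space \<Rightarrow> complex"
 assumes h: "integrable lborel h" and h': "integrable lborel h'" "continuous_on UNIV h'"
  and der: "\<And>x t. ((\<lambda>t. h (x + t *\<^sub>R b)) has_vector_derivative h' (x + t *\<^sub>R b)) (at t)"
 shows "(LBINT x. h' x) = 0"
proof -
 interpret U: prob_space unit_interval by (rule prob_space_unit_interval)
 interpret LU: pair_sigma_finite "lborel :: 'a measure" unit_interval by unfold_locales
 have [measurable]: "h' \<in> bmeas borel" by (rule borel_measurable_continuous_onI[OF h'(2)])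
 have ftc: "h (x + b) - h x = (LINT t|unit_interval. h' (x + t *\<^sub>R b))" for x
 proof -
  have "((\<lambda>t. h' (x + t *\<^sub>R b)) has_integral h (x + 1 *\<^sub>R b) - h (x + 0 *\<^sub>R b)) {0..1}"
   by (rule fundamental_theorem_of_calculus) (auto intro: has_vector_derivative_at_within der)
  then have "h (x + b) - h x = integral {0..1} (\<lambda>t. h' (x + t *\<^sub>R b))" by (simp add: integral_unique)
  also have "... = (LINT t|unit_interval. h' (x + t *\<^sub>R b))"
   by (rule integral_unit_interval, rule continuous_on_compose2[OF h'(2)]) (auto intro!: continuous_intros)
  finally show ?thesis .
 qed
 have i: "integrable (lborel \<Otimes>\<^sub>M unit_interval) (\<lambda>(x, t). h' (x + t *\<^sub>R b))"
 proof -
  interpret UL: pair_sigma_finite unit_interval "lborel :: 'a measure" by unfold_locales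
  have "integrable (unit_interval \<Otimes>\<^sub>M lborel) (\<lambda>(t, x). h' (x + t *\<^sub>R b))"
  proof (rule UL.Fubini_integrable)
   show "(\<lambda>(t, x). h' (x + t *\<^sub>R b)) \<in> bmeas (unit_interval \<Otimes>\<^sub>M lborel)" by measurable
   show "integrable unit_interval (\<lambda>t. \<integral>x. norm (case (t, x) of (t, x) \<Rightarrow> h' (x + t *\<^sub>R b)) \<partial>lborel)"
    using integral_translate[of "\<lambda>x. norm (h' x)"] by simp
   show "AE t in unit_interval. integrable lborel (\<lambda>x. case (t, x) of (t, x) \<Rightarrow> h' (x + t *\<^sub>R b))"
    using h'(1) integrable_translate[of h'] by simp
  qed
  from UL.integrable_product_swap[OF this] show ?thesis by (simp add: case_prod_unfold)
 qed
 have "0 = (LBINT x. h (x + b) - h x)"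
  using h integrable_translate[of h b] integral_translate[of h b] by (simp add: integral_diff')
 also have "... = (LINT t|unit_interval. (LBINT x. h' (x + t *\<^sub>R b)))"
  unfolding ftc by (rule LU.Fubini_integral[OF i, symmetric])
 also have "... = (LBINT x. h' x)" by (simp add: integral_translate U.prob_space[simplified])
 finally show ?thesis by simp
qed

lemma smooth_directional:
 assumes g: "smooth g" and b: "b \<in> Basis"
 shows "((\<lambda>t. g (x + t *\<^sub>R b)) has_vector_derivative pdiff b g (x + t *\<^sub>R b)) (at t)"
proof -
 have "((\<lambda>t. g (x + t *\<^sub>R b)) has_derivative (\<lambda>s. frechet_derivative g (at (x + t *\<^sub>R b)) (s *\<^sub>R b))) (at t)"
  by (rule has_derivative_compose[where f="\<lambda>t. x + t *\<^sub>R b" and g=g, OF _ smooth_has_frechet[OF g]])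
   (auto intro!: derivative_eq_intros)
 then show ?thesis
  using linear_frechet_derivative[OF smooth_differentiable[OF g]]
  by (simp add: has_vector_derivative_def pdiff_def linear_scale)
qed

lemma schwartz_integrable0:
 fixes g :: "'a::euclidean_space \<Rightarrow> complex"
 shows "g \<in> schwartz \<Longrightarrow> integrable lborel g"
 using schwartz_integrable[of g 0] by simp

lemma fourier_pdiff:
 assumes g: "g \<in> schwartz" and b: "b \<in> Basis"
 shows "fourier (pdiff b g) z = - \<i> * (z \<bullet> b) * fourier g z"
proof -
 let ?e = "\<lambda>k. exp (\<i> * (k \<bullet> z))"
 have s: "smooth g" "smooth (pdiff b g)" using g b by (auto intro: schwartz_smooth smooth_pdiff)
 have i1: "integrable lborel (\<lambda>k. g k * ?e k)" and i2: "integrable lborel (\<lambda>k. pdiff b g k * ?e k)"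
  by (intro fourier_integrand_integrable schwartz_integrable0 g schwartz_pdiff b)+
 have "(LBINT k. pdiff b g k * ?e k + (\<i> * (z \<bullet> b)) * (g k * ?e k)) = 0"
 proof (rule integral_directional_derivative_zero[OF i1, where b=b])
  show "integrable lborel (\<lambda>k. pdiff b g k * ?e k + (\<i> * (z \<bullet> b)) * (g k * ?e k))"
   by (intro integrable_add' integrable_mult_right i1 i2)
  show "continuous_on UNIV (\<lambda>k. pdiff b g k * ?e k + (\<i> * (z \<bullet> b)) * (g k * ?e k))"
   by (intro continuous_intros smooth_continuous s)
  fix x t
  have e: "((\<lambda>t. ?e (x + t *\<^sub>R b)) has_vector_derivative (\<i> * (z \<bullet> b)) * ?e (x + t *\<^sub>R b)) (at t)"
  proof -
   have "((\<lambda>t. \<i> * cplx ((x + t *\<^sub>R b) \<bullet> z)) has_vector_derivative \<i> * cplx (z \<bullet> b)) (at t)"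
    by (auto intro!: derivative_eq_intros simp: inner_add_left inner_commute has_vector_derivative_def scaleR_conv_of_real)
   from field_vector_diff_chain_at[OF this DERIV_exp] show ?thesis by (simp add: o_def)
  qed
  show "((\<lambda>t. g (x + t *\<^sub>R b) * ?e (x + t *\<^sub>R b)) has_vector_derivative
    pdiff b g (x + t *\<^sub>R b) * ?e (x + t *\<^sub>R b) + (\<i> * (z \<bullet> b)) * (g (x + t *\<^sub>R b) * ?e (x + t *\<^sub>R b))) (at t)"
   by (rule has_vector_derivative_eq_rhs[OF has_vector_derivative_mult[OF smooth_directional[OF s(1) b] e]]) (simp add: algebra_simps)
 qed
 moreover have "(LBINT k. pdiff b g k * ?e k + (\<i> * (z \<bullet> b)) * (g k * ?e k))
   = fourier (pdiff b g) z + (\<i> * (z \<bullet> b)) * fourier g z"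
  unfolding fourier_def by (subst integral_add'[OF i2 integrable_mult_right[OF i1]]) simp
 ultimately show ?thesis by (simp add: add_eq_0_iff)
qed

text \<open>The Fourier transform turns \<open>(1 - r \<partial>\<^sub>b^2)^2\<close> into multiplication by \<open>(1 + r z\<^sub>b^2)^2\<close>.\<close>

definition bessel_op :: "real \<Rightarrow> 'a::euclidean_space \<Rightarrow> ('a \<Rightarrow> 'b::real_normed_vector) \<Rightarrow> 'a \<Rightarrow> 'b" where
 "bessel_op r b g = (\<lambda>\<xi>. g \<xi> + ((- 2 * r) *\<^sub>R pdiffs [b, b] g \<xi> + r^2 *\<^sub>R pdiffs [b, b, b, b] g \<xi>))"

definition bessel_ops :: "real \<Rightarrow> 'a::euclidean_space list \<Rightarrow> ('a \<Rightarrow> 'b::real_normed_vector) \<Rightarrow> 'a \<Rightarrow> 'b" where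
 "bessel_ops r bs g = foldr (bessel_op r) bs g"

definition basis_list :: "'a::euclidean_space list" where
 "basis_list = (SOME bs. set bs = Basis \<and> distinct bs)"

lemma basis_list: "set basis_list = (Basis :: 'a::euclidean_space set)" "distinct (basis_list :: 'a list)"
 using someI_ex[OF finite_distinct_list[OF finite_Basis]] unfolding basis_list_def by blast+

lemma schwartz_pdiffs: "g \<in> schwartz \<Longrightarrow> set bs \<subseteq> Basis \<Longrightarrow> pdiffs bs g \<in> schwartz"
 by (rule pdiffs_closed[where P="\<lambda>g. g \<in> schwartz"]) (auto intro: schwartz_pdiff)

lemma bessel_op_schwartz:
 assumes "g \<in> schwartz" "b \<in> Basis" shows "bessel_op r b g \<in> schwartz"
 unfolding bessel_op_def
 by (intro schwartz_add schwartz_bounded_linear[OF bounded_linear_scaleR_right] schwartz_pdiffs)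
  (use assms in auto)

lemma bessel_ops_schwartz:
 assumes "g \<in> schwartz" "set bs \<subseteq> Basis" shows "bessel_ops r bs g \<in> schwartz"
 using assms(2) by (induction bs) (auto simp: bessel_ops_def assms(1) bessel_op_schwartz)

lemma fourier_bessel_op:
 assumes g: "g \<in> schwartz" and b: "b \<in> Basis"
 shows "fourier (bessel_op r b g) z = cplx ((1 + r * (z \<bullet> b)^2)^2) * fourier g z"
proof -
 let ?e = "\<lambda>k. exp (\<i> * (k \<bullet> z))"
 let ?w = "- \<i> * cplx (z \<bullet> b)"
 have s: "pdiff b g \<in> schwartz" "pdiff b (pdiff b g) \<in> schwartz" "pdiff b (pdiff b (pdiff b g)) \<in> schwartz"
  "pdiff b (pdiff b (pdiff b (pdiff b g))) \<in> schwartz"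
  by (intro schwartz_pdiff g b)+
 have f2: "fourier (pdiffs [b, b] g) z = ?w * (?w * fourier g z)"
  by (simp only: pdiffs_Cons pdiffs_Nil fourier_pdiff[OF s(1) b] fourier_pdiff[OF g b])
 have f4: "fourier (pdiffs [b, b, b, b] g) z = ?w * (?w * (?w * (?w * fourier g z)))"
  by (simp only: pdiffs_Cons pdiffs_Nil fourier_pdiff[OF s(3) b] fourier_pdiff[OF s(2) b] fourier_pdiff[OF s(1) b] fourier_pdiff[OF g b])
 have i: "integrable lborel (\<lambda>k. g k * ?e k)" "integrable lborel (\<lambda>k. pdiffs [b, b] g k * ?e k)" "integrable lborel (\<lambda>k. pdiffs [b, b, b, b] g k * ?e k)"
  by (intro fourier_integrand_integrable schwartz_integrable0 g schwartz_pdiffs; use b in simp)+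
 have "fourier (bessel_op r b g) z = (LBINT k. g k * ?e k + (cplx (- 2 * r) * (pdiffs [b, b] g k * ?e k)
   + cplx (r^2) * (pdiffs [b, b, b, b] g k * ?e k)))"
  unfolding fourier_def bessel_op_def scaleR_conv_of_real
  by (intro integral_cong' refl) (simp only: distrib_right mult.assoc)
 also have "... = (LBINT k. g k * ?e k) + ((LBINT k. cplx (- 2 * r) * (pdiffs [b, b] g k * ?e k))
   + (LBINT k. cplx (r^2) * (pdiffs [b, b, b, b] g k * ?e k)))"
  by (subst integral_add', rule i, intro integrable_add' integrable_mult_right i,
    subst integral_add') (intro integrable_mult_right i refl)+
 also have "... = fourier g z + (cplx (- 2 * r) * fourier (pdiffs [b, b] g) z + cplx (r^2) * fourier (pdiffs [b, b, b, b] g) z)"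
  unfolding fourier_def integral_mult_right_zero ..
 also have "... = cplx ((1 + r * (z \<bullet> b)^2)^2) * fourier g z"
  unfolding f2 f4 by (simp add: power2_eq_square algebra_simps)
 finally show ?thesis .
qed

lemma fourier_bessel_ops:
 assumes g: "g \<in> schwartz" and bs: "set bs \<subseteq> Basis" "distinct bs"
 shows "fourier (bessel_ops r bs g) z = cplx (\<Prod>b\<in>set bs. (1 + r * (z \<bullet> b)^2)^2) * fourier g z"
 using bs
proof (induction bs)
 case (Cons b bs)
 have "fourier (bessel_ops r (b # bs) g) z = fourier (bessel_op r b (bessel_ops r bs g)) z" by (simp add: bessel_ops_def)
 also have "... = cplx ((1 + r * (z \<bullet> b)^2)^2) * fourier (bessel_ops r bs g) z"
  by (rule fourier_bessel_op) (use Cons.prems in \<open>auto intro: bessel_ops_schwartz g\<close>)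
 finally show ?case using Cons by (simp add: mult.assoc)
qed (simp add: bessel_ops_def)

text \<open>The Fourier transform of \<open>bessel_ops r basis_list g\<close> is the reciprocal of
  the squared weight times that of \<open>g\<close>, and it is bounded by the L1 norm.\<close>

lemma fourier_decay:
 fixes g :: "'a::euclidean_space \<Rightarrow> complex"
 assumes g: "g \<in> schwartz" and r: "r > 0"
 shows "norm (fourier g z) \<le> (cauchy_weight (sqrt r *\<^sub>R z))^2 * (LBINT k. norm (bessel_ops r basis_list g k))"
proof -
 let ?P = "\<Prod>b\<in>Basis. (1 + r * (z \<bullet> b)^2)^2"
 have e: "fourier (bessel_ops r basis_list g) z = cplx ?P * fourier g z"
  using fourier_bessel_ops[OF g, of basis_list r z] by (simp add: basis_list)
 have P: "?P > 0" using r by (intro prod_pos zero_less_power add_pos_nonneg mult_nonneg_nonneg) auto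
 have w: "(cauchy_weight (sqrt r *\<^sub>R z))^2 = 1 / ?P"
  using r by (simp add: cauchy_weight_def prod_dividef prod_power_distrib power_mult_distrib power_divide flip: prod_inversef)
 have "?P * norm (fourier g z) = norm (fourier (bessel_ops r basis_list g) z)"
  unfolding e norm_mult norm_of_real abs_of_pos[OF P] ..
 also have "... \<le> (LBINT k. norm (bessel_ops r basis_list g k))" by (rule norm_fourier_le)
 finally show ?thesis unfolding w using P by (simp add: field_simps)
qed

lemma cauchy_weight_le_1: "cauchy_weight x \<le> 1"
 unfolding cauchy_weight_def by (rule prod_le_1) (auto simp: add_pos_nonneg)

lemma integrable_cauchy_weight2: "integrable lborel (\<lambda>x. (cauchy_weight x)^2)"
 by (rule integrable_bound'[OF integrable_cauchy_weight])
  (auto simp: power2_eq_square abs_mult abs_of_pos[OF cauchy_weight_pos] mult_left_le cauchy_weight_le_1 less_imp_le[OF cauchy_weight_pos])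

text \<open>One of the two factors absorbs \<open>(norm x)^2\<close> and the other stays integrable.
  This is why the differential operator is squared: a single power of the weight would have no
  second moment.\<close>

lemma cauchy_weight_moment: "(cauchy_weight x)^2 * (norm x)^2 \<le> real DIM('a) * cauchy_weight (x::'a::euclidean_space)"
proof -
 have "cauchy_weight x * (x \<bullet> b)^2 \<le> 1" if b: "b \<in> Basis" for b
 proof -
  have "cauchy_weight x = 1 / (1 + (x \<bullet> b)^2) * (\<Prod>b\<in>Basis - {b}. 1 / (1 + (x \<bullet> b)^2))"
   unfolding cauchy_weight_def by (rule prod.remove) (use b in auto)
  also have "... \<le> 1 / (1 + (x \<bullet> b)^2) * 1"
   by (intro mult_left_mono prod_le_1) (auto simp: add_pos_nonneg add_nonneg_nonneg)
  finally have "cauchy_weight x * (x \<bullet> b)^2 \<le> (1 / (1 + (x \<bullet> b)^2) * 1) * (x \<bullet> b)^2" by (rule mult_right_mono) simp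
  also have "... \<le> 1" by (simp add: divide_le_eq add_pos_nonneg)
  finally show ?thesis .
 qed
 then have "(\<Sum>b\<in>(Basis::'a set). cauchy_weight x * (x \<bullet> b)^2) \<le> (\<Sum>b\<in>(Basis::'a set). 1)" by (rule sum_mono)
 then have "cauchy_weight x * (norm x)^2 \<le> real DIM('a)" by (simp add: norm_sq_Basis sum_distrib_left)
 then have "cauchy_weight x * (cauchy_weight x * (norm x)^2) \<le> cauchy_weight x * real DIM('a)"
  by (rule mult_left_mono) (use cauchy_weight_pos less_imp_le in blast)
 then show ?thesis by (simp add: power2_eq_square mult_ac)
qed

lemma fourier_measurable:
 assumes "g \<in> bmeas borel" shows "fourier g \<in> bmeas borel"
proof -
 have [measurable]: "g \<in> bmeas borel" by (rule assms)
 have "(\<lambda>z. \<integral>k. g k * exp (\<i> * (k \<bullet> z)) \<partial>lborel) \<in> bmeas borel"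
  by (rule lborel.borel_measurable_lebesgue_integral) measurable
 then show ?thesis by (simp add: fourier_def[abs_def])
qed

lemma fourier_integrable:
 assumes g: "g \<in> schwartz" shows "integrable lborel (fourier g)"
proof (rule integrable_bound'[OF integrable_mult_left[OF integrable_cauchy_weight2, of "\<integral>k. norm (bessel_ops 1 basis_list g k) \<partial>lborel"]])
 show "fourier g \<in> bmeas lborel"
  using fourier_measurable[OF smooth_measurable[OF schwartz_smooth[OF g]]] by simp
 show "AE z in lborel. norm (fourier g z) \<le> norm ((cauchy_weight z)^2 * (LBINT k. norm (bessel_ops 1 basis_list g k)))"
  using fourier_decay[OF g, of 1] by (intro AE_I2) (simp add: abs_mult)
qed

section \<open>Gaussians and Fourier inversion\<close>

definition gauss :: "'a::euclidean_space \<Rightarrow> real" where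
 "gauss x = (\<Prod>b\<in>Basis. std_normal_density (x \<bullet> b))"

lemma gauss_props:
 shows gauss_integrable: "integrable lborel (gauss :: 'a::euclidean_space \<Rightarrow> real)"
  and gauss_integral: "(LBINT x. gauss (x::'a)) = 1"
  and gauss_nonneg: "0 \<le> gauss x"
proof -
 have i: "integrable lborel std_normal_density" "(LBINT x. std_normal_density x) = 1"
  by (auto intro: integrable_normal_density simp: integral_normal_density)
 show "integrable lborel (gauss :: 'a \<Rightarrow> real)"
  unfolding gauss_def[abs_def] by (rule integrable_product_Basis) (rule i)
 show "(LBINT x. gauss (x::'a)) = 1"
  unfolding gauss_def by (subst integral_product_Basis) (auto simp: i)
 show "0 \<le> gauss x" unfolding gauss_def by (intro prod_nonneg) auto
qed

lemma gauss_eq: "gauss (x::'a::euclidean_space) = exp (- (norm x)\<^sup>2 / 2) / sqrt (2 * pi) ^ DIM('a)"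
proof -
 have "gauss x = (\<Prod>b\<in>(Basis::'a set). exp (- (x \<bullet> b)\<^sup>2 / 2) / sqrt (2 * pi))"
  by (simp add: gauss_def std_normal_density_def)
 also have "... = exp (\<Sum>b\<in>(Basis::'a set). - (x \<bullet> b)\<^sup>2 / 2) / sqrt (2 * pi) ^ DIM('a)"
  by (simp add: prod_dividef exp_sum)
 also have "(\<Sum>b\<in>(Basis::'a set). - (x \<bullet> b)\<^sup>2 / 2) = - (norm x)\<^sup>2 / 2"
  by (simp add: norm_sq_Basis sum_negf sum_divide_distrib)
 finally show ?thesis .
qed

lemma fourier_gauss: "(LBINT x. cplx (gauss x) * exp (\<i> * (x \<bullet> z))) = cplx (exp (- (norm z)\<^sup>2 / 2))"
proof -
 let ?g = "\<lambda>b s. cplx (std_normal_density s) * exp (\<i> * cplx (s * (z \<bullet> b)))"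
 have e: "cplx (gauss x) * exp (\<i> * (x \<bullet> z)) = (\<Prod>b\<in>Basis. ?g b (x \<bullet> b))" for x
 proof -
  have "exp (\<i> * (x \<bullet> z)) = (\<Prod>b\<in>Basis. exp (\<i> * cplx ((x \<bullet> b) * (z \<bullet> b))))"
   by (simp add: euclidean_inner[of x z] sum_distrib_left exp_sum)
  then show ?thesis by (simp add: gauss_def prod.distrib)
 qed
 have i: "integrable lborel (?g b)" for b
 proof (rule integrable_bound')
  show "integrable lborel std_normal_density" by (rule integrable_normal_density) simp
 qed (auto simp: norm_mult)
 have v: "(LBINT s. ?g b s) = cplx (exp (- (z \<bullet> b)\<^sup>2 / 2))" for b
 proof -
  have "(LBINT s. ?g b s) = char std_normal_distribution (z \<bullet> b)"
   unfolding char_def by (subst integral_density) (auto simp: scaleR_conv_of_real mult.commute intro!: integral_cong')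
  then show ?thesis by (simp add: char_std_normal_distribution)
 qed
 have "(LBINT x. cplx (gauss x) * exp (\<i> * (x \<bullet> z))) = (\<Prod>b\<in>Basis. cplx (exp (- (z \<bullet> b)\<^sup>2 / 2)))"
  unfolding e by (subst integral_product_Basis, rule i) (simp only: v)
 also have "... = cplx (exp (\<Sum>b\<in>Basis. - (z \<bullet> b)\<^sup>2 / 2))"
  by (simp only: of_real_prod[symmetric] exp_sum[OF finite_Basis])
 also have "(\<Sum>b\<in>Basis. - (z \<bullet> b)\<^sup>2 / 2) = - (norm z)\<^sup>2 / 2"
  by (simp add: norm_sq_Basis sum_negf sum_divide_distrib)
 finally show ?thesis .
qed

text \<open>The integral of the transform is regularized by the Gaussian \<open>P\<close> at scale
  \<open>s n\<close>. Letting the scale tend to zero recovers the integral on one side; on the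
  other, Fubini turns the regularization into an average of \<open>g\<close> that concentrates at
  the origin.\<close>

lemma fourier_inversion_0:
 fixes g :: "'a::euclidean_space \<Rightarrow> complex"
 assumes g: "integrable lborel g" and F: "integrable lborel (fourier g)"
  and c: "continuous_on UNIV g" and b: "\<And>x. norm (g x) \<le> C"
 shows "(LBINT z. fourier g z) = (2 * pi) ^ DIM('a) * g 0"
proof -
 have [measurable]: "g \<in> bmeas borel" by (rule borel_measurable_continuous_onI[OF c])
 have [measurable]: "gauss \<in> bmeas (borel :: 'a measure)" using gauss_integrable borel_measurable_integrable by force
 have Fm[measurable]: "fourier g \<in> bmeas borel" by (rule fourier_measurable) measurable
 define P where "P z = exp (- (norm z)\<^sup>2 / 2)" for z :: 'a
 have [measurable]: "P \<in> bmeas borel" unfolding P_def by measurable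
 let ?c = "sqrt (2 * pi) ^ DIM('a)"
 have Pg: "P z = ?c * gauss z" for z by (simp add: P_def gauss_eq)
 have P1: "\<bar>P z\<bar> \<le> 1" for z by (simp add: P_def)
 define s where "s n = 1 / real (Suc n)" for n
 have s: "s n > 0" for n by (simp add: s_def)
 have s0: "s \<longlonglongrightarrow> 0" unfolding s_def by (rule LIMSEQ_Suc[OF lim_1_over_n])
 define I where "I n = (LBINT z. fourier g z * cplx (P (s n *\<^sub>R z)))" for n
 have lim1: "I \<longlonglongrightarrow> (LBINT z. fourier g z * 1)"
  unfolding I_def
 proof (rule integral_dominated_convergence[where w="\<lambda>z. norm (fourier g z)"])
  show "AE z in lborel. (\<lambda>n. fourier g z * cplx (P (s n *\<^sub>R z))) \<longlonglongrightarrow> fourier g z * 1"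
  proof (rule AE_I2)
   fix z :: 'a
   have "(\<lambda>n. P (s n *\<^sub>R z)) \<longlonglongrightarrow> exp (- (norm (0 *\<^sub>R z))\<^sup>2 / 2)"
    unfolding P_def by (intro tendsto_intros s0)  simp
   then have "(\<lambda>n. cplx (P (s n *\<^sub>R z))) \<longlonglongrightarrow> cplx 1" by (intro tendsto_of_real) simp
   then show "(\<lambda>n. fourier g z * cplx (P (s n *\<^sub>R z))) \<longlonglongrightarrow> fourier g z * 1" by (intro tendsto_intros) simp
  qed
  show "AE z in lborel. norm (fourier g z * cplx (P (s n *\<^sub>R z))) \<le> norm (fourier g z)" for n
   using P1 by (intro AE_I2) (simp add: norm_mult mult_left_le)
 qed (use F in auto)
 \<comment> \<open>Fubini moves the transform onto the Gaussian, which is its own transform up to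
   constants. After rescaling, the powers of \<open>s n\<close> cancel.\<close>
 have In: "I n = (2 * pi) ^ DIM('a) * (LBINT x. g (s n *\<^sub>R x) * cplx (gauss x))" for n
 proof -
  have ker: "(LBINT z. cplx (P (s n *\<^sub>R z)) * exp (\<i> * (k \<bullet> z)))
   = cplx (?c * ?c * inverse (s n) ^ DIM('a) * gauss (inverse (s n) *\<^sub>R k))" for k
  proof -
   have "(LBINT z. cplx (P (s n *\<^sub>R z)) * exp (\<i> * (k \<bullet> z)))
    = \<bar>inverse (s n)\<bar> ^ DIM('a) *\<^sub>R (LBINT z. cplx (P (s n *\<^sub>R (inverse (s n) *\<^sub>R z))) * exp (\<i> * (k \<bullet> (inverse (s n) *\<^sub>R z))))"
    by (rule integral_scale) (use s[of n] in auto)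
   also have "(LBINT z. cplx (P (s n *\<^sub>R (inverse (s n) *\<^sub>R z))) * exp (\<i> * (k \<bullet> (inverse (s n) *\<^sub>R z))))
    = (LBINT z. cplx ?c * (cplx (gauss z) * exp (\<i> * (z \<bullet> (inverse (s n) *\<^sub>R k)))))"
    using s[of n] by (intro integral_cong' refl) (simp add: Pg inner_commute)
   also have "... = cplx (?c * P (inverse (s n) *\<^sub>R k))"
    unfolding integral_mult_right_zero fourier_gauss by (simp add: P_def)
   finally show ?thesis using s[of n] by (simp add: Pg scaleR_conv_of_real mult_ac)
  qed
  have Pi: "integrable lborel (\<lambda>z. P (s n *\<^sub>R z))"
   by (rule integrable_scale) (use s[of n] gauss_integrable in \<open>auto simp: Pg[abs_def]\<close>)
  have pm: "(\<lambda>(z, k). g k * exp (\<i> * (k \<bullet> z)) * cplx (P (s n *\<^sub>R z))) \<in> bmeas (lborel \<Otimes>\<^sub>M lborel)"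
   by measurable
  have pi: "integrable (lborel \<Otimes>\<^sub>M lborel) (\<lambda>(z, k). g k * exp (\<i> * (k \<bullet> z)) * cplx (P (s n *\<^sub>R z)))"
   by (rule lborel_pair.Fubini_integrable[OF pm])
    (use Pi g in \<open>auto simp: norm_mult intro!: integrable_mult_left fourier_integrand_integrable\<close>)
  have "I n = (LBINT z. (LBINT k. g k * exp (\<i> * (k \<bullet> z)) * cplx (P (s n *\<^sub>R z))))"
   unfolding I_def fourier_def by simp
  also have "... = (LBINT k. (LBINT z. g k * exp (\<i> * (k \<bullet> z)) * cplx (P (s n *\<^sub>R z))))"
   by (rule lborel_pair.Fubini_integral[OF pi, symmetric])
  also have "... = (LBINT k. g k * (LBINT z. cplx (P (s n *\<^sub>R z)) * exp (\<i> * (k \<bullet> z))))"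
   by (simp only: integral_mult_right_zero[symmetric] mult_ac)
  also have "... = (LBINT k. g k * cplx (?c * ?c * inverse (s n) ^ DIM('a) * gauss (inverse (s n) *\<^sub>R k)))"
   unfolding ker ..
  also have "... = \<bar>s n\<bar> ^ DIM('a) *\<^sub>R (LBINT x. g (s n *\<^sub>R x) * cplx (?c * ?c * inverse (s n) ^ DIM('a) * gauss (inverse (s n) *\<^sub>R (s n *\<^sub>R x))))"
   by (rule integral_scale) (use s[of n] in auto)
  also have "... = \<bar>s n\<bar> ^ DIM('a) *\<^sub>R (LBINT x. cplx (?c * ?c * inverse (s n) ^ DIM('a)) * (g (s n *\<^sub>R x) * cplx (gauss x)))"
   using s[of n] by (simp add: mult_ac)
  also have "... = cplx (?c * ?c) * (LBINT x. g (s n *\<^sub>R x) * cplx (gauss x))"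
   unfolding integral_mult_right_zero using s[of n] by (simp add: scaleR_conv_of_real field_simps)
  also have "?c * ?c = (2 * pi) ^ DIM('a)" by (subst power_mult_distrib[symmetric]) simp
  finally show ?thesis by simp
 qed
 have lim2: "(\<lambda>n. \<integral>x. g (s n *\<^sub>R x) * cplx (gauss x) \<partial>lborel) \<longlonglongrightarrow> (LBINT x. g 0 * cplx (gauss (x::'a)))"
 proof (rule integral_dominated_convergence[where w="\<lambda>x. C * gauss x"])
  show "AE x in lborel. (\<lambda>n. g (s n *\<^sub>R x) * cplx (gauss x)) \<longlonglongrightarrow> g 0 * cplx (gauss x)"
  proof (rule AE_I2)
   fix x :: 'a
   have "(\<lambda>n. s n *\<^sub>R x) \<longlonglongrightarrow> 0 *\<^sub>R x" by (intro tendsto_intros s0)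
   then have l: "(\<lambda>n. s n *\<^sub>R x) \<longlonglongrightarrow> 0" by simp
   have "(\<lambda>n. g (s n *\<^sub>R x)) \<longlonglongrightarrow> g 0"
   proof -
    have "isCont g 0" using c by (simp add: continuous_on_eq_continuous_at)
    then show ?thesis by (rule isCont_tendsto_compose[OF _ l])
   qed
   then show "(\<lambda>n. g (s n *\<^sub>R x) * cplx (gauss x)) \<longlonglongrightarrow> g 0 * cplx (gauss x)" by (intro tendsto_intros)
  qed
  show "AE x in lborel. norm (g (s n *\<^sub>R x) * cplx (gauss x)) \<le> C * gauss x" for n
   by (intro AE_I2) (simp add: norm_mult abs_of_nonneg[OF gauss_nonneg] mult_right_mono[OF b gauss_nonneg])
 qed (use gauss_integrable in auto)
 have "I \<longlonglongrightarrow> (2 * pi) ^ DIM('a) * (LBINT x. g 0 * cplx (gauss (x::'a)))"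
  unfolding In by (intro tendsto_intros lim2)
 moreover have "(LBINT x. g 0 * cplx (gauss (x::'a))) = g 0"
  unfolding integral_mult_right_zero integral_complex_of_real gauss_integral by simp
 ultimately have "I \<longlonglongrightarrow> (2 * pi) ^ DIM('a) * g 0" by (simp only:)
 from LIMSEQ_unique[OF lim1 this] show ?thesis by simp
qed

lemma fourier_inversion:
 fixes g :: "'a::euclidean_space \<Rightarrow> complex"
 assumes g: "g \<in> schwartz"
 shows "(LBINT z. fourier g z * exp (- \<i> * (x \<bullet> z))) = (2 * pi) ^ DIM('a) * g x"
proof -
 let ?h = "\<lambda>y. g (y + x)"
 have gi: "integrable lborel g" by (rule schwartz_integrable0[OF g])
 have f: "fourier ?h z = fourier g z * exp (- \<i> * (x \<bullet> z))" for z
 proof -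
  have "fourier g z = (LBINT k. g (k + x) * exp (\<i> * ((k + x) \<bullet> z)))"
   unfolding fourier_def by (rule integral_translate[symmetric])
  also have "... = (LBINT k. exp (\<i> * (x \<bullet> z)) * (g (k + x) * exp (\<i> * (k \<bullet> z))))"
   by (simp add: inner_add_left distrib_left exp_add mult_ac)
  also have "... = exp (\<i> * (x \<bullet> z)) * fourier ?h z" unfolding fourier_def by simp
  finally show ?thesis by (simp add: exp_minus field_simps)
 qed
 obtain C where C: "\<And>y. norm (g y) \<le> C" using schwartz_bound[OF g, of 0] by auto
 have "(LBINT z. fourier ?h z) = (2 * pi) ^ DIM('a) * ?h 0"
 proof (rule fourier_inversion_0)
  show "integrable lborel ?h" using gi by (simp add: integrable_translate)
  show "integrable lborel (fourier ?h)"
   unfolding f[abs_def] using fourier_integrable[OF g]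
   by (rule integrable_bound'[OF integrable_norm])
    (use fourier_measurable[OF smooth_measurable[OF schwartz_smooth[OF g]]] in \<open>auto simp: norm_mult\<close>)
  show "continuous_on UNIV ?h"
   by (rule continuous_on_compose2[OF smooth_continuous[OF schwartz_smooth[OF g], of UNIV]]) (auto intro!: continuous_intros)
  show "norm (?h y) \<le> C" for y by (rule C)
 qed
 then show ?thesis by (simp add: f)
qed

subsection \<open>Magnetic quantization of symbols that are Fourier transforms of measures\<close>

lemma Basis_Pair_0: "b \<in> Basis \<Longrightarrow> (0, b) \<in> Basis"
 by (simp add: Basis_prod_def)

lemma pdiff_slice:
 fixes g :: "'a::euclidean_space \<times> 'b::euclidean_space \<Rightarrow> 'c::real_normed_vector"
 assumes g: "smooth g" and b: "b \<in> Basis"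
 shows "pdiff b (\<lambda>k. g (u, k)) = (\<lambda>k. pdiff (0, b) g (u, k))"
proof -
 have L: "bounded_linear (\<lambda>k. (0::'a, k::'b))"
  by (intro bounded_linear_Pair bounded_linear_zero bounded_linear_ident)
 have "pdiff b (\<lambda>k. g ((u, 0::'b) + (0::'a, k))) = (\<lambda>k. \<Sum>b'\<in>Basis. ((0::'a, b) \<bullet> b') *\<^sub>R pdiff b' g ((u, 0::'b) + (0::'a, k)))"
  by (rule pdiff_affine[OF L g])
 also have "(\<lambda>k. \<Sum>b'\<in>Basis. ((0::'a, b) \<bullet> b') *\<^sub>R pdiff b' g ((u, 0::'b) + (0::'a, k))) = (\<lambda>k. \<Sum>b'\<in>Basis. if b' = (0::'a, b) then pdiff (0, b) g (u, k) else 0)"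
  by (intro ext sum.cong) (auto simp: inner_Basis[OF Basis_Pair_0[OF b]])
 also have "... = (\<lambda>k. pdiff (0, b) g (u, k))" by (simp add: Basis_Pair_0[OF b])
 finally show ?thesis by simp
qed

lemma smooth_slice:
 fixes g :: "'a::euclidean_space \<times> 'b::euclidean_space \<Rightarrow> 'c::real_normed_vector"
 assumes g: "smooth g" shows "smooth (\<lambda>k. g (u, k))"
proof -
 have L: "bounded_linear (\<lambda>k. (0::'a, k::'b))"
  by (intro bounded_linear_Pair bounded_linear_zero bounded_linear_ident)
 from smooth_affine[OF L g, of "(u, 0)"] show ?thesis by simp
qed

lemma pdiffs_slice:
 fixes g :: "'a::euclidean_space \<times> 'b::euclidean_space \<Rightarrow> 'c::real_normed_vector"
 assumes g: "smooth g" and bs: "set bs \<subseteq> Basis"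
 shows "pdiffs bs (\<lambda>k. g (u, k)) = (\<lambda>k. pdiffs (map (Pair 0) bs) g (u, k))"
 using bs
proof (induction bs)
 case (Cons b bs)
 have s: "smooth (pdiffs (map (Pair 0) bs) g)"
  by (rule smooth_pdiffs[OF g]) (use Cons.prems Basis_Pair_0 in auto)
 show ?case using Cons pdiff_slice[OF s] by (simp add: pdiffs_Cons)
qed simp

lemma schwartz_slice:
 fixes g :: "'a::euclidean_space \<times> 'b::euclidean_space \<Rightarrow> 'c::real_normed_vector"
 assumes g: "g \<in> schwartz" shows "(\<lambda>k. g (u, k)) \<in> schwartz"
 unfolding schwartz_def
proof (intro CollectI conjI allI impI)
 show "smooth (\<lambda>k. g (u, k))" by (rule smooth_slice[OF schwartz_smooth[OF g]])
 fix bs :: "'b list" and N :: nat assume bs: "set bs \<subseteq> Basis"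
 have "set (map (Pair (0::'a)) bs) \<subseteq> Basis" using bs Basis_Pair_0 by auto
 then obtain C where C: "\<And>x. norm x ^ N * norm (pdiffs (map (Pair 0) bs) g x) \<le> C"
  using g unfolding schwartz_def by blast
 have "norm k ^ N * norm (pdiffs bs (\<lambda>k. g (u, k)) k) \<le> C" for k
 proof -
  have "norm k \<le> norm (u, k)" by (simp add: norm_Pair real_le_rsqrt)
  then have "norm k ^ N * norm (pdiffs (map (Pair 0) bs) g (u, k)) \<le> norm (u, k) ^ N * norm (pdiffs (map (Pair 0) bs) g (u, k))"
   by (intro mult_right_mono power_mono) auto
  also have "... \<le> C" by (rule C)
  finally show ?thesis by (simp add: pdiffs_slice[OF schwartz_smooth[OF g] bs])
 qed
 then show "\<exists>C. \<forall>x. norm x ^ N * norm (pdiffs bs (\<lambda>k. g (u, k)) x) \<le> C" by blast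
qed

lemma schwartz_slice_bound:
 fixes g :: "'a::euclidean_space \<times> 'b::euclidean_space \<Rightarrow> 'c::real_normed_vector"
 assumes g: "g \<in> schwartz"
 shows "\<exists>C\<ge>0. \<forall>u k. norm (g (u, k)) \<le> C * cauchy_weight k"
proof -
 obtain C where C: "C \<ge> 0" "\<And>x. (1 + norm x) ^ (2 * DIM('b)) * norm (g x) \<le> C"
  using schwartz_bound[OF g] by blast
 have "norm (g (u, k)) \<le> C * cauchy_weight k" for u k
 proof -
  have "norm k \<le> norm (u, k)" by (simp add: norm_Pair real_le_rsqrt)
  then have "(1 + norm k) ^ (2 * DIM('b)) * norm (g (u, k)) \<le> (1 + norm (u, k)) ^ (2 * DIM('b)) * norm (g (u, k))"
   by (intro mult_right_mono power_mono) auto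
  also have "... \<le> C" by (rule C)
  finally have "norm (g (u, k)) \<le> C * (1 / (1 + norm k) ^ (2 * DIM('b)))"
   by (simp add: pos_le_divide_eq add_pos_nonneg mult.commute)
  also have "... \<le> C * cauchy_weight k" by (rule mult_left_mono[OF cauchy_weight_ge C(1)])
  finally show ?thesis .
 qed
 with C(1) show ?thesis by blast
qed

lemma bessel_ops_slice:
 fixes g :: "'a::euclidean_space \<times> 'b::euclidean_space \<Rightarrow> complex"
 assumes g: "g \<in> schwartz" and bs: "set bs \<subseteq> Basis"
 shows "bessel_ops r bs (\<lambda>k. g (u, k)) = (\<lambda>k. bessel_ops r (map (Pair 0) bs) g (u, k))"
 using bs
proof (induction bs)
 case (Cons b bs)
 let ?h = "bessel_ops r (map (Pair 0) bs) g"
 have s: "smooth ?h"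
  by (intro schwartz_smooth bessel_ops_schwartz g) (use Cons.prems Basis_Pair_0 in auto)
 have "bessel_ops r (b # bs) (\<lambda>k. g (u, k)) = bessel_op r b (\<lambda>k. ?h (u, k))"
  using Cons by (simp add: bessel_ops_def)
 also have "... = (\<lambda>k. bessel_op r (0, b) ?h (u, k))"
  unfolding bessel_op_def
  using pdiffs_slice[OF s, of "[b, b]" u] pdiffs_slice[OF s, of "[b, b, b, b]" u] Cons.prems by simp
 finally show ?case by (simp add: bessel_ops_def)
qed (simp add: bessel_ops_def)

text \<open>The cut-offs of an oscillatory integral are arbitrary Schwartz functions on phase space
  and need not factor. Decay of the partial transform that is uniform in the position variable is
  what dominated convergence requires.\<close>

lemma fourier_slice_bound:
 fixes g :: "'a::euclidean_space \<times> 'b::euclidean_space \<Rightarrow> complex"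
 assumes g: "g \<in> schwartz"
 shows "\<exists>C\<ge>0. \<forall>u v. norm (fourier (\<lambda>k. g (u, k)) v) \<le> C * (cauchy_weight v)^2"
proof -
 let ?h = "bessel_ops 1 (map (Pair 0) (basis_list :: 'b list)) g"
 have h: "?h \<in> schwartz"
  by (rule bessel_ops_schwartz[OF g]) (use basis_list Basis_Pair_0 in auto)
 obtain C where C: "C \<ge> 0" "\<And>u k. norm (?h (u, k)) \<le> C * cauchy_weight k"
  using schwartz_slice_bound[OF h] by blast
 define I :: real where "I = (LINT k|(lborel :: 'b measure). cauchy_weight k)"
 have "norm (fourier (\<lambda>k. g (u, k)) v) \<le> (C * I) * (cauchy_weight v)^2" for u v
 proof -
  have "norm (fourier (\<lambda>k. g (u, k)) v) \<le> (cauchy_weight v)^2 * (LBINT k. norm (?h (u, k)))"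
   using fourier_decay[OF schwartz_slice[OF g], of 1 u v] bessel_ops_slice[OF g, of basis_list 1 u] by (simp add: basis_list)
  moreover have "(LBINT k. norm (?h (u, k))) \<le> (LINT k|(lborel :: 'b measure). C * cauchy_weight k)"
   by (intro integral_mono integrable_norm schwartz_integrable0 schwartz_slice h integrable_mult_right integrable_cauchy_weight C)
  moreover have "(LINT k|(lborel :: 'b measure). C * cauchy_weight k) = C * I" by (simp add: I_def)
  ultimately show ?thesis
   by (metis (no_types, lifting) mult.commute mult_left_mono order_trans zero_le_power2)
 qed
 moreover have "C * I \<ge> 0"
  unfolding I_def using C(1) cauchy_weight_pos by (intro mult_nonneg_nonneg integral_nonneg') (auto intro: less_imp_le)
 ultimately show ?thesis by blast
qed

lemma fourier_slice_tendsto: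
 fixes g :: "'a::euclidean_space \<times> 'b::euclidean_space \<Rightarrow> complex"
 assumes g: "g \<in> schwartz" and u: "u \<longlonglongrightarrow> u0"
 shows "(\<lambda>n. fourier (\<lambda>k. g (u n, k)) v) \<longlonglongrightarrow> fourier (\<lambda>k. g (u0, k)) v"
proof -
 obtain C where C: "C \<ge> 0" "\<And>u k. norm (g (u, k)) \<le> C * cauchy_weight k"
  using schwartz_slice_bound[OF g] by blast
 have m[measurable]: "(\<lambda>k. g (u, k)) \<in> bmeas borel" for u
  by (rule smooth_measurable[OF smooth_slice[OF schwartz_smooth[OF g]]])
 show ?thesis
  unfolding fourier_def
 proof (rule integral_dominated_convergence[where w="\<lambda>k. C * cauchy_weight k"])
  show "AE k in lborel. (\<lambda>n. g (u n, k) * exp (\<i> * (k \<bullet> v))) \<longlonglongrightarrow> g (u0, k) * exp (\<i> * (k \<bullet> v))"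
  proof (rule AE_I2)
   fix k
   have "isCont g (u0, k)"
    using smooth_continuous[OF schwartz_smooth[OF g], of UNIV] by (simp add: continuous_on_eq_continuous_at)
   then have "(\<lambda>n. g (u n, k)) \<longlonglongrightarrow> g (u0, k)"
    by (rule isCont_tendsto_compose) (intro tendsto_intros u)
   then show "(\<lambda>n. g (u n, k) * exp (\<i> * (k \<bullet> v))) \<longlonglongrightarrow> g (u0, k) * exp (\<i> * (k \<bullet> v))" by (intro tendsto_intros)
  qed
  show "AE k in lborel. norm (g (u n, k) * exp (\<i> * (k \<bullet> v))) \<le> C * cauchy_weight k" for n
   using C(2) by (simp add: norm_mult)
 qed (auto intro: integrable_cauchy_weight)
qed

text \<open>The representation of the symbol as a superposition of characters of the momentum.
  Continuity of \<open>\<kappa>\<close> in the position is there for the pointwise limit in the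
  oscillatory integral.\<close>

locale symbol_rep = kernel_op M z b for M :: "'w measure" and z :: "'w \<Rightarrow> real ^ 'n" and b +
 fixes F :: "(real ^ 'n) \<times> (real ^ 'n) \<Rightarrow> real" and \<kappa> :: "real ^ 'n \<Rightarrow> 'w \<Rightarrow> complex"
 assumes \<kappa>_meas: "(\<lambda>(x, w). \<kappa> x w) \<in> bmeas (lborel \<Otimes>\<^sub>M M)"
  and \<kappa>_cont: "\<And>w. continuous_on UNIV (\<lambda>x. \<kappa> x w)"
  and \<kappa>_le: "\<And>x w. norm (\<kappa> x w) \<le> b w"
  and rep: "\<And>x \<xi>. cplx (F (x, \<xi>)) = (LINT w|M. \<kappa> x w * exp (- \<i> * (\<xi> \<bullet> z w)))"
begin

text \<open>The argument \<open>x - (1/2) *\<^sub>R z w\<close> is the midpoint of \<open>x\<close>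
  and \<open>x - z w\<close>, as Weyl quantization prescribes.\<close>

definition mkernel :: "(real ^ 'n \<Rightarrow> real ^ 'n \<Rightarrow> real) \<Rightarrow> real ^ 'n \<Rightarrow> 'w \<Rightarrow> complex" where
 "mkernel \<theta> x w = \<kappa> (x - (1/2) *\<^sub>R z w) w * exp (\<i> * \<theta> x (x - z w))"

lemma \<kappa>_measurable_compose:
 assumes "f \<in> bmeas N" "g \<in> N \<rightarrow>\<^sub>M M"
 shows "(\<lambda>p. \<kappa> (f p) (g p)) \<in> bmeas N"
proof -
 have "(\<lambda>p. (f p, g p)) \<in> N \<rightarrow>\<^sub>M (lborel \<Otimes>\<^sub>M M)" using assms by simp
 from measurable_compose[OF this \<kappa>_meas] show ?thesis by simp
qed

lemma phase_measurable_compose: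
 fixes t :: "real ^ 'n \<Rightarrow> real ^ 'n \<Rightarrow> real"
 assumes t: "continuous_on UNIV (\<lambda>(x, y). t x y)" and f: "f \<in> bmeas N" and g: "g \<in> bmeas N"
 shows "(\<lambda>p. t (f p) (g p)) \<in> bmeas N"
 using measurable_compose[OF borel_measurable_Pair[OF f g] borel_measurable_continuous_onI[OF t]] by simp

lemma mkernel_admissible:
 assumes t: "continuous_on UNIV (\<lambda>(x, y). t x y)"
 shows "admissible (mkernel t)"
 unfolding admissible_def
proof (intro conjI allI)
 have [measurable]: "(\<lambda>p. t (fst p) (fst p - z (snd p))) \<in> bmeas (lborel \<Otimes>\<^sub>M M)"
  by (rule phase_measurable_compose[OF t]) measurable
 have [measurable]: "(\<lambda>p. \<kappa> (fst p - (1/2) *\<^sub>R z (snd p)) (snd p)) \<in> bmeas (lborel \<Otimes>\<^sub>M M)"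
  by (rule \<kappa>_measurable_compose) measurable
 show "(\<lambda>(x, w). mkernel t x w) \<in> bmeas (lborel \<Otimes>\<^sub>M M)"
  unfolding mkernel_def case_prod_unfold by measurable
 show "norm (mkernel t x w) \<le> b w" for x w using \<kappa>_le by (simp add: mkernel_def norm_mult)
qed

text \<open>Integrating over the momentum first turns the cut-off into its partial Fourier
  transform, a kernel of width \<open>c\<close> in the position variable centred at
  \<open>x - z w\<close>. As \<open>c\<close> tends to zero it concentrates there and the
  translation operator appears.\<close>

lemma osc_limit:
 fixes j :: "(real ^ 'n) \<times> (real ^ 'n) \<Rightarrow> complex"
 assumes P: "continuous_on UNIV (\<lambda>(x, y). P x y)" and f: "f \<in> schwartz"
  and j: "j \<in> schwartz" "j 0 = 1"
 shows "((\<lambda>c::real. \<integral>p. j (c *\<^sub>R p) * (case p of (y, l) \<Rightarrow> exp (\<i> * (l \<bullet> (x - y))) * exp (\<i> * P x y) *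
   of_real (F ((1/2) *\<^sub>R (x + y), l)) * f y) \<partial>lborel) \<longlongrightarrow> (2 * pi) ^ CARD('n) * kop (mkernel P) f x) (at_right 0)"
proof -
 define g where "g y = exp (\<i> * P x y) * f y" for y
 obtain Cf where Cf: "Cf \<ge> 0" "\<And>y. norm (f y) \<le> Cf" using schwartz_bound[OF f, of 0] by auto
 have fc: "continuous_on UNIV f" by (rule smooth_continuous[OF schwartz_smooth[OF f]])
 have gc: "continuous_on UNIV g"
 proof -
  have "continuous_on UNIV (\<lambda>y. P x y)"
   using continuous_on_compose2[OF P continuous_on_Pair[OF continuous_on_const[of UNIV x] continuous_on_id]] by simp
  then show ?thesis unfolding g_def by (intro continuous_intros fc)
 qed
 have gm[measurable]: "g \<in> bmeas borel" by (rule borel_measurable_continuous_onI[OF gc])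
 have gle: "norm (g y) \<le> Cf" for y using Cf by (simp add: g_def norm_mult)
 have jc: "continuous_on UNIV j" by (rule smooth_continuous[OF schwartz_smooth[OF j(1)]])
 have jm[measurable]: "j \<in> bmeas borel" by (rule borel_measurable_continuous_onI[OF jc])
 define a where "a u v = fourier (\<lambda>l. j (u, l)) (- v)" for u v
 obtain C where C: "C \<ge> 0" "\<And>u v. norm (a u v) \<le> C * (cauchy_weight v)^2"
 proof -
  obtain C where C: "C \<ge> 0" "\<And>u v. norm (fourier (\<lambda>l. j (u, l)) v) \<le> C * (cauchy_weight v)^2"
   using fourier_slice_bound[OF j(1)] by blast
  have "cauchy_weight (- v) = cauchy_weight v" for v :: "real ^ 'n" by (simp add: cauchy_weight_def)
  then show thesis using C that[of C] by (metis a_def)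
 qed
 have am: "(\<lambda>p. a (h p) (k p)) \<in> bmeas N" if [measurable]: "h \<in> bmeas N" "k \<in> bmeas N" for h k and N :: "'c measure"
 proof -
  have "(\<lambda>p. \<integral>l. j (h p, l) * exp (\<i> * (l \<bullet> - k p)) \<partial>lborel) \<in> bmeas N"
   by (rule lborel.borel_measurable_lebesgue_integral) measurable
  then show ?thesis by (simp add: a_def fourier_def)
 qed
 \<comment> \<open>By Fourier inversion the total mass of the concentrating kernel is determined by
   the value of the cut-off at the origin alone, so the limit is the same for all cut-offs.\<close>
 have a0: "(LBINT v. a 0 v) = (2 * pi) ^ CARD('n)"
 proof -
  have s: "(\<lambda>l. j (0, l)) \<in> schwartz" by (rule schwartz_slice[OF j(1)])
  have "(LBINT v. a 0 v) = (LBINT v. fourier (\<lambda>l. j (0, l)) v)"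
   unfolding a_def by (rule lborel_reflect[OF fourier_measurable[OF smooth_measurable[OF schwartz_smooth[OF s]]]])
  also have "... = (2 * pi) ^ CARD('n)"
   using fourier_inversion[OF s, of 0] j(2) by (simp add: zero_prod_def)
  finally show ?thesis .
 qed
 define I where "I c = (LBINT p. j (c *\<^sub>R p) * (case p of (y, l) \<Rightarrow> exp (\<i> * (l \<bullet> (x - y))) * exp (\<i> * P x y) *
   of_real (F ((1/2) *\<^sub>R (x + y), l)) * f y))" for c :: real
 \<comment> \<open>This is the integrand after rescaling the momentum by \<open>1 / c\<close> and
   substituting \<open>x - z w + c *\<^sub>R v\<close> for the position; the two Jacobians cancel,
   and a majorant independent of \<open>c\<close> exists.\<close>
 define Q where "Q c w v = g (x - z w + c *\<^sub>R v) * \<kappa> ((1/2) *\<^sub>R (x + (x - z w + c *\<^sub>R v))) w * a (c *\<^sub>R (x - z w + c *\<^sub>R v)) v" for c w v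
 have I_eq: "I c = (LINT w|M. (LBINT v. Q c w v))" and Jm: "(\<lambda>w. \<integral>v. Q c w v \<partial>lborel) \<in> bmeas M" if c: "c > 0" for c
 proof -
  interpret PM: pair_sigma_finite "lborel :: ((real ^ 'n) \<times> (real ^ 'n)) measure" M
   by (rule pair_sigma_finite.intro[OF sigma_finite_lborel sigma_finite_M])
  define H where "H p w = j (c *\<^sub>R p) * (exp (\<i> * (snd p \<bullet> (x - fst p))) * g (fst p)) * (\<kappa> ((1/2) *\<^sub>R (x + fst p)) w * exp (- \<i> * (snd p \<bullet> z w)))" for p w
  have Hm: "(\<lambda>(p, w). H p w) \<in> bmeas (lborel \<Otimes>\<^sub>M M)"
  proof -
   define Y S where "Y q = fst (fst q)" and "S q = snd (fst q)" for q :: "((real ^ 'n) \<times> (real ^ 'n)) \<times> 'w"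
   have [measurable]: "Y \<in> bmeas (lborel \<Otimes>\<^sub>M M)" "S \<in> bmeas (lborel \<Otimes>\<^sub>M M)"
    unfolding Y_def S_def
    by (rule measurable_compose[OF measurable_fst], simp add: borel_measurable_continuous_onI continuous_on_fst continuous_on_snd)+
   have "(\<lambda>q. j (c *\<^sub>R fst q) * (exp (\<i> * (S q \<bullet> (x - Y q))) * g (Y q)) *
     (\<kappa> ((1/2) *\<^sub>R (x + Y q)) (snd q) * exp (- \<i> * (S q \<bullet> z (snd q))))) \<in> bmeas (lborel \<Otimes>\<^sub>M M)"
    using \<kappa>_measurable_compose[of "\<lambda>q. (1/2) *\<^sub>R (x + Y q)" "lborel \<Otimes>\<^sub>M M" snd] by measurable
   then show ?thesis unfolding H_def case_prod_unfold Y_def S_def .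
  qed
  have ji: "integrable lborel (\<lambda>p. j (c *\<^sub>R p))"
   by (rule integrable_scale) (use c schwartz_integrable0[OF j(1)] in auto)
  have Hle: "norm (H p w) \<le> norm (j (c *\<^sub>R p)) * Cf * b w" for p w
   unfolding H_def norm_mult using gle \<kappa>_le b_nonneg Cf(1)
   by (auto simp: mult.assoc intro!: mult_left_mono mult_mono)
  have dom: "integrable (lborel \<Otimes>\<^sub>M M) (\<lambda>(p, w). norm (j (c *\<^sub>R p)) * Cf * b w)"
  proof (rule PM.Fubini_integrable)
   show "(\<lambda>(p, w). norm (j (c *\<^sub>R p)) * Cf * b w) \<in> bmeas (lborel \<Otimes>\<^sub>M M)" by measurable
   show "AE p in lborel. integrable M (\<lambda>w. case (p, w) of (p, w) \<Rightarrow> norm (j (c *\<^sub>R p)) * Cf * b w)"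
    using b_integrable by simp
   show "integrable lborel (\<lambda>p. \<integral>w. norm (case (p, w) of (p, w) \<Rightarrow> norm (j (c *\<^sub>R p)) * Cf * b w) \<partial>M)"
    using ji Cf(1) b_nonneg by (simp add: abs_mult)
  qed
  have Hi: "integrable (lborel \<Otimes>\<^sub>M M) (\<lambda>(p, w). H p w)"
   by (rule integrable_bound'[OF dom Hm])
    (auto intro: order_trans[OF Hle abs_ge_self])
  have "I c = (LBINT p. (LINT w|M. H p w))"
   unfolding I_def
  proof (rule integral_cong'[OF refl])
   fix p :: "(real ^ 'n) \<times> (real ^ 'n)"
   have "(LINT w|M. H p w) = j (c *\<^sub>R p) * (exp (\<i> * (snd p \<bullet> (x - fst p))) * g (fst p)) * (LINT w|M. \<kappa> ((1/2) *\<^sub>R (x + fst p)) w * exp (- \<i> * (snd p \<bullet> z w)))"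
    unfolding H_def integral_mult_right_zero ..
   then show "j (c *\<^sub>R p) * (case p of (y, l) \<Rightarrow> exp (\<i> * (l \<bullet> (x - y))) * exp (\<i> * P x y) *
    of_real (F ((1/2) *\<^sub>R (x + y), l)) * f y) = (LINT w|M. H p w)"
    unfolding rep[symmetric] g_def by (simp add: case_prod_unfold mult_ac)
  qed
  also have "... = (LINT w|M. (LBINT p. H p w))"
   by (rule PM.Fubini_integral[OF Hi, symmetric])
  finally have I1: "I c = (LINT w|M. (LBINT p. H p w))" .
  have H1: "(LBINT p. H p w) = (LBINT v. Q c w v)" if w: "w \<in> space M" for w
  proof -
   define Y where "Y y = g y * \<kappa> ((1/2) *\<^sub>R (x + y)) w" for y
   have \<kappa>m[measurable]: "(\<lambda>y. \<kappa> y w) \<in> bmeas borel" by (rule borel_measurable_continuous_onI[OF \<kappa>_cont])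
   have Ym[measurable]: "Y \<in> bmeas borel" unfolding Y_def by measurable
   have e: "H p w = j (c *\<^sub>R p) * Y (fst p) * exp (\<i> * (snd p \<bullet> (x - z w - fst p)))" for p
    unfolding H_def Y_def by (simp add: inner_diff_right algebra_simps flip: exp_add)
   have Hm': "(\<lambda>p. H p w) \<in> bmeas lborel"
   proof -
    define q r where "q p = fst p" and "r p = snd p" for p :: "(real ^ 'n) \<times> (real ^ 'n)"
    have [measurable]: "q \<in> bmeas borel" "r \<in> bmeas borel"
     unfolding q_def r_def by (simp_all add: borel_measurable_continuous_onI continuous_on_fst continuous_on_snd)
    have "(\<lambda>p. j (c *\<^sub>R p) * Y (q p) * exp (\<i> * (r p \<bullet> (x - z w - q p)))) \<in> bmeas borel"
     by measurable
    then show ?thesis unfolding e q_def r_def by simp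
   qed
   have Hi': "integrable lborel (\<lambda>p. H p w)"
   proof (rule integrable_bound'[OF integrable_mult_left[OF integrable_norm[OF ji], of "Cf * b w"] Hm'])
    show "AE p in lborel. norm (H p w) \<le> norm (norm (j (c *\<^sub>R p)) * (Cf * b w))"
     using Hle Cf(1) b_nonneg by (intro AE_I2) (simp add: mult.assoc)
   qed
   have "(LBINT p. H p w) = (LBINT y. (LBINT l. H (y, l) w))"
    using lborel_pair.integral_fst'[of "\<lambda>p. H p w"] Hi' by (simp add: lborel_prod)
   also have "... = (LBINT y. Y y * (inverse c ^ CARD('n) * a (c *\<^sub>R y) ((1/c) *\<^sub>R (y - x + z w))))"
   proof (rule integral_cong'[OF refl])
    fix y :: "real ^ 'n"
    have "(LBINT l. H (y, l) w) = (LBINT l. Y y * (j (c *\<^sub>R y, c *\<^sub>R l) * exp (\<i> * (l \<bullet> (x - z w - y)))))"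
     unfolding e by (simp add: mult_ac)
    also have "... = Y y * (LBINT l. j (c *\<^sub>R y, c *\<^sub>R l) * exp (\<i> * (l \<bullet> (x - z w - y))))" by (rule integral_mult_right_zero)
    also have "(LBINT l. j (c *\<^sub>R y, c *\<^sub>R l) * exp (\<i> * (l \<bullet> (x - z w - y))))
     = \<bar>inverse c\<bar> ^ CARD('n) *\<^sub>R (LBINT l. j (c *\<^sub>R y, c *\<^sub>R (inverse c *\<^sub>R l)) * exp (\<i> * ((inverse c *\<^sub>R l) \<bullet> (x - z w - y))))"
     by (subst integral_scale[of "inverse c"]) (use c in auto)
    also have "(LBINT l. j (c *\<^sub>R y, c *\<^sub>R (inverse c *\<^sub>R l)) * exp (\<i> * ((inverse c *\<^sub>R l) \<bullet> (x - z w - y))))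
     = a (c *\<^sub>R y) ((1/c) *\<^sub>R (y - x + z w))"
    proof -
     have "(inverse c *\<^sub>R l) \<bullet> (x - z w - y) = l \<bullet> - ((1/c) *\<^sub>R (y - x + z w))" for l
      by (simp add: inner_diff_right inner_add_right inverse_eq_divide algebra_simps)
     then show ?thesis using c by (simp add: a_def fourier_def)
    qed
    finally show "(LBINT l. H (y, l) w) = Y y * (inverse c ^ CARD('n) * a (c *\<^sub>R y) ((1/c) *\<^sub>R (y - x + z w)))"
     using c by (simp add: scaleR_conv_of_real)
   qed
   also have "... = (LBINT y. Y (y + (x - z w)) * (inverse c ^ CARD('n) * a (c *\<^sub>R (y + (x - z w))) ((1/c) *\<^sub>R (y + (x - z w) - x + z w))))"
    by (rule integral_translate[symmetric])
   also have "... = \<bar>c\<bar> ^ CARD('n) *\<^sub>R (LBINT v. Y (c *\<^sub>R v + (x - z w)) * (inverse c ^ CARD('n) * a (c *\<^sub>R (c *\<^sub>R v + (x - z w))) ((1/c) *\<^sub>R (c *\<^sub>R v + (x - z w) - x + z w))))"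
    by (subst integral_scale[of c]) (use c in \<open>auto intro!: borel_measurable_times am\<close>)
   also have "... = \<bar>c\<bar> ^ CARD('n) *\<^sub>R (LBINT v. inverse c ^ CARD('n) * Q c w v)"
    using c by (simp add: Q_def Y_def add.commute mult_ac)
   also have "... = (LBINT v. Q c w v)"
    unfolding integral_mult_right_zero using c by (simp add: scaleR_conv_of_real flip: mult.assoc power_mult_distrib of_real_mult of_real_power)
   finally show ?thesis .
  qed
  show "I c = (LINT w|M. (LBINT v. Q c w v))" unfolding I1 by (rule integral_cong'[OF refl H1])
  have "(\<lambda>w. \<integral>p. H p w \<partial>lborel) \<in> bmeas M" by (rule borel_measurable_integrable[OF PM.integrable_snd[OF Hi]])
  then show "(\<lambda>w. \<integral>v. Q c w v \<partial>lborel) \<in> bmeas M"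
   by (subst measurable_cong[where g="\<lambda>w. \<integral>p. H p w \<partial>lborel"]) (auto simp: H1)
 qed
 define W :: real where "W = (LINT v|(lborel :: (real ^ 'n) measure). (cauchy_weight v)^2)"
 have Qle: "norm (Q c w v) \<le> Cf * b w * (C * (cauchy_weight v)^2)" for c w v
  unfolding Q_def norm_mult using gle \<kappa>_le C Cf(1) b_nonneg by (intro mult_mono) auto
 have seq: "(\<lambda>n. I (d n)) \<longlonglongrightarrow> (2 * pi) ^ CARD('n) * kop (mkernel P) f x" if d: "\<And>n. d n > 0" "d \<longlonglongrightarrow> 0" for d :: "nat \<Rightarrow> real"
 proof -
  have Qm: "(\<lambda>v. Q c w v) \<in> bmeas lborel" for c w
  proof -
   have [measurable]: "(\<lambda>y. \<kappa> y w) \<in> bmeas borel" by (rule borel_measurable_continuous_onI[OF \<kappa>_cont])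
   have [measurable]: "(\<lambda>v. a (c *\<^sub>R (x - z w + c *\<^sub>R v)) v) \<in> bmeas borel" by (rule am) measurable
   show ?thesis unfolding Q_def by measurable
  qed
  have a0m: "(\<lambda>v. a 0 v) \<in> bmeas lborel"
   unfolding a_def
   using measurable_compose[OF borel_measurable_uminus[OF measurable_ident] fourier_measurable[OF smooth_measurable[OF smooth_slice[OF schwartz_smooth[OF j(1)], of 0]]]]
   by simp
  have dom: "integrable lborel (\<lambda>v. Cf * b w * (C * (cauchy_weight (v :: real ^ 'n))^2))" for w
   by (intro integrable_mult_right integrable_cauchy_weight2)
  have inner: "(\<lambda>n. \<integral>v. Q (d n) w v \<partial>lborel) \<longlonglongrightarrow> (2 * pi) ^ CARD('n) * (mkernel P x w * f (x - z w))" for w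
  proof -
   have "(\<lambda>n. \<integral>v. Q (d n) w v \<partial>lborel) \<longlonglongrightarrow> (LBINT v. g (x - z w) * \<kappa> ((1/2) *\<^sub>R (x + (x - z w))) w * a 0 v)"
   proof (rule integral_dominated_convergence[where w="\<lambda>v. Cf * b w * (C * (cauchy_weight v)^2)"])
    show "(\<lambda>v. Q (d n) w v) \<in> bmeas lborel" for n by (rule Qm)
    show "integrable lborel (\<lambda>v. Cf * b w * (C * (cauchy_weight (v :: real ^ 'n))^2))" by (rule dom)
    show "(\<lambda>v. g (x - z w) * \<kappa> ((1/2) *\<^sub>R (x + (x - z w))) w * a 0 v) \<in> bmeas lborel"
     by (rule borel_measurable_times[OF borel_measurable_const a0m])
    show "AE v in lborel. (\<lambda>n. Q (d n) w v) \<longlonglongrightarrow> g (x - z w) * \<kappa> ((1/2) *\<^sub>R (x + (x - z w))) w * a 0 v"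
    proof (rule AE_I2)
     fix v :: "real ^ 'n"
     have t: "(\<lambda>n. x - z w + d n *\<^sub>R v) \<longlonglongrightarrow> x - z w + 0 *\<^sub>R v" by (intro tendsto_intros d)
     have t1: "(\<lambda>n. g (x - z w + d n *\<^sub>R v)) \<longlonglongrightarrow> g (x - z w)"
      using isCont_tendsto_compose[OF _ t, of g] gc by (simp add: continuous_on_eq_continuous_at)
     have t2: "(\<lambda>n. \<kappa> ((1/2) *\<^sub>R (x + (x - z w + d n *\<^sub>R v))) w) \<longlonglongrightarrow> \<kappa> ((1/2) *\<^sub>R (x + (x - z w))) w"
     proof (rule isCont_tendsto_compose[where f="\<lambda>n. (1/2) *\<^sub>R (x + (x - z w + d n *\<^sub>R v))"])
      show "isCont (\<lambda>x. \<kappa> x w) ((1/2) *\<^sub>R (x + (x - z w)))" using \<kappa>_cont[of w] by (simp add: continuous_on_eq_continuous_at)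
      have "(\<lambda>n. (1/2) *\<^sub>R (x + (x - z w + d n *\<^sub>R v))) \<longlonglongrightarrow> (1/2) *\<^sub>R (x + (x - z w + 0 *\<^sub>R v))" by (intro tendsto_intros d)
      then show "(\<lambda>n. (1/2) *\<^sub>R (x + (x - z w + d n *\<^sub>R v))) \<longlonglongrightarrow> (1/2) *\<^sub>R (x + (x - z w))" by simp
     qed
     have "(\<lambda>n. d n *\<^sub>R (x - z w + d n *\<^sub>R v)) \<longlonglongrightarrow> 0 *\<^sub>R (x - z w + 0 *\<^sub>R v)" by (intro tendsto_intros d)
     then have "(\<lambda>n. d n *\<^sub>R (x - z w + d n *\<^sub>R v)) \<longlonglongrightarrow> 0" by simp
     then have t3: "(\<lambda>n. a (d n *\<^sub>R (x - z w + d n *\<^sub>R v)) v) \<longlonglongrightarrow> a 0 v"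
      unfolding a_def by (rule fourier_slice_tendsto[OF j(1)])
     show "(\<lambda>n. Q (d n) w v) \<longlonglongrightarrow> g (x - z w) * \<kappa> ((1/2) *\<^sub>R (x + (x - z w))) w * a 0 v"
      unfolding Q_def by (intro tendsto_mult t1 t2 t3)
    qed
    show "AE v in lborel. norm (Q (d n) w v) \<le> Cf * b w * (C * (cauchy_weight v)^2)" for n
     using Qle by (intro AE_I2)
   qed
   moreover have "(1/2) *\<^sub>R (x + (x - z w)) = x - (1/2) *\<^sub>R z w"
    using scaleR_half_double[of x] by (simp add: scaleR_diff_right scaleR_add_right algebra_simps)
   ultimately show ?thesis unfolding integral_mult_right_zero a0 by (simp add: mkernel_def g_def mult_ac)
  qed
  have "(\<lambda>n. \<integral>w. (LBINT v. Q (d n) w v) \<partial>M) \<longlonglongrightarrow> (LINT w|M. (2 * pi) ^ CARD('n) * (mkernel P x w * f (x - z w)))"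
  proof (rule integral_dominated_convergence[where w="\<lambda>w. b w * (Cf * (C * W))"])
   show "(\<lambda>w. (2 * pi) ^ CARD('n) * (mkernel P x w * f (x - z w))) \<in> bmeas M"
   proof -
    have fm[measurable]: "f \<in> bmeas borel" by (rule borel_measurable_continuous_onI[OF fc])
    have [measurable]: "(\<lambda>w. P x (x - z w)) \<in> bmeas M" by (rule phase_measurable_compose[OF P]) measurable
    have [measurable]: "(\<lambda>w. \<kappa> (x - (1/2) *\<^sub>R z w) w) \<in> bmeas M" by (rule \<kappa>_measurable_compose) measurable
    show ?thesis unfolding mkernel_def by measurable
   qed
   show "(\<lambda>w. \<integral>v. Q (d n) w v \<partial>lborel) \<in> bmeas M" for n by (rule Jm[OF d(1)])
   show "integrable M (\<lambda>w. b w * (Cf * (C * W)))" by (intro integrable_mult_left b_integrable)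
   show "AE w in M. (\<lambda>n. \<integral>v. Q (d n) w v \<partial>lborel) \<longlonglongrightarrow> (2 * pi) ^ CARD('n) * (mkernel P x w * f (x - z w))"
    using inner by (intro AE_I2)
   show "AE w in M. norm (LBINT v. Q (d n) w v) \<le> b w * (Cf * (C * W))" for n
   proof (rule AE_I2)
    fix w
    have Qi: "integrable lborel (Q (d n) w)"
     by (rule integrable_bound'[OF dom[of w] Qm])
      (auto intro: order_trans[OF Qle abs_ge_self])
    have "norm (LBINT v. Q (d n) w v) \<le> (LBINT v. norm (Q (d n) w v))" by (rule integral_norm_bound)
    also have "(LBINT v. norm (Q (d n) w v)) \<le> (LINT v|(lborel :: (real ^ 'n) measure). Cf * b w * (C * (cauchy_weight v)^2))"
     by (rule integral_mono[OF integrable_norm[OF Qi] dom Qle])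
    also have "(LINT v|(lborel :: (real ^ 'n) measure). Cf * b w * (C * (cauchy_weight v)^2)) = b w * (Cf * (C * W))" by (simp add: W_def)
    finally show "norm (LBINT v. Q (d n) w v) \<le> b w * (Cf * (C * W))" .
   qed
  qed
  then show ?thesis unfolding I_eq[OF d(1)] kop_def integral_mult_right_zero .
 qed
 show ?thesis
  unfolding I_def[symmetric] tendsto_at_iff_sequentially comp_def
  using seq by (auto simp: greaterThan_def)
qed

lemma Op_schwartz_eq:
 assumes t: "continuous_on UNIV (\<lambda>(x, y). t x y)" and f: "f \<in> schwartz"
 shows "Op_schwartz t (\<lambda>p. of_real (F p)) f = kop (mkernel t) f"
proof
 fix x
 let ?G = "\<lambda>(y, k). exp (\<i> * (k \<bullet> (x - y))) * exp (\<i> * t x y) * of_real (F ((1/2) *\<^sub>R (x + y), k)) * f y"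
 let ?l = "(2 * pi) ^ CARD('n) * kop (mkernel t) f x"
 have lim: "((\<lambda>d::real. \<integral>p. v (d *\<^sub>R p) * ?G p \<partial>lborel) \<longlongrightarrow> ?l) (at_right 0)"
  if "v \<in> schwartz" "v 0 = (1::complex)" for v
  using osc_limit[OF t f that, of x] .
 have "osc_integral ?G = ?l"
  unfolding osc_integral_def
 proof (rule the_equality)
  show "\<forall>v\<in>schwartz. v 0 = (1::complex) \<longrightarrow> ((\<lambda>d::real. \<integral>p. v (d *\<^sub>R p) * ?G p \<partial>lborel) \<longlongrightarrow> ?l) (at_right 0)"
   using lim by blast
  fix l
  assume l: "\<forall>v\<in>schwartz. v 0 = (1::complex) \<longrightarrow> ((\<lambda>d::real. \<integral>p. v (d *\<^sub>R p) * ?G p \<partial>lborel) \<longlongrightarrow> l) (at_right 0)"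
  \<comment> \<open>Uniqueness of the limit needs at least one admissible cut-off, and the Gaussian
    is one.\<close>
  let ?v = "\<lambda>p :: (real ^ 'n) \<times> (real ^ 'n). cplx (exp (- (norm p)\<^sup>2))"
  have v: "?v \<in> schwartz" "?v 0 = 1" by (rule gaussian_schwartz) simp
  show "l = ?l"
   by (rule tendsto_unique[OF _ l[rule_format, OF v] lim[OF v]]) simp
 qed
 moreover have "cplx ((2 * pi) powi (- int CARD('n))) * ((2 * pi) ^ CARD('n) * u) = u" for u :: complex
 proof -
  have "cplx ((2 * pi) powi (- int CARD('n))) * cplx ((2 * pi) ^ CARD('n)) = 1"
   unfolding of_real_mult[symmetric] of_real_eq_1_iff by (simp add: power_int_minus field_simps)
  then show ?thesis by (simp flip: mult.assoc)
 qed
 ultimately show "Op_schwartz t (\<lambda>p. of_real (F p)) f x = kop (mkernel t) f x"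
  unfolding Op_schwartz_def by simp
qed

text \<open>The kernel operator is a bounded extension of the oscillatory integrals, and by density
  of the Schwartz functions it is the only one. This resolves the definite description in
  \<open>Op\<close>.\<close>

lemma Op_apply:
 assumes t: "continuous_on UNIV (\<lambda>(x, y). t x y)" and f: "square_integrable f"
 shows "Op t F (L2_class f) = L2_class (kop (mkernel t) f)"
proof -
 note k = mkernel_admissible[OF t]
 obtain T :: "(real ^ 'n) L2 \<Rightarrow>\<^sub>L (real ^ 'n) L2" where T: "\<And>f. square_integrable f \<Longrightarrow> T (L2_class f) = L2_class (kop (mkernel t) f)"
  using kop_L2_exists[OF k] by blast
 have "Op t F = T"
  unfolding Op_def
 proof (rule the_equality)
  show "\<forall>f\<in>schwartz. square_integrable (Op_schwartz t (\<lambda>z. of_real (F z)) f) \<and>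
    T (L2_class f) = L2_class (Op_schwartz t (\<lambda>z. of_real (F z)) f)"
  proof
   fix f :: "real ^ 'n \<Rightarrow> complex" assume f: "f \<in> schwartz"
   show "square_integrable (Op_schwartz t (\<lambda>z. of_real (F z)) f) \<and>
     T (L2_class f) = L2_class (Op_schwartz t (\<lambda>z. of_real (F z)) f)"
    using kop_square_integrable(1)[OF k schwartz_square_integrable[OF f]] T[OF schwartz_square_integrable[OF f]]
    by (simp add: Op_schwartz_eq[OF t f])
  qed
  fix T' :: "(real ^ 'n) L2 \<Rightarrow>\<^sub>L (real ^ 'n) L2"
  assume T': "\<forall>f\<in>schwartz. square_integrable (Op_schwartz t (\<lambda>z. of_real (F z)) f) \<and>
    T' (L2_class f) = L2_class (Op_schwartz t (\<lambda>z. of_real (F z)) f)"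
  have "T' - T = 0"
  proof (rule schwartz_dense)
   fix f :: "real ^ 'n \<Rightarrow> complex" assume f: "f \<in> schwartz"
   show "(T' - T) (L2_class f) = 0"
    using T'[rule_format, OF f] T[OF schwartz_square_integrable[OF f]]
    by (simp add: blinfun.diff_left Op_schwartz_eq[OF t f])
  qed
  then show "T' = T" by simp
 qed
 then show ?thesis using T[OF f] by simp
qed

lemma inner_Op:
 assumes t: "continuous_on UNIV (\<lambda>(x, y). t x y)" and f: "square_integrable f" and g: "square_integrable g"
 shows "L2_class g \<bullet> Op t F (L2_class f) = kform (mkernel t) g f"
 unfolding Op_apply[OF t f] by (rule inner_kop[OF mkernel_admissible[OF t] f g])

text \<open>Since \<open>F\<close> is real, the adjoint kernel represents the same symbol, and so the operator is
 symmetric by uniqueness of \<open>Op\<close>.\<close>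

lemma Op_symmetric:
 assumes t: "continuous_on UNIV (\<lambda>(x, y). t x y)" and anti: "\<And>x y. t y x = - t x y"
 shows "symmetric_op (Op t F)"
proof -
 \<comment> \<open>Conjugating the representation of the real symbol gives a second one, with
   \<open>- z\<close> and the conjugate of \<open>\<kappa>\<close>. Both quantize to the same
   operator, and the kernel of the second is the adjoint of the first.\<close>
 interpret adj: symbol_rep M "\<lambda>w. - z w" b F "\<lambda>x w. cnj (\<kappa> x w)"
 proof
  show "(\<lambda>w. - z w) \<in> bmeas M" by measurable
  show "integrable M b" by (rule b_integrable)
  show "0 \<le> b w" for w by (rule b_nonneg)
  show "(\<lambda>(x, w). cnj (\<kappa> x w)) \<in> bmeas (lborel \<Otimes>\<^sub>M M)"
   using borel_measurable_cnj[OF \<kappa>_meas] by (simp add: case_prod_unfold)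
  show "continuous_on UNIV (\<lambda>x. cnj (\<kappa> x w))" for w using \<kappa>_cont by (intro continuous_intros)
  show "norm (cnj (\<kappa> x w)) \<le> b w" for x w using \<kappa>_le by simp
  show "cplx (F (x, k)) = (LINT w|M. cnj (\<kappa> x w) * exp (- \<i> * (k \<bullet> - z w)))" for x k
  proof -
   have "cplx (F (x, k)) = cnj (LINT w|M. \<kappa> x w * exp (- \<i> * (k \<bullet> z w)))" unfolding rep[symmetric] by simp
   also have "... = (LINT w|M. cnj (\<kappa> x w * exp (- \<i> * (k \<bullet> z w))))" by (rule integral_cnj'[symmetric])
   finally show ?thesis by (simp add: exp_cnj)
  qed
 qed
 have "L2_class g \<bullet> Op t F (L2_class f) = Op t F (L2_class g) \<bullet> L2_class f"
  if f: "square_integrable f" and g: "square_integrable g" for f g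
 proof -
  have "L2_class g \<bullet> Op t F (L2_class f) = adj.kform (adj.mkernel t) g f"
   by (rule adj.inner_Op[OF t f g])
  also have "... = (LINT w|M. (LBINT x. g x \<bullet> (adj.mkernel t x w * f (x - - z w))))"
   by (rule adj.kform_swap[OF adj.mkernel_admissible[OF t] f g])
  also have "... = (LINT w|M. (LBINT x. f x \<bullet> (mkernel t x w * g (x - z w))))"
  proof (rule integral_cong'[OF refl])
   fix w
   have "(LBINT x. g x \<bullet> (adj.mkernel t x w * f (x - - z w)))
     = (LBINT x. g (x + - z w) \<bullet> (adj.mkernel t (x + - z w) w * f ((x + - z w) - - z w)))"
    by (rule integral_translate[symmetric])
   also have "... = (LBINT x. f x \<bullet> (mkernel t x w * g (x - z w)))"
   proof (rule integral_cong'[OF refl])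
    fix x
    have h: "x + - z w - (1/2) *\<^sub>R - z w = x - (1/2) *\<^sub>R z w"
     by (rule euclidean_eqI) (simp add: inner_diff_left inner_add_left field_simps)
    have "adj.mkernel t (x + - z w) w = cnj (mkernel t x w)"
     unfolding adj.mkernel_def mkernel_def h using anti[of "x - z w" x]
     by (simp add: exp_cnj)
    moreover have "u \<bullet> (cnj c * v) = v \<bullet> (c * u)" for u v c :: complex
     by (simp add: inner_complex_def algebra_simps)
    ultimately show "g (x + - z w) \<bullet> (adj.mkernel t (x + - z w) w * f ((x + - z w) - - z w)) = f x \<bullet> (mkernel t x w * g (x - z w))"
     by simp
   qed
   finally show "(LBINT x. g x \<bullet> (adj.mkernel t x w * f (x - - z w))) = (LBINT x. f x \<bullet> (mkernel t x w * g (x - z w)))" .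
  qed
  also have "... = kform (mkernel t) f g"
   by (rule kform_swap[OF mkernel_admissible[OF t] g f, symmetric])
  also have "... = L2_class f \<bullet> Op t F (L2_class g)" by (rule inner_Op[OF t g f, symmetric])
  finally show ?thesis by (simp add: inner_commute)
 qed
 then show ?thesis unfolding symmetric_op_def by (metis L2_cases)
qed

lemma form_bounds_Op:
 assumes t: "continuous_on UNIV (\<lambda>(x, y). t x y)"
 shows "c \<in> form_bounds (Op t F) \<longleftrightarrow> (\<forall>f. square_integrable f \<longrightarrow> kform (mkernel t) f f \<le> c * (norm (L2_class f))^2)"
 unfolding form_bounds_def
proof safe
 fix f :: "real ^ 'n \<Rightarrow> complex"
 assume a: "\<forall>f. f \<bullet> Op t F f \<le> c * (f \<bullet> f)" and f: "square_integrable f"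
 show "kform (mkernel t) f f \<le> c * (norm (L2_class f))^2"
  using a[rule_format, of "L2_class f"] by (simp add: inner_Op[OF t f f] power2_norm_eq_inner)
next
 fix f :: "(real ^ 'n) L2"
 assume a: "\<forall>f. square_integrable f \<longrightarrow> kform (mkernel t) f f \<le> c * (norm (L2_class f))^2"
 obtain h where h: "square_integrable h" "f = L2_class h" by (rule L2_cases)
 show "f \<bullet> Op t F f \<le> c * (f \<bullet> f)"
  using a[rule_format, OF h(1)] by (simp add: h(2) inner_Op[OF t h(1) h(1)] power2_norm_eq_inner)
qed

lemma form_bounds_Op_uminus:
 assumes t: "continuous_on UNIV (\<lambda>(x, y). t x y)"
 shows "c \<in> form_bounds (- Op t F) \<longleftrightarrow> (\<forall>f. square_integrable f \<longrightarrow> kform (\<lambda>x w. - mkernel t x w) f f \<le> c * (norm (L2_class f))^2)"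
proof -
 have e: "kform (\<lambda>x w. - mkernel t x w) f f = - kform (mkernel t) f f" for f
  unfolding kform_def by (simp add: case_prod_unfold)
 show ?thesis
  unfolding form_bounds_def e
 proof safe
  fix f :: "real ^ 'n \<Rightarrow> complex"
  assume a: "\<forall>f. f \<bullet> (- Op t F) f \<le> c * (f \<bullet> f)" and f: "square_integrable f"
  show "- kform (mkernel t) f f \<le> c * (norm (L2_class f))^2"
   using a[rule_format, of "L2_class f"] by (simp add: blinfun.minus_left inner_Op[OF t f f] power2_norm_eq_inner)
 next
  fix f :: "(real ^ 'n) L2"
  assume a: "\<forall>f. square_integrable f \<longrightarrow> - kform (mkernel t) f f \<le> c * (norm (L2_class f))^2"
  obtain h where h: "square_integrable h" "f = L2_class h" by (rule L2_cases)
  show "f \<bullet> (- Op t F) f \<le> c * (f \<bullet> f)"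
   using a[rule_format, OF h(1)]
   by (simp add: h(2) inner_Op[OF t h(1) h(1)] power2_norm_eq_inner blinfun.minus_left)
 qed
qed

text \<open>The comparison of forms is applied four times: to the kernel and to its negative, for
  the two ends of the spectrum, and with \<open>t\<close> and with \<open>- t\<close>, because
  multiplication by the conjugate magnetic factor leads from the magnetic kernel back to the free
  one.\<close>

lemma spectral_quantity_phase:
 fixes A :: "real ^ 'n \<Rightarrow> real ^ 'n \<Rightarrow> real ^ 'n" and L :: "real ^ 'n \<Rightarrow> real ^ 'n \<Rightarrow> real" and t :: "real ^ 'n \<Rightarrow> real ^ 'n \<Rightarrow> real"
 assumes mom: "integrable M (\<lambda>w. b w * (norm (z w))^2)"
  and R: "R > 0" and l: "l > 0"
  and t: "continuous_on UNIV (\<lambda>(x, y). t x y)" and anti: "\<And>x y. t y x = - t x y"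
  and A: "(\<lambda>(c, x). A c x) \<in> bmeas (borel \<Otimes>\<^sub>M borel)"
  and L: "(\<lambda>(c, x). L c x) \<in> bmeas (borel \<Otimes>\<^sub>M borel)"
  and lip: "\<And>c x y. norm (x - c) \<le> R \<Longrightarrow> norm (y - c) \<le> R \<Longrightarrow> norm (A c x - A c y) \<le> l * norm (x - y)"
  and gauge: "\<And>c x y. norm (x - c) \<le> R \<Longrightarrow> norm (y - c) \<le> R \<Longrightarrow>
   \<bar>t x y - (L c x - L c y) - (1/2) * ((A c x + A c y) \<bullet> (x - y))\<bar> \<le> l * (norm (x - y))^2"
  and E: "E \<in> {sup_spectrum, inf_spectrum, norm}"
 shows "\<bar>E (Op t F) - E (Op (\<lambda>x y. 0) F)\<bar>
  \<le> (bump_const TYPE(real ^ 'n) + 2) * (l + 1 / R^2) * (LINT w|M. b w * (norm (z w))^2)"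
proof -
 let ?d = "(bump_const TYPE(real ^ 'n) + 2) * (l + 1 / R^2) * (LINT w|M. b w * (norm (z w))^2)"
 let ?Z = "\<lambda>x y :: real ^ 'n. 0 :: real"
 have c0: "continuous_on UNIV (\<lambda>(x, y). ?Z x y)" by (simp add: case_prod_unfold)
 have tm: "(\<lambda>(x, y). t x y) \<in> bmeas (borel \<Otimes>\<^sub>M borel)"
  unfolding borel_prod by (rule borel_measurable_continuous_onI[OF t])
 have tm': "(\<lambda>(x, y). - t x y) \<in> bmeas (borel \<Otimes>\<^sub>M borel)" using tm by (simp add: case_prod_unfold)
 have A': "(\<lambda>(c, x). - A c x) \<in> bmeas (borel \<Otimes>\<^sub>M borel)" using A by (simp add: case_prod_unfold)
 have L': "(\<lambda>(c, x). - L c x) \<in> bmeas (borel \<Otimes>\<^sub>M borel)" using L by (simp add: case_prod_unfold)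
 have lip': "norm (- A c x - - A c y) \<le> l * norm (x - y)" if "norm (x - c) \<le> R" "norm (y - c) \<le> R" for c x y
  using lip[OF that] by (simp add: norm_minus_commute)
 have gauge': "\<bar>- t x y - (- L c x - - L c y) - (1/2) * ((- A c x + - A c y) \<bullet> (x - y))\<bar> \<le> l * (norm (x - y))^2"
  if "norm (x - c) \<le> R" "norm (y - c) \<le> R" for c x y
 proof -
  have "- t x y - (- L c x - - L c y) - (1/2) * ((- A c x + - A c y) \<bullet> (x - y))
   = - (t x y - (L c x - L c y) - (1/2) * ((A c x + A c y) \<bullet> (x - y)))"
   by (simp add: inner_diff_left inner_add_left algebra_simps)
  then show ?thesis using gauge[OF that] by (simp only: abs_minus_cancel)
 qed
 have adm: "admissible (mkernel t)" "admissible (mkernel ?Z)" "admissible (\<lambda>x w. - mkernel t x w)" "admissible (\<lambda>x w. - mkernel ?Z x w)"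
  using mkernel_admissible[OF t] mkernel_admissible[OF c0] by (auto simp: admissible_def case_prod_unfold)
 have e1: "(\<lambda>x w. mkernel ?Z x w * exp (\<i> * t x (x - z w))) = mkernel t"
  by (simp add: mkernel_def fun_eq_iff)
 have e2: "(\<lambda>x w. mkernel t x w * exp (\<i> * cplx (- t x (x - z w)))) = mkernel ?Z"
  by (simp add: mkernel_def fun_eq_iff mult.assoc flip: exp_add)
 have e3: "(\<lambda>x w. - mkernel ?Z x w * exp (\<i> * t x (x - z w))) = (\<lambda>x w. - mkernel t x w)"
  by (simp add: mkernel_def fun_eq_iff)
 have e4: "(\<lambda>x w. - mkernel t x w * exp (\<i> * cplx (- t x (x - z w)))) = (\<lambda>x w. - mkernel ?Z x w)"
  by (simp add: mkernel_def fun_eq_iff mult.assoc flip: exp_add)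
 show ?thesis
 proof (rule spectral_quantity_stable[OF _ _ _ _ _ _ _ E])
  show "symmetric_op (Op ?Z F)" by (rule Op_symmetric[OF c0]) simp
  show "symmetric_op (Op t F)" by (rule Op_symmetric[OF t anti])
  show "0 \<le> ?d"
   using l R b_nonneg by (intro mult_nonneg_nonneg integral_nonneg') (auto simp: bump_const_def)
  show "a + ?d \<in> form_bounds (Op t F)" if "a \<in> form_bounds (Op ?Z F)" for a
   using that kform_compare_gauge[OF R l adm(2) A L tm lip gauge mom, of a]
   unfolding form_bounds_Op[OF t] form_bounds_Op[OF c0] e1 by blast
  show "a + ?d \<in> form_bounds (Op ?Z F)" if "a \<in> form_bounds (Op t F)" for a
   using that kform_compare_gauge[OF R l adm(1) A' L' tm' lip' gauge' mom, of a]
   unfolding form_bounds_Op[OF t] form_bounds_Op[OF c0] e2 by blast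
  show "a + ?d \<in> form_bounds (- Op t F)" if "a \<in> form_bounds (- Op ?Z F)" for a
   using that kform_compare_gauge[OF R l adm(4) A L tm lip gauge mom, of a]
   unfolding form_bounds_Op_uminus[OF t] form_bounds_Op_uminus[OF c0] e3 by blast
  show "a + ?d \<in> form_bounds (- Op ?Z F)" if "a \<in> form_bounds (- Op t F)" for a
   using that kform_compare_gauge[OF R l adm(3) A' L' tm' lip' gauge' mom, of a]
   unfolding form_bounds_Op_uminus[OF t] form_bounds_Op_uminus[OF c0] e4 by blast
 qed
qed

end

subsection \<open>Symbols of negative order\<close>

lemma pdiff_mult:
 fixes f g :: "'a::euclidean_space \<Rightarrow> complex"
 assumes "smooth f" "smooth g"
 shows "pdiff b (\<lambda>x. f x * g x) = (\<lambda>x. pdiff b f x * g x + f x * pdiff b g x)"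
 by (rule ext, rule pdiff_eqI[THEN trans, OF has_derivative_mult[OF smooth_has_frechet[OF assms(1)] smooth_has_frechet[OF assms(2)]]])
  (simp add: pdiff_def)

text \<open>The derivative of a product is a sum of two products, so closure under sums is added to
  obtain an invariant class for \<open>smooth_coinduct\<close>.\<close>

inductive product_sum :: "('a::euclidean_space \<Rightarrow> complex) \<Rightarrow> bool" where
 mult: "smooth f \<Longrightarrow> smooth g \<Longrightarrow> product_sum (\<lambda>x. f x * g x)"
| add: "product_sum f \<Longrightarrow> product_sum g \<Longrightarrow> product_sum (\<lambda>x. f x + g x)"

lemma smooth_mult:
 fixes f g :: "'a::euclidean_space \<Rightarrow> complex"
 assumes "smooth f" "smooth g" shows "smooth (\<lambda>x. f x * g x)"
proof (rule smooth_coinduct[where P=product_sum])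
 show "product_sum (\<lambda>x. f x * g x)" by (rule product_sum.mult[OF assms])
 show d: "h differentiable (at x)" if "product_sum h" for h :: "'a \<Rightarrow> complex" and x
  using that by induction (simp_all add: differentiable_mult differentiable_add smooth_differentiable)
 show "product_sum (pdiff b h)" if "product_sum h" and b: "b \<in> Basis" for h :: "'a \<Rightarrow> complex" and b
  using that(1)
 proof induction
  case (mult f g)
  then show ?case
   using product_sum.add[OF product_sum.mult[OF smooth_pdiff[OF mult(1) b] mult(2)] product_sum.mult[OF mult(1) smooth_pdiff[OF mult(2) b]]]
   by (simp add: pdiff_mult)
 next
  case (add f g)
  have "pdiff b (\<lambda>x. f x + g x) = (\<lambda>x. pdiff b f x + pdiff b g x)"
  proof
   fix x
   have "(f has_derivative frechet_derivative f (at x)) (at x)" "(g has_derivative frechet_derivative g (at x)) (at x)"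
    using d[OF add.hyps(1)] d[OF add.hyps(2)] by (simp_all add: frechet_derivative_works)
   from pdiff_eqI[OF has_derivative_add[OF this], of b]
   show "pdiff b (\<lambda>x. f x + g x) x = pdiff b f x + pdiff b g x" by (simp add: pdiff_def)
  qed
  then show ?case using product_sum.add[OF add.IH] by simp
 qed
qed

text \<open>In terms of the rescaled momentum \<eta> = sqrt s * \<xi> this is
  \<open>s * (1 + |\<xi>|^2)\<close>, the exponent in the Gamma integral for powers of
  \<open>1 + |\<xi>|^2\<close>.\<close>

definition shifted_sq :: "real \<Rightarrow> 'a::euclidean_space \<Rightarrow> real" where
 "shifted_sq s \<eta> = s + (norm \<eta>)^2"

lemma shifted_sq_pos: "s > 0 \<Longrightarrow> shifted_sq s \<eta> > 0"
 by (simp add: shifted_sq_def add_pos_nonneg)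

abbreviation family_bound :: "real \<Rightarrow> real \<Rightarrow> nat \<Rightarrow> real \<Rightarrow> 'a::euclidean_space \<Rightarrow> real" where
 "family_bound s q N c \<eta> \<equiv> shifted_sq s \<eta> powr q * (1 + shifted_sq s \<eta>) ^ N * exp (- c * shifted_sq s \<eta>)"

text \<open>Families in the rescaled momentum \<open>\<eta>\<close>, with bounds that are uniform in the scale \<open>s\<close> and in the
 parameter \<open>x\<close>. Each derivative costs half a power of \<open>s + |\<eta>|^2\<close>.\<close>

definition scaled_family :: "nat \<Rightarrow> real \<Rightarrow> real \<Rightarrow> (real \<Rightarrow> 'x \<Rightarrow> 'a::euclidean_space \<Rightarrow> complex) \<Rightarrow> bool" where
 "scaled_family K q c H \<longleftrightarrow> (\<forall>s>0. \<forall>x. smooth (H s x)) \<and>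
  (\<forall>bs. set bs \<subseteq> Basis \<and> length bs \<le> K \<longrightarrow> (\<exists>C\<ge>0. \<exists>N::nat. \<forall>s>0. \<forall>x \<eta>.
    norm (pdiffs bs (H s x) \<eta>) \<le> C * family_bound s (q - real (length bs) / 2) N c \<eta>))"

section \<open>Closure properties of scaled families\<close>

lemma scaled_family_smooth: "scaled_family K q c H \<Longrightarrow> s > 0 \<Longrightarrow> smooth (H s x)"
 by (simp add: scaled_family_def)

lemma scaled_family_bound:
 assumes "scaled_family K q c H" "set bs \<subseteq> Basis" "length bs \<le> K"
 obtains C N where "C \<ge> 0" "\<And>s x v. s > 0 \<Longrightarrow> norm (pdiffs bs (H s x) v)
   \<le> C * family_bound s (q - real (length bs) / 2) N c v"
 using assms unfolding scaled_family_def by meson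

lemma scaled_family_bound_0:
 assumes "scaled_family K q c H"
 obtains C N where "C \<ge> 0" "\<And>s x v. s > 0 \<Longrightarrow> norm (H s x v)
   \<le> C * family_bound s q N c v"
 by (rule scaled_family_bound[OF assms, of "[]"]) (use that in auto)

lemma scaled_familyI:
 assumes "\<And>s x. s > 0 \<Longrightarrow> smooth (H s x)"
  and "\<And>bs. set bs \<subseteq> Basis \<Longrightarrow> length bs \<le> K \<Longrightarrow> \<exists>C\<ge>0. \<exists>N::nat. \<forall>s>0. \<forall>x v.
    norm (pdiffs bs (H s x) v) \<le> C * family_bound s (q - real (length bs) / 2) N c v"
 shows "scaled_family K q c H"
 using assms unfolding scaled_family_def by blast

lemma powr_le_shifted:
 fixes y :: real assumes "y > 0" "q' \<le> q"
 shows "y powr q \<le> y powr q' * (1 + y) ^ nat \<lceil>q - q'\<rceil>"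
proof -
 have "y powr q = y powr q' * y powr (q - q')" by (simp flip: powr_add)
 also have "y powr (q - q') \<le> (1 + y) powr (q - q')" using assms by (intro powr_mono2) auto
 also have "... \<le> (1 + y) powr real (nat \<lceil>q - q'\<rceil>)" using assms by (intro powr_mono) auto
 also have "... = (1 + y) ^ nat \<lceil>q - q'\<rceil>" using assms by (intro powr_realpow) auto
 finally show ?thesis by (simp add: mult_left_mono)
qed

text \<open>Lowering the power \<open>q\<close> strengthens the bound at large momenta but weakens
  it near \<open>s = 0\<close>, \<open>\<eta> = 0\<close>. The polynomial factor in
  \<open>family_bound\<close> is there to absorb the former; only the behaviour near zero is tracked
  by \<open>q\<close>.\<close>

lemma scaled_family_mono:
 assumes H: "scaled_family K q c H" and le: "q' \<le> q" "K' \<le> K"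
 shows "scaled_family K' q' c H"
proof (rule scaled_familyI)
 fix bs :: "'b list" assume bs: "set bs \<subseteq> Basis" "length bs \<le> K'"
 obtain C N where C: "C \<ge> 0" "\<And>s x v. s > 0 \<Longrightarrow> norm (pdiffs bs (H s x) v)
   \<le> C * family_bound s (q - real (length bs) / 2) N c v"
  by (rule scaled_family_bound[OF H bs(1)]) (use bs(2) le in auto)
 let ?M = "nat \<lceil>q - q'\<rceil>"
 have "norm (pdiffs bs (H s x) v) \<le> C * family_bound s (q' - real (length bs) / 2) (?M + N) c v"
  if s: "s > 0" for s x v
 proof -
  let ?y = "shifted_sq s v"
  note y = shifted_sq_pos[OF s, of v]
  have "?y powr (q - real (length bs) / 2) * (1 + ?y) ^ N \<le> ?y powr (q' - real (length bs) / 2) * (1 + ?y) ^ ?M * (1 + ?y) ^ N"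
   using powr_le_shifted[OF y, of "q' - real (length bs) / 2" "q - real (length bs) / 2"] le y by (intro mult_right_mono) auto
  then have "C * (?y powr (q - real (length bs) / 2) * (1 + ?y) ^ N * exp (- c * ?y)) \<le> C * (?y powr (q' - real (length bs) / 2) * (1 + ?y) ^ ?M * (1 + ?y) ^ N * exp (- c * ?y))"
   by (rule mult_left_mono[OF mult_right_mono C(1)]) simp
  with C(2)[OF s, of x v] show ?thesis by (simp add: power_add mult.assoc)
 qed
 with C(1) show "\<exists>C\<ge>0. \<exists>N::nat. \<forall>s>0. \<forall>x v. norm (pdiffs bs (H s x) v)
   \<le> C * family_bound s (q' - real (length bs) / 2) N c v" by blast
qed (use H in \<open>simp add: scaled_family_smooth\<close>)

lemma scaled_family_cong:
 "scaled_family K q c H \<Longrightarrow> (\<And>s x. s > 0 \<Longrightarrow> H s x = G s x) \<Longrightarrow> scaled_family K q c G"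
 by (simp add: scaled_family_def)

lemma scaled_family_add:
 assumes H: "scaled_family K q c H" and G: "scaled_family K q c G"
 shows "scaled_family K q c (\<lambda>s x v. H s x v + G s x v)"
proof (rule scaled_familyI)
 show "smooth (\<lambda>v. H s x v + G s x v)" if "s > 0" for s x
  using H G that by (simp add: smooth_add scaled_family_smooth)
 fix bs :: "'b list" assume bs: "set bs \<subseteq> Basis" "length bs \<le> K"
 obtain C N where C: "C \<ge> 0" "\<And>s x v. s > 0 \<Longrightarrow> norm (pdiffs bs (H s x) v)
   \<le> C * family_bound s (q - real (length bs) / 2) N c v"
  by (rule scaled_family_bound[OF H bs]) blast
 obtain D M where D: "D \<ge> 0" "\<And>s x v. s > 0 \<Longrightarrow> norm (pdiffs bs (G s x) v)
   \<le> D * family_bound s (q - real (length bs) / 2) M c v"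
  by (rule scaled_family_bound[OF G bs]) blast
 have "norm (pdiffs bs (\<lambda>v. H s x v + G s x v) v) \<le> (C + D) * family_bound s (q - real (length bs) / 2) (N + M) c v"
  if s: "s > 0" for s x v
 proof -
  let ?y = "shifted_sq s v"
  note y = shifted_sq_pos[OF s, of v]
  have p: "?y powr (q - real (length bs) / 2) * (1 + ?y) ^ L * exp (- c * ?y) \<le> ?y powr (q - real (length bs) / 2) * (1 + ?y) ^ (N + M) * exp (- c * ?y)" if "L \<le> N + M" for L
   using y that by (intro mult_left_mono mult_right_mono power_increasing) auto
  have "norm (pdiffs bs (\<lambda>v. H s x v + G s x v) v) \<le> norm (pdiffs bs (H s x) v) + norm (pdiffs bs (G s x) v)"
   using pdiffs_add[OF scaled_family_smooth[OF H s] scaled_family_smooth[OF G s] bs(1)] by (simp add: norm_triangle_ineq)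
  moreover have "norm (pdiffs bs (H s x) v) \<le> C * (?y powr (q - real (length bs) / 2) * (1 + ?y) ^ (N + M) * exp (- c * ?y))"
   by (rule order_trans[OF C(2)[OF s] mult_left_mono[OF p C(1)]]) simp
  moreover have "norm (pdiffs bs (G s x) v) \<le> D * (?y powr (q - real (length bs) / 2) * (1 + ?y) ^ (N + M) * exp (- c * ?y))"
   by (rule order_trans[OF D(2)[OF s] mult_left_mono[OF p D(1)]]) simp
  ultimately show ?thesis by (simp only: distrib_right)
 qed
 moreover have "C + D \<ge> 0" using C(1) D(1) by simp
 ultimately show "\<exists>C\<ge>0. \<exists>N::nat. \<forall>s>0. \<forall>x v. norm (pdiffs bs (\<lambda>v. H s x v + G s x v) v)
   \<le> C * family_bound s (q - real (length bs) / 2) N c v" by blast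
qed

lemma scaled_family_pdiff:
 assumes H: "scaled_family (Suc K) q c H" and b: "b \<in> Basis"
 shows "scaled_family K (q - 1/2) c (\<lambda>s x. pdiff b (H s x))"
proof (rule scaled_familyI)
 show "smooth (pdiff b (H s x))" if "s > 0" for s x
  by (rule smooth_pdiff[OF scaled_family_smooth[OF H that] b])
 fix bs :: "'b list" assume bs: "set bs \<subseteq> Basis" "length bs \<le> K"
 obtain C N where C: "C \<ge> 0" "\<And>s x v. s > 0 \<Longrightarrow> norm (pdiffs (bs @ [b]) (H s x) v)
   \<le> C * (shifted_sq s v powr (q - real (length (bs @ [b])) / 2) * (1 + shifted_sq s v) ^ N * exp (- c * shifted_sq s v))"
  by (rule scaled_family_bound[OF H, of "bs @ [b]"]) (use bs b in auto)
 have "q - real (length (bs @ [b])) / 2 = q - 1/2 - real (length bs) / 2" by (simp add: field_simps)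
 with C show "\<exists>C\<ge>0. \<exists>N::nat. \<forall>s>0. \<forall>x v. norm (pdiffs bs (pdiff b (H s x)) v)
   \<le> C * family_bound s (q - 1/2 - real (length bs) / 2) N c v"
  unfolding pdiffs_snoc by metis
qed

lemma scaled_family_zeroI:
 assumes "\<And>s x. s > 0 \<Longrightarrow> smooth (H s x)"
  and "C \<ge> 0" "\<And>s x v. s > 0 \<Longrightarrow> norm (H s x v) \<le> C * family_bound s q N c v"
 shows "scaled_family 0 q c H"
proof (rule scaled_familyI[OF assms(1)])
 fix bs :: "'b list" assume bs: "set bs \<subseteq> Basis" "length bs \<le> 0"
 have "\<forall>s>0. \<forall>x v. norm (pdiffs bs (H s x) v)
   \<le> C * family_bound s (q - real (length bs) / 2) N c v"
  using assms(3) bs by simp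
 with assms(2) show "\<exists>C\<ge>0. \<exists>N::nat. \<forall>s>0. \<forall>x v. norm (pdiffs bs (H s x) v)
   \<le> C * family_bound s (q - real (length bs) / 2) N c v" by blast
qed

text \<open>Multi-indices are peeled from the end, at the derivative that acts first. Membership up
  to order \<open>Suc K\<close> thereby reduces to the function and its first derivatives, and
  Leibniz formulas for multi-indices never appear.\<close>

lemma scaled_family_SucI:
 assumes H: "scaled_family 0 q c H" and d: "\<And>b. b \<in> Basis \<Longrightarrow> scaled_family K (q - 1/2) c (\<lambda>s x. pdiff b (H s x))"
 shows "scaled_family (Suc K) q c H"
proof (rule scaled_familyI)
 fix bs :: "'b list" assume bs: "set bs \<subseteq> Basis" "length bs \<le> Suc K"
 show "\<exists>C\<ge>0. \<exists>N::nat. \<forall>s>0. \<forall>x v. norm (pdiffs bs (H s x) v)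
   \<le> C * family_bound s (q - real (length bs) / 2) N c v"
 proof (cases bs rule: rev_cases)
  case Nil
  obtain C N where C: "C \<ge> 0" "\<And>s x v. s > 0 \<Longrightarrow> norm (H s x v)
   \<le> C * family_bound s q N c v"
   by (rule scaled_family_bound_0[OF H]) blast
  have "\<forall>s>0. \<forall>x v. norm (pdiffs bs (H s x) v)
   \<le> C * family_bound s (q - real (length bs) / 2) N c v"
   using C(2) by (simp add: Nil)
  with C(1) show ?thesis by blast
 next
  case (snoc as b)
  obtain C N where C: "C \<ge> 0" "\<And>s x v. s > 0 \<Longrightarrow> norm (pdiffs as (pdiff b (H s x)) v)
   \<le> C * family_bound s (q - 1/2 - real (length as) / 2) N c v"
   by (rule scaled_family_bound[OF d[of b], of as]) (use bs snoc in auto)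
  have "q - real (length bs) / 2 = q - 1/2 - real (length as) / 2" by (simp add: snoc field_simps)
  with C show ?thesis unfolding snoc pdiffs_snoc by metis
 qed
qed (use H in \<open>simp add: scaled_family_smooth\<close>)

text \<open>Induction on the order with the product rule. In each of the two terms exactly one
  factor is differentiated, and the half power is lost once.\<close>

lemma scaled_family_mult:
 assumes "scaled_family K q c H" "scaled_family K q' c' G"
 shows "scaled_family K (q + q') (c + c') (\<lambda>s x v. H s x v * G s x v)"
 using assms
proof (induction K arbitrary: q q' H G)
 case 0
 obtain C N where C: "C \<ge> 0" "\<And>s x v. s > 0 \<Longrightarrow> norm (H s x v)
   \<le> C * family_bound s q N c v"
  by (rule scaled_family_bound_0[OF 0(1)]) blast
 obtain D M where D: "D \<ge> 0" "\<And>s x v. s > 0 \<Longrightarrow> norm (G s x v)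
   \<le> D * (shifted_sq s v powr q' * (1 + shifted_sq s v) ^ M * exp (- c' * shifted_sq s v))"
  by (rule scaled_family_bound_0[OF 0(2)]) blast
 show ?case
 proof (rule scaled_family_zeroI[where C="C * D" and N="N + M"])
  show "smooth (\<lambda>v. H s x v * G s x v)" if "s > 0" for s x
   by (rule smooth_mult[OF scaled_family_smooth[OF 0(1) that] scaled_family_smooth[OF 0(2) that]])
  show "C * D \<ge> 0" using C(1) D(1) by simp
  fix s x and v :: 'b assume s: "(s::real) > 0"
  let ?y = "shifted_sq s v"
  have "norm (H s x v * G s x v) \<le> (C * (?y powr q * (1 + ?y) ^ N * exp (- c * ?y))) * (D * (?y powr q' * (1 + ?y) ^ M * exp (- c' * ?y)))"
   unfolding norm_mult using C D s shifted_sq_pos[OF s, of v] by (intro mult_mono) auto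
  also have "... = C * D * ((?y powr q * ?y powr q') * ((1 + ?y) ^ N * (1 + ?y) ^ M) * (exp (- c * ?y) * exp (- c' * ?y)))"
   by (simp only: mult_ac)
  also have "... = C * D * (?y powr (q + q') * (1 + ?y) ^ (N + M) * exp (- (c + c') * ?y))"
   by (simp add: powr_add power_add algebra_simps flip: exp_add)
  finally show "norm (H s x v * G s x v) \<le> C * D * (?y powr (q + q') * (1 + ?y) ^ (N + M) * exp (- (c + c') * ?y))" .
 qed
next
 case (Suc K)
 have K: "scaled_family K q c H" "scaled_family K q' c' G" "scaled_family 0 q c H" "scaled_family 0 q' c' G"
  by (rule scaled_family_mono[OF Suc.prems(1)] scaled_family_mono[OF Suc.prems(2)]; simp)+
 show ?case
 proof (rule scaled_family_SucI)
  show "scaled_family 0 (q + q') (c + c') (\<lambda>s x v. H s x v * G s x v)"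
   by (rule scaled_family_mono[OF Suc.IH[OF K(1,2)]]) auto
  fix b :: 'b assume b: "b \<in> Basis"
  have "scaled_family K (q + q' - 1/2) (c + c') (\<lambda>s x v. pdiff b (H s x) v * G s x v)"
   using Suc.IH[OF scaled_family_pdiff[OF Suc.prems(1) b] K(2)] by (simp add: algebra_simps)
  moreover have "scaled_family K (q + q' - 1/2) (c + c') (\<lambda>s x v. H s x v * pdiff b (G s x) v)"
   using Suc.IH[OF K(1) scaled_family_pdiff[OF Suc.prems(2) b]] by (simp add: algebra_simps)
  ultimately show "scaled_family K (q + q' - 1/2) (c + c') (\<lambda>s x. pdiff b (\<lambda>v. H s x v * G s x v))"
   by (rule scaled_family_cong[OF scaled_family_add])
    (simp add: pdiff_mult scaled_family_smooth[OF Suc.prems(1)] scaled_family_smooth[OF Suc.prems(2)])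
 qed
qed

lemma scaled_family_zero: "scaled_family K q c (\<lambda>s x \<eta>. 0)"
 by (rule scaled_familyI) (auto intro!: exI[of _ 0])

lemma scaled_family_const: "scaled_family K 0 0 (\<lambda>s x \<eta>. a)"
proof (cases K)
 have 0: "scaled_family 0 0 0 (\<lambda>s x \<eta>. a)"
  by (rule scaled_family_zeroI[where C="norm a" and N=0]) (simp_all add: shifted_sq_pos less_imp_neq[symmetric])
 case (Suc k)
 show ?thesis unfolding Suc by (rule scaled_family_SucI[OF 0]) (simp add: scaled_family_zero)
qed (auto intro!: scaled_family_zeroI[where C="norm a" and N=0] simp: shifted_sq_pos less_imp_neq[symmetric])

lemma smooth_inner_of_real: "smooth (\<lambda>y::'a::euclidean_space. cplx (y \<bullet> b))"
 and pdiff_inner_of_real: "pdiff b' (\<lambda>y::'a. cplx (y \<bullet> b)) = (\<lambda>y. cplx (b' \<bullet> b))"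
proof -
 have hd: "((\<lambda>y::'a. cplx (y \<bullet> b)) has_derivative (\<lambda>v. cplx (v \<bullet> b))) (at x)" for x
  by (auto intro!: derivative_eq_intros)
 have p: "pdiff b' (\<lambda>y::'a. cplx (y \<bullet> b)) = (\<lambda>y. cplx (b' \<bullet> b))" for b'
  by (rule ext, rule pdiff_eqI[OF hd])
 show "pdiff b' (\<lambda>y::'a. cplx (y \<bullet> b)) = (\<lambda>y. cplx (b' \<bullet> b))" by (rule p)
 let ?P = "\<lambda>h::'a \<Rightarrow> complex. h = (\<lambda>y. cplx (y \<bullet> b)) \<or> (\<exists>a. h = (\<lambda>y. a))"
 show "smooth (\<lambda>y::'a. cplx (y \<bullet> b))"
 proof (rule smooth_coinduct[where P="?P"])
  have "(\<lambda>y::'a. cplx (y \<bullet> b)) differentiable (at x)" for x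
   unfolding differentiable_def by (rule exI, rule hd)
  then show "h differentiable (at x)" if "?P h" for h x using that by auto
  show "?P (pdiff b' h)" if "?P h" "b' \<in> Basis" for h b' using that p[of b'] by auto
 qed simp
qed

lemma scaled_family_inner:
 assumes b: "b \<in> Basis"
 shows "scaled_family K (1/2) 0 (\<lambda>s x v. cplx (v \<bullet> b))"
proof -
 have "norm (cplx (v \<bullet> b)) \<le> 1 * family_bound s (1/2) 0 0 v" if "s > 0" for s and v :: 'a
 proof -
  have "\<bar>v \<bullet> b\<bar> \<le> norm v" by (rule Basis_le_norm[OF b])
  also have "... \<le> sqrt (shifted_sq s v)" using that by (intro real_le_rsqrt) (simp add: shifted_sq_def)
  finally show ?thesis using shifted_sq_pos[OF that, of v] by (simp add: powr_half_sqrt)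
 qed
 then have 0: "scaled_family 0 (1/2) 0 (\<lambda>s x v. cplx (v \<bullet> b))"
  by (intro scaled_family_zeroI[where C=1 and N=0] smooth_inner_of_real) auto
 show ?thesis
 proof (cases K)
  case (Suc k)
  show ?thesis unfolding Suc
   by (rule scaled_family_SucI[OF 0]) (simp add: pdiff_inner_of_real scaled_family_const)
 qed (simp add: 0)
qed

lemma shifted_sq_smooth:
 shows "smooth (\<lambda>v::'a::euclidean_space. cplx (shifted_sq s v))"
  and "pdiff b (\<lambda>v::'a. cplx (shifted_sq s v)) = (\<lambda>v. 2 * cplx (v \<bullet> b))"
proof -
 have "(\<lambda>v::'a. cplx (shifted_sq s v)) = (\<lambda>v. cplx s + (\<Sum>b\<in>Basis. cplx (v \<bullet> b) * cplx (v \<bullet> b)))"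
  unfolding shifted_sq_def norm_sq_Basis by (simp add: power2_eq_square)
 then show "smooth (\<lambda>v::'a::euclidean_space. cplx (shifted_sq s v))"
  by (simp add: smooth_add smooth_sum smooth_mult smooth_inner_of_real)
 show "pdiff b (\<lambda>v::'a. cplx (shifted_sq s v)) = (\<lambda>v. 2 * cplx (v \<bullet> b))"
  unfolding shifted_sq_def power2_norm_eq_inner
  by (rule ext, rule pdiff_eqI[THEN trans], (rule derivative_eq_intros refl)+) (simp add: inner_commute)
qed

lemma scaled_family_shifted_sq: "scaled_family K 1 0 (\<lambda>s x v. cplx (shifted_sq s v))"
proof (cases K)
 have 0: "scaled_family 0 1 0 (\<lambda>s x v. cplx (shifted_sq s v))"
  by (rule scaled_family_zeroI[where C=1 and N=0]) (auto simp: shifted_sq_smooth shifted_sq_pos less_imp_le abs_of_pos)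
 case (Suc k)
 show ?thesis unfolding Suc
 proof (rule scaled_family_SucI[OF 0])
  fix b :: 'b assume b: "b \<in> Basis"
  show "scaled_family k (1 - 1/2) 0 (\<lambda>s x. pdiff b (\<lambda>v. cplx (shifted_sq s v)))"
   unfolding shifted_sq_smooth using scaled_family_mult[OF scaled_family_const[of k 2] scaled_family_inner[OF b, of k]] by simp
 qed
qed (auto intro!: scaled_family_zeroI[where C=1 and N=0] simp: shifted_sq_smooth shifted_sq_pos less_imp_le abs_of_pos)

lemma scaled_family_power: "scaled_family K (real p) 0 (\<lambda>s x \<eta>. cplx (shifted_sq s \<eta>) ^ p)"
proof (induction p)
 case (Suc p)
 from scaled_family_mult[OF scaled_family_shifted_sq Suc] show ?case by (simp add: algebra_simps)
qed (simp add: scaled_family_const)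

lemma exp_shifted_sq_pdiff:
 "pdiff b (\<lambda>v::'a::euclidean_space. cplx (exp (- shifted_sq s v)))
  = (\<lambda>v. - 2 * cplx (v \<bullet> b) * cplx (exp (- shifted_sq s v)))"
 unfolding shifted_sq_def power2_norm_eq_inner
 by (rule ext, rule pdiff_eqI[THEN trans], (rule derivative_eq_intros refl)+) (simp add: inner_commute)

lemma exp_shifted_sq_smooth: "smooth (\<lambda>v::'a::euclidean_space. cplx (exp (- shifted_sq s v)))"
proof -
 have "(\<lambda>v::'a. cplx (exp (- shifted_sq s v))) = (\<lambda>v. cplx (exp (- s)) * cplx (exp (- (norm v)\<^sup>2)))"
  by (simp add: shifted_sq_def exp_diff exp_minus field_simps flip: of_real_mult exp_add)
 then show ?thesis using smooth_mult[OF smooth_const schwartz_smooth[OF gaussian_schwartz]] by metis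
qed

lemma scaled_family_exp: "scaled_family K 0 1 (\<lambda>s (x::'x) v. cplx (exp (- shifted_sq s v)))"
proof (induction K)
 case 0
 show ?case
  by (rule scaled_family_zeroI[where C=1 and N=0]) (simp_all add: exp_shifted_sq_smooth shifted_sq_pos less_imp_neq[symmetric])
next
 case (Suc K)
 show ?case
 proof (rule scaled_family_SucI)
  show "scaled_family 0 0 1 (\<lambda>s (x::'x) (v::'a::euclidean_space). cplx (exp (- shifted_sq s v)))"
   by (rule scaled_family_mono[OF Suc]) auto
  fix b :: 'a assume b: "b \<in> Basis"
  have "scaled_family K (1/2) 1 (\<lambda>s (x::'x) (v::'a). - 2 * cplx (v \<bullet> b) * cplx (exp (- shifted_sq s v)))"
   using scaled_family_mult[OF scaled_family_mult[OF scaled_family_const[of K "- 2"] scaled_family_inner[OF b, of K]] Suc] by simp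
  \<comment> \<open>Differentiating the Gaussian gains half a power instead of losing one; the
    surplus is given up to the polynomial factor.\<close>
  from scaled_family_mono[OF this, of "- 1/2" K]
  show "scaled_family K (0 - 1/2) 1 (\<lambda>s (x::'x). pdiff b (\<lambda>v::'a. cplx (exp (- shifted_sq s v))))"
   unfolding exp_shifted_sq_pdiff by simp
 qed
qed

text \<open>Four derivatives cost two powers. The terms of lower order cost less and are relaxed to
  the same exponent.\<close>

lemma scaled_family_bessel_op:
 assumes H: "scaled_family (K + 4) q c H" and b: "b \<in> Basis"
 shows "scaled_family K (q - 2) c (\<lambda>s x. bessel_op 1 b (H s x))"
proof -
 have 1: "scaled_family (K + 3) (q - 1/2) c (\<lambda>s x. pdiff b (H s x))"
  using scaled_family_pdiff[of "K + 3", OF _ b] H by (simp add: numeral_eq_Suc)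
 have 2: "scaled_family (K + 2) (q - 1) c (\<lambda>s x. pdiff b (pdiff b (H s x)))"
  using scaled_family_pdiff[of "K + 2" "q - 1/2" c "\<lambda>s x. pdiff b (H s x)", OF _ b] 1 by (simp add: numeral_eq_Suc)
 have 3: "scaled_family (K + 1) (q - 3/2) c (\<lambda>s x. pdiff b (pdiff b (pdiff b (H s x))))"
  using scaled_family_pdiff[of "K + 1" "q - 1" c "\<lambda>s x. pdiff b (pdiff b (H s x))", OF _ b] 2 by (simp add: numeral_eq_Suc)
 have 4: "scaled_family K (q - 2) c (\<lambda>s x. pdiff b (pdiff b (pdiff b (pdiff b (H s x)))))"
  using scaled_family_pdiff[of K "q - 3/2" c "\<lambda>s x. pdiff b (pdiff b (pdiff b (H s x)))", OF _ b] 3 by simp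
 have two: "scaled_family K (q - 2) c (\<lambda>s x \<eta>. - 2 * pdiff b (pdiff b (H s x)) \<eta>)"
  using scaled_family_mult[OF scaled_family_const[of K "- 2"] scaled_family_mono[OF 2, of "q - 2" K]] by simp
 have 0: "scaled_family K (q - 2) c H" by (rule scaled_family_mono[OF H]) auto
 show ?thesis
  by (rule scaled_family_cong[OF scaled_family_add[OF 0 scaled_family_add[OF two 4]]])
   (simp add: bessel_op_def pdiffs_Cons scaleR_conv_of_real)
qed

lemma scaled_family_bessel_ops:
 assumes "scaled_family (K + 4 * length bs) q c H" "set bs \<subseteq> Basis"
 shows "scaled_family K (q - 2 * real (length bs)) c (\<lambda>s x. bessel_ops 1 bs (H s x))"
 using assms
proof (induction bs arbitrary: K)
 case (Cons b bs)
 have "scaled_family (K + 4) (q - 2 * real (length bs)) c (\<lambda>s x. bessel_ops 1 bs (H s x))"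
  by (rule Cons.IH) (use Cons.prems in \<open>simp_all add: add.assoc\<close>)
 from scaled_family_bessel_op[OF this, of b] Cons.prems(2) show ?case
  by (simp add: bessel_ops_def algebra_simps)
qed (simp add: bessel_ops_def)

lemma power_le_exp_half: "\<exists>D\<ge>0. \<forall>y\<ge>0::real. (1 + y) ^ L * exp (- y) \<le> D * exp (- y / 2)"
proof -
 obtain C :: real where C: "\<And>u. u \<ge> 0 \<Longrightarrow> (1 + u) ^ (2 * L) * exp (- (u^2 / 2)) \<le> C"
  using power_le_exp_quadratic[of 2 "2 * L"] by auto
 have "(1 + y) ^ L * exp (- y) \<le> C * exp (- y / 2)" if y: "y \<ge> 0" for y :: real
 proof -
  have "1 + y \<le> (1 + sqrt y)^2" using y by (simp add: power2_sum)
  then have "(1 + y) ^ L \<le> ((1 + sqrt y)^2) ^ L" using y by (intro power_mono) auto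
  then have "(1 + y) ^ L * exp (- y / 2) \<le> (1 + sqrt y) ^ (2 * L) * exp (- y / 2)" by (simp add: power_mult)
  also have "... \<le> C" using C[of "sqrt y"] y by simp
  finally have "(1 + y) ^ L * exp (- y / 2) * exp (- y / 2) \<le> C * exp (- y / 2)" by simp
  then show ?thesis by (simp add: mult.assoc flip: exp_add)
 qed
 moreover have "C \<ge> 0" using C[of 0] by simp
 ultimately show ?thesis by blast
qed

text \<open>For \<open>q \<ge> 0\<close> the power of \<open>shifted_sq\<close> is not singular as
  \<open>s\<close> tends to zero, so it can be put into the polynomial factor; half of the
  exponential absorbs that factor, and the other half splits into a function of \<open>s\<close> and
  a Gaussian in \<open>v\<close>.\<close>

lemma scaled_family_decay:
 assumes H: "scaled_family K q 1 H" and q: "q \<ge> 0"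
 shows "\<exists>C\<ge>0. \<forall>s>0. \<forall>x v. norm (H s x v) \<le> C * exp (- s / 2) * exp (- (norm v)\<^sup>2 / 2)"
proof -
 obtain C N where C: "C \<ge> 0" "\<And>s x v. s > 0 \<Longrightarrow> norm (H s x v)
   \<le> C * family_bound s 0 N 1 v"
  by (rule scaled_family_bound_0[OF scaled_family_mono[OF H q order_refl]]) blast
 obtain D where D: "D \<ge> 0" "\<And>y::real. y \<ge> 0 \<Longrightarrow> (1 + y) ^ N * exp (- y) \<le> D * exp (- y / 2)"
  using power_le_exp_half[of N] by blast
 have "norm (H s x v) \<le> C * D * exp (- s / 2) * exp (- (norm v)\<^sup>2 / 2)" if s: "s > 0" for s x v
 proof -
  note y = shifted_sq_pos[OF s, of v]
  have "norm (H s x v) \<le> C * ((1 + shifted_sq s v) ^ N * exp (- shifted_sq s v))" using C(2)[OF s, of x v] y by simp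
  also have "... \<le> C * (D * exp (- shifted_sq s v / 2))" using D(2) y by (intro mult_left_mono C(1)) auto
  also have "exp (- shifted_sq s v / 2) = exp (- s / 2) * exp (- (norm v)\<^sup>2 / 2)"
   by (simp add: shifted_sq_def field_simps flip: exp_add)
  finally show ?thesis by (simp add: mult.assoc)
 qed
 moreover have "C * D \<ge> 0" using C(1) D(1) by simp
 ultimately show ?thesis by blast
qed

text \<open>Here \<open>s\<close> is fixed and the bound need not be uniform in it, so that negative
  powers, which high derivatives produce, are harmless.\<close>

lemma scaled_family_schwartz:
 fixes H :: "real \<Rightarrow> 'x \<Rightarrow> 'b::euclidean_space \<Rightarrow> complex"
 assumes H: "\<And>K. scaled_family K q 1 H" and s: "s > 0"
 shows "H s x \<in> schwartz"
 unfolding schwartz_def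
proof (intro CollectI conjI allI impI)
 show "smooth (H s x)" by (rule scaled_family_smooth[OF H[of 0] s])
 fix bs :: "'b list" and M :: nat assume bs: "set bs \<subseteq> Basis"
 define a where "a = q - real (length bs) / 2"
 obtain C N where C: "C \<ge> 0" "\<And>s x v. s > 0 \<Longrightarrow> norm (pdiffs bs (H s x) v)
   \<le> C * family_bound s (q - real (length bs) / 2) N 1 v"
  by (rule scaled_family_bound[OF H bs order_refl]) blast
 define L where "L = M + nat \<lceil>a\<rceil> + N"
 obtain D where D: "D \<ge> 0" "\<And>y::real. y \<ge> 0 \<Longrightarrow> (1 + y) ^ L * exp (- y) \<le> D * exp (- y / 2)"
  using power_le_exp_half[of L] by blast
 have "norm v ^ M * norm (pdiffs bs (H s x) v) \<le> C * ((1 + s powr a) * D)" for v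
 proof -
  define y where "y = shifted_sq s v"
  have y: "y > 0" "s \<le> y" using shifted_sq_pos[OF s, of v] by (auto simp: y_def shifted_sq_def)
  have "norm v \<le> 1 + (norm v)^2" by (rule order_trans[OF _ sum_squares_bound[of "norm v" 1, THEN order_trans]]) (auto simp: power2_eq_square)
  also have "... \<le> 1 + y" using s by (simp add: y_def shifted_sq_def)
  finally have n: "norm v ^ M \<le> (1 + y) ^ M" by (intro power_mono) auto
  \<comment> \<open>The exponent can have either sign. A nonnegative power goes into the polynomial;
    a negative one is bounded by its value at \<open>s\<close>, the minimum of
    \<open>shifted_sq s\<close>.\<close>
  have p: "y powr a \<le> (1 + s powr a) * (1 + y) ^ nat \<lceil>a\<rceil>"
  proof (cases "a \<ge> 0")
   case True
   have "y powr a \<le> 1 * (1 + y) ^ nat \<lceil>a\<rceil>" using powr_le_shifted[OF y(1) True] y by simp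
   also have "... \<le> (1 + s powr a) * (1 + y) ^ nat \<lceil>a\<rceil>" using y by (intro mult_right_mono) auto
   finally show ?thesis .
  next
   case False
   have "y powr a \<le> s powr a * 1" using False s y by (simp add: powr_mono2')
   also have "... \<le> (1 + s powr a) * (1 + y) ^ nat \<lceil>a\<rceil>" using y by (intro mult_mono) auto
   finally show ?thesis .
  qed
  have "norm v ^ M * norm (pdiffs bs (H s x) v) \<le> (1 + y) ^ M * (C * (((1 + s powr a) * (1 + y) ^ nat \<lceil>a\<rceil>) * (1 + y) ^ N * exp (- y)))"
  proof (rule mult_mono[OF n])
   have "norm (pdiffs bs (H s x) v) \<le> C * (y powr a * (1 + y) ^ N * exp (- y))"
    using C(2)[OF s, of x v] by (simp add: y_def a_def)
   also have "... \<le> C * (((1 + s powr a) * (1 + y) ^ nat \<lceil>a\<rceil>) * (1 + y) ^ N * exp (- y))"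
    by (rule mult_left_mono[OF mult_right_mono[OF mult_right_mono[OF p]] C(1)]) (use y in auto)
   finally show "norm (pdiffs bs (H s x) v) \<le> C * (((1 + s powr a) * (1 + y) ^ nat \<lceil>a\<rceil>) * (1 + y) ^ N * exp (- y))" .
  qed (use y in auto)
  also have "... = C * ((1 + s powr a) * ((1 + y) ^ L * exp (- y)))"
   by (simp add: L_def power_add mult_ac)
  also have "... \<le> C * ((1 + s powr a) * D)"
  proof (rule mult_left_mono[OF mult_left_mono C(1)])
   have "(1 + y) ^ L * exp (- y) \<le> D * exp (- y / 2)" by (rule D(2)) (use y in auto)
   also have "... \<le> D * 1" by (rule mult_left_mono) (use y D in auto)
   finally show "(1 + y) ^ L * exp (- y) \<le> D" by simp
  qed (simp add: add_nonneg_nonneg)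
  finally show ?thesis .
 qed
 then show "\<exists>C. \<forall>v. norm v ^ M * norm (pdiffs bs (H s x) v) \<le> C" by blast
qed

lemma pdiffs_dilate:
 fixes g :: "'a::euclidean_space \<Rightarrow> 'b::real_normed_vector"
 assumes g: "smooth g" and bs: "set bs \<subseteq> Basis"
 shows "pdiffs bs (\<lambda>v. g (c *\<^sub>R v)) = (\<lambda>v. c ^ length bs *\<^sub>R pdiffs bs g (c *\<^sub>R v))"
 using bs
proof (induction bs)
 case (Cons b bs)
 have s: "smooth (pdiffs bs g)" by (rule smooth_pdiffs[OF g]) (use Cons.prems in auto)
 have d: "pdiff b (\<lambda>v. pdiffs bs g (c *\<^sub>R v)) = (\<lambda>v. c *\<^sub>R pdiff b (pdiffs bs g) (c *\<^sub>R v))"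
 proof -
  have "pdiff b (\<lambda>v. pdiffs bs g (0 + c *\<^sub>R v)) = (\<lambda>v. \<Sum>b'\<in>Basis. ((c *\<^sub>R b) \<bullet> b') *\<^sub>R pdiff b' (pdiffs bs g) (0 + c *\<^sub>R v))"
   by (rule pdiff_affine[OF bounded_linear_scaleR_right s])
  also have "... = (\<lambda>v. \<Sum>b'\<in>Basis. if b' = b then c *\<^sub>R pdiff b (pdiffs bs g) (c *\<^sub>R v) else 0)"
   using Cons.prems by (intro ext sum.cong) (auto simp: inner_Basis)
  finally show ?thesis using Cons.prems by simp
 qed
 have s': "smooth (\<lambda>v. pdiffs bs g (c *\<^sub>R v))"
  using smooth_affine[OF bounded_linear_scaleR_right s, of 0 c] by simp
 show ?case
  using Cons by (simp add: pdiffs_Cons pdiff_scaleR[OF s'] d power_commutes)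
qed simp

lemma symbol_S1_slice:
 fixes F :: "(real ^ 'n) \<times> (real ^ 'n) \<Rightarrow> real"
 assumes F: "F \<in> symbol_S1 t" and bs: "set bs \<subseteq> Basis"
 shows "\<exists>C\<ge>0. \<forall>x k. \<bar>pdiffs bs (\<lambda>k. F (x, k)) k\<bar> \<le> C * (1 + (norm k)^2) powr ((t - real (length bs)) / 2)"
proof -
 have "\<exists>is. bs = map (\<lambda>i. axis i (1::real)) is"
  using bs
 proof (induction bs)
  case (Cons b bs)
  then obtain "is" i where "bs = map (\<lambda>i. axis i (1::real)) is" "b = axis i 1" by (auto simp: Basis_vec_def)
  then show ?case by (intro exI[of _ "i # is"]) simp
 qed simp
 then obtain "is" where i: "bs = map (\<lambda>i. axis i (1::real)) is" by blast
 obtain C where C: "\<And>x k. \<bar>pdiffs (map (\<lambda>i. (axis i 1, 0)) [] @ map (\<lambda>i. (0, axis i 1)) is) F (x, k)\<bar>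
     \<le> C * (1 + (norm k)^2) powr ((t - real (length is)) / 2)"
  using F unfolding symbol_S1_def by blast
 have sm: "smooth F" using F by (simp add: symbol_S1_def)
 have "\<bar>pdiffs bs (\<lambda>k. F (x, k)) k\<bar> \<le> \<bar>C\<bar> * (1 + (norm k)^2) powr ((t - real (length bs)) / 2)" for x k
 proof -
  have "\<bar>pdiffs bs (\<lambda>k. F (x, k)) k\<bar> \<le> C * (1 + (norm k)^2) powr ((t - real (length bs)) / 2)"
   using C[of x k] by (simp add: pdiffs_slice[OF sm bs]) (simp add: i comp_def)
  also have "... \<le> \<bar>C\<bar> * (1 + (norm k)^2) powr ((t - real (length bs)) / 2)" by (intro mult_right_mono) auto
  finally show ?thesis .
 qed
 then show ?thesis by (intro exI[of _ "\<bar>C\<bar>"]) auto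
qed

text \<open>Multiplying by \<open>s powr (t / 2)\<close> turns the symbol bound into a power of
  \<open>shifted_sq\<close>. Each derivative brings a factor \<open>1 / sqrt s\<close> from the
  chain rule, exactly what converts the gain in \<open>1 + |\<xi>|^2\<close> into half a power of
  \<open>shifted_sq\<close>.\<close>

lemma scaled_family_symbol:
 fixes F :: "(real ^ 'n) \<times> (real ^ 'n) \<Rightarrow> real"
 assumes F: "F \<in> symbol_S1 t"
 shows "scaled_family K (t / 2) 0 (\<lambda>s x v. cplx (s powr (t / 2) * F (x, (1 / sqrt s) *\<^sub>R v)))"
proof (rule scaled_familyI)
 have sm: "smooth F" using F by (simp add: symbol_S1_def)
 have sl: "smooth (\<lambda>k. F (x, k))" for x by (rule smooth_slice[OF sm])
 have sd: "smooth (\<lambda>v. F (x, (1 / sqrt s) *\<^sub>R v))" for x and s :: real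
  using smooth_affine[OF bounded_linear_scaleR_right sl[of x], of 0 "1 / sqrt s"] by simp
 have sd': "smooth (\<lambda>v. s powr (t / 2) * F (x, (1 / sqrt s) *\<^sub>R v))" for x and s :: real
  using smooth_scaleR[OF sd] by simp
 show "smooth (\<lambda>v. cplx (s powr (t / 2) * F (x, (1 / sqrt s) *\<^sub>R v)))" for s x
  by (rule smooth_of_real[OF sd'])
 fix bs :: "(real ^ 'n) list" assume bs: "set bs \<subseteq> Basis"
 let ?m = "length bs"
 obtain C where C: "C \<ge> 0" "\<And>x k. \<bar>pdiffs bs (\<lambda>k. F (x, k)) k\<bar> \<le> C * (1 + (norm k)^2) powr ((t - real ?m) / 2)"
  using symbol_S1_slice[OF F bs] by blast
 have "norm (pdiffs bs (\<lambda>v. cplx (s powr (t / 2) * F (x, (1 / sqrt s) *\<^sub>R v))) v)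
   \<le> C * family_bound s (t / 2 - real ?m / 2) 0 0 v"
  if s: "s > 0" for s x v
 proof -
  have e: "pdiffs bs (\<lambda>v. cplx (s powr (t / 2) * F (x, (1 / sqrt s) *\<^sub>R v))) v
    = cplx (s powr (t / 2) * ((1 / sqrt s) ^ ?m * pdiffs bs (\<lambda>k. F (x, k)) ((1 / sqrt s) *\<^sub>R v)))"
   unfolding pdiffs_of_real[OF sd' bs] using pdiffs_scaleR[OF sd bs, of "s powr (t / 2)" x s]
   by (simp only: pdiffs_dilate[OF sl bs] real_scaleR_def)
  have r: "s powr (t / 2) * (1 / sqrt s) ^ ?m = s powr ((t - real ?m) / 2)"
  proof -
   have "(1 / sqrt s) ^ ?m = (s powr (- 1 / 2)) powr real ?m"
    using s by (simp add: powr_realpow powr_minus powr_half_sqrt inverse_eq_divide)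
   also have "... = s powr (- real ?m / 2)" by (simp add: powr_powr)
   finally have "s powr (t / 2) * (1 / sqrt s) ^ ?m = s powr (t / 2 + - real ?m / 2)" by (simp only: powr_add)
   also have "t / 2 + - real ?m / 2 = (t - real ?m) / 2" by (simp add: field_simps)
   finally show ?thesis .
  qed
  have n: "s * (1 + (norm ((1 / sqrt s) *\<^sub>R v))^2) = shifted_sq s v"
   using s by (simp add: shifted_sq_def power_divide power_mult_distrib field_simps)
  have "norm (pdiffs bs (\<lambda>v. cplx (s powr (t / 2) * F (x, (1 / sqrt s) *\<^sub>R v))) v)
    = s powr ((t - real ?m) / 2) * \<bar>pdiffs bs (\<lambda>k. F (x, k)) ((1 / sqrt s) *\<^sub>R v)\<bar>"
   unfolding e norm_of_real mult.assoc[symmetric] r by (simp add: abs_mult)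
  also have "... \<le> s powr ((t - real ?m) / 2) * (C * (1 + (norm ((1 / sqrt s) *\<^sub>R v))^2) powr ((t - real ?m) / 2))"
   by (intro mult_left_mono C) auto
  also have "... = C * (s * (1 + (norm ((1 / sqrt s) *\<^sub>R v))^2)) powr ((t - real ?m) / 2)"
   using s by (simp add: powr_mult)
  also have "(t - real ?m) / 2 = t / 2 - real ?m / 2" by (simp add: field_simps)
  finally show ?thesis unfolding n by simp
 qed
 with C(1) show "\<exists>C\<ge>0. \<exists>N::nat. \<forall>s>0. \<forall>x v. norm (pdiffs bs (\<lambda>v. cplx (s powr (t / 2) * F (x, (1 / sqrt s) *\<^sub>R v))) v)
   \<le> C * family_bound s (t / 2 - real ?m / 2) N 0 v" by blast
qed

section \<open>Gamma integrals and the representation of symbols of negative order\<close>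

lemma gamma_weight_integrable:
 assumes a: "a > 0"
 shows "integrable lborel (\<lambda>s::real. indicator {0<..} s * (s powr (a - 1) * exp (- s / 2)))"
proof -
 have "(\<lambda>t. cplx t powr (of_real a - 1) / of_real (exp ((1/2) * t))) absolutely_integrable_on {0<..}"
  by (rule absolutely_integrable_Gamma_integral) (use a in auto)
 then have "integrable lebesgue (\<lambda>t. norm (indicator {0<..} t *\<^sub>R (cplx t powr (of_real a - 1) / of_real (exp ((1/2) * t)))))"
  unfolding set_integrable_def by (rule integrable_norm)
 moreover have "(\<lambda>t. norm (indicator {0<..} t *\<^sub>R (cplx t powr (of_real a - 1) / of_real (exp ((1/2) * t))))) = (\<lambda>t::real. indicator {0<..} t * (t powr (a - 1) * exp (- t / 2)))"
 proof
  fix t :: real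
  show "norm (indicator {0<..} t *\<^sub>R (cplx t powr (of_real a - 1) / of_real (exp ((1/2) * t)))) = indicator {0<..} t * (t powr (a - 1) * exp (- t / 2))"
 proof (cases "t > 0")
  case True
  have "cplx t powr (of_real a - 1) = of_real (t powr (a - 1))"
   using True by (simp add: powr_of_real[symmetric])
  moreover have "exp (- t / 2) = inverse (exp ((1/2) * t))" by (simp flip: exp_minus)
  ultimately have "indicator {0<..} t *\<^sub>R (cplx t powr (of_real a - 1) / of_real (exp ((1/2) * t))) = cplx (t powr (a - 1) * exp (- t / 2))"
   using True by (simp only: of_real_mult of_real_inverse divide_inverse indicator_def mem_Collect_eq greaterThan_iff if_True of_bool_eq scaleR_one)
  then have "norm (indicator {0<..} t *\<^sub>R (cplx t powr (of_real a - 1) / of_real (exp ((1/2) * t)))) = \<bar>t powr (a - 1) * exp (- t / 2)\<bar>"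
   by (simp only: norm_of_real)
  also have "... = t powr (a - 1) * exp (- t / 2)" by (rule abs_of_nonneg) simp
  finally show ?thesis using True by (simp only: greaterThan_iff indicator_def of_bool_eq if_True mult_1_left)
 qed simp
 qed
 ultimately have "integrable lebesgue (\<lambda>s::real. indicator {0<..} s * (s powr (a - 1) * exp (- s / 2)))" by (simp only:)
 then show ?thesis by (subst (asm) integrable_completion) auto
qed

lemma integrable_lborel_mult:
 fixes f :: "'a::euclidean_space \<Rightarrow> real" and g :: "'b::euclidean_space \<Rightarrow> real"
 assumes f: "integrable lborel f" and g: "integrable lborel g"
 shows "integrable lborel (\<lambda>p. f (fst p) * g (snd p))"
proof -
 have "integrable (lborel \<Otimes>\<^sub>M lborel) (\<lambda>p. f (fst p) * g (snd p))"
 proof (rule lborel_pair.Fubini_integrable)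
  have [measurable]: "f \<in> bmeas borel" "g \<in> bmeas borel" using f g by auto
  show "(\<lambda>p. f (fst p) * g (snd p)) \<in> bmeas (lborel \<Otimes>\<^sub>M lborel)" by measurable
  show "integrable lborel (\<lambda>x. \<integral>y. norm (f (fst (x, y)) * g (snd (x, y))) \<partial>lborel)" using f by (simp add: abs_mult)
  show "AE x in lborel. integrable lborel (\<lambda>y. f (fst (x, y)) * g (snd (x, y)))" using g by simp
 qed
 then show ?thesis by (simp add: lborel_prod)
qed

lemma integral_erlang_density: "l > 0 \<Longrightarrow> (LBINT s. erlang_density k l s) = 1"
proof -
 assume l: "l > 0"
 have "(\<integral>\<^sup>+ s. ennreal (erlang_density k l s) \<partial>lborel) = 1"
  using nn_integral_erlang_ith_moment[OF l, of k 0] by simp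
 then show ?thesis using l by (subst integral_eq_nn_integral) auto
qed


text \<open>The Erlang density with rate \<open>l = 1 + (norm Q)^2\<close> has total mass one, so
  \<open>F (x, Q)\<close> is the integral over \<open>s\<close> of
  \<open>F (x, Q) * erlang_density k l s\<close>. For each \<open>s\<close> this is a
  Gaussian-damped function of the rescaled momentum, to which Fourier inversion applies. The
  negative order supplies integrability at small \<open>s\<close>.\<close>

theorem symbol_S1_rep:
 fixes F :: "(real ^ 'n) \<times> (real ^ 'n) \<Rightarrow> real"
 assumes F: "F \<in> symbol_S1 t" and t: "t < 0"
 shows "\<exists>(z :: real \<times> (real ^ 'n) \<Rightarrow> real ^ 'n) b \<kappa>. symbol_rep lborel z b F \<kappa> \<and> integrable lborel (\<lambda>W. b W * (norm (z W))^2)"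
proof -
 let ?d = "CARD('n)"
 \<comment> \<open>The Bessel operators use four derivatives for each of the \<open>?d\<close>
   coordinates and lower the power by \<open>2 * ?d\<close>; the second summand compensates the
   negative \<open>t / 2\<close>. Together they leave a nonnegative power.\<close>
 define k where "k = 2 * ?d + nat \<lceil>- t / 2\<rceil>"
 \<comment> \<open>At \<open>v = sqrt s *\<^sub>R Q\<close> the value of \<open>shifted_sq\<close>
   is \<open>l * s\<close>, and up to powers of \<open>s\<close> and constants \<open>P\<close> is
   \<open>F\<close> times the Erlang density. The factor \<open>s powr (t / 2)\<close> makes the
   bounds uniform and is undone in \<open>\<kappa>\<close>.\<close>
 define P where "P s x v = cplx (s powr (t / 2) * F (x, (1 / sqrt s) *\<^sub>R v)) * cplx (shifted_sq s v) ^ Suc k * cplx (exp (- shifted_sq s v))"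
  for s and x v :: "real ^ 'n"
 define q where "q = t / 2 + real (Suc k)"
 have q: "q - 2 * real ?d \<ge> 0" "q \<ge> 0" unfolding q_def k_def by linarith+
 have sm: "smooth F" using F by (simp add: symbol_S1_def)
 have fam: "scaled_family K q 1 P" for K
  using scaled_family_mult[OF scaled_family_mult[OF scaled_family_symbol[OF F] scaled_family_power[of K "Suc k"]] scaled_family_exp]
  unfolding P_def q_def by simp
 have Ps: "P s x \<in> schwartz" if "s > 0" for s x by (rule scaled_family_schwartz[OF fam that])
 have len: "length (basis_list :: (real ^ 'n) list) = ?d"
  using basis_list[where 'a="real ^ 'n"] by (metis DIM_cart DIM_real distinct_card mult.right_neutral)
 obtain D where D: "D \<ge> 0" "\<And>s x v. s > 0 \<Longrightarrow> norm (bessel_ops 1 basis_list (P s x) v) \<le> D * exp (- s / 2) * exp (- (norm v)\<^sup>2 / 2)"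
 proof -
  have "scaled_family 0 (q - 2 * real ?d) 1 (\<lambda>s x. bessel_ops 1 basis_list (P s x))"
   using scaled_family_bessel_ops[OF fam, of basis_list 0] by (simp add: basis_list len)
  from scaled_family_decay[OF this q(1)] show thesis using that by blast
 qed
 obtain D' where D': "D' \<ge> 0" "\<And>s x v. s > 0 \<Longrightarrow> norm (P s x v) \<le> D' * exp (- s / 2) * exp (- (norm v)\<^sup>2 / 2)"
  using scaled_family_decay[OF fam[of 0] q(2)] by blast
 have gi: "integrable lborel (\<lambda>v::real ^ 'n. exp (- (norm v)\<^sup>2 / 2))"
 proof -
  have "integrable lborel (\<lambda>v::real ^ 'n. exp (- (norm ((1 / sqrt 2) *\<^sub>R v))\<^sup>2))"
   by (rule integrable_scale) (use integrable_norm[OF schwartz_integrable0[OF gaussian_schwartz]] in auto)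
  then show ?thesis by (simp add: power_divide)
 qed
 define G where "G = (LINT v|(lborel :: (real ^ 'n) measure). exp (- (norm v)\<^sup>2 / 2))"
 \<comment> \<open>The factorial belongs to the Erlang density, the power of \<open>2 * pi\<close>
   to Fourier inversion.\<close>
 define N where "N = fact k * (2 * pi) ^ ?d"
 have N: "N > 0" by (simp add: N_def)
 have G: "G \<ge> 0" by (simp add: G_def)
 define h where "h a s = indicator {0<..} s * (s powr (a - 1) * exp (- s / 2))" for a s :: real
 \<comment> \<open>In \<open>s\<close> this is the integrand of a Gamma function with parameter
   \<open>- t / 2 > 0\<close>; in the dual variable it is the squared weight from
   \<open>fourier_decay\<close>.\<close>
 define b where "b W = (D * G / N) * (h (- t / 2) (fst W) * (cauchy_weight (snd W))^2)" for W :: "real \<times> (real ^ 'n)"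
 define z where "z W = sqrt (fst W) *\<^sub>R snd W" for W :: "real \<times> (real ^ 'n)"
 define \<kappa> where "\<kappa> x W = cplx (indicator {0<..} (fst W) * fst W powr (- t / 2 - 1) / N) * fourier (P (fst W) x) (snd W)" for x W
 have bn: "b W \<ge> 0" for W using D(1) G N by (auto simp: b_def h_def intro!: mult_nonneg_nonneg)
 have \<kappa>le: "norm (\<kappa> x W) \<le> b W" for x W
 proof (cases "fst W > 0")
  case True
  have "norm (fourier (P (fst W) x) (snd W)) \<le> (cauchy_weight (snd W))^2 * (LBINT v. norm (bessel_ops 1 basis_list (P (fst W) x) v))"
   using fourier_decay[OF Ps[OF True], of 1 x "snd W"] by simp
  also have "(LBINT v. norm (bessel_ops 1 basis_list (P (fst W) x) v)) \<le> (LINT v|(lborel :: (real ^ 'n) measure). D * exp (- fst W / 2) * exp (- (norm v)\<^sup>2 / 2))"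
   by (intro integral_mono integrable_norm schwartz_integrable0 bessel_ops_schwartz Ps True D(2) integrable_mult_right gi) (simp add: basis_list)
  also have "(LINT v|(lborel :: (real ^ 'n) measure). D * exp (- fst W / 2) * exp (- (norm v)\<^sup>2 / 2)) = D * exp (- fst W / 2) * G"
   by (simp add: G_def)
  finally have "norm (fourier (P (fst W) x) (snd W)) \<le> (cauchy_weight (snd W))^2 * (D * exp (- fst W / 2) * G)"
   by (simp add: mult_left_mono)
  then have "fst W powr (- t / 2 - 1) / N * norm (fourier (P (fst W) x) (snd W)) \<le> fst W powr (- t / 2 - 1) / N * ((cauchy_weight (snd W))^2 * (D * exp (- fst W / 2) * G))"
   by (rule mult_left_mono) (use N in auto)
  then show ?thesis using True N by (simp add: \<kappa>_def b_def h_def norm_mult norm_divide norm_power field_simps)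
 next
  case False
  then show ?thesis using bn[of W] by (simp add: \<kappa>_def)
 qed
 have hi: "integrable lborel (h a)" if "a > 0" for a unfolding h_def by (rule gamma_weight_integrable[OF that])
 have bi: "integrable lborel b"
  unfolding b_def by (intro integrable_mult_right integrable_lborel_mult hi integrable_cauchy_weight2) (use t in simp)
 have z_meas: "z \<in> bmeas borel"
  unfolding z_def by (intro borel_measurable_continuous_onI continuous_intros)
 have mom: "integrable lborel (\<lambda>W. b W * (norm (z W))^2)"
 proof (rule integrable_bound')
  show "integrable lborel (\<lambda>W::real \<times> (real ^ 'n). (D * G / N * real DIM(real ^ 'n)) * (h (- t / 2 + 1) (fst W) * cauchy_weight (snd W)))"
   by (intro integrable_mult_right integrable_lborel_mult hi integrable_cauchy_weight) (use t in simp)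
  show "(\<lambda>W. b W * (norm (z W))^2) \<in> bmeas lborel" using borel_measurable_integrable[OF bi] z_meas by simp
  show "AE W in lborel. norm (b W * (norm (z W))^2) \<le> norm ((D * G / N * real DIM(real ^ 'n)) * (h (- t / 2 + 1) (fst W) * cauchy_weight (snd W)))"
  proof (rule AE_I2)
   fix W :: "real \<times> (real ^ 'n)"
   \<comment> \<open>The translation is \<open>sqrt s\<close> times the dual variable. Its square
     raises the Gamma parameter by one and uses up one of the two weight factors.\<close>
   have hs: "h (- t / 2) (fst W) * (sqrt (fst W))^2 = h (- t / 2 + 1) (fst W)"
   proof (cases "fst W > 0")
    case True
    then have "fst W powr (- t / 2 - 1) * fst W = fst W powr (- t / 2 + 1 - 1)" using powr_add[of "fst W" "- t / 2 - 1" 1] by simp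
    then show ?thesis using True by (simp add: h_def mult_ac)
   qed (simp add: h_def)
   have hn: "h a s \<ge> 0" for a s by (simp add: h_def)
   have DG: "D * G / N \<ge> 0" using D(1) G N by simp
   have "norm (b W * (norm (z W))^2) = b W * (norm (z W))^2" using bn by simp
   also have "... = D * G / N * ((h (- t / 2) (fst W) * (sqrt (fst W))^2) * ((cauchy_weight (snd W))^2 * (norm (snd W))^2))"
    unfolding b_def z_def norm_scaleR power_mult_distrib power2_abs by (simp only: mult_ac)
   also have "... \<le> D * G / N * (h (- t / 2 + 1) (fst W) * (real DIM(real ^ 'n) * cauchy_weight (snd W)))"
    unfolding hs by (rule mult_left_mono[OF mult_left_mono[OF cauchy_weight_moment hn] DG])
   also have "... = (D * G / N * real DIM(real ^ 'n)) * (h (- t / 2 + 1) (fst W) * cauchy_weight (snd W))" by (simp only: mult_ac)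
   also have "... \<le> norm ..." unfolding real_norm_def by (rule abs_ge_self)
   finally show "norm (b W * (norm (z W))^2) \<le> norm ((D * G / N * real DIM(real ^ 'n)) * (h (- t / 2 + 1) (fst W) * cauchy_weight (snd W)))" .
  qed
 qed
 have F_comp: "(\<lambda>p. F (f p, g p)) \<in> bmeas M" if "f \<in> bmeas M" "g \<in> bmeas M" for f g and M :: "'z measure"
  by (rule measurable_compose[OF borel_measurable_Pair[OF that] smooth_measurable[OF sm]])
 have \<kappa>m: "(\<lambda>(x, W). \<kappa> x W) \<in> bmeas (lborel \<Otimes>\<^sub>M lborel)"
 proof -
  let ?M = "(lborel :: (real ^ 'n) measure) \<Otimes>\<^sub>M (lborel :: (real \<times> (real ^ 'n)) measure)"
  define s w x where "s p = fst (snd p)" and "w p = snd (snd p)" and "x p = fst p" for p :: "(real ^ 'n) \<times> real \<times> (real ^ 'n)"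
  have [measurable]: "s \<in> bmeas ?M" "w \<in> bmeas ?M" "x \<in> bmeas ?M"
   unfolding s_def w_def x_def
    apply (rule measurable_compose[OF measurable_snd], simp add: borel_measurable_continuous_onI continuous_on_fst)
   apply (rule measurable_compose[OF measurable_snd], simp add: borel_measurable_continuous_onI continuous_on_snd)
   by measurable
  have [measurable]: "(\<lambda>r. F (x (fst r), (1 / sqrt (s (fst r))) *\<^sub>R snd r)) \<in> bmeas (?M \<Otimes>\<^sub>M lborel)"
   by (rule F_comp) measurable
  have [measurable]: "(\<lambda>p. \<integral>v. P (s p) (x p) v * exp (\<i> * (v \<bullet> w p)) \<partial>lborel) \<in> bmeas ?M"
   unfolding P_def shifted_sq_def by (rule lborel.borel_measurable_lebesgue_integral) (simp add: case_prod_unfold)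
  have "(\<lambda>p. cplx (indicator {0<..} (s p) * s p powr (- t / 2 - 1) / N) * (LBINT v. P (s p) (x p) v * exp (\<i> * (v \<bullet> w p)))) \<in> bmeas ?M"
   by measurable
  then show ?thesis unfolding \<kappa>_def fourier_def s_def w_def x_def case_prod_unfold .
 qed
 have Pc: "continuous_on UNIV (\<lambda>x. P s x v)" for s v
  unfolding P_def by (intro continuous_intros continuous_on_compose2[OF smooth_continuous[OF sm, of UNIV]]) auto
 have \<kappa>c: "continuous_on UNIV (\<lambda>x. \<kappa> x W)" for W
 proof (cases "fst W > 0")
  case True
  have "continuous_on UNIV (\<lambda>x. fourier (P (fst W) x) (snd W))"
   unfolding continuous_on_sequentially comp_def
  proof (intro ballI allI impI)
   fix u and x :: "real ^ 'n" assume u: "(\<forall>n. u n \<in> UNIV) \<and> u \<longlonglongrightarrow> x"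
   show "(\<lambda>n. fourier (P (fst W) (u n)) (snd W)) \<longlonglongrightarrow> fourier (P (fst W) x) (snd W)"
    unfolding fourier_def
   proof (rule integral_dominated_convergence[where w="\<lambda>v. D' * exp (- fst W / 2) * exp (- (norm v)\<^sup>2 / 2)"])
    have m[measurable]: "P (fst W) x \<in> bmeas borel" for x
     by (rule smooth_measurable[OF schwartz_smooth[OF Ps[OF True]]])
    show "(\<lambda>v. P (fst W) x v * exp (\<i> * (v \<bullet> snd W))) \<in> bmeas lborel"
     "(\<lambda>v. P (fst W) (u n) v * exp (\<i> * (v \<bullet> snd W))) \<in> bmeas lborel" for n by measurable
    show "integrable lborel (\<lambda>v. D' * exp (- fst W / 2) * exp (- (norm (v :: real ^ 'n))\<^sup>2 / 2))"
     by (rule integrable_mult_right[OF gi])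
    show "AE v in lborel. (\<lambda>n. P (fst W) (u n) v * exp (\<i> * (v \<bullet> snd W))) \<longlonglongrightarrow> P (fst W) x v * exp (\<i> * (v \<bullet> snd W))"
    proof (rule AE_I2)
     fix v
     have "(\<lambda>n. P (fst W) (u n) v) \<longlonglongrightarrow> P (fst W) x v"
      using Pc[of "fst W" v] u unfolding continuous_on_sequentially comp_def by auto
     then show "(\<lambda>n. P (fst W) (u n) v * exp (\<i> * (v \<bullet> snd W))) \<longlonglongrightarrow> P (fst W) x v * exp (\<i> * (v \<bullet> snd W))"
      by (intro tendsto_intros)
    qed
    show "AE v in lborel. norm (P (fst W) (u n) v * exp (\<i> * (v \<bullet> snd W))) \<le> D' * exp (- fst W / 2) * exp (- (norm v)\<^sup>2 / 2)" for n
     using D'(2)[OF True] by (intro AE_I2) (simp add: norm_mult)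
   qed
  qed
  then show ?thesis unfolding \<kappa>_def by (intro continuous_intros)
 qed (simp add: \<kappa>_def)
 have rep: "cplx (F (x, Q)) = (LBINT W. \<kappa> x W * exp (- \<i> * (Q \<bullet> z W)))" for x Q
 proof -
  have \<kappa>x[measurable]: "\<kappa> x \<in> bmeas borel"
   using measurable_compose[OF measurable_Pair1' \<kappa>m, of x] by simp
  have i: "integrable lborel (\<lambda>W. \<kappa> x W * exp (- \<i> * (Q \<bullet> z W)))"
  proof (rule integrable_bound'[OF bi])
   show "(\<lambda>W. \<kappa> x W * exp (- \<i> * (Q \<bullet> z W))) \<in> bmeas lborel" using z_meas by measurable
   show "AE W in lborel. norm (\<kappa> x W * exp (- \<i> * (Q \<bullet> z W))) \<le> norm (b W)"
    using \<kappa>le bn by (intro AE_I2) (simp add: norm_mult)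
  qed
  define l where "l = 1 + (norm Q)^2"
  have l: "l > 0" by (simp add: l_def add_pos_nonneg)
  \<comment> \<open>The factor \<open>sqrt s\<close> in \<open>z\<close> lets the inner integral
    perform Fourier inversion exactly at the rescaled momentum
    \<open>sqrt s *\<^sub>R Q\<close>.\<close>
  have inner: "(LBINT w. \<kappa> x (s, w) * exp (- \<i> * (Q \<bullet> z (s, w)))) = cplx (F (x, Q) * erlang_density k l s)" for s
  proof (cases "s > 0")
   case True
   have "(LBINT w. \<kappa> x (s, w) * exp (- \<i> * (Q \<bullet> z (s, w))))
     = (LBINT w. cplx (s powr (- t / 2 - 1) / N) * (fourier (P s x) w * exp (- \<i> * ((sqrt s *\<^sub>R Q) \<bullet> w))))"
    using True by (intro integral_cong' refl) (simp add: \<kappa>_def z_def)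
   also have "... = cplx (s powr (- t / 2 - 1) / N) * ((2 * pi) ^ ?d * P s x (sqrt s *\<^sub>R Q))"
    unfolding integral_mult_right_zero using fourier_inversion[OF Ps[OF True], of x "sqrt s *\<^sub>R Q"] by simp
   also have "P s x (sqrt s *\<^sub>R Q) = cplx (s powr (t / 2) * F (x, Q) * (l * s) ^ Suc k * exp (- l * s))"
   proof -
    have "shifted_sq s (sqrt s *\<^sub>R Q) = l * s" using True by (simp add: shifted_sq_def l_def power_mult_distrib algebra_simps)
    then show ?thesis using True by (simp add: P_def)
   qed
   also have "cplx (s powr (- t / 2 - 1) / N) * ((2 * pi) ^ ?d * cplx (s powr (t / 2) * F (x, Q) * (l * s) ^ Suc k * exp (- l * s)))
    = cplx (s powr (- t / 2 - 1) / N * ((2 * pi) ^ ?d * (s powr (t / 2) * F (x, Q) * (l * s) ^ Suc k * exp (- l * s))))"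
    by (simp only: of_real_mult of_real_power of_real_numeral)
   also have "s powr (- t / 2 - 1) / N * ((2 * pi) ^ ?d * (s powr (t / 2) * F (x, Q) * (l * s) ^ Suc k * exp (- l * s))) = F (x, Q) * erlang_density k l s"
   proof -
    have p: "s powr (- t / 2 - 1) * s powr (t / 2) * s = 1" using True by (simp add: powr_minus flip: powr_add)
    have "s powr (- t / 2 - 1) / N * ((2 * pi) ^ ?d * (s powr (t / 2) * F (x, Q) * (l * s) ^ Suc k * exp (- l * s)))
     = (s powr (- t / 2 - 1) * s powr (t / 2) * s) * ((2 * pi) ^ ?d / N) * (F (x, Q) * l ^ Suc k * s ^ k * exp (- l * s))"
     by (simp add: power_mult_distrib mult_ac)
    also have "(2 * pi) ^ ?d / N = 1 / fact k" by (simp add: N_def)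
    finally show ?thesis using True unfolding p by (simp add: erlang_density_def mult_ac)
   qed
   finally show ?thesis .
  next
   case False
   \<comment> \<open>At \<open>s = 0\<close> the Erlang density contains \<open>0 ^ k\<close>, which
     vanishes only for positive \<open>k\<close>; there \<open>\<kappa>\<close> is zero by its
     indicator.\<close>
   have "k > 0" by (simp add: k_def)
   then have "erlang_density k l s = 0" using False by (simp add: erlang_density_def power_0_left)
   then show ?thesis using False by (simp add: \<kappa>_def)
  qed
  have "(LBINT W. \<kappa> x W * exp (- \<i> * (Q \<bullet> z W))) = (LBINT s. (LBINT w. \<kappa> x (s, w) * exp (- \<i> * (Q \<bullet> z (s, w)))))"
   using lborel_pair.integral_fst'[of "\<lambda>W. \<kappa> x W * exp (- \<i> * (Q \<bullet> z W))"] i by (simp add: lborel_prod)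
  also have "... = cplx (F (x, Q) * (LBINT s. erlang_density k l s))"
   unfolding inner integral_complex_of_real by simp
  finally show ?thesis by (simp add: integral_erlang_density[OF l])
 qed
 have "symbol_rep lborel z b F \<kappa>"
  by unfold_locales (use z_meas bi bn \<kappa>m \<kappa>c \<kappa>le rep in auto)
 with mom show ?thesis by blast
qed

subsection \<open>Periodic symbols\<close>

lemma sin_lower_bound:
 assumes "0 \<le> y" "y \<le> pi / 2" shows "y / 4 \<le> sin y"
proof (cases "y \<le> pi / 3")
 case True
 have "(\<lambda>y. sin y - y * cos y) 0 \<le> (\<lambda>y. sin y - y * cos y) y"
 proof (rule DERIV_nonneg_imp_nondecreasing[OF assms(1)])
  fix x assume x: "0 \<le> x" "x \<le> y"
  have "((\<lambda>y. sin y - y * cos y) has_real_derivative x * sin x) (at x)"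
   by (auto intro!: derivative_eq_intros)
  moreover have "0 \<le> x * sin x" using x True by (intro mult_nonneg_nonneg sin_ge_zero) auto
  ultimately show "\<exists>d. ((\<lambda>y. sin y - y * cos y) has_real_derivative d) (at x) \<and> 0 \<le> d" by blast
 qed
 moreover have "y * (1 / 2) \<le> y * cos y"
  using cos_monotone_0_pi_le[of y "pi / 3"] assms True by (intro mult_left_mono) (auto simp: cos_60)
 ultimately show ?thesis using assms by simp
next
 case False
 have "sin (pi / 6) \<le> sin y" using False assms by (intro sin_monotone_2pi_le) auto
 moreover have "y < 2" using assms pi_less_4 by linarith
 ultimately show ?thesis by (simp add: sin_30)
qed

definition circle_exp :: "real \<Rightarrow> complex" where
 "circle_exp v = exp (\<i> * of_real (2 * pi * v))"

lemma circle_exp_add: "circle_exp (u + v) = circle_exp u * circle_exp v"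
 by (simp add: circle_exp_def distrib_left flip: exp_add)

lemma circle_exp_0 [simp]: "circle_exp 0 = 1" by (simp add: circle_exp_def)

lemma norm_circle_exp [simp]: "norm (circle_exp v) = 1" by (simp add: circle_exp_def)

lemma circle_exp_int [simp]: "circle_exp (of_int m) = 1"
proof -
 have "\<i> * cplx (2 * pi * of_int m) = of_real (of_int m * 2 * pi) * \<i>" by (simp add: mult_ac)
 then show ?thesis unfolding circle_exp_def using exp_integer_2pi[of "of_int m"] by (simp add: mult_ac)
qed

lemma circle_exp_add_int: "circle_exp (v + of_int m) = circle_exp v" by (simp add: circle_exp_add)

lemma cnj_circle_exp: "cnj (circle_exp v) = circle_exp (- v)" by (simp add: circle_exp_def exp_cnj)

lemma continuous_circle_exp [continuous_intros]: "continuous_on S f \<Longrightarrow> continuous_on S (\<lambda>x. circle_exp (f x))"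
 unfolding circle_exp_def by (intro continuous_intros)

lemma circle_exp_measurable [measurable]: "circle_exp \<in> bmeas borel"
 by (intro borel_measurable_continuous_onI continuous_intros)

lemma circle_exp_has_vector_derivative:
 "((\<lambda>s. circle_exp (a * (c - s))) has_vector_derivative - (2 * pi * \<i> * a) * circle_exp (a * (c - s))) (at s)"
proof -
 have "((\<lambda>s. \<i> * cplx (2 * pi * (a * (c - s)))) has_vector_derivative - (2 * pi * \<i> * a)) (at s)"
  unfolding has_vector_derivative_def by (auto intro!: derivative_eq_intros simp: scaleR_conv_of_real algebra_simps)
 from field_vector_diff_chain_at[OF this DERIV_exp] show ?thesis by (simp add: comp_def circle_exp_def)
qed

text \<open>A chord of the circle is \<open>2 * \<bar>sin (pi * v)\<bar>\<close>, hence comparable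
  to the distance of \<open>v\<close> from the nearest integer. It turns a Lipschitz bound for a
  periodic function into one relative to the chord.\<close>

lemma abs_le_norm_circle_exp: "\<bar>v - of_int (round v)\<bar> \<le> norm (circle_exp v - 1)"
proof -
 define u where "u = v - of_int (round v)"
 have u: "\<bar>u\<bar> \<le> 1 / 2" using of_int_round_abs_le[of v] by (simp add: u_def abs_minus_commute)
 have "2 * \<bar>u\<bar> \<le> pi * \<bar>u\<bar>" using pi_gt3 by (intro mult_right_mono) auto
 then have "\<bar>u\<bar> \<le> 2 * (pi * \<bar>u\<bar> / 4)" by simp
 also have "... \<le> 2 * sin (pi * \<bar>u\<bar>)" using u by (intro mult_left_mono sin_lower_bound) auto
 also have "... \<le> 2 * \<bar>sin (pi * u)\<bar>" by (cases "u \<ge> 0") auto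
 also have "... = norm (circle_exp u - 1)"
  using dist_exp_i_1[of "2 * pi * u"] by (simp add: circle_exp_def)
 also have "circle_exp u = circle_exp v"
  using circle_exp_add_int[of u "round v"] by (simp add: u_def)
 finally show ?thesis by (simp add: u_def)
qed

lemma unit_interval_FTC:
 fixes G :: "real \<Rightarrow> complex"
 assumes G: "\<And>s. (G has_vector_derivative g s) (at s)" and g: "continuous_on UNIV g"
 shows "(LINT s|unit_interval. g s) = G 1 - G 0"
proof -
 have "(g has_integral G 1 - G 0) {0..1}"
  by (rule fundamental_theorem_of_calculus) (auto intro: has_vector_derivative_at_within G)
 from integral_unique[OF this] show ?thesis by (simp add: integral_unit_interval[OF g])
qed

lemma unit_interval_integrable:
 fixes f :: "real \<Rightarrow> 'b::{banach,second_countable_topology}"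
 assumes "f \<in> bmeas borel" "\<And>s. norm (f s) \<le> C"
 shows "integrable unit_interval f"
proof -
 interpret prob_space unit_interval by (rule prob_space_unit_interval)
 show ?thesis by (rule integrable_const_bound[of _ C]) (use assms in auto)
qed

lemma circle_exp_orthogonal: "(LINT s|unit_interval. circle_exp (of_int n * (t - s))) = (if n = 0 then 1 else 0)"
proof (cases "n = 0")
 case True
 then show ?thesis using prob_space.prob_space[OF prob_space_unit_interval] by simp
next
 case False
 let ?c = "- (2 * pi * \<i> * of_int n)"
 have c: "?c \<noteq> 0" using False by simp
 have "((\<lambda>s. circle_exp (of_int n * (t - s)) / ?c) has_vector_derivative circle_exp (of_int n * (t - s))) (at s)" for s
  using has_vector_derivative_divide[OF circle_exp_has_vector_derivative[of "of_int n" t s], of ?c] c by simp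
 note unit_interval_FTC[OF this]
 moreover have "continuous_on UNIV (\<lambda>s. circle_exp (of_int n * (t - s)))" by (intro continuous_intros)
 moreover have "circle_exp (of_int n * (t - 1)) = circle_exp (of_int n * (t - 0))"
  using circle_exp_add_int[of "of_int n * (t - 1)" n] by (simp add: algebra_simps)
 ultimately show ?thesis using False by (simp del: diff_0_right)
qed

text \<open>The integral of the squared distance between \<open>g\<close> and its partial Fourier
  sum \<open>P\<close> is nonnegative; by orthogonality both mixed and quadratic terms equal the sum
  \<open>T\<close>. The shift by \<theta> only multiplies the coefficients by phases.\<close>

lemma bessel_inequality:
 fixes g :: "real \<Rightarrow> complex"
 assumes gm[measurable]: "g \<in> bmeas borel" and K: "\<And>s. norm (g s) \<le> K" and A: "finite A"
 shows "(\<Sum>n\<in>A. (norm (LINT s|unit_interval. g s * circle_exp (of_int n * (\<theta> - s))))^2) \<le> K^2"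
proof -
 define E where "E n s = circle_exp (of_int n * (\<theta> - s))" for n :: int and s
 define c where "c n = (LINT s|unit_interval. g s * E n s)" for n
 define P where "P s = (\<Sum>n\<in>A. c n * E (- n) s)" for s
 define T where "T = (\<Sum>n\<in>A. (norm (c n))^2)"
 have Em[measurable]: "E n \<in> bmeas borel" for n unfolding E_def by measurable
 have Pm[measurable]: "P \<in> bmeas borel" unfolding P_def by measurable
 have nE[simp]: "norm (E n s) = 1" for n s by (simp add: E_def)
 have nP: "norm (P s) \<le> (\<Sum>n\<in>A. norm (c n))" for s
  unfolding P_def by (rule order_trans[OF norm_sum]) (simp add: norm_mult)
 have EE: "E n s * E m s = E (n + m) s" for n m s
  by (simp add: E_def flip: circle_exp_add distrib_right of_int_add)
 have cE: "cnj (E n s) = E (- n) s" for n s by (simp add: E_def cnj_circle_exp)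
 have cP: "cnj (P s) = (\<Sum>n\<in>A. cnj (c n) * E n s)" for s by (simp add: P_def cE)
 have gE: "integrable unit_interval (\<lambda>s. g s * E n s)" for n
  by (rule unit_interval_integrable[where C=K]) (use K in \<open>auto simp: norm_mult\<close>)
 have Ei: "integrable unit_interval (E n)" for n by (rule unit_interval_integrable[where C=1]) auto
 have "(LINT s|unit_interval. g s * cnj (P s)) = (\<Sum>n\<in>A. \<integral>s. cnj (c n) * (g s * E n s) \<partial>unit_interval)"
 proof -
  have "g s * cnj (P s) = (\<Sum>n\<in>A. cnj (c n) * (g s * E n s))" for s
   unfolding cP sum_distrib_left by (simp only: mult_ac)
  then show ?thesis by (simp only: integral_sum'[OF integrable_mult_right[OF gE]])
 qed
 also have "... = of_real T"
  unfolding integral_mult_right_zero c_def[symmetric] T_def of_real_sum complex_norm_square by (simp only: mult.commute)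
 finally have gP: "(LINT s|unit_interval. g s * cnj (P s)) = of_real T" .
 have "(LINT s|unit_interval. P s * cnj (P s)) = (\<Sum>n\<in>A. \<Sum>m\<in>A. \<integral>s. c n * cnj (c m) * E (m - n) s \<partial>unit_interval)"
 proof -
  have "P s * cnj (P s) = (\<Sum>n\<in>A. \<Sum>m\<in>A. c n * cnj (c m) * E (m - n) s)" for s
   by (subst cP, subst P_def, unfold sum_product, intro sum.cong refl) (use EE[of "- _" s] in \<open>simp add: mult_ac\<close>)
  then show ?thesis by (simp add: integral_sum' Ei)
 qed
 also have "... = (\<Sum>n\<in>A. \<Sum>m\<in>A. if n = m then c n * cnj (c m) else 0)"
 proof -
  have "(LINT s|unit_interval. E k s) = (if k = 0 then 1 else 0)" for k unfolding E_def by (rule circle_exp_orthogonal)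
  then show ?thesis unfolding integral_mult_right_zero by (intro sum.cong refl) auto
 qed
 also have "... = of_real T"
  unfolding T_def of_real_sum complex_norm_square using A by simp
 finally have PP: "(LINT s|unit_interval. P s * cnj (P s)) = of_real T" .
 have i1: "integrable unit_interval (\<lambda>s. g s * cnj (P s))"
  by (rule unit_interval_integrable[where C="K * (\<Sum>n\<in>A. norm (c n))"])
   (use K nP order_trans[OF norm_ge_zero K] in \<open>auto simp: norm_mult intro!: mult_mono borel_measurable_times borel_measurable_cnj\<close>)
 have i2: "integrable unit_interval (\<lambda>s. P s * cnj (P s))"
  by (rule unit_interval_integrable[where C="(\<Sum>n\<in>A. norm (c n)) * (\<Sum>n\<in>A. norm (c n))"])
   (use nP in \<open>auto simp: norm_mult intro!: mult_mono sum_nonneg borel_measurable_times borel_measurable_cnj\<close>)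
 have i3: "integrable unit_interval (\<lambda>s. (norm (g s))^2)"
  by (rule unit_interval_integrable[where C="K^2"]) (use K in \<open>auto intro: power_mono\<close>)
 have "0 \<le> (LINT s|unit_interval. (norm (g s))^2 - 2 * Re (g s * cnj (P s)) + Re (P s * cnj (P s)))"
 proof (rule integral_nonneg')
  fix s
  have "(norm (g s))^2 - 2 * Re (g s * cnj (P s)) + Re (P s * cnj (P s)) = (norm (g s - P s))^2"
   unfolding cmod_power2 by (simp add: power2_eq_square algebra_simps)
  then show "0 \<le> (norm (g s))^2 - 2 * Re (g s * cnj (P s)) + Re (P s * cnj (P s))" by simp
 qed
 also have "... = (LINT s|unit_interval. (norm (g s))^2) - 2 * Re (of_real T) + Re (of_real T)"
  unfolding integral_add'[OF integrable_diff'[OF i3 integrable_mult_right[OF integrable_Re[OF i1], of 2]] integrable_Re[OF i2]]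
   integral_diff'[OF i3 integrable_mult_right[OF integrable_Re[OF i1], of 2]]
   integral_mult_right_zero integral_Re[OF i1] integral_Re[OF i2] gP PP by (rule refl)
 finally have "T \<le> (LINT s|unit_interval. (norm (g s))^2)" by simp
 also have "... \<le> K^2"
 proof -
  interpret prob_space unit_interval by (rule prob_space_unit_interval)
  have "(LINT s|unit_interval. (norm (g s))^2) \<le> (LINT s|unit_interval. K^2)"
   by (rule integral_mono[OF i3]) (use K in \<open>auto intro: power_mono\<close>)
  then show ?thesis using prob_space by simp
 qed
 finally show ?thesis by (simp add: T_def c_def E_def)
qed

text \<open>Writing \<open>f s - f q = g s * (circle_exp (s - q) - 1)\<close> with \<open>g\<close> bounded, the Fourier coefficients of
 \<open>f - f q\<close> become differences of those of \<open>g\<close>, and the partial sums telescope.\<close>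

lemma fourier_partial_sums:
 fixes f :: "real \<Rightarrow> complex"
 assumes c: "continuous_on UNIV f" and per: "\<And>s. f (s + 1) = f s" and lip: "\<And>s t. norm (f s - f t) \<le> C * \<bar>s - t\<bar>"
 shows "(\<lambda>N. \<Sum>n\<in>{- int N..int N}. \<integral>s. f s * circle_exp (of_int n * (q - s)) \<partial>unit_interval) \<longlonglongrightarrow> f q"
proof -
 have C: "C \<ge> 0" using order_trans[OF norm_ge_zero lip[of 1 0]] by simp
 have pern: "f (s + of_nat m) = f s" for s and m :: nat
  by (induction m) (use per[of "s + of_nat _"] in \<open>auto simp: add.assoc add.commute[of 1]\<close>)
 have perz: "f (s + of_int m) = f s" for s m
 proof (cases "m \<ge> 0")
  case True then show ?thesis using pern[of s "nat m"] by simp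
 next
  case False then show ?thesis using pern[of "s + of_int m" "nat (- m)"] by simp
 qed
 have [measurable]: "f \<in> bmeas borel" by (rule borel_measurable_continuous_onI[OF c])
 \<comment> \<open>Where the denominator vanishes, \<open>s - q\<close> is an integer and
   periodicity gives \<open>f s = f q\<close>, so the default value zero keeps the factorization
   \<open>ge\<close> valid. Boundedness of the quotient is the Lipschitz condition.\<close>
 define g where "g s = (if circle_exp (s - q) = 1 then 0 else (f s - f q) / (circle_exp (s - q) - 1))" for s
 have gm[measurable]: "g \<in> bmeas borel" unfolding g_def by measurable
 have diff: "norm (f s - f q) \<le> C * norm (circle_exp (s - q) - 1)" for s
 proof -
  have "norm (f s - f q) \<le> C * \<bar>s - (q + of_int (round (s - q)))\<bar>"
   using lip[of s "q + of_int (round (s - q))"] by (simp add: perz)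
  also have "\<bar>s - (q + of_int (round (s - q)))\<bar> = \<bar>s - q - of_int (round (s - q))\<bar>" by (simp add: algebra_simps)
  also have "C * ... \<le> C * norm (circle_exp (s - q) - 1)" by (rule mult_left_mono[OF abs_le_norm_circle_exp C])
  finally show ?thesis .
 qed
 have gb: "norm (g s) \<le> C" for s
  using diff[of s] C by (simp add: g_def norm_divide divide_le_eq)
 have ge: "f s = f q + g s * (circle_exp (s - q) - 1)" for s
  using diff[of s] by (cases "circle_exp (s - q) = 1") (simp_all add: g_def)
 define a where "a n = (LINT s|unit_interval. g s * circle_exp (of_int n * (q - s)))" for n
 have gi: "integrable unit_interval (\<lambda>s. g s * circle_exp (of_int n * (q - s)))" for n
  by (rule unit_interval_integrable[where C=C]) (auto simp: norm_mult gb)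
 have ei: "integrable unit_interval (\<lambda>s. circle_exp (of_int n * (q - s)))" for n
  by (rule unit_interval_integrable[where C=1]) auto
 define I where "I n = (LINT s|unit_interval. f s * circle_exp (of_int n * (q - s)))" for n
 \<comment> \<open>Multiplication by \<open>circle_exp (s - q)\<close> lowers the frequency by one,
   so the coefficient is a difference of neighbouring coefficients of \<open>g\<close>.\<close>
 have co: "I n = (if n = 0 then f q else 0) + (a (n - 1) - a n)" for n
 proof -
  have "circle_exp (s - q) * circle_exp (of_int n * (q - s)) = circle_exp (of_int (n - 1) * (q - s))" for s
   by (simp add: algebra_simps flip: circle_exp_add)
  then have "f s * circle_exp (of_int n * (q - s)) = f q * circle_exp (of_int n * (q - s)) +
   (g s * circle_exp (of_int (n - 1) * (q - s)) - g s * circle_exp (of_int n * (q - s)))" for s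
   by (subst ge) (simp add: algebra_simps)
  then show ?thesis
   using ei gi[of "n - 1"] gi[of n] circle_exp_orthogonal[of n q] by (simp add: a_def I_def)
 qed
 have S: "(\<Sum>n\<in>{- int N..int N}. I n) = f q + (a (- int N - 1) - a (int N))" for N
 proof (induction N)
  case (Suc N)
  have "{- int (Suc N)..int (Suc N)} = insert (- int (Suc N)) (insert (int (Suc N)) {- int N..int N})" by auto
  moreover have "a (- 1 - int N) = a (- int N - 1)" by (rule arg_cong[of _ _ a]) presburger
  ultimately show ?case using Suc by (simp add: co algebra_simps)
 qed (simp add: co)
 \<comment> \<open>The two boundary terms of the telescoped sum vanish in the limit, since by
   Bessel's inequality the coefficients of \<open>g\<close> are square-summable along any injective
   sequence.\<close>
 have lim: "(\<lambda>N. a (h N)) \<longlonglongrightarrow> 0" if h: "inj h" for h :: "nat \<Rightarrow> int"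
 proof -
  have "(\<Sum>i<n. (norm (a (h i)))^2) \<le> C^2" for n
   using bessel_inequality[OF gm gb, of "h ` {..<n}" q] h by (simp add: a_def sum.reindex inj_on_subset)
  then have "summable (\<lambda>i. (norm (a (h i)))^2)" by (intro summableI_nonneg_bounded) auto
  then have "(\<lambda>i. (norm (a (h i)))^2) \<longlonglongrightarrow> 0" by (rule summable_LIMSEQ_zero)
  from tendsto_real_sqrt[OF this] show ?thesis by (simp add: tendsto_norm_zero_iff)
 qed
 have "(\<lambda>N. f q + (a (- int N - 1) - a (int N))) \<longlonglongrightarrow> f q + (0 - 0)"
  by (intro tendsto_intros lim) (auto intro: injI)
 then show ?thesis by (simp add: S flip: I_def)
qed

lemma fourier_coefficient_deriv:
 fixes h :: "real \<Rightarrow> complex"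
 assumes d: "\<And>s. (h has_vector_derivative h' s) (at s)" and c: "continuous_on UNIV h'" and per: "\<And>s. h (s + 1) = h s"
 shows "(LINT s|unit_interval. h' s * circle_exp (of_int n * (t - s)))
  = (2 * pi * \<i> * of_int n) * (LINT s|unit_interval. h s * circle_exp (of_int n * (t - s)))"
proof -
 let ?e = "\<lambda>s. circle_exp (of_int n * (t - s))"
 have c0: "continuous_on UNIV h"
  using d by (meson continuous_at_imp_continuous_on has_vector_derivative_continuous)
 have ce: "continuous_on UNIV ?e" by (intro continuous_intros)
 have int: "integrable unit_interval (\<lambda>s. f s * ?e s)" if f: "continuous_on UNIV f" for f
 proof -
  have "continuous_on {0..1} (\<lambda>s. f s * ?e s)" by (intro continuous_on_subset[OF continuous_on_mult[OF f ce]]) auto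
  then have "set_integrable lborel {0..1} (\<lambda>s. f s * ?e s)" by (rule borel_integrable_atLeastAtMost')
  moreover have "(\<lambda>s. f s * ?e s) \<in> bmeas borel" by (rule borel_measurable_continuous_onI[OF continuous_on_mult[OF f ce]])
  ultimately show ?thesis
   unfolding unit_interval_def set_integrable_def by (subst integrable_density) auto
 qed
 have "((\<lambda>s. h s * ?e s) has_vector_derivative h s * (- (2 * pi * \<i> * of_int n) * ?e s) + h' s * ?e s) (at s)" for s
  using has_vector_derivative_mult[OF d[of s] circle_exp_has_vector_derivative[of "of_int n" t s]] by simp
 from unit_interval_FTC[OF this]
 have "(LINT s|unit_interval. h s * (- (2 * pi * \<i> * of_int n) * ?e s) + h' s * ?e s) = h 1 * ?e 1 - h 0 * ?e 0"
  by (simp add: continuous_intros c c0)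
 moreover have "h 1 * ?e 1 = h 0 * ?e 0"
  using per[of 0] circle_exp_add_int[of "of_int n * (t - 1)" n] by (simp add: algebra_simps)
 moreover have "(\<lambda>s. h s * (- (2 * pi * \<i> * of_int n) * ?e s) + h' s * ?e s) = (\<lambda>s. - (2 * pi * \<i> * of_int n) * (h s * ?e s) + h' s * ?e s)"
  by (simp add: mult_ac)
 ultimately have "- (2 * pi * \<i> * of_int n) * (LINT s|unit_interval. h s * ?e s) + (LINT s|unit_interval. h' s * ?e s) = 0"
  using int[OF c0] int[OF c] by simp
 then show ?thesis by (simp add: eq_neg_iff_add_eq_0 add.commute)
qed

text \<open>The reciprocal of the Fourier multiplier of one minus the second derivative on the
  circle of length one; only the frequency enters.\<close>

definition fourier_weight :: "int \<times> real \<Rightarrow> real" where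
 "fourier_weight y = 1 / (1 + 4 * pi^2 * (of_int (fst y))^2)"

text \<open>Pairs of a frequency and a point of the circle. The integral that defines a Fourier
  coefficient is kept in the measure, which makes a Fourier series a single integral with an
  explicit kernel.\<close>

abbreviation fourier_measure :: "(int \<times> real) measure" where
 "fourier_measure \<equiv> count_space UNIV \<Otimes>\<^sub>M unit_interval"

lemma fourier_weight_bounds:
 "0 < fourier_weight y" "fourier_weight y \<le> 1" "(of_int (fst y))^2 * fourier_weight y \<le> 1"
proof -
 have p: "0 < 1 + 4 * pi^2 * (of_int (fst y))^2" by (simp add: add_pos_nonneg)
 have "1 * (of_int (fst y))^2 \<le> 4 * pi^2 * (of_int (fst y))^2"
  using pi_gt3 power_mono[of 3 pi 2] by (intro mult_right_mono) auto
 then show "0 < fourier_weight y" "fourier_weight y \<le> 1" "(of_int (fst y))^2 * fourier_weight y \<le> 1"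
  using p by (auto simp: fourier_weight_def divide_le_eq)
qed

lemma fourier_measure_sigma_finite: "sigma_finite_measure fourier_measure"
proof -
 interpret P: prob_space unit_interval by (rule prob_space_unit_interval)
 interpret C: sigma_finite_measure "count_space (UNIV :: int set)" by (rule sigma_finite_measure_count_space_countable) simp
 interpret pair_sigma_finite "count_space (UNIV :: int set)" unit_interval ..
 show "sigma_finite_measure fourier_measure" by unfold_locales
qed

lemma fourier_weight_measurable [measurable]: "fourier_weight \<in> bmeas fourier_measure"
proof -
 have "(\<lambda>n. 1 / (1 + 4 * pi^2 * (of_int n)^2)) \<in> bmeas (count_space UNIV)" by simp
 from measurable_compose[OF measurable_fst this] show ?thesis by (simp add: fourier_weight_def[abs_def])
qed

lemma integrable_fourier_weight:
 "integrable (count_space UNIV) (\<lambda>n::int. 1 / (1 + 4 * pi^2 * (of_int n)^2))"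
 "integrable fourier_measure fourier_weight"
proof -
 let ?k = "\<lambda>n::int. 1 / (1 + 4 * pi^2 * (of_int n)^2) :: real"
 have s: "summable (\<lambda>n::nat. ?k (int n))"
 proof (rule summable_comparison_test'[where N=1])
  show "summable (\<lambda>n. inverse (real n ^ 2))" by (rule inverse_power_summable) simp
  fix n :: nat assume n: "n \<ge> 1"
  have "(real n)^2 \<le> 1 + 4 * pi^2 * (real n)^2"
   using pi_gt3 power_mono[of 3 pi 2] mult_right_mono[of 1 "4 * pi^2" "(real n)^2"] by simp
  then show "norm (?k (int n)) \<le> inverse (real n ^ 2)" using n by (simp add: inverse_eq_divide frac_le)
 qed
 have a: "Infinite_Set_Sum.abs_summable_on ?k (range int)" "Infinite_Set_Sum.abs_summable_on ?k (range (\<lambda>n. - int n))"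
  by (subst abs_summable_on_reindex_iff[symmetric], (auto intro: injI)[1], use s in \<open>simp add: abs_summable_on_nat_iff'\<close>)+
 have "(UNIV :: int set) = range int \<union> range (\<lambda>n. - int n)"
  using int_cases2 by (metis (mono_tags, lifting) UNIV_eq_I UnI1 UnI2 rangeI)
 with abs_summable_on_union[OF a] show 1: "integrable (count_space UNIV) ?k" by (simp add: abs_summable_on_def)
 interpret C: sigma_finite_measure "count_space (UNIV :: int set)" by (rule sigma_finite_measure_count_space_countable) simp
 interpret P: prob_space unit_interval by (rule prob_space_unit_interval)
 interpret CP: pair_sigma_finite "count_space (UNIV :: int set)" unit_interval ..
 show "integrable fourier_measure fourier_weight"
 proof (rule CP.Fubini_integrable)
  show "integrable (count_space UNIV) (\<lambda>x. \<integral>y. norm (fourier_weight (x, y)) \<partial>unit_interval)"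
   using integrable_norm[OF 1] P.prob_space by (simp add: fourier_weight_def)
 qed (auto simp: fourier_weight_def)
qed

text \<open>The \<open>f j\<close> are the successive derivatives. Integrating by parts multiplies
  the coefficient by \<open>(1 + 4 * pi^2 * n^2)^2\<close>, which the squared weight cancels. In
  this form the series converges absolutely, with a second moment in the frequency.\<close>

lemma fourier_series_smoothed:
 fixes f :: "nat \<Rightarrow> real \<Rightarrow> complex"
 assumes d: "\<And>j s. (f j has_vector_derivative f (Suc j) s) (at s)" and per: "\<And>j s. f j (s + 1) = f j s"
  and b: "\<And>j s. norm (f j s) \<le> K j"
 shows "f 0 q = (LINT y|fourier_measure. (fourier_weight y)^2 * (circle_exp (of_int (fst y) * (q - snd y)) * (f 0 (snd y) - 2 * f 2 (snd y) + f 4 (snd y))))"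
proof -
 interpret C: sigma_finite_measure "count_space (UNIV :: int set)" by (rule sigma_finite_measure_count_space_countable) simp
 interpret P: prob_space unit_interval by (rule prob_space_unit_interval)
 interpret CP: pair_sigma_finite "count_space (UNIV :: int set)" unit_interval ..
 have c: "continuous_on UNIV (f j)" for j
  using d by (meson continuous_at_imp_continuous_on has_vector_derivative_continuous)
 have m[measurable]: "f j \<in> bmeas borel" for j by (rule borel_measurable_continuous_onI[OF c])
 have lip: "norm (f 0 s - f 0 t) \<le> K 1 * \<bar>s - t\<bar>" for s t
 proof -
  have "onorm (\<lambda>h. h *\<^sub>R f (Suc 0) x) \<le> K 1" for x
   by (rule onorm_le) (use b[of 1 x] in \<open>simp add: mult.commute mult_left_mono\<close>)
  then have "norm (f 0 s - f 0 t) \<le> K 1 * norm (s - t)"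
   by (intro differentiable_bound[of UNIV "f 0" "\<lambda>s h. h *\<^sub>R f (Suc 0) s"])
    (use d[of 0] in \<open>auto simp: has_vector_derivative_def\<close>)
  then show ?thesis by simp
 qed
 define co where "co j n = (LINT s|unit_interval. f j s * circle_exp (of_int n * (q - s)))" for j n
 have co: "co (Suc j) n = (2 * pi * \<i> * of_int n) * co j n" for j n
  unfolding co_def by (rule fourier_coefficient_deriv[of "f j" "f (Suc j)", OF d c per])
 have ci: "integrable unit_interval (\<lambda>s. f j s * circle_exp (of_int n * (q - s)))" for j n
  by (rule unit_interval_integrable[where C="K j"]) (auto simp: norm_mult b)
 let ?h = "\<lambda>y. (fourier_weight y)^2 * (circle_exp (of_int (fst y) * (q - snd y)) * (f 0 (snd y) - 2 * f 2 (snd y) + f 4 (snd y)))"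
 let ?K = "K 0 + 2 * K 2 + K 4"
 have nb: "norm (f 0 s - 2 * f 2 s + f 4 s) \<le> ?K" for s
  using norm_triangle_ineq[of "f 0 s - 2 * f 2 s" "f 4 s"] norm_triangle_ineq4[of "f 0 s" "2 * f 2 s"] b[of 0 s] b[of 2 s] b[of 4 s]
  by (simp add: norm_mult)
 have hm: "?h \<in> bmeas fourier_measure"
 proof -
  have [measurable]: "(\<lambda>y. real_of_int (fst y)) \<in> bmeas fourier_measure"
   by (rule measurable_compose[OF measurable_fst]) simp
  show ?thesis by measurable
 qed
 have hb: "norm (?h y) \<le> ?K * fourier_weight y" for y
 proof -
  have "(fourier_weight y)^2 \<le> fourier_weight y"
   using fourier_weight_bounds(1,2)[of y] by (simp add: power2_eq_square mult_le_cancel_right1 mult_left_le)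
  moreover have "norm (?h y) = (fourier_weight y)^2 * norm (f 0 (snd y) - 2 * f 2 (snd y) + f 4 (snd y))"
   by (simp add: norm_mult norm_power)
  moreover have "(fourier_weight y)^2 * norm (f 0 (snd y) - 2 * f 2 (snd y) + f 4 (snd y)) \<le> fourier_weight y * ?K"
   by (rule mult_mono[OF calculation(1) nb]) (use fourier_weight_bounds(1)[of y] in auto)
  ultimately show ?thesis by (simp add: mult.commute)
 qed
 have hi: "integrable fourier_measure ?h"
  by (rule integrable_bound'[OF integrable_mult_right[OF integrable_fourier_weight(2), of ?K] hm])
   (rule AE_I2, rule order_trans[OF hb], simp)
 have inner: "(LINT s|unit_interval. ?h (n, s)) = co 0 n" for n
 proof -
  have "?h (n, s) = (fourier_weight (n, 0))^2 * (f 0 s * circle_exp (of_int n * (q - s)) - 2 * (f 2 s * circle_exp (of_int n * (q - s))) + f 4 s * circle_exp (of_int n * (q - s)))" for s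
   by (simp add: fourier_weight_def algebra_simps)
  then have "(LINT s|unit_interval. ?h (n, s)) = (fourier_weight (n, 0))^2 * (co 0 n - 2 * co 2 n + co 4 n)"
   using ci[of 0 n] ci[of 2 n] ci[of 4 n] by (simp add: co_def)
  also have "co 0 n - 2 * co 2 n + co 4 n = of_real ((1 + 4 * pi^2 * (of_int n)^2)^2) * co 0 n"
   by (simp add: numeral_eq_Suc co algebra_simps)
  also have "cplx ((fourier_weight (n, 0))^2) * (of_real ((1 + 4 * pi^2 * (of_int n)^2)^2) * co 0 n) = co 0 n"
  proof -
   have "1 + 4 * pi^2 * (of_int n)^2 \<noteq> (0::real)" using fourier_weight_bounds(1)[of "(n, 0)"] by (auto simp: fourier_weight_def)
   then have "(fourier_weight (n, 0))^2 * (1 + 4 * pi^2 * (of_int n)^2)^2 = 1" by (simp add: fourier_weight_def power_divide)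
   then show ?thesis by (metis (no_types) mult.assoc mult_1 of_real_1 of_real_mult)
  qed
  finally show ?thesis .
 qed
 have I: "(LINT y|fourier_measure. ?h y) = (LINT n|(count_space UNIV). co 0 n)"
  using CP.integral_fst'[OF hi] by (simp only: inner)
 have coi: "integrable (count_space UNIV) (co 0)"
  using CP.integrable_fst'[OF hi] by (simp only: inner)
 \<comment> \<open>Absolute convergence identifies the integral over all frequencies with the limit
   of the symmetric partial sums, which \<open>fourier_partial_sums\<close> evaluates.\<close>
 have "(\<lambda>N. \<integral>n. indicator {- int N..int N} n *\<^sub>R co 0 n \<partial>count_space UNIV) \<longlonglongrightarrow> (LINT n|(count_space UNIV). co 0 n)"
 proof (rule integral_dominated_convergence[where w="\<lambda>n. norm (co 0 n)"])
  show "AE n in count_space UNIV. (\<lambda>N. indicator {- int N..int N} n *\<^sub>R co 0 n) \<longlonglongrightarrow> co 0 n"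
  proof (rule AE_I2)
   fix n :: int
   have "\<forall>\<^sub>F N in sequentially. indicator {- int N..int N} n *\<^sub>R co 0 n = co 0 n"
    using eventually_ge_at_top[of "nat \<bar>n\<bar>"] by eventually_elim (auto simp: indicator_def)
   then show "(\<lambda>N. indicator {- int N..int N} n *\<^sub>R co 0 n) \<longlonglongrightarrow> co 0 n" by (rule tendsto_eventually)
  qed
 qed (use coi in \<open>auto simp: indicator_def\<close>)
 moreover have "(LINT n|(count_space UNIV). indicator {- int N..int N} n *\<^sub>R co 0 n) = (\<Sum>n\<in>{- int N..int N}. co 0 n)" for N
 proof -
  have "{n. indicator {- int N..int N} n *\<^sub>R co 0 n \<noteq> 0} \<subseteq> {- int N..int N}" by (auto simp: indicator_def)
  then have "(LINT n|(count_space UNIV). indicator {- int N..int N} n *\<^sub>R co 0 n) = (\<Sum>n\<in>{n. indicator {- int N..int N} n *\<^sub>R co 0 n \<noteq> 0}. indicator {- int N..int N} n *\<^sub>R co 0 n)"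
   by (subst lebesgue_integral_count_space_finite_support) (auto intro: finite_subset)
  also have "... = (\<Sum>n\<in>{- int N..int N}. co 0 n)" by (rule sum.mono_neutral_cong_left) (auto simp: indicator_def)
  finally show ?thesis .
 qed
 ultimately have "(\<lambda>N. \<Sum>n\<in>{- int N..int N}. co 0 n) \<longlonglongrightarrow> (LINT n|(count_space UNIV). co 0 n)" by simp
 from LIMSEQ_unique[OF this fourier_partial_sums[OF c per lip, of q, folded co_def]] show ?thesis unfolding I by simp
qed


section \<open>Fourier expansion on the torus and periodic symbols\<close>

definition torus_smooth :: "(real ^ 'n \<Rightarrow> complex) set" where
 "torus_smooth = {g \<in> BC_infinity. \<forall>i x. g (x + axis i 1) = g x}"

lemma torus_smooth_pdiff:
 assumes g: "g \<in> torus_smooth" and b: "b \<in> Basis" shows "pdiff b g \<in> torus_smooth"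
proof -
 have "pdiff b g (x + axis i 1) = pdiff b g x" for x i
 proof -
  have "pdiff b (\<lambda>x. g (axis i 1 + x)) = (\<lambda>x. \<Sum>b'\<in>Basis. (b \<bullet> b') *\<^sub>R pdiff b' g (axis i 1 + x))"
   using pdiff_affine[OF bounded_linear_ident BC_infinity_smooth] g by (auto simp: torus_smooth_def)
  also have "... = (\<lambda>x. \<Sum>b'\<in>Basis. if b' = b then pdiff b g (axis i 1 + x) else 0)"
   using b by (intro ext sum.cong) (auto simp: inner_Basis)
  finally show ?thesis using g b by (simp add: torus_smooth_def add.commute fun_eq_iff)
 qed
 then show ?thesis using g BC_infinity_pdiff[of g b] b by (simp add: torus_smooth_def)
qed

lemma torus_smooth_pdiffs: "g \<in> torus_smooth \<Longrightarrow> set bs \<subseteq> Basis \<Longrightarrow> pdiffs bs g \<in> torus_smooth"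
 by (induction bs) (auto simp: pdiffs_Cons torus_smooth_pdiff)

lemma torus_smooth_bessel_ops:
 "g \<in> torus_smooth \<Longrightarrow> set bs \<subseteq> Basis \<Longrightarrow> bessel_ops r bs g \<in> torus_smooth"
proof (induction bs)
 case (Cons b bs)
 let ?h = "bessel_ops r bs g"
 have h: "?h \<in> torus_smooth" "pdiffs [b, b] ?h \<in> torus_smooth" "pdiffs [b, b, b, b] ?h \<in> torus_smooth"
  using Cons by (auto intro: torus_smooth_pdiffs)
 have sc: "(\<lambda>x. c *\<^sub>R u x) \<in> torus_smooth" if "u \<in> torus_smooth" for u and c :: real
  using that BC_infinity_bounded_linear[OF bounded_linear_scaleR_right] by (auto simp: torus_smooth_def)
 have ad: "(\<lambda>x. u x + v x) \<in> torus_smooth" if "u \<in> torus_smooth" "v \<in> torus_smooth" for u v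
  using that BC_infinity_add by (auto simp: torus_smooth_def)
 have "bessel_op r b ?h \<in> torus_smooth" unfolding bessel_op_def by (intro ad sc h)
 then show ?case by (simp add: bessel_ops_def)
qed (simp add: bessel_ops_def)

text \<open>Expanding in the coordinate \<open>j\<close> replaces that coordinate by the integration
  point \<open>snd (\<omega> j)\<close>; the set \<open>I\<close> records the coordinates already
  treated.\<close>

definition replace_coords :: "'n set \<Rightarrow> ('n \<Rightarrow> int \<times> real) \<Rightarrow> real ^ 'n \<Rightarrow> real ^ 'n" where
 "replace_coords I \<omega> \<theta> = (\<chi> j. if j \<in> I then snd (\<omega> j) else \<theta> $ j)"

text \<open>The one-dimensional kernel of \<open>fourier_series_smoothed\<close>, with the
  differentiated function left out.\<close>

definition fourier_factor :: "real \<Rightarrow> int \<times> real \<Rightarrow> complex" where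
 "fourier_factor \<theta> y = of_real ((fourier_weight y)^2) * circle_exp (of_int (fst y) * (\<theta> - snd y))"

lemma fourier_factor_measurable [measurable]: "fourier_factor \<theta> \<in> bmeas fourier_measure"
proof -
 have [measurable]: "(\<lambda>y. real_of_int (fst y)) \<in> bmeas fourier_measure"
  by (rule measurable_compose[OF measurable_fst]) simp
 show ?thesis unfolding fourier_factor_def by measurable
qed

lemma norm_fourier_factor: "norm (fourier_factor \<theta> y) = (fourier_weight y)^2"
 by (simp add: fourier_factor_def norm_mult norm_power)

lemma integrable_fourier_weight_sq: "integrable fourier_measure (\<lambda>y. (fourier_weight y)^2)"
proof (rule integrable_bound'[OF integrable_fourier_weight(2)])
 show "AE y in fourier_measure. norm ((fourier_weight y)^2) \<le> norm (fourier_weight y)"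
  using fourier_weight_bounds(1,2) by (intro AE_I2) (simp add: power2_eq_square mult_left_le less_imp_le)
qed measurable

lemma torus_coordinate_expansion:
 fixes g :: "real ^ 'n \<Rightarrow> complex"
 assumes g: "g \<in> torus_smooth"
 shows "g v = (LINT y|fourier_measure. fourier_factor (v $ i) y * bessel_op 1 (axis i 1) g (\<chi> k. if k = i then snd y else v $ k))"
proof -
 let ?b = "axis i 1 :: real ^ 'n"
 have b: "?b \<in> Basis" by (auto simp: Basis_vec_def)
 define P where "P s = (\<chi> k. if k = i then s else v $ k)" for s
 have P: "P s = P 0 + s *\<^sub>R ?b" for s by (simp add: P_def vec_eq_iff axis_def)
 define f where "f j s = pdiffs (replicate j ?b) g (P s)" for j s
 have t: "pdiffs (replicate j ?b) g \<in> torus_smooth" for j by (rule torus_smooth_pdiffs[OF g]) (use b in auto)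
 have "\<exists>K. \<forall>s. norm (f j s) \<le> K" for j
  using BC_infinity_bound[of "pdiffs (replicate j ?b) g"] t[of j] by (auto simp: f_def torus_smooth_def)
 then obtain K where K: "\<And>j s. norm (f j s) \<le> K j" by metis
 have d: "(f j has_vector_derivative f (Suc j) s) (at s)" for j s
 proof -
  let ?u = "pdiffs (replicate j ?b) g"
  have sm: "smooth ?u" using t[of j] BC_infinity_smooth by (auto simp: torus_smooth_def)
  have "((\<lambda>s. P 0 + s *\<^sub>R ?b) has_derivative (\<lambda>h. h *\<^sub>R ?b)) (at s)" by (auto intro!: derivative_eq_intros)
  then have "(P has_derivative (\<lambda>h. h *\<^sub>R ?b)) (at s)" unfolding P[symmetric] .
  from has_derivative_compose[OF this smooth_has_frechet[OF sm]]
  have "((\<lambda>s. ?u (P s)) has_derivative (\<lambda>h. frechet_derivative ?u (at (P s)) (h *\<^sub>R ?b))) (at s)" .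
  moreover have "frechet_derivative ?u (at (P s)) (h *\<^sub>R ?b) = h *\<^sub>R pdiff ?b ?u (P s)" for h
   by (simp add: pdiff_def linear_scale[OF linear_frechet_derivative[OF smooth_differentiable[OF sm]]])
  ultimately show ?thesis by (simp add: has_vector_derivative_def f_def[abs_def] pdiffs_Cons)
 qed
 have per: "f j (s + 1) = f j s" for j s
 proof -
  have "P (s + 1) = P s + ?b" using P[of "s + 1"] P[of s] by (simp add: scaleR_left_distrib)
  then show ?thesis using t[of j] by (simp add: f_def torus_smooth_def)
 qed
 have "P (v $ i) = v" by (simp add: P_def vec_eq_iff)
 then have "g v = f 0 (v $ i)" by (simp add: f_def)
 also note fourier_series_smoothed[of f K "v $ i", OF d per K]
 also have "(\<lambda>y. (fourier_weight y)^2 * (circle_exp (of_int (fst y) * (v $ i - snd y)) * (f 0 (snd y) - 2 * f 2 (snd y) + f 4 (snd y))))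
   = (\<lambda>y. fourier_factor (v $ i) y * bessel_op 1 ?b g (P (snd y)))"
  by (simp add: fourier_factor_def bessel_op_def f_def numeral_eq_Suc scaleR_conv_of_real algebra_simps)
 finally show ?thesis by (simp add: P_def)
qed

interpretation fourier_product: product_sigma_finite "\<lambda>_. fourier_measure"
 by (rule product_sigma_finite.intro) (rule fourier_measure_sigma_finite)

lemma replace_coords_measurable:
 "(\<lambda>w. replace_coords I w t) \<in> bmeas (PiM I (\<lambda>_::'n::finite. fourier_measure))"
proof -
 have e: "replace_coords I w t = (\<Sum>j\<in>UNIV. (if j \<in> I then snd (w j) else t $ j) *\<^sub>R axis j 1)" for w
  using basis_expansion[of "replace_coords I w t"] by (simp add: replace_coords_def scalar_mult_eq_scaleR)
 have "(\<lambda>w. if j \<in> I then snd (w j) else t $ j) \<in> bmeas (PiM I (\<lambda>_. fourier_measure))" for j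
 proof (cases "j \<in> I")
  case True
  have "snd \<in> bmeas fourier_measure" by measurable
  from measurable_compose[OF measurable_component_singleton[OF True] this] True show ?thesis by simp
 qed simp
 then show ?thesis unfolding e by (intro borel_measurable_sum borel_measurable_scaleR borel_measurable_const)
qed

lemma torus_integrand_integrable:
 fixes u :: "real ^ 'n \<Rightarrow> complex"
 assumes u: "u \<in> torus_smooth"
 shows "integrable (PiM I (\<lambda>_. fourier_measure)) (\<lambda>w. (\<Prod>i\<in>I. fourier_factor (t $ i) (w i)) * u (replace_coords I w t))"
proof -
 obtain K where K: "\<And>x. norm (u x) \<le> K" using BC_infinity_bound[of u] u by (auto simp: torus_smooth_def)
 have um: "u \<in> bmeas borel" using u BC_infinity_smooth smooth_measurable by (auto simp: torus_smooth_def)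
 have f: "(\<lambda>w. fourier_factor (t $ i) (w i)) \<in> bmeas (PiM I (\<lambda>_. fourier_measure))" if "i \<in> I" for i
  by (rule measurable_compose[OF _ fourier_factor_measurable]) (rule measurable_component_singleton[OF that])
 have "integrable (PiM I (\<lambda>_. fourier_measure)) (\<lambda>w. (\<Prod>i\<in>I. (fourier_weight (w i))^2) * K)"
  by (intro integrable_mult_left fourier_product.product_integrable_prod integrable_fourier_weight_sq) simp
 then show ?thesis
 proof (rule integrable_bound')
  show "(\<lambda>w. (\<Prod>i\<in>I. fourier_factor (t $ i) (w i)) * u (replace_coords I w t)) \<in> bmeas (PiM I (\<lambda>_. fourier_measure))"
   by (intro borel_measurable_times borel_measurable_prod measurable_compose[OF replace_coords_measurable um] f)
  show "AE w in PiM I (\<lambda>_. fourier_measure). norm ((\<Prod>i\<in>I. fourier_factor (t $ i) (w i)) * u (replace_coords I w t)) \<le> norm ((\<Prod>i\<in>I. (fourier_weight (w i))^2) * K)"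
  proof (rule AE_I2)
   fix w
   have "norm ((\<Prod>i\<in>I. fourier_factor (t $ i) (w i)) * u (replace_coords I w t)) \<le> (\<Prod>i\<in>I. (fourier_weight (w i))^2) * K"
    unfolding norm_mult prod_norm[symmetric] norm_fourier_factor by (intro mult_left_mono K prod_nonneg) simp
   then show "norm ((\<Prod>i\<in>I. fourier_factor (t $ i) (w i)) * u (replace_coords I w t)) \<le> norm ((\<Prod>i\<in>I. (fourier_weight (w i))^2) * K)"
    by (rule order_trans) simp
  qed
 qed
qed

text \<open>Induction over the coordinates: the outermost Bessel operator is removed by the
  one-dimensional expansion at the point where the other coordinates are already replaced, and the
  product measure splits off one factor.\<close>

lemma torus_expansion:
 fixes g :: "real ^ 'n \<Rightarrow> complex"
 assumes "distinct js" and g: "g \<in> torus_smooth"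
 shows "g t = (LINT w|(PiM (set js) (\<lambda>_. fourier_measure)). (\<Prod>i\<in>set js. fourier_factor (t $ i) (w i)) *
   bessel_ops 1 (map (\<lambda>i. axis i 1) js) g (replace_coords (set js) w t))"
 using assms(1)
proof (induction js)
 case Nil
 have "replace_coords {} w t = t" for w by (simp add: replace_coords_def)
 then show ?case by (simp add: bessel_ops_def PiM_empty lebesgue_integral_count_space_finite)
next
 case (Cons i js)
 let ?u = "bessel_ops 1 (map (\<lambda>i. axis i 1) js) g"
 let ?v = "bessel_op 1 (axis i 1) ?u"
 have sub: "set (map (\<lambda>i. axis i (1::real)) is') \<subseteq> Basis" for is' :: "'n list" by (auto simp: Basis_vec_def)
 have u: "?u \<in> torus_smooth" by (rule torus_smooth_bessel_ops[OF g sub])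
 have v: "?v \<in> torus_smooth" using torus_smooth_bessel_ops[OF g sub, of 1 "i # js"] by (simp add: bessel_ops_def)
 have ni: "i \<notin> set js" using Cons.prems by simp
 have "(LINT w|(PiM (insert i (set js)) (\<lambda>_. fourier_measure)). (\<Prod>i\<in>insert i (set js). fourier_factor (t $ i) (w i)) * ?v (replace_coords (insert i (set js)) w t))
  = (LINT w|(PiM (set js) (\<lambda>_. fourier_measure)). (LINT y|fourier_measure. (\<Prod>j\<in>insert i (set js). fourier_factor (t $ j) (fun_upd w i y j)) * ?v (replace_coords (insert i (set js)) (fun_upd w i y) t)))"
  by (rule fourier_product.product_integral_insert[OF _ ni torus_integrand_integrable[OF v]]) simp
 also have "... = (LINT w|(PiM (set js) (\<lambda>_. fourier_measure)). (\<Prod>i\<in>set js. fourier_factor (t $ i) (w i)) * ?u (replace_coords (set js) w t))"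
 proof (rule integral_cong'[OF refl])
  fix w
  let ?h = "replace_coords (set js) w t"
  have r: "replace_coords (insert i (set js)) (fun_upd w i y) t = (\<chi> k. if k = i then snd y else ?h $ k)" for y
   by (simp add: replace_coords_def vec_eq_iff)
  have p: "(\<Prod>j\<in>insert i (set js). fourier_factor (t $ j) (fun_upd w i y j)) = (\<Prod>j\<in>set js. fourier_factor (t $ j) (w j)) * fourier_factor (?h $ i) y" for y
  proof -
   have "(\<Prod>j\<in>set js. fourier_factor (t $ j) (fun_upd w i y j)) = (\<Prod>j\<in>set js. fourier_factor (t $ j) (w j))"
    using ni by (intro prod.cong) auto
   then show ?thesis using ni by (simp add: replace_coords_def mult.commute)
  qed
  show "(LINT y|fourier_measure. (\<Prod>j\<in>insert i (set js). fourier_factor (t $ j) (fun_upd w i y j)) * ?v (replace_coords (insert i (set js)) (fun_upd w i y) t))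
   = (\<Prod>i\<in>set js. fourier_factor (t $ i) (w i)) * ?u ?h"
   unfolding p r mult.assoc integral_mult_right_zero using torus_coordinate_expansion[OF u, of ?h i] by simp
 qed
 finally show ?case using Cons by (simp add: bessel_ops_def)
qed

text \<open>A basis of the lattice gives a linear map that transports the symbol to a function on
  the standard torus. Its smoothed Fourier expansion is a superposition of characters in which the
  momentum enters only through the exponential.\<close>

theorem symbol_periodic_rep:
 fixes F :: "(real ^ 'n) \<times> (real ^ 'n) \<Rightarrow> real"
 assumes \<Gamma>: "full_lattice \<Gamma>" and F: "F \<in> symbol_periodic \<Gamma>"
 shows "\<exists>(z :: ('n \<Rightarrow> int \<times> real) \<Rightarrow> real ^ 'n) b \<kappa>. symbol_rep (PiM UNIV (\<lambda>_. fourier_measure)) z b F \<kappa> \<and>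
  integrable (PiM UNIV (\<lambda>_. fourier_measure)) (\<lambda>w. b w * (norm (z w))^2)"
proof -
 let ?M = "PiM UNIV (\<lambda>_::'n. fourier_measure)"
 obtain B where B: "independent B" "span B = UNIV" "\<Gamma> = {\<Sum>v\<in>B. of_int (m v) *\<^sub>R v | m :: real ^ 'n \<Rightarrow> int. True}"
  using \<Gamma> unfolding full_lattice_def by blast
 have fin: "finite B" by (rule finiteI_independent[OF B(1)])
 have "card B = CARD('n)" using basis_card_eq_dim[of B UNIV] B by (simp add: dim_UNIV)
 then obtain a :: "'n \<Rightarrow> real ^ 'n" where a: "bij_betw a UNIV B"
  using finite_same_card_bij[of "UNIV :: 'n set" B] fin by auto
 \<comment> \<open>\<open>L\<close> maps the standard basis onto the lattice basis, so periodicity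
   in \<Gamma> becomes periodicity with period one in each coordinate.\<close>
 define L where "L t = (\<Sum>i\<in>UNIV. (t $ i) *\<^sub>R a i)" for t :: "real ^ 'n"
 have linL: "linear L" by (auto simp: L_def linear_iff scaleR_left_distrib sum.distrib scaleR_sum_right)
 have "surj L"
 proof -
  have "k \<in> range L" for k
  proof -
   have "k \<in> span B" using B(2) by simp
   then obtain u where u: "k = (\<Sum>v\<in>B. u v *\<^sub>R v)" unfolding span_finite[OF fin] by blast
   have "k = L (\<chi> i. u (a i))" unfolding u L_def by (simp add: sum.reindex_bij_betw[OF a, of "\<lambda>v. u v *\<^sub>R v"])
   then show ?thesis by blast
  qed
  then show ?thesis by blast
 qed
 then obtain L' where L': "linear L'" "\<And>x. L' (L x) = x" "\<And>x. L (L' x) = x"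
  using linear_surjective_isomorphism[OF linL] by blast
 define g where "g t = cplx (F (0, L t))" for t
 have F0: "F (x, k) = F (0, k)" for x k using F unfolding symbol_periodic_def by blast
 have g: "g \<in> torus_smooth"
 proof -
  have "bounded_linear (\<lambda>t. (0::real ^ 'n, L t))"
   by (intro bounded_linear_Pair bounded_linear_zero linear_conv_bounded_linear[THEN iffD1, OF linL])
  moreover have "F \<in> BC_infinity" using F by (simp add: symbol_periodic_def symbol_S00_def)
  ultimately have "(\<lambda>t. F (0 + (0, L t))) \<in> BC_infinity" by (rule BC_infinity_affine)
  then have "(\<lambda>t. F (0, L t)) \<in> BC_infinity" by (simp add: zero_prod_def)
  from BC_infinity_bounded_linear[OF bounded_linear_of_real this] have "g \<in> BC_infinity" by (simp add: g_def[abs_def])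
  moreover have "g (t + axis i 1) = g t" for t i
  proof -
   have "(\<Sum>v\<in>B. of_int (if v = a i then 1 else 0) *\<^sub>R v) = a i"
    using a fin by (simp add: if_distrib[of of_int] if_distrib[of "\<lambda>c. c *\<^sub>R _"] cong: if_cong) (auto simp: bij_betw_def)
   then have "a i \<in> \<Gamma>" unfolding B(3) by (intro CollectI exI[of _ "\<lambda>v. if v = a i then 1 else 0"]) simp
   moreover have "L (axis i 1) = a i" by (simp add: L_def axis_def if_distrib[of "\<lambda>c. c *\<^sub>R _"] cong: if_cong)
   ultimately show ?thesis using F by (simp add: g_def linear_add[OF linL] symbol_periodic_def)
  qed
  ultimately show ?thesis by (simp add: torus_smooth_def)
 qed
 obtain js :: "'n list" where js: "distinct js" "set js = UNIV" using finite_distinct_list[of "UNIV :: 'n set"] by auto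
 define D where "D = bessel_ops 1 (map (\<lambda>i. axis i 1) js) g"
 have D: "D \<in> torus_smooth" unfolding D_def by (rule torus_smooth_bessel_ops[OF g]) (auto simp: Basis_vec_def)
 obtain K where K: "K \<ge> 0" "\<And>x. norm (D x) \<le> K" using BC_infinity_bound[of D] D by (auto simp: torus_smooth_def)
 \<comment> \<open>The vector \<open>l i\<close> represents the \<open>i\<close>-th coordinate of
   the inverse map as an inner product; it is the dual basis of the lattice basis.\<close>
 define l where "l i = (\<Sum>b\<in>Basis. (L' b $ i) *\<^sub>R b)" for i
 have l: "L' k $ i = k \<bullet> l i" for k i
 proof -
  have "L' k = L' (\<Sum>b\<in>Basis. (k \<bullet> b) *\<^sub>R b)" by (simp add: euclidean_representation)
  also have "... = (\<Sum>b\<in>Basis. (k \<bullet> b) *\<^sub>R L' b)" by (simp add: linear_sum[OF L'(1)] linear_scale[OF L'(1)])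
  finally show ?thesis by (simp add: l_def inner_sum_right sum_component mult.commute)
 qed
 \<comment> \<open>The translations are points of the lattice spanned by \<open>2 * pi\<close> times
   the dual basis; the sign compensates the minus in the character
   \<open>exp (- \<i> * (k \<bullet> z w))\<close>.\<close>
 define z where "z w = (\<Sum>i\<in>UNIV. (- 2 * pi * of_int (fst (w i))) *\<^sub>R l i)" for w :: "'n \<Rightarrow> int \<times> real"
 define b where "b w = (\<Prod>i\<in>UNIV. (fourier_weight (w i))^2) * K" for w :: "'n \<Rightarrow> int \<times> real"
 define \<kappa> where "\<kappa> x w = (\<Prod>i\<in>UNIV. fourier_factor 0 (w i)) * D (replace_coords UNIV w 0)" for x :: "real ^ 'n" and w
 have zm: "z \<in> bmeas ?M"
 proof -
  have "(\<lambda>y. real_of_int (fst y)) \<in> bmeas fourier_measure" by (rule measurable_compose[OF measurable_fst]) simp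
  then show ?thesis unfolding z_def
   by (intro borel_measurable_sum borel_measurable_scaleR borel_measurable_times borel_measurable_const
    measurable_compose[OF measurable_component_singleton[OF UNIV_I]])
 qed
 have bi: "integrable ?M b"
  unfolding b_def by (intro integrable_mult_left fourier_product.product_integrable_prod integrable_fourier_weight_sq) simp
 have bn: "b w \<ge> 0" for w unfolding b_def by (intro mult_nonneg_nonneg prod_nonneg K) simp
 have \<kappa>le: "norm (\<kappa> x w) \<le> b w" for x w
  unfolding \<kappa>_def b_def norm_mult prod_norm[symmetric] norm_fourier_factor by (intro mult_left_mono K prod_nonneg) simp
 have \<kappa>m: "\<kappa> x \<in> bmeas ?M" for x
  using borel_measurable_integrable[OF torus_integrand_integrable[OF D, of UNIV 0]] by (simp add: \<kappa>_def[abs_def])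
 define S where "S = 2 * pi * (\<Sum>i\<in>UNIV. norm (l i))"
 have mom: "integrable ?M (\<lambda>w. b w * (norm (z w))^2)"
 proof (rule integrable_bound')
  show "integrable ?M (\<lambda>w. (\<Prod>i\<in>UNIV. fourier_weight (w i)) * (K * S^2))"
   by (intro integrable_mult_left fourier_product.product_integrable_prod integrable_fourier_weight) simp
  show "(\<lambda>w. b w * (norm (z w))^2) \<in> bmeas ?M" using borel_measurable_integrable[OF bi] zm by measurable
  show "AE w in ?M. norm (b w * (norm (z w))^2) \<le> norm ((\<Prod>i\<in>UNIV. fourier_weight (w i)) * (K * S^2))"
  proof (rule AE_I2)
   fix w :: "'n \<Rightarrow> int \<times> real"
   let ?W = "\<Prod>i\<in>UNIV. fourier_weight (w i)"
   have W: "?W > 0" by (intro prod_pos fourier_weight_bounds)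
   \<comment> \<open>The majorant contains the square of the product \<open>?W\<close> of weights.
     One factor \<open>?W\<close> pays for the square of any single frequency, and the other remains
     integrable.\<close>
   have n: "\<bar>of_int (fst (w i))\<bar> \<le> sqrt (1 / ?W)" for i
   proof (rule real_le_rsqrt)
    have "?W = fourier_weight (w i) * (\<Prod>j\<in>UNIV - {i}. fourier_weight (w j))" by (simp add: prod.remove)
    also have "... \<le> fourier_weight (w i) * 1"
     by (intro mult_left_mono prod_le_1 conjI fourier_weight_bounds less_imp_le[OF fourier_weight_bounds(1)])
    finally have "(of_int (fst (w i)))^2 * ?W \<le> (of_int (fst (w i)))^2 * fourier_weight (w i)" by (intro mult_left_mono) auto
    also have "... \<le> 1" by (rule fourier_weight_bounds(3))
    finally show "\<bar>of_int (fst (w i))\<bar>^2 \<le> 1 / ?W" using W by (simp add: pos_le_divide_eq)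
   qed
   have "norm (z w) \<le> (\<Sum>i\<in>UNIV. 2 * pi * \<bar>of_int (fst (w i))\<bar> * norm (l i))"
    unfolding z_def by (rule order_trans[OF norm_sum]) (simp add: abs_mult)
   also have "... \<le> (\<Sum>i\<in>UNIV. 2 * pi * sqrt (1 / ?W) * norm (l i))"
    by (intro sum_mono mult_right_mono mult_left_mono n) auto
   also have "... = S * sqrt (1 / ?W)" by (simp add: S_def sum_distrib_left mult_ac)
   finally have "(norm (z w))^2 \<le> (S * sqrt (1 / ?W))^2" by (intro power_mono) auto
   also have "... = S^2 / ?W" using W by (simp add: power_mult_distrib)
   finally have "b w * (norm (z w))^2 \<le> b w * (S^2 / ?W)" by (rule mult_left_mono[OF _ bn])
   also have "... = ?W * (K * S^2)" using W by (simp add: b_def power2_eq_square flip: prod_power_distrib) (simp add: prod.distrib)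
   finally show "norm (b w * (norm (z w))^2) \<le> norm (?W * (K * S^2))" using bn[of w] W K(1) by simp
  qed
 qed
 have rep: "cplx (F (x, k)) = (LINT w|?M. \<kappa> x w * exp (- \<i> * (k \<bullet> z w)))" for x k
 proof -
  have "cplx (F (x, k)) = g (L' k)" by (subst F0) (simp add: g_def L'(3))
  also have "... = (LINT w|?M. (\<Prod>i\<in>UNIV. fourier_factor (L' k $ i) (w i)) * D (replace_coords UNIV w (L' k)))"
   using torus_expansion[OF js(1) g, of "L' k"] by (simp add: D_def js(2))
  also have "... = (LINT w|?M. \<kappa> x w * exp (- \<i> * (k \<bullet> z w)))"
  proof (rule integral_cong'[OF refl])
   fix w
   have "fourier_factor t y = fourier_factor 0 y * circle_exp (of_int (fst y) * t)" for t y
    by (simp add: fourier_factor_def right_diff_distrib mult.assoc flip: circle_exp_add)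
   from this[of "L' k $ _"] have "(\<Prod>i\<in>UNIV. fourier_factor (L' k $ i) (w i)) = (\<Prod>i\<in>UNIV. fourier_factor 0 (w i)) * (\<Prod>i\<in>UNIV. circle_exp (of_int (fst (w i)) * (L' k $ i)))"
    unfolding prod.distrib[symmetric] by (intro prod.cong refl)
   also have "(\<Prod>i\<in>UNIV. circle_exp (of_int (fst (w i)) * (L' k $ i))) = exp (- \<i> * (k \<bullet> z w))"
    by (simp add: circle_exp_def z_def l inner_sum_right sum_negf sum_distrib_left mult_ac flip: exp_sum)
   finally show "(\<Prod>i\<in>UNIV. fourier_factor (L' k $ i) (w i)) * D (replace_coords UNIV w (L' k)) = \<kappa> x w * exp (- \<i> * (k \<bullet> z w))"
    by (simp add: \<kappa>_def replace_coords_def)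
  qed
  finally show ?thesis .
 qed
 interpret S: sigma_finite_measure ?M by (rule fourier_product.sigma_finite) simp
 have "(\<lambda>p. \<kappa> 0 (snd p)) \<in> bmeas ((lborel :: (real ^ 'n) measure) \<Otimes>\<^sub>M ?M)" by (rule measurable_compose[OF measurable_snd \<kappa>m])
 then have "(\<lambda>(x, w). \<kappa> x w) \<in> bmeas (lborel \<Otimes>\<^sub>M ?M)" by (simp add: \<kappa>_def case_prod_unfold)
 then have "symbol_rep ?M z b F \<kappa>"
  by unfold_locales (use zm bi bn \<kappa>le rep in \<open>auto simp: \<kappa>_def\<close>)
 with mom show ?thesis by blast
qed

subsection \<open>The spectral estimates\<close>

text \<open>The hypotheses say that, on balls of radius \<open>R\<close>, the phase is a gradient plus the
 midpoint rule for the line integral of \<open>a c\<close>.\<close>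

definition gauge_stable :: "((real ^ 'n) \<times> (real ^ 'n) \<Rightarrow> real) \<Rightarrow> real \<Rightarrow> bool" where
 "gauge_stable F C \<longleftrightarrow> (\<forall>R l \<theta> (a :: real ^ 'n \<Rightarrow> real ^ 'n \<Rightarrow> real ^ 'n) \<Lambda> E. R > 0 \<longrightarrow> l > 0 \<longrightarrow>
  continuous_on UNIV (\<lambda>(x, y). \<theta> x y) \<longrightarrow> (\<forall>x y. \<theta> y x = - \<theta> x y) \<longrightarrow>
  (\<lambda>(c, x). a c x) \<in> bmeas (borel \<Otimes>\<^sub>M borel) \<longrightarrow> (\<lambda>(c, x). \<Lambda> c x) \<in> bmeas (borel \<Otimes>\<^sub>M borel) \<longrightarrow>
  (\<forall>c x y. norm (x - c) \<le> R \<longrightarrow> norm (y - c) \<le> R \<longrightarrow> norm (a c x - a c y) \<le> l * norm (x - y)) \<longrightarrow>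
  (\<forall>c x y. norm (x - c) \<le> R \<longrightarrow> norm (y - c) \<le> R \<longrightarrow>
    \<bar>\<theta> x y - (\<Lambda> c x - \<Lambda> c y) - (1/2) * ((a c x + a c y) \<bullet> (x - y))\<bar> \<le> l * (norm (x - y))^2) \<longrightarrow>
  E \<in> {sup_spectrum, inf_spectrum, norm} \<longrightarrow>
  \<bar>E (Op \<theta> F) - E (Op (\<lambda>x y. 0) F)\<bar> \<le> C * (l + 1 / R^2))"

lemma (in symbol_rep) gauge_stable_rep:
 assumes mom: "integrable M (\<lambda>w. b w * (norm (z w))^2)"
 shows "\<exists>C\<ge>0. gauge_stable F C"
proof (intro exI conjI)
 let ?C = "(bump_const TYPE(real ^ 'n) + 2) * (LINT w|M. b w * (norm (z w))^2)"
 show "?C \<ge> 0" using b_nonneg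
  by (intro mult_nonneg_nonneg integral_nonneg') (auto simp: bump_const_def)
 have e: "?C * u = (bump_const TYPE(real ^ 'n) + 2) * u * (LINT w|M. b w * (norm (z w))^2)" for u by (simp only: mult_ac)
 show "gauge_stable F ?C"
  unfolding gauge_stable_def e using spectral_quantity_phase[OF mom] by blast
qed

text \<open>The two representations live on measure spaces of different types.
  \<open>gauge_stable\<close> mentions neither, so from here on the two symbol classes are treated
  alike.\<close>

lemma symbol_gauge_stable:
 fixes F :: "(real ^ 'n) \<times> (real ^ 'n) \<Rightarrow> real"
 assumes "(\<exists>t<0. F \<in> symbol_S1 t) \<or> (\<exists>\<Gamma>. full_lattice \<Gamma> \<and> F \<in> symbol_periodic \<Gamma>)"
 shows "\<exists>C\<ge>0. gauge_stable F C"
 using assms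
proof (elim disjE exE conjE)
 fix t assume "t < 0" "F \<in> symbol_S1 t"
 then obtain z :: "real \<times> (real ^ 'n) \<Rightarrow> real ^ 'n" and b \<kappa> where "symbol_rep lborel z b F \<kappa>"
  "integrable lborel (\<lambda>w. b w * (norm (z w))^2)"
  using symbol_S1_rep by blast
 then show ?thesis by (rule symbol_rep.gauge_stable_rep)
next
 fix \<Gamma> assume "full_lattice \<Gamma>" "F \<in> symbol_periodic \<Gamma>"
 then obtain z :: "('n \<Rightarrow> int \<times> real) \<Rightarrow> real ^ 'n" and b \<kappa> where "symbol_rep (PiM UNIV (\<lambda>_. fourier_measure)) z b F \<kappa>"
  "integrable (PiM UNIV (\<lambda>_. fourier_measure)) (\<lambda>w. b w * (norm (z w))^2)"
  using symbol_periodic_rep by blast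
 then show ?thesis by (rule symbol_rep.gauge_stable_rep)
qed

text \<open>The phase of a potential is compared with the averaged gauge of its own field. The upper
  bound \<open>l\<close> in place of \<open>lip_const\<close> supplies the strict positivity that
  \<open>gauge_stable\<close> demands, even for a vanishing field.\<close>

lemma local_gauge_spectral_bound:
 fixes A :: "real ^ 'n \<Rightarrow> real ^ 'n"
 assumes F: "gauge_stable F C" "C \<ge> 0" and A: "local_gauge R A m m'" and E: "E \<in> {sup_spectrum, inf_spectrum, norm}"
  and t: "0 < u" "u \<le> 1" and l: "lip_const TYPE('n) R m m' u \<le> l" "l > 0"
 shows "\<bar>E (Op (phase A) F) - E (Op (\<lambda>x y. 0) F)\<bar> \<le> C * (l + 1 / R^2)"
proof -
 interpret local_gauge R A m m' by (rule A)
 note lip = order_trans[OF avg_gauge_lipschitz[OF _ _ t] mult_right_mono[OF l(1) norm_ge_zero]]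
  and gau = order_trans[OF avg_gauge_phase[OF _ _ t] mult_right_mono[OF l(1) zero_le_power2]]
 show ?thesis
  using F(1)[unfolded gauge_stable_def, rule_format, OF R l(2) phase_continuous[OF A] phase_antisym
   avg_gauge_measurable avg_phase_measurable lip gau E] by blast
qed

section \<open>Bounds of the field and their behaviour under scaling\<close>

lemma BC_infinity_lipschitz:
 fixes f :: "'a::euclidean_space \<Rightarrow> real"
 assumes f: "f \<in> BC_infinity"
 shows "\<exists>C\<ge>0. \<forall>x y. \<bar>f x - f y\<bar> \<le> C * norm (x - y)"
proof -
 have "\<exists>C\<ge>0. \<forall>x. norm (pdiff b f x) \<le> C" if "b \<in> Basis" for b
  by (rule BC_infinity_bound[OF BC_infinity_pdiff[OF f that]])
 then obtain C where C: "\<And>b. b \<in> Basis \<Longrightarrow> C b \<ge> 0" "\<And>b x. b \<in> Basis \<Longrightarrow> norm (pdiff b f x) \<le> C b" by metis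
 have "onorm (\<lambda>v. \<Sum>b\<in>Basis. (v \<bullet> b) *\<^sub>R pdiff b f x) \<le> (\<Sum>b\<in>Basis. C b)" for x
 proof (rule onorm_le)
  fix v :: 'a
  have "norm (\<Sum>b\<in>Basis. (v \<bullet> b) *\<^sub>R pdiff b f x) \<le> (\<Sum>b\<in>Basis. norm v * C b)"
   by (rule order_trans[OF norm_sum], intro sum_mono) (use C(2) in \<open>auto simp: abs_mult intro!: mult_mono Basis_le_norm\<close>)
  then show "norm (\<Sum>b\<in>Basis. (v \<bullet> b) *\<^sub>R pdiff b f x) \<le> (\<Sum>b\<in>Basis. C b) * norm v"
   unfolding sum_distrib_left[symmetric] by (simp only: mult.commute)
 qed
 then have "norm (f x - f y) \<le> (\<Sum>b\<in>Basis. C b) * norm (x - y)" for x y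
  by (intro differentiable_bound[of UNIV f "\<lambda>x v. \<Sum>b\<in>Basis. (v \<bullet> b) *\<^sub>R pdiff b f x"])
   (simp_all del: real_scaleR_def add: smooth_has_derivative[OF BC_infinity_smooth[OF f]])
 then show ?thesis using C(1) by (intro exI[of _ "\<Sum>b\<in>Basis. C b"]) (auto intro: sum_nonneg)
qed

lemma dform_bounds:
 fixes A :: "real ^ 'n \<Rightarrow> real ^ 'n"
 assumes "\<And>j k. dform A j k \<in> BC_infinity"
 obtains m m' where "m \<ge> 0" "m' \<ge> 0" "\<And>j k q. \<bar>dform A j k q\<bar> \<le> m"
  "\<And>j k q q'. \<bar>dform A j k q - dform A j k q'\<bar> \<le> m' * norm (q - q')"
proof -
 obtain M where M: "\<And>j k. M j k \<ge> 0" "\<And>j k q. norm (dform A j k q) \<le> M j k" using BC_infinity_bound[OF assms] by metis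
 obtain N where N: "\<And>j k. N j k \<ge> 0" "\<And>j k q q'. \<bar>dform A j k q - dform A j k q'\<bar> \<le> N j k * norm (q - q')"
  using BC_infinity_lipschitz[OF assms] by metis
 have le: "f j k \<le> (\<Sum>j\<in>UNIV. \<Sum>k\<in>UNIV. f j k)" if "\<And>j k. f j k \<ge> 0" for f :: "'n \<Rightarrow> 'n \<Rightarrow> real" and j k
  by (rule order_trans[OF member_le_sum[of k UNIV "f j"] member_le_sum[of j UNIV "\<lambda>j. \<Sum>k\<in>UNIV. f j k"]])
   (auto intro: sum_nonneg that)
 show thesis
 proof (rule that[of "\<Sum>j\<in>UNIV. \<Sum>k\<in>UNIV. M j k" "\<Sum>j\<in>UNIV. \<Sum>k\<in>UNIV. N j k"])
  show "\<bar>dform A j k q\<bar> \<le> (\<Sum>j\<in>UNIV. \<Sum>k\<in>UNIV. M j k)" for j k q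
   using M(2)[of j k q] le[of M, OF M(1), of j k] by simp
  show "\<bar>dform A j k q - dform A j k q'\<bar> \<le> (\<Sum>j\<in>UNIV. \<Sum>k\<in>UNIV. N j k) * norm (q - q')" for j k q q'
   by (rule order_trans[OF N(2) mult_right_mono[OF le[of N, OF N(1)] norm_ge_zero]])
 qed (auto intro!: sum_nonneg M N)
qed

lemma dform_scaleR:
 assumes A: "smooth A"
 shows "dform (\<lambda>x. c *\<^sub>R A x) j k x = c * dform A j k x"
proof -
 have "pdiff b (\<lambda>z. c *\<^sub>R (A z $ i)) x = c *\<^sub>R pdiff b (\<lambda>z. A z $ i) x" for b i
  using pdiff_scaleR[OF smooth_bounded_linear[OF bounded_linear_vec_nth A]] by metis
 then show ?thesis by (simp add: dform_def right_diff_distrib)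
qed

lemma dform_dilate:
 fixes A :: "real ^ 'n \<Rightarrow> real ^ 'n"
 assumes A: "smooth A"
 shows "dform (\<lambda>x. A (c *\<^sub>R x)) j k x = c * dform A j k (c *\<^sub>R x)"
proof -
 have "pdiff (axis i 1) (\<lambda>z. A (c *\<^sub>R z) $ i') x = c * pdiff (axis i 1) (\<lambda>z. A z $ i') (c *\<^sub>R x)" for i i'
  using pdiffs_dilate[OF smooth_bounded_linear[OF bounded_linear_vec_nth[of i'] A], of "[axis i 1]" c]
  by (auto simp: pdiffs_Cons Basis_vec_def fun_eq_iff)
 then show ?thesis by (simp add: dform_def right_diff_distrib)
qed

text \<open>The radius \<open>R = |\<epsilon>| powr (- 1/2)\<close> balances the localization error \<open>1 / R^2\<close> against the
 field strength.\<close>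

theorem corollary1p6:
  fixes A :: "real ^ 'n \<Rightarrow> real ^ 'n"
    and B :: "'n \<Rightarrow> 'n \<Rightarrow> real ^ 'n \<Rightarrow> real"
    and F :: "(real ^ 'n) \<times> (real ^ 'n) \<Rightarrow> real"
    and \<E> :: "((real ^ 'n) L2 \<Rightarrow>\<^sub>L (real ^ 'n) L2) \<Rightarrow> real"
  assumes "smooth A" and "transverse_gauge A"
    and "B = dform A"
    and "\<And>j k. B j k \<in> BC_infinity"
    and "(\<exists>t<0. F \<in> symbol_S1 t) \<or> (\<exists>\<Gamma>. full_lattice \<Gamma> \<and> F \<in> symbol_periodic \<Gamma>)"
    and "\<E> \<in> {sup_spectrum, inf_spectrum, norm}"
  shows
    "(\<exists>C. \<forall>\<epsilon>. 0 < \<bar>\<epsilon>\<bar> \<and> \<bar>\<epsilon>\<bar> \<le> 1/2 \<longrightarrow>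
        \<bar>\<E> (Op (phase (\<lambda>x. \<epsilon> *\<^sub>R A x)) F) - \<E> (Op (phase (\<lambda>x. 0 *\<^sub>R A x)) F)\<bar>
          \<le> C * \<bar>\<epsilon>\<bar> * ln (1 / \<bar>\<epsilon>\<bar>)) \<and>
     (\<exists>C. \<forall>\<epsilon>. \<bar>\<epsilon>\<bar> \<le> 1/2 \<longrightarrow>
        ((\<forall>j k x x'. B j k x = B j k x') \<longrightarrow>
          \<bar>\<E> (Op (phase (\<lambda>x. \<epsilon> *\<^sub>R A x)) F) - \<E> (Op (phase (\<lambda>x. 0 *\<^sub>R A x)) F)\<bar>
            \<le> C * \<bar>\<epsilon>\<bar>) \<and>
        \<bar>\<E> (Op (slow_phase B \<epsilon>) F) - \<E> (Op (slow_phase B 0) F)\<bar> \<le> C * \<bar>\<epsilon>\<bar>)"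
proof -
 note A = assms(1) and E = assms(6)
 obtain C where C: "C \<ge> 0" "gauge_stable F C" using symbol_gauge_stable[OF assms(5)] by blast
 obtain m m' where m: "m \<ge> 0" "m' \<ge> 0" "\<And>j k q. \<bar>dform A j k q\<bar> \<le> m"
  "\<And>j k q q'. \<bar>dform A j k q - dform A j k q'\<bar> \<le> m' * norm (q - q')"
  using assms(3,4) by (metis dform_bounds)
 let ?d = "(real CARD('n))^2" and ?g = "gauge_const TYPE('n)"
 have g: "?g \<ge> 0" by (simp add: gauge_const_def bump_const_def)
 have p0: "phase (\<lambda>x. 0 *\<^sub>R A x) = (\<lambda>x y. 0)" "slow_phase B 0 = (\<lambda>x y. 0)"
  by (simp_all add: phase_def slow_phase_def fun_eq_iff)
 have smA: "smooth (\<lambda>x. \<epsilon> *\<^sub>R A x)" "smooth (\<lambda>x. A (\<epsilon> *\<^sub>R x))" for \<epsilon>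
  using smooth_scaleR[OF A] smooth_affine[OF bounded_linear_scaleR_right A, of 0 \<epsilon>] by auto
 \<comment> \<open>The Lipschitz constant \<open>n\<close> of the field is kept separate from
   \<open>m'\<close> so that it can be set to zero for a constant field.\<close>
 have lgA: "local_gauge R (\<lambda>x. \<epsilon> *\<^sub>R A x) (\<bar>\<epsilon>\<bar> * m) (\<bar>\<epsilon>\<bar> * n)"
  if "R > 0" "\<And>j k q q'. \<bar>dform A j k q - dform A j k q'\<bar> \<le> n * norm (q - q')" for R \<epsilon> n
 proof
  show "\<bar>dform (\<lambda>x. \<epsilon> *\<^sub>R A x) j k q\<bar> \<le> \<bar>\<epsilon>\<bar> * m" for j k q
   by (simp add: dform_scaleR[OF A] abs_mult mult_left_mono m(3))
  show "\<bar>dform (\<lambda>x. \<epsilon> *\<^sub>R A x) j k q - dform (\<lambda>x. \<epsilon> *\<^sub>R A x) j k q'\<bar> \<le> \<bar>\<epsilon>\<bar> * n * norm (q - q')" for j k q q'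
   using mult_left_mono[OF that(2)[of j k q q'], of "\<bar>\<epsilon>\<bar>"]
   by (simp add: dform_scaleR[OF A] mult.assoc flip: right_diff_distrib abs_mult)
 qed (simp_all add: that(1) smA)
 \<comment> \<open>The slowly varying potential has the field
   \<open>\<epsilon> * dform A j k (\<epsilon> *\<^sub>R x)\<close>: its size is of first order in
   \<epsilon>, but its Lipschitz constant is of second order.\<close>
 have lgS: "local_gauge R (\<lambda>x. A (\<epsilon> *\<^sub>R x)) (\<bar>\<epsilon>\<bar> * m) (\<bar>\<epsilon>\<bar>^2 * m')" if "R > 0" for R \<epsilon>
 proof
  show "\<bar>dform (\<lambda>x. A (\<epsilon> *\<^sub>R x)) j k q\<bar> \<le> \<bar>\<epsilon>\<bar> * m" for j k q
   by (simp add: dform_dilate[OF A] abs_mult mult_left_mono m(3))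
  show "\<bar>dform (\<lambda>x. A (\<epsilon> *\<^sub>R x)) j k q - dform (\<lambda>x. A (\<epsilon> *\<^sub>R x)) j k q'\<bar> \<le> \<bar>\<epsilon>\<bar>^2 * m' * norm (q - q')" for j k q q'
  proof -
   have "\<bar>dform A j k (\<epsilon> *\<^sub>R q) - dform A j k (\<epsilon> *\<^sub>R q')\<bar> \<le> m' * (\<bar>\<epsilon>\<bar> * norm (q - q'))"
    using m(4)[of j k "\<epsilon> *\<^sub>R q" "\<epsilon> *\<^sub>R q'"] by (simp flip: scaleR_diff_right)
   moreover have "\<bar>dform (\<lambda>x. A (\<epsilon> *\<^sub>R x)) j k q - dform (\<lambda>x. A (\<epsilon> *\<^sub>R x)) j k q'\<bar> = \<bar>\<epsilon>\<bar> * \<bar>dform A j k (\<epsilon> *\<^sub>R q) - dform A j k (\<epsilon> *\<^sub>R q')\<bar>"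
    by (simp add: dform_dilate[OF A] flip: right_diff_distrib abs_mult)
   ultimately show ?thesis
    using mult_left_mono[OF _ abs_ge_zero[of \<epsilon>]] by (simp only: power2_eq_square mult.assoc mult.left_commute[of m'])
  qed
 qed (simp_all add: that smA)
 note bd = local_gauge_spectral_bound[OF C(2,1) _ E]
 have R: "1 / sqrt \<bar>\<epsilon>\<bar> > 0" "1 / (1 / sqrt \<bar>\<epsilon>\<bar>)^2 = \<bar>\<epsilon>\<bar>" if "\<epsilon> \<noteq> 0" for \<epsilon> :: real
  using that by (simp_all add: power_divide)
 have "\<bar>\<E> (Op (phase (\<lambda>x. \<epsilon> *\<^sub>R A x)) F) - \<E> (Op (\<lambda>x y. 0) F)\<bar> \<le> C * (?g * m + 2 * ?d * (m + 2 * m') + 4) * \<bar>\<epsilon>\<bar> * ln (1 / \<bar>\<epsilon>\<bar>)"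
  if \<epsilon>: "0 < \<bar>\<epsilon>\<bar>" "\<bar>\<epsilon>\<bar> \<le> 1/2" for \<epsilon> :: real
 proof -
  let ?e = "\<bar>\<epsilon>\<bar>" and ?t = "sqrt \<bar>\<epsilon>\<bar>" and ?R = "1 / sqrt \<bar>\<epsilon>\<bar>" and ?L = "ln (1 / \<bar>\<epsilon>\<bar>)"
  have t: "0 < ?t" "?t \<le> 1" "?t * ?t = ?e" using \<epsilon> by (simp_all add: real_sqrt_le_1_iff)
  \<comment> \<open>For \<open>?e \<le> 1/2\<close> the logarithm is at least \<open>ln 2\<close>,
    so terms of order \<open>?e\<close> without logarithm can be absorbed.\<close>
  have L: "1 \<le> 2 * ?L"
  proof -
   have "ln 2 \<le> ?L" using \<epsilon> by (intro ln_mono) (auto simp: field_simps)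
   then show ?thesis using ln2_ge_two_thirds by linarith
  qed
  have lnt: "ln (1 / ?t) \<le> ?L"
   using \<epsilon> L by (simp add: ln_div ln_sqrt)
  \<comment> \<open>The cut \<open>\<tau> = ?t = 1 / ?R\<close> is chosen so that
    \<open>?t * ?R = 1\<close>: the direct bound on the last slices is then of order
    \<open>?e\<close>, and \<open>ln (1 / ?t)\<close> is half of \<open>?L\<close>. The final
    \<open>?e\<close> makes \<open>l\<close> positive.\<close>
  define l where "l = ?e * ?L * (?g * m) + ?e * (?d * (m + 2 * m')) + ?e"
  have "lip_const TYPE('n) ?R (?e * m) (?e * m') ?t \<le> l"
  proof -
   have "lip_const TYPE('n) ?R (?e * m) (?e * m') ?t = ?g * (?e * m) * ln (1 / ?t) + ?d * (?t * ?e * m + 2 * ((?t * ?R) * (?e * m')))"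
    by (simp add: lip_const_def algebra_simps)
   also have "?t * ?R = 1" using t by simp
   also have "?g * (?e * m) * ln (1 / ?t) + ?d * (?t * ?e * m + 2 * (1 * (?e * m'))) \<le> ?g * (?e * m) * ?L + ?d * (1 * ?e * m + 2 * (1 * (?e * m')))"
    by (intro add_mono mult_left_mono mult_right_mono lnt t order_refl) (auto simp: g m)
   also have "... \<le> l" by (simp add: l_def algebra_simps)
   finally show ?thesis .
  qed
  moreover have "l > 0" unfolding l_def using \<epsilon> g m L by (intro add_nonneg_pos add_nonneg_nonneg mult_nonneg_nonneg) auto
  ultimately have "\<bar>\<E> (Op (phase (\<lambda>x. \<epsilon> *\<^sub>R A x)) F) - \<E> (Op (\<lambda>x y. 0) F)\<bar> \<le> C * (l + 1 / ?R^2)"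
   using \<epsilon> by (intro bd[OF lgA[OF R(1) m(4)] t(1,2)]) auto
  also have "... = C * (?e * ?L * (?g * m) + ?e * (?d * (m + 2 * m') + 2) * 1)"
   using \<epsilon> by (subst R(2)) (auto simp: l_def algebra_simps)
  also have "... \<le> C * (?e * ?L * (?g * m) + ?e * (?d * (m + 2 * m') + 2) * (2 * ?L))"
   using L m by (intro mult_left_mono[OF _ C(1)] add_left_mono mult_left_mono) auto
  finally show ?thesis by (simp add: algebra_simps)
 qed
 moreover have "\<bar>\<E> (Op (phase (\<lambda>x. \<epsilon> *\<^sub>R A x)) F) - \<E> (Op (\<lambda>x y. 0) F)\<bar> \<le> C * (?d * (m + 2 * m') + 2) * \<bar>\<epsilon>\<bar>"
  if const: "\<forall>j k x x'. B j k x = B j k x'" for \<epsilon> :: real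
 proof (cases "\<epsilon> = 0")
  case False
  have c: "\<bar>dform A j k q - dform A j k q'\<bar> \<le> 0 * norm (q - q')" for j k q q'
   using const[rule_format, of j k q q'] by (simp add: assms(3))
  \<comment> \<open>With \<open>\<tau> = 1\<close> the logarithm vanishes, and for a constant field
    the term with \<open>R\<close> vanishes too, so the direct bound is already of order
    \<epsilon>.\<close>
  have "lip_const TYPE('n) (1 / sqrt \<bar>\<epsilon>\<bar>) (\<bar>\<epsilon>\<bar> * m) (\<bar>\<epsilon>\<bar> * 0) 1 \<le> \<bar>\<epsilon>\<bar> * (?d * (m + 2 * m')) + \<bar>\<epsilon>\<bar>"
   using m by (simp add: lip_const_def algebra_simps)
  from bd[OF lgA[OF R(1)[OF False] c] zero_less_one order_refl this]
  have "\<bar>\<E> (Op (phase (\<lambda>x. \<epsilon> *\<^sub>R A x)) F) - \<E> (Op (\<lambda>x y. 0) F)\<bar> \<le> C * (\<bar>\<epsilon>\<bar> * (?d * (m + 2 * m')) + \<bar>\<epsilon>\<bar> + 1 / (1 / sqrt \<bar>\<epsilon>\<bar>)^2)"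
   using False m by (simp add: add_nonneg_pos)
  then show ?thesis unfolding R(2)[OF False] by (simp add: algebra_simps)
 qed (use p0 in simp)
 moreover have "\<bar>\<E> (Op (slow_phase B \<epsilon>) F) - \<E> (Op (\<lambda>x y. 0) F)\<bar> \<le> C * (?d * (m + 2 * m') + 2) * \<bar>\<epsilon>\<bar>"
  if \<epsilon>: "\<bar>\<epsilon>\<bar> \<le> 1/2" for \<epsilon> :: real
 proof (cases "\<epsilon> = 0")
  case False
  let ?e = "\<bar>\<epsilon>\<bar>" and ?t = "sqrt \<bar>\<epsilon>\<bar>"
  have s: "slow_phase B \<epsilon> = phase (\<lambda>x. A (\<epsilon> *\<^sub>R x))"
   using slow_phase_eq[OF A assms(2)] by (simp add: assms(3) fun_eq_iff)
  have t: "?t \<le> 1" "(1 / ?t) * ?e^2 = ?t * ?e"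
   using \<epsilon> False by (simp_all add: power2_eq_square field_simps)
  \<comment> \<open>Again \<open>\<tau> = 1\<close>: the radius \<open>1 / ?t\<close> times the
    second-order Lipschitz constant is of order \<open>?t * ?e\<close>, which does not exceed
    \<open>?e\<close>.\<close>
  have "lip_const TYPE('n) (1 / ?t) (?e * m) (?e^2 * m') 1 = ?d * (?e * m + 2 * (((1 / ?t) * ?e^2) * m'))"
   by (simp add: lip_const_def)
  also have "... \<le> ?d * (?e * m + 2 * ((1 * ?e) * m'))"
   unfolding t(2) by (intro mult_left_mono add_left_mono mult_right_mono t(1)) (auto simp: m)
  also have "... \<le> ?e * (?d * (m + 2 * m')) + ?e" by (simp add: algebra_simps)
  finally have "lip_const TYPE('n) (1 / ?t) (?e * m) (?e^2 * m') 1 \<le> ?e * (?d * (m + 2 * m')) + ?e" .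
  from bd[OF lgS[OF R(1)[OF False]] zero_less_one order_refl this]
  have "\<bar>\<E> (Op (slow_phase B \<epsilon>) F) - \<E> (Op (\<lambda>x y. 0) F)\<bar> \<le> C * (?e * (?d * (m + 2 * m')) + ?e + 1 / (1 / ?t)^2)"
   unfolding s using False m by (simp add: add_nonneg_pos)
  then show ?thesis unfolding R(2)[OF False] by (simp add: algebra_simps)
 qed (use p0 in simp)
 ultimately show ?thesis unfolding p0 by blast
qed

end
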